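(* Let $A$ be a $k$-algebra with identity ($k=\overline{\mathbb F}_q$) with a Frobenius morphism $F_A$. Let $M$ be an $F$-periodic indecomposable $A$-module with $F$-period $r$, and let $(\tilde M,F_{\tilde M})$ be the associated $F$-stable module. Then $(\tilde M,F_{\tilde M})$ is indecomposable in $\mathrm{mod}^F\text{-}A$ and $$\mathrm{End}_{A^F}(\tilde M^F)/\mathrm{rad}\bigl(\mathrm{End}_{A^F}(\tilde M^F)\bigr)\cong\mathbb F_{q^r}.$$ Moreover, every indecomposable $A^F$-module is isomorphic to a module of the form $\tilde M^F$ for some $F$-periodic indecomposable $A$-module $M$.
   Context: Let $q$ be a prime power and $k=\overline{\mathbb F}_q$. All modules are left modules, finite dimensional over the base field. A Frobenius map on a $k$-vector space $V$ is an $\mathbb F_q$-linear isomorphism $F:V\to V$ with $F(\lambda v)=\lambda^qF(v)$ ($\lambda\in k$, $v\in V$) such that for every $v$ there is $n>0$ with $F^n(v)=v$; $V^F$ denotes the fixed points. A Frobenius morphism on a $k$-algebra $A$ is a Frobenius map $F_A$ on $A$ that is also an $\mathbb F_q$-algebra isomorphism with $F_A(1)=1$; $A^F$ is its fixed-point $\mathbb F_q$-algebra. An $A$-module $M$ is $F$-stable if there is a Frobenius map $F_M$ on $M$ with $F_M(am)=F_A(a)F_M(m)$ for all $a,m$; then $M^F=M^{F_M}$ is an $A^F$-module. $\mathrm{mod}^F\text{-}A$ is the category of pairs $(M,F_M)$ of this kind, with morphisms the $A$-homomorphisms commuting with the Frobenius maps. Frobenius twist: for an $A$-module $M$ with any Frobenius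 map $F_M$ on the underlying space (no compatibility with the action is required), $M^{[1]}$ is the same vector space with action $a*m=F_M(F_A^{-1}(a)F_M^{-1}(m))$; up to isomorphism it does not depend on $F_M$. $M^{[0]}=M$ and $M^{[s]}=(M^{[s-1]})^{[1]}$, always using the same $F_M$. $M$ is $F$-periodic if it is isomorphic to a direct summand of an $F$-stable $A$-module (equivalently, $M^{[s]}\cong M$ for some $s\ge1$); its $F$-period $r$ is the least integer $r\ge1$ with $M^{[r]}\cong M$. There is then an $A$-module structure $M'$ on the vector space $M$ with $M'\cong M$ and $M'^{[r]}=M'$ (twists with respect to $F_M$). Put $\tilde M=M'\oplus M'^{[1]}\oplus\cdots\oplus M'^{[r-1]}$ and $F_{\tilde M}(x_0,x_1,\dots,x_{r-1})=(F_M(x_{r-1}),F_M(x_0),\dots,F_M(x_{r-2}))$. Then $(\tilde M,F_{\tilde M})$ is $F$-stable, and $\tilde M^F=\tilde M^{F_{\tilde M}}$ is, up to isomorphism, independent of the choice of $M'$. *)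

theory Defs
  imports "HOL-Algebra.Algebra" "HOL-Number_Theory.Prime_Powers"
begin

section \<open>Algebras and modules\<close>

text \<open>Associative unital, not necessarily commutative (the library locale \<open>algebra\<close> is
  for commutative algebras only).\<close>

locale assoc_algebra = module k A + ring A for k (structure) and A (structure) +
  assumes smult_mult_left:
      "\<lbrakk>c \<in> carrier k; x \<in> carrier A; y \<in> carrier A\<rbrakk>
       \<Longrightarrow> (c \<odot>\<^bsub>A\<^esub> x) \<otimes>\<^bsub>A\<^esub> y = c \<odot>\<^bsub>A\<^esub> (x \<otimes>\<^bsub>A\<^esub> y)"
    and smult_mult_right:
      "\<lbrakk>c \<in> carrier k; x \<in> carrier A; y \<in> carrier A\<rbrakk>
       \<Longrightarrow> x \<otimes>\<^bsub>A\<^esub> (c \<odot>\<^bsub>A\<^esub> y) = c \<odot>\<^bsub>A\<^esub> (x \<otimes>\<^bsub>A\<^esub> y)"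

text \<open>Unital left modules over a ring that need not be commutative (the library locale
  \<open>module\<close> requires a commutative ring). As there, the record fields \<open>mult\<close> and \<open>one\<close> of a
  module carry no meaning.\<close>

locale left_module = R?: ring R + M?: abelian_group M
  for R :: "('a, 'b) ring_scheme" (structure) and M :: "('a, 'm, 'c) module_scheme" (structure) +
  assumes left_smult_closed:
      "\<lbrakk>a \<in> carrier R; x \<in> carrier M\<rbrakk> \<Longrightarrow> a \<odot>\<^bsub>M\<^esub> x \<in> carrier M"
    and left_smult_l_distr:
      "\<lbrakk>a \<in> carrier R; b \<in> carrier R; x \<in> carrier M\<rbrakk>
       \<Longrightarrow> (a \<oplus>\<^bsub>R\<^esub> b) \<odot>\<^bsub>M\<^esub> x = a \<odot>\<^bsub>M\<^esub> x \<oplus>\<^bsub>M\<^esub> b \<odot>\<^bsub>M\<^esub> x"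
    and left_smult_r_distr:
      "\<lbrakk>a \<in> carrier R; x \<in> carrier M; y \<in> carrier M\<rbrakk>
       \<Longrightarrow> a \<odot>\<^bsub>M\<^esub> (x \<oplus>\<^bsub>M\<^esub> y) = a \<odot>\<^bsub>M\<^esub> x \<oplus>\<^bsub>M\<^esub> a \<odot>\<^bsub>M\<^esub> y"
    and left_smult_assoc:
      "\<lbrakk>a \<in> carrier R; b \<in> carrier R; x \<in> carrier M\<rbrakk>
       \<Longrightarrow> (a \<otimes>\<^bsub>R\<^esub> b) \<odot>\<^bsub>M\<^esub> x = a \<odot>\<^bsub>M\<^esub> (b \<odot>\<^bsub>M\<^esub> x)"
    and left_smult_one:
      "x \<in> carrier M \<Longrightarrow> \<one>\<^bsub>R\<^esub> \<odot>\<^bsub>M\<^esub> x = x"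

text \<open>The vector space underlying an \<open>A\<close>-module: scalars act through \<open>c \<mapsto> c \<cdot> 1\<^sub>A\<close>.\<close>

definition base_space :: "('k, 'a) module \<Rightarrow> ('a, 'm) module \<Rightarrow> ('k, 'm) module" where
  "base_space A M =
     \<lparr>carrier = carrier M, monoid.mult = monoid.mult M, one = one M,
      ring.zero = \<zero>\<^bsub>M\<^esub>, ring.add = ring.add M,
      smult = (\<lambda>c m. (c \<odot>\<^bsub>A\<^esub> \<one>\<^bsub>A\<^esub>) \<odot>\<^bsub>M\<^esub> m)\<rparr>"

definition finite_dimensional :: "'k ring \<Rightarrow> ('k, 'v) module \<Rightarrow> bool" where
  "finite_dimensional k V \<longleftrightarrow>
     (\<exists>S. finite S \<and> S \<subseteq> carrier V \<and>
       (\<forall>v \<in> carrier V. \<exists>c \<in> S \<rightarrow> carrier k. v = (\<Oplus>\<^bsub>V\<^esub>s \<in> S. c s \<odot>\<^bsub>V\<^esub> s)))"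

definition fd_module :: "'k ring \<Rightarrow> ('k, 'a) module \<Rightarrow> ('a, 'm) module \<Rightarrow> bool" where
  "fd_module k A M \<longleftrightarrow> left_module A M \<and> finite_dimensional k (base_space A M)"

definition module_hom ::
    "('k, 'a) module \<Rightarrow> ('a, 'm) module \<Rightarrow> ('a, 'n) module \<Rightarrow> ('m \<Rightarrow> 'n) set" where
  "module_hom A M N =
     {f \<in> carrier M \<rightarrow> carrier N.
        (\<forall>x \<in> carrier M. \<forall>y \<in> carrier M. f (x \<oplus>\<^bsub>M\<^esub> y) = f x \<oplus>\<^bsub>N\<^esub> f y) \<and>
        (\<forall>a \<in> carrier A. \<forall>x \<in> carrier M. f (a \<odot>\<^bsub>M\<^esub> x) = a \<odot>\<^bsub>N\<^esub> f x)}"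

definition module_isomorphic ::
    "('k, 'a) module \<Rightarrow> ('a, 'm) module \<Rightarrow> ('a, 'n) module \<Rightarrow> bool" where
  "module_isomorphic A M N \<longleftrightarrow>
     (\<exists>f \<in> module_hom A M N. bij_betw f (carrier M) (carrier N))"

definition internal_direct_sum ::
    "('k, 'a) module \<Rightarrow> ('a, 'm) module \<Rightarrow> 'm set \<Rightarrow> 'm set \<Rightarrow> bool" where
  "internal_direct_sum A M U W \<longleftrightarrow>
     submodule U A M \<and> submodule W A M \<and> U \<inter> W = {\<zero>\<^bsub>M\<^esub>} \<and> U <+>\<^bsub>M\<^esub> W = carrier M"

definition indecomposable_module ::
    "'k ring \<Rightarrow> ('k, 'a) module \<Rightarrow> ('a, 'm) module \<Rightarrow> bool" where
  "indecomposable_module k A M \<longleftrightarrow>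
     fd_module k A M \<and> carrier M \<noteq> {\<zero>\<^bsub>M\<^esub>} \<and>
     (\<forall>U W. internal_direct_sum A M U W \<longrightarrow> U = {\<zero>\<^bsub>M\<^esub>} \<or> W = {\<zero>\<^bsub>M\<^esub>})"


section \<open>Endomorphism algebras and the Jacobson radical\<close>

text \<open>Endomorphisms are normalised to be \<open>undefined\<close> off the carrier, so that they are equal
  as soon as they agree on the carrier.\<close>

definition End_algebra ::
    "('k, 'a) module \<Rightarrow> ('a, 'm) module \<Rightarrow> ('k, 'm \<Rightarrow> 'm) module" where
  "End_algebra A M =
     \<lparr>carrier = module_hom A M M \<inter> extensional (carrier M),
      monoid.mult = compose (carrier M),
      one = (\<lambda>x \<in> carrier M. x),
      ring.zero = (\<lambda>x \<in> carrier M. \<zero>\<^bsub>M\<^esub>),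
      ring.add = (\<lambda>f g. \<lambda>x \<in> carrier M. f x \<oplus>\<^bsub>M\<^esub> g x),
      smult = (\<lambda>c f. \<lambda>x \<in> carrier M. (c \<odot>\<^bsub>A\<^esub> \<one>\<^bsub>A\<^esub>) \<odot>\<^bsub>M\<^esub> f x)\<rparr>"

definition left_ideal :: "'a set \<Rightarrow> ('a, 'b) ring_scheme \<Rightarrow> bool" where
  "left_ideal I R \<longleftrightarrow>
     additive_subgroup I R \<and> (\<forall>a \<in> carrier R. \<forall>x \<in> I. a \<otimes>\<^bsub>R\<^esub> x \<in> I)"

definition maximal_left_ideal :: "'a set \<Rightarrow> ('a, 'b) ring_scheme \<Rightarrow> bool" where
  "maximal_left_ideal I R \<longleftrightarrow>
     left_ideal I R \<and> I \<noteq> carrier R \<and>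
     (\<forall>J. left_ideal J R \<and> I \<subseteq> J \<longrightarrow> J = I \<or> J = carrier R)"

definition jacobson_radical :: "('a, 'b) ring_scheme \<Rightarrow> 'a set" where
  "jacobson_radical R = carrier R \<inter> \<Inter> {I. maximal_left_ideal I R}"

text \<open>\<open>R / rad R \<cong> L\<close> as algebras over the subfield \<open>K\<close> of the field \<open>L\<close>.\<close>

definition residue_algebra_iso ::
    "'k set \<Rightarrow> ('k, 'a) module \<Rightarrow> 'k ring \<Rightarrow> bool" where
  "residue_algebra_iso K R L \<longleftrightarrow>
     (\<exists>h \<in> ring_iso (R Quot jacobson_radical R) L.
        \<forall>c \<in> K. \<forall>x \<in> carrier R.
          h (jacobson_radical R +>\<^bsub>R\<^esub> (c \<odot>\<^bsub>R\<^esub> x)) =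
          c \<otimes>\<^bsub>L\<^esub> h (jacobson_radical R +>\<^bsub>R\<^esub> x))"


section \<open>Frobenius maps\<close>

text \<open>Throughout, \<open>k\<close> is an algebraic closure of its finite subfield \<open>K\<close>, and \<open>q = card K\<close>.\<close>

definition frobenius_map ::
    "'k ring \<Rightarrow> 'k set \<Rightarrow> ('k, 'v) module \<Rightarrow> ('v \<Rightarrow> 'v) \<Rightarrow> bool" where
  "frobenius_map k K V F \<longleftrightarrow>
     module k V \<and>
     bij_betw F (carrier V) (carrier V) \<and>
     (\<forall>v \<in> carrier V. \<forall>w \<in> carrier V. F (v \<oplus>\<^bsub>V\<^esub> w) = F v \<oplus>\<^bsub>V\<^esub> F w) \<and>
     (\<forall>c \<in> K. \<forall>v \<in> carrier V. F (c \<odot>\<^bsub>V\<^esub> v) = c \<odot>\<^bsub>V\<^esub> F v) \<and>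
     (\<forall>c \<in> carrier k. \<forall>v \<in> carrier V. F (c \<odot>\<^bsub>V\<^esub> v) = (c [^]\<^bsub>k\<^esub> card K) \<odot>\<^bsub>V\<^esub> F v) \<and>
     (\<forall>v \<in> carrier V. \<exists>n > 0. (F ^^ n) v = v)"

definition frobenius_morphism ::
    "'k ring \<Rightarrow> 'k set \<Rightarrow> ('k, 'a) module \<Rightarrow> ('a \<Rightarrow> 'a) \<Rightarrow> bool" where
  "frobenius_morphism k K A FA \<longleftrightarrow> frobenius_map k K A FA \<and> FA \<in> ring_iso A A"

text \<open>Used both for \<open>A\<^sup>F\<close> and for \<open>M\<^sup>F\<close>.\<close>

definition fixed_points :: "('a, 'b) module \<Rightarrow> ('b \<Rightarrow> 'b) \<Rightarrow> ('a, 'b) module" where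
  "fixed_points U F = U\<lparr>carrier := {x \<in> carrier U. F x = x}\<rparr>"

text \<open>The pairs \<open>(M, F\<^sub>M)\<close> that are the objects of \<open>mod\<^sup>F-A\<close>.\<close>

definition F_stable_pair ::
    "'k ring \<Rightarrow> 'k set \<Rightarrow> ('k, 'a) module \<Rightarrow> ('a \<Rightarrow> 'a) \<Rightarrow> ('a, 'm) module \<Rightarrow> ('m \<Rightarrow> 'm) \<Rightarrow> bool"
  where
  "F_stable_pair k K A FA M FM \<longleftrightarrow>
     fd_module k A M \<and> frobenius_map k K (base_space A M) FM \<and>
     (\<forall>a \<in> carrier A. \<forall>m \<in> carrier M. FM (a \<odot>\<^bsub>M\<^esub> m) = FA a \<odot>\<^bsub>M\<^esub> FM m)"

text \<open>A decomposition in \<open>mod\<^sup>F-A\<close> is one into submodules on each of which \<open>F\<^sub>M\<close> restricts to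
  a Frobenius map.\<close>

definition F_indecomposable ::
    "'k ring \<Rightarrow> 'k set \<Rightarrow> ('k, 'a) module \<Rightarrow> ('a \<Rightarrow> 'a) \<Rightarrow> ('a, 'm) module \<Rightarrow> ('m \<Rightarrow> 'm) \<Rightarrow> bool"
  where
  "F_indecomposable k K A FA M FM \<longleftrightarrow>
     F_stable_pair k K A FA M FM \<and> carrier M \<noteq> {\<zero>\<^bsub>M\<^esub>} \<and>
     (\<forall>U W. internal_direct_sum A M U W \<and>
            F_stable_pair k K A FA (M\<lparr>carrier := U\<rparr>) FM \<and>
            F_stable_pair k K A FA (M\<lparr>carrier := W\<rparr>) FM
        \<longrightarrow> U = {\<zero>\<^bsub>M\<^esub>} \<or> W = {\<zero>\<^bsub>M\<^esub>})"


section \<open>Twists and periodicity\<close>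

definition frobenius_twist ::
    "('k, 'a) module \<Rightarrow> ('a \<Rightarrow> 'a) \<Rightarrow> ('m \<Rightarrow> 'm) \<Rightarrow> ('a, 'm) module \<Rightarrow> ('a, 'm) module" where
  "frobenius_twist A FA FM M =
     M\<lparr>smult := (\<lambda>a m. FM (inv_into (carrier A) FA a \<odot>\<^bsub>M\<^esub> inv_into (carrier M) FM m))\<rparr>"

definition iterated_twist ::
    "('k, 'a) module \<Rightarrow> ('a \<Rightarrow> 'a) \<Rightarrow> ('m \<Rightarrow> 'm) \<Rightarrow> nat \<Rightarrow> ('a, 'm) module \<Rightarrow> ('a, 'm) module" where
  "iterated_twist A FA FM s = frobenius_twist A FA FM ^^ s"

text \<open>The ambient \<open>F\<close>-stable module \<open>N\<close> lives on the type \<open>nat \<Rightarrow> 'k\<close>. This is no restriction: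
  that type contains a copy of \<open>k\<^sup>n\<close> for every \<open>n\<close>, and \<open>F\<close>-stability is invariant under
  isomorphism.\<close>

definition F_periodic ::
    "'k ring \<Rightarrow> 'k set \<Rightarrow> ('k, 'a) module \<Rightarrow> ('a \<Rightarrow> 'a) \<Rightarrow> ('a, 'm) module \<Rightarrow> bool" where
  "F_periodic k K A FA M \<longleftrightarrow>
     fd_module k A M \<and>
     (\<exists>(N :: ('a, nat \<Rightarrow> 'k) module) FN U W.
        F_stable_pair k K A FA N FN \<and> internal_direct_sum A N U W \<and>
        module_isomorphic A M (N\<lparr>carrier := U\<rparr>))"

definition is_F_period ::
    "('k, 'a) module \<Rightarrow> ('a \<Rightarrow> 'a) \<Rightarrow> ('a, 'm) module \<Rightarrow> ('m \<Rightarrow> 'm) \<Rightarrow> nat \<Rightarrow> bool" where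
  "is_F_period A FA M FM r \<longleftrightarrow>
     r \<ge> 1 \<and> module_isomorphic A (iterated_twist A FA FM r M) M \<and>
     (\<forall>s. s \<ge> 1 \<and> module_isomorphic A (iterated_twist A FA FM s M) M \<longrightarrow> r \<le> s)"

text \<open>\<open>M'\<close> is an \<open>A\<close>-module structure on the vector space \<open>M\<close> with \<open>M' \<cong> M\<close> and
  \<open>M'\<^bsup>[r]\<^esup> = M'\<close>. The equalities of structures are required on the carriers only.\<close>

definition periodic_structure ::
    "'k ring \<Rightarrow> ('k, 'a) module \<Rightarrow> ('a \<Rightarrow> 'a) \<Rightarrow> ('a, 'm) module \<Rightarrow> ('m \<Rightarrow> 'm) \<Rightarrow> nat
     \<Rightarrow> ('a, 'm) module \<Rightarrow> bool" where
  "periodic_structure k A FA M FM r M' \<longleftrightarrow>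
     fd_module k A M' \<and>
     carrier M' = carrier M \<and> \<zero>\<^bsub>M'\<^esub> = \<zero>\<^bsub>M\<^esub> \<and>
     (\<forall>x \<in> carrier M. \<forall>y \<in> carrier M. x \<oplus>\<^bsub>M'\<^esub> y = x \<oplus>\<^bsub>M\<^esub> y) \<and>
     (\<forall>c \<in> carrier k. \<forall>x \<in> carrier M.
        c \<odot>\<^bsub>base_space A M'\<^esub> x = c \<odot>\<^bsub>base_space A M\<^esub> x) \<and>
     module_isomorphic A M' M \<and>
     (\<forall>a \<in> carrier A. \<forall>x \<in> carrier M.
        a \<odot>\<^bsub>iterated_twist A FA FM r M'\<^esub> x = a \<odot>\<^bsub>M'\<^esub> x)"

text \<open>\<open>M' \<oplus> M'\<^bsup>[1]\<^esup> \<oplus> \<dots> \<oplus> M'\<^bsup>[r-1]\<^esup>\<close>, the tuples being the extensional functions on \<open>{..<r}\<close>.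
  The fields \<open>mult\<close> and \<open>one\<close> are placeholders.\<close>

definition tilde_module ::
    "('k, 'a) module \<Rightarrow> ('a \<Rightarrow> 'a) \<Rightarrow> ('m \<Rightarrow> 'm) \<Rightarrow> nat \<Rightarrow> ('a, 'm) module
     \<Rightarrow> ('a, nat \<Rightarrow> 'm) module" where
  "tilde_module A FA FM r M' =
     \<lparr>carrier = {..<r} \<rightarrow>\<^sub>E carrier M',
      monoid.mult = undefined, one = undefined,
      ring.zero = (\<lambda>i \<in> {..<r}. \<zero>\<^bsub>M'\<^esub>),
      ring.add = (\<lambda>x y. \<lambda>i \<in> {..<r}. x i \<oplus>\<^bsub>M'\<^esub> y i),
      smult = (\<lambda>a x. \<lambda>i \<in> {..<r}. a \<odot>\<^bsub>iterated_twist A FA FM i M'\<^esub> x i)\<rparr>"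

definition tilde_frobenius :: "('m \<Rightarrow> 'm) \<Rightarrow> nat \<Rightarrow> (nat \<Rightarrow> 'm) \<Rightarrow> (nat \<Rightarrow> 'm)" where
  "tilde_frobenius FM r x = (\<lambda>i \<in> {..<r}. if i = 0 then FM (x (r - 1)) else FM (x (i - 1)))"

end

theory Submission
  imports Defs
begin

text \<open>
  Everything rests on descent: if \<open>F\<close> is a Frobenius map and \<open>F\<^sup>n v = v\<close>, then
  \<open>v = - \<Sum> c\<^sup>-\<^sup>1 Tr(c v)\<close>, where \<open>c\<close> runs over the nonzero elements of the field with \<open>q\<^sup>n\<close>
  elements and \<open>Tr = 1 + F + \<dots> + F\<^bsup>n-1\<^esup>\<close> takes values in the fixed points.

  For the first part put \<open>G = F\<^sub>M\<^sup>r\<close>. The map \<open>x \<mapsto> x\<^sub>0\<close> identifies the fixed points of the stable module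
  with \<open>M'\<^sup>G\<close>. An endomorphism \<open>f\<close> of \<open>M'\<^sup>G\<close> is a sum of components \<open>g\<^sub>s\<close>, \<open>0 \<le> s < r\<close>, with
  \<open>g\<^sub>s(c x) = c\<^bsup>q^s\<^esup> g\<^sub>s(x)\<close> for \<open>c\<close> in the field with \<open>q\<^sup>r\<close> elements, and \<open>g\<^sub>s\<close> extends to a map of \<open>M'\<close>
  that is semilinear for \<open>F\<^sub>A\<^sup>s\<close>. A bijective extension would be an isomorphism of \<open>M'\<^bsup>[s]\<^esup>\<close> with
  \<open>M'\<close>, so \<open>g\<^sub>s\<close> is not injective for \<open>0 < s\<close>, and neither is \<open>g\<^sub>0 - c\<close> for an eigenvalue \<open>c\<close>, which
  lies in the field with \<open>q\<^sup>r\<close> elements. The noninjective homogeneous maps are nilpotent by Fitting's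
  lemma and form a finite semigroup; hence \<open>f \<mapsto> c\<close> is a ring homomorphism whose kernel is the radical.

  For the second part, \<open>k \<otimes> N\<close> is a stable module. On an indecomposable direct summand \<open>M\<close> of it let \<open>G\<close>
  be a bijective map that is semilinear for \<open>F\<^sub>A\<^sup>r\<close>, with \<open>r\<close> minimal; it has an \<open>r\<close>-th root \<open>F\<^sub>M\<close> which
  is a Frobenius map. As \<open>M\<^sup>G\<close> has a local endomorphism ring, descent shows that it is a direct summand
  of \<open>N\<close>.
\<close>

section \<open>Additive maps\<close>

text \<open>\<open>A\<close> may be infinite-dimensional, so no basis of \<open>A\<close> is
  available; the descent formula does the work of \<open>A = k \<otimes> A^F\<close>. The tensor
  product \<open>k \<otimes> N\<close> is not formed either: it is modelled on a coordinate space,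
  and the action of \<open>A\<close> on it is extended by descent, once in the vector and once in
  the algebra variable. This also explains why the modules of the second part live on functions from
  \<open>nat\<close> to \<open>k\<close>. Passing to \<open>M'^G\<close> trades the r summands of
  the stable module for a grading modulo r on one finite ring. The obstacle there is addition: sums
  of nilpotent maps need not be nilpotent, so it is not clear that the candidates for the radical
  form an ideal. Instead of nilpotence of single elements, nilpotence of the whole semigroup is
  used: if x is a sum of terms \<open>f_i x\<close> with every \<open>f_i\<close> in the semigroup,
  then substituting this into itself often enough gives x = 0. This yields quasi-regularity, and
  from it closure under addition. Twists are hardly ever computed with; an isomorphism from a twist
  is replaced by a bijective semilinear map, and these compose with added degrees.\<close>

definition additive_map :: "('a, 'b) ring_scheme \<Rightarrow> ('c, 'd) ring_scheme \<Rightarrow> ('a \<Rightarrow> 'c) \<Rightarrow> bool" where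
  "additive_map V W f \<longleftrightarrow> f \<in> carrier V \<rightarrow> carrier W \<and>
     (\<forall>x \<in> carrier V. \<forall>y \<in> carrier V. f (x \<oplus>\<^bsub>V\<^esub> y) = f x \<oplus>\<^bsub>W\<^esub> f y)"

lemma additive_mapI:
  assumes "\<And>x. x \<in> carrier V \<Longrightarrow> f x \<in> carrier W"
    and "\<And>x y. \<lbrakk>x \<in> carrier V; y \<in> carrier V\<rbrakk> \<Longrightarrow> f (x \<oplus>\<^bsub>V\<^esub> y) = f x \<oplus>\<^bsub>W\<^esub> f y"
  shows "additive_map V W f"
  using assms by (auto simp: additive_map_def)

lemma additive_map_closed: "additive_map V W f \<Longrightarrow> x \<in> carrier V \<Longrightarrow> f x \<in> carrier W"
  by (auto simp: additive_map_def)

lemma additive_map_add: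
  "\<lbrakk>additive_map V W f; x \<in> carrier V; y \<in> carrier V\<rbrakk> \<Longrightarrow> f (x \<oplus>\<^bsub>V\<^esub> y) = f x \<oplus>\<^bsub>W\<^esub> f y"
  by (auto simp: additive_map_def)

lemma additive_map_zero:
  assumes "abelian_group V" "abelian_group W" "additive_map V W f"
  shows "f \<zero>\<^bsub>V\<^esub> = \<zero>\<^bsub>W\<^esub>"
proof -
  interpret V: abelian_group V by fact
  interpret W: abelian_group W by fact
  have "f \<zero>\<^bsub>V\<^esub> \<oplus>\<^bsub>W\<^esub> f \<zero>\<^bsub>V\<^esub> = f \<zero>\<^bsub>V\<^esub>"
    using additive_map_add[OF assms(3), of "\<zero>\<^bsub>V\<^esub>" "\<zero>\<^bsub>V\<^esub>"] by simp
  then show ?thesis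
    using additive_map_closed[OF assms(3)] W.add.l_cancel_one' by (metis V.zero_closed)
qed

lemma additive_map_neg:
  assumes "abelian_group V" "abelian_group W" "additive_map V W f" "x \<in> carrier V"
  shows "f (\<ominus>\<^bsub>V\<^esub> x) = \<ominus>\<^bsub>W\<^esub> f x"
proof -
  interpret V: abelian_group V by fact
  interpret W: abelian_group W by fact
  have "f (\<ominus>\<^bsub>V\<^esub> x) \<oplus>\<^bsub>W\<^esub> f x = \<zero>\<^bsub>W\<^esub>"
    using additive_map_add[OF assms(3), of "\<ominus>\<^bsub>V\<^esub> x" x] assms additive_map_zero[OF assms(1-3)]
    by (simp add: V.l_neg)
  then show ?thesis
    using additive_map_closed[OF assms(3)] assms(4) by (metis V.a_inv_closed W.minus_equality)
qed

lemma additive_map_minus: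
  assumes "abelian_group V" "abelian_group W" "additive_map V W f" "x \<in> carrier V" "y \<in> carrier V"
  shows "f (x \<ominus>\<^bsub>V\<^esub> y) = f x \<ominus>\<^bsub>W\<^esub> f y"
proof -
  interpret V: abelian_group V by fact
  interpret W: abelian_group W by fact
  show ?thesis
    using assms additive_map_add[OF assms(3), of x "\<ominus>\<^bsub>V\<^esub> y"] additive_map_neg[OF assms(1-3)]
    by (simp add: a_minus_def)
qed

lemma additive_map_finsum:
  assumes "abelian_group V" "abelian_group W" "additive_map V W f" "g \<in> I \<rightarrow> carrier V"
  shows "f (finsum V g I) = finsum W (\<lambda>i. f (g i)) I"
proof -
  interpret V: abelian_group V by fact
  interpret W: abelian_group W by fact
  show ?thesis using assms(4)
  proof (induction I rule: infinite_finite_induct)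
    \<comment> \<open>Sums over infinite sets are zero by convention, so here the claim is that f
      maps zero to zero.\<close>
    case (infinite I)
    then show ?case
      by (simp add: V.finsum_infinite W.finsum_infinite additive_map_zero[OF assms(1-3)])
  next
    case empty
    then show ?case by (simp add: additive_map_zero[OF assms(1-3)])
  next
    case (insert i I)
    have *: "(\<lambda>i. f (g i)) \<in> I \<rightarrow> carrier W" "f (g i) \<in> carrier W"
      using insert.prems additive_map_closed[OF assms(3)] by auto
    then show ?case using insert additive_map_add[OF assms(3), of "g i" "finsum V g I"]
      by (simp add: V.finsum_insert W.finsum_insert)
  qed
qed

lemma additive_map_eq_zero_inj:
  assumes "abelian_group V" "abelian_group W" "additive_map V W f"
    and "\<And>x. \<lbrakk>x \<in> carrier V; f x = \<zero>\<^bsub>W\<^esub>\<rbrakk> \<Longrightarrow> x = \<zero>\<^bsub>V\<^esub>"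
  shows "inj_on f (carrier V)"
proof (rule inj_onI)
  interpret V: abelian_group V by fact
  interpret W: abelian_group W by fact
  fix x y assume xy: "x \<in> carrier V" "y \<in> carrier V" "f x = f y"
  then have "f (x \<ominus>\<^bsub>V\<^esub> y) = \<zero>\<^bsub>W\<^esub>"
    using additive_map_minus[OF assms(1-3)] additive_map_closed[OF assms(3)]
    by (simp add: W.r_neg a_minus_def)
  then have "x \<ominus>\<^bsub>V\<^esub> y = \<zero>\<^bsub>V\<^esub>" using assms(4) xy by simp
  then have "x \<ominus>\<^bsub>V\<^esub> y \<oplus>\<^bsub>V\<^esub> y = y" using xy by simp
  then show "x = y" using xy by (simp add: a_minus_def V.a_assoc V.l_neg)
qed

lemma additive_map_inj_on_iff:
  assumes "abelian_group V" "abelian_group W" "additive_map V W f"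
  shows "inj_on f (carrier V) \<longleftrightarrow> (\<forall>x \<in> carrier V. f x = \<zero>\<^bsub>W\<^esub> \<longrightarrow> x = \<zero>\<^bsub>V\<^esub>)"
proof
  interpret V: abelian_group V by fact
  assume inj: "inj_on f (carrier V)"
  show "\<forall>x \<in> carrier V. f x = \<zero>\<^bsub>W\<^esub> \<longrightarrow> x = \<zero>\<^bsub>V\<^esub>"
    using inj_onD[OF inj, of _ "\<zero>\<^bsub>V\<^esub>"] additive_map_zero[OF assms] by auto
qed (use additive_map_eq_zero_inj[OF assms] in blast)

lemma additive_map_compose:
  "\<lbrakk>additive_map V W f; additive_map U V g\<rbrakk> \<Longrightarrow> additive_map U W (\<lambda>x. f (g x))"
  by (auto simp: additive_map_def Pi_iff)

lemma additive_map_funpow: "additive_map V V f \<Longrightarrow> additive_map V V (f ^^ n)"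
  by (induction n) (auto simp: additive_map_def Pi_iff)

lemma additive_map_finsum_fun:
  assumes "abelian_group V" "abelian_group W" "\<And>i. i \<in> I \<Longrightarrow> additive_map V W (f i)"
  shows "additive_map V W (\<lambda>x. finsum W (\<lambda>i. f i x) I)"
proof -
  interpret W: abelian_group W by fact
  show ?thesis
  proof (rule additive_mapI)
    fix x assume "x \<in> carrier V"
    then show "finsum W (\<lambda>i. f i x) I \<in> carrier W"
      using assms(3) by (auto intro!: W.finsum_closed dest: additive_map_closed)
  next
    fix x y assume xy: "x \<in> carrier V" "y \<in> carrier V"
    have "finsum W (\<lambda>i. f i (x \<oplus>\<^bsub>V\<^esub> y)) I = finsum W (\<lambda>i. f i x \<oplus>\<^bsub>W\<^esub> f i y) I"
      using assms(3) xy by (intro W.finsum_cong') (auto simp: additive_map_add dest: additive_map_closed)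
    also have "\<dots> = finsum W (\<lambda>i. f i x) I \<oplus>\<^bsub>W\<^esub> finsum W (\<lambda>i. f i y) I"
      using assms(3) xy by (intro W.finsum_addf) (auto dest: additive_map_closed)
    finally show "finsum W (\<lambda>i. f i (x \<oplus>\<^bsub>V\<^esub> y)) I =
        finsum W (\<lambda>i. f i x) I \<oplus>\<^bsub>W\<^esub> finsum W (\<lambda>i. f i y) I" .
  qed
qed

lemma (in abelian_group) finsum_swap:
  assumes "finite I" "finite J" "\<And>i j. \<lbrakk>i \<in> I; j \<in> J\<rbrakk> \<Longrightarrow> f i j \<in> carrier G"
  shows "(\<Oplus>i\<in>I. \<Oplus>j\<in>J. f i j) = (\<Oplus>j\<in>J. \<Oplus>i\<in>I. f i j)"
  using assms(1,3)
proof (induction I rule: finite_induct)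
  case empty
  then show ?case by (simp add: finsum_zero)
next
  case (insert i I)
  have "(\<Oplus>i'\<in>insert i I. \<Oplus>j\<in>J. f i' j) = (\<Oplus>j\<in>J. f i j) \<oplus> (\<Oplus>j\<in>J. \<Oplus>i\<in>I. f i j)"
    using insert by (subst finsum_insert) auto
  also have "\<dots> = (\<Oplus>j\<in>J. f i j \<oplus> (\<Oplus>i\<in>I. f i j))"
    using insert by (intro finsum_addf[symmetric]) auto
  also have "\<dots> = (\<Oplus>j\<in>J. \<Oplus>i'\<in>insert i I. f i' j)"
    using insert by (intro finsum_cong') (auto simp: finsum_insert)
  finally show ?case .
qed

text \<open>Both sides are the sum over \<open>{..<Suc n}\<close>, once with the first and once with
  the last term split off. This is the shift that makes traces fixed.\<close>

lemma (in abelian_group) finsum_lessThan_shift: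
  assumes "\<And>i. f i \<in> carrier G"
  shows "f (0::nat) \<oplus> (\<Oplus>i\<in>{..<n}. f (Suc i)) = (\<Oplus>i\<in>{..<n}. f i) \<oplus> f n"
proof -
  note * = lessThan_Suc[of n] lessThan_Suc_eq_insert_0[of n]
  have "(\<Oplus>i\<in>{..<Suc n}. f i) = f 0 \<oplus> (\<Oplus>i\<in>{..<n}. f (Suc i))"
    unfolding *(2) using assms
    by (subst finsum_insert) (auto simp: finsum_reindex)
  moreover have "(\<Oplus>i\<in>{..<Suc n}. f i) = f n \<oplus> (\<Oplus>i\<in>{..<n}. f i)"
    unfolding *(1) using assms by (subst finsum_insert) auto
  ultimately show ?thesis using assms by (simp add: a_comm)
qed

lemma (in abelian_group) finsum_neg:
  assumes "f \<in> I \<rightarrow> carrier G"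
  shows "(\<Oplus>i\<in>I. \<ominus> f i) = \<ominus> (\<Oplus>i\<in>I. f i)"
proof -
  have "additive_map G G (\<lambda>x. \<ominus> x)"
    by (rule additive_mapI) (auto simp: minus_add)
  from additive_map_finsum[OF _ _ this assms] show ?thesis
    using abelian_group_axioms by simp
qed

section \<open>Fields with a Frobenius automorphism\<close>

text \<open>The consequences of \<open>k\<close> being an algebraic closure of a field with q
  elements on which descent rests. They pass from q to \<open>q^r\<close>
  (\<open>frobenius_field_power\<close>), so every result below can be reused for maps that are
  semilinear for the \<open>q^r\<close>-power.\<close>

locale frobenius_field = field k for k (structure) +
  fixes q :: nat
  assumes q_gt_1: "1 < q"
    and frob_add: "\<lbrakk>x \<in> carrier k; y \<in> carrier k\<rbrakk> \<Longrightarrow> (x \<oplus> y) [^] q = x [^] q \<oplus> y [^] q"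
    and frob_periodic: "x \<in> carrier k \<Longrightarrow> \<exists>n>0. x [^] (q ^ n) = x"
    and card_frob_fixed: "n > 0 \<Longrightarrow> card {x \<in> carrier k. x [^] (q ^ n) = x} = q ^ n"
begin

text \<open>The subfield with \<open>q^n\<close> elements for positive n; \<open>Kn 0\<close> is all
  of \<open>k\<close>.\<close>

definition Kn :: "nat \<Rightarrow> 'a set" where
  "Kn n = {x \<in> carrier k. x [^] (q ^ n) = x}"

lemma Kn_carrier: "x \<in> Kn n \<Longrightarrow> x \<in> carrier k"
  by (simp add: Kn_def)

lemma Kn_pow: "x \<in> Kn n \<Longrightarrow> x [^] (q ^ n) = x"
  by (simp add: Kn_def)

lemma finite_Kn: "n > 0 \<Longrightarrow> finite (Kn n)"
  using card_frob_fixed[of n] q_gt_1 by (auto simp: Kn_def intro: card_ge_0_finite)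

lemma card_Kn: "n > 0 \<Longrightarrow> card (Kn n) = q ^ n"
  using card_frob_fixed[of n] by (simp add: Kn_def)

lemma frob_pow_add:
  "\<lbrakk>x \<in> carrier k; y \<in> carrier k\<rbrakk> \<Longrightarrow> (x \<oplus> y) [^] (q ^ n) = x [^] (q ^ n) \<oplus> y [^] (q ^ n)"
proof (induction n)
  case (Suc n)
  then have "(x \<oplus> y) [^] (q ^ n * q) = (x [^] (q ^ n) \<oplus> y [^] (q ^ n)) [^] q"
    by (subst nat_pow_pow[symmetric]) auto
  also have "\<dots> = x [^] (q ^ n * q) \<oplus> y [^] (q ^ n * q)"
    using Suc.prems by (simp add: frob_add nat_pow_pow)
  finally show ?case by (simp add: mult.commute)
qed simp

lemma frob_pow_pow: "x \<in> carrier k \<Longrightarrow> (x [^] (q ^ n)) [^] (q ^ m) = x [^] (q ^ (n + m))"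
  by (simp add: nat_pow_pow power_add)

lemma frob_additive: "additive_map k k (\<lambda>x. x [^] (q ^ n))"
  by (rule additive_mapI) (auto simp: frob_pow_add)

lemma frob_pow_zero: "\<zero> [^] (q ^ n) = \<zero>"
  using q_gt_1 by (simp add: nat_pow_zero)

lemma frob_pow_neg: "x \<in> carrier k \<Longrightarrow> (\<ominus> x) [^] (q ^ n) = \<ominus> (x [^] (q ^ n))"
  using additive_map_neg[OF _ _ frob_additive] abelian_group_axioms by blast

lemma nat_pow_inv: "x \<in> carrier k - {\<zero>} \<Longrightarrow> (inv x) [^] (m::nat) = inv (x [^] m)"
proof -
  assume x: "x \<in> carrier k - {\<zero>}"
  then have u: "x \<in> Units k" using field_Units by simp
  then have "x [^] m \<otimes> inv x [^] m = (x \<otimes> inv x) [^] m"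
    by (subst nat_pow_distrib) auto
  also have "\<dots> = \<one>" using u by simp
  finally show "inv x [^] m = inv (x [^] m)"
    using comm_inv_char[of "x [^] m" "inv x [^] m"] u x by simp
qed

lemma Kn_zero: "\<zero> \<in> Kn n" and Kn_one: "\<one> \<in> Kn n"
  by (auto simp: Kn_def frob_pow_zero)

lemma Kn_add: "x \<in> Kn n \<Longrightarrow> y \<in> Kn n \<Longrightarrow> x \<oplus> y \<in> Kn n"
  by (auto simp: Kn_def frob_pow_add)

lemma Kn_mult: "x \<in> Kn n \<Longrightarrow> y \<in> Kn n \<Longrightarrow> x \<otimes> y \<in> Kn n"
  by (auto simp: Kn_def nat_pow_distrib)

lemma Kn_neg: "x \<in> Kn n \<Longrightarrow> \<ominus> x \<in> Kn n"
  by (auto simp: Kn_def frob_pow_neg)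

lemma inv_carrier: "x \<in> carrier k - {\<zero>} \<Longrightarrow> inv x \<in> carrier k - {\<zero>}"
  using field_Units Units_inv_Units by blast

lemma Kn_inv: "x \<in> Kn n - {\<zero>} \<Longrightarrow> inv x \<in> Kn n - {\<zero>}"
  using inv_carrier[of x] nat_pow_inv[of x "q ^ n"] by (auto simp: Kn_def)

lemma Kn_pow_closed: "x \<in> Kn n \<Longrightarrow> x [^] (m::nat) \<in> Kn n"
  by (induction m) (auto simp: Kn_one Kn_mult)

lemma Kn_dvd: "x \<in> Kn n \<Longrightarrow> n dvd m \<Longrightarrow> x \<in> Kn m"
proof (elim dvdE)
  fix j assume x: "x \<in> Kn n" and m: "m = n * j"
  have "x [^] (q ^ (n * j)) = x" for j
  proof (induction j)
    case (Suc j)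
    have "x [^] (q ^ (n + n * j)) = (x [^] (q ^ n)) [^] (q ^ (n * j))"
      using x Kn_carrier by (simp add: frob_pow_pow)
    then show ?case using Suc x by (simp add: Kn_def)
  qed (use x Kn_carrier in simp)
  then show ?thesis using x m by (simp add: Kn_def)
qed

lemma nonzero_mult: "x \<in> carrier k - {\<zero>} \<Longrightarrow> y \<in> carrier k - {\<zero>} \<Longrightarrow> x \<otimes> y \<in> carrier k - {\<zero>}"
  using integral by auto

lemma r_inv_k: "x \<in> carrier k - {\<zero>} \<Longrightarrow> x \<otimes> inv x = \<one>"
  and l_inv_k: "x \<in> carrier k - {\<zero>} \<Longrightarrow> inv x \<otimes> x = \<one>"
  using field_Units by auto

lemma inv_mult:
  assumes "x \<in> carrier k - {\<zero>}" "y \<in> carrier k - {\<zero>}"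
  shows "inv (x \<otimes> y) = inv x \<otimes> inv y"
proof -
  have "(x \<otimes> y) \<otimes> (inv x \<otimes> inv y) = (x \<otimes> inv x) \<otimes> (y \<otimes> inv y)"
    using assms inv_carrier[of x] inv_carrier[of y] by (simp add: m_ac)
  also have "\<dots> = \<one>" using assms r_inv_k by simp
  finally show ?thesis
    using comm_inv_char[of "x \<otimes> y" "inv x \<otimes> inv y"] assms inv_carrier[of x] inv_carrier[of y] by simp
qed

text \<open>If m is a period of x, then x is also fixed by the \<open>q^(m n)\<close>-power, so the
  root is the \<open>q^(m n - n)\<close>-power of x.\<close>

lemma frob_pow_surj:
  assumes "x \<in> carrier k" shows "\<exists>y \<in> carrier k. y [^] (q ^ n) = x"
proof -
  obtain m where m: "m > 0" "x [^] (q ^ m) = x" using frob_periodic assms by blast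
  have "x \<in> Kn (m * n)" using Kn_dvd[of x m "m * n"] m assms by (simp add: Kn_def)
  moreover have "m * n = (m * n - n) + n" using m(1) by simp
  ultimately have "(x [^] (q ^ (m * n - n))) [^] (q ^ n) = x"
    using frob_pow_pow[OF assms, of "m * n - n" n] by (simp add: Kn_def)
  then show ?thesis using assms by blast
qed

lemma Kn_nonzero_mult_image:
  assumes "g \<in> Kn n - {\<zero>}"
  shows "(\<lambda>c. g \<otimes> c) ` (Kn n - {\<zero>}) = Kn n - {\<zero>}" "inj_on (\<lambda>c. g \<otimes> c) (Kn n - {\<zero>})"
proof -
  have gc: "g \<in> carrier k - {\<zero>}" using assms Kn_carrier by auto
  have 0: "h \<otimes> c \<in> Kn n - {\<zero>}" if "h \<in> Kn n - {\<zero>}" "c \<in> Kn n - {\<zero>}" for h c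
    using nonzero_mult[of h c] Kn_mult[of h n c] Kn_carrier[of c n] Kn_carrier[of h n] that by simp
  then have 1: "(\<lambda>c. h \<otimes> c) ` (Kn n - {\<zero>}) \<subseteq> Kn n - {\<zero>}" if "h \<in> Kn n - {\<zero>}" for h
    using that by (simp add: image_subset_iff)
  have 2: "Kn n - {\<zero>} \<subseteq> (\<lambda>c. g \<otimes> c) ` (Kn n - {\<zero>})"
  proof
    fix c assume c: "c \<in> Kn n - {\<zero>}"
    have "inv g \<otimes> c \<in> Kn n - {\<zero>}" using 0[OF Kn_inv[OF assms] c] .
    moreover have "g \<otimes> (inv g \<otimes> c) = c"
      using gc c r_inv_k[OF gc] inv_carrier[OF gc] Kn_carrier[of c n] m_assoc[of g "inv g" c] by simp
    ultimately show "c \<in> (\<lambda>c. g \<otimes> c) ` (Kn n - {\<zero>})"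
      by (intro image_eqI[where x = "inv g \<otimes> c"]) (simp_all del: Diff_iff)
  qed
  show "(\<lambda>c. g \<otimes> c) ` (Kn n - {\<zero>}) = Kn n - {\<zero>}" using 1[OF assms] 2 by (rule subset_antisym)
  show "inj_on (\<lambda>c. g \<otimes> c) (Kn n - {\<zero>})"
    using gc by (intro inj_onI) (simp add: Kn_def m_lcancel)
qed

text \<open>Translation by 1 permutes \<open>Kn n\<close>. Comparing the sum of all elements with
  its translate shows that the sum of 1 over \<open>Kn n\<close> vanishes; removing the term at zero
  leaves -1.\<close>

lemma sum_one_Kn:
  assumes "n > 0" shows "(\<Oplus>c\<in>Kn n - {\<zero>}. \<one>) = \<ominus> \<one>"
proof -
  have fin: "finite (Kn n)" using finite_Kn assms .
  have img: "(\<lambda>c. c \<oplus> \<one>) ` Kn n = Kn n"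
  proof
    show "(\<lambda>c. c \<oplus> \<one>) ` Kn n \<subseteq> Kn n" using Kn_add Kn_one by auto
    show "Kn n \<subseteq> (\<lambda>c. c \<oplus> \<one>) ` Kn n"
    proof
      fix c assume c: "c \<in> Kn n"
      have "c = (c \<oplus> \<ominus> \<one>) \<oplus> \<one>" using Kn_carrier[OF c] by (simp add: a_assoc l_neg)
      then show "c \<in> (\<lambda>c. c \<oplus> \<one>) ` Kn n" using Kn_add[OF c Kn_neg[OF Kn_one]] by blast
    qed
  qed
  have inj: "inj_on (\<lambda>c. c \<oplus> \<one>) (Kn n)"
    using Kn_carrier by (auto intro!: inj_onI)
  have Kc: "(\<lambda>c. c) \<in> Kn n \<rightarrow> carrier k" using Kn_carrier by auto
  have "(\<Oplus>c\<in>Kn n. c) = (\<Oplus>c\<in>(\<lambda>c. c \<oplus> \<one>) ` Kn n. c)" by (simp add: img)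
  also have "\<dots> = (\<Oplus>c\<in>Kn n. c \<oplus> \<one>)" using Kc inj by (subst finsum_reindex) auto
  also have "\<dots> = (\<Oplus>c\<in>Kn n. c) \<oplus> (\<Oplus>c\<in>Kn n. \<one>)" using Kc by (subst finsum_addf) auto
  finally have *: "(\<Oplus>c\<in>Kn n. \<one>) = \<zero>"
    using add.r_cancel_one'[of "\<Oplus>c\<in>Kn n. c" "\<Oplus>c\<in>Kn n. \<one>"]
    by (simp add: finsum_closed Kc)
  have "(\<Oplus>c\<in>insert \<zero> (Kn n - {\<zero>}). \<one>) = \<one> \<oplus> (\<Oplus>c\<in>Kn n - {\<zero>}. \<one>)"
    using fin by (subst finsum_insert) auto
  moreover have "insert \<zero> (Kn n - {\<zero>}) = Kn n" using Kn_zero by auto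
  ultimately have "\<one> \<oplus> (\<Oplus>c\<in>Kn n - {\<zero>}. \<one>) = \<zero>" using * by simp
  then show ?thesis
    using minus_equality[of "\<Oplus>c\<in>Kn n - {\<zero>}. \<one>" "\<one>"] a_comm[of \<one>] by (simp add: finsum_closed)
qed

text \<open>Character orthogonality: replacing c by g c multiplies the sum by
  \<open>g^(q^s - 1)\<close>, which is not 1 when g lies outside \<open>Kn s\<close>.\<close>

lemma sum_frob_Kn:
  assumes "0 < s" "s < n"
  shows "(\<Oplus>c\<in>Kn n - {\<zero>}. inv c \<otimes> c [^] (q ^ s)) = \<zero>" (is "?S = _")
proof -
  let ?f = "\<lambda>c. inv c \<otimes> c [^] (q ^ s)"
  have Kc: "c \<in> carrier k - {\<zero>}" if "c \<in> Kn n - {\<zero>}" for c using that Kn_carrier by auto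
  have fc: "?f c \<in> carrier k" if "c \<in> carrier k - {\<zero>}" for c using inv_carrier[OF that] that by auto
  \<comment> \<open>Counting provides an element g of \<open>Kn n\<close> outside
    \<open>Kn s\<close>.\<close>
  have "q ^ s < q ^ n" using assms q_gt_1 by simp
  then have "\<not> Kn n \<subseteq> Kn s"
    using card_mono[OF finite_Kn[OF assms(1)], of "Kn n"] card_Kn[of n] card_Kn[of s] assms by auto
  then obtain g where g: "g \<in> Kn n" "g \<notin> Kn s" by auto
  then have g0: "g \<in> Kn n - {\<zero>}" "g \<in> carrier k - {\<zero>}" using Kn_zero Kn_carrier by auto
  have S: "?S \<in> carrier k" using fc Kc by (intro finsum_closed) auto
  have "?S = (\<Oplus>c\<in>(\<lambda>c. g \<otimes> c) ` (Kn n - {\<zero>}). ?f c)"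
    by (simp add: Kn_nonzero_mult_image[OF g0(1)])
  also have "\<dots> = (\<Oplus>c\<in>Kn n - {\<zero>}. ?f (g \<otimes> c))"
    using Kn_nonzero_mult_image[OF g0(1)] fc Kc by (subst finsum_reindex) auto
  also have "\<dots> = (\<Oplus>c\<in>Kn n - {\<zero>}. ?f g \<otimes> ?f c)"
  proof (rule finsum_cong')
    fix c assume c: "c \<in> Kn n - {\<zero>}"
    note c' = Kc[OF c]
    have "inv (g \<otimes> c) = inv g \<otimes> inv c"
      using inv_mult g0(2) c' .
    then show "?f (g \<otimes> c) = ?f g \<otimes> ?f c"
      using c' g0 inv_carrier[OF c'] inv_carrier[OF g0(2)]
      by (simp add: nat_pow_distrib m_ac)
  qed (use fc g0 Kc in auto)
  also have "\<dots> = ?f g \<otimes> ?S"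
    using fc g0 Kc finite_Kn[of n] assms by (intro finsum_rdistr[symmetric]) auto
  finally have "(?f g \<ominus> \<one>) \<otimes> ?S = \<zero>"
    using S fc[OF g0(2)] by (simp add: l_distr minus_eq l_minus r_neg)
  moreover have "?f g \<noteq> \<one>"
  proof
    assume "?f g = \<one>"
    then have "g \<otimes> (inv g \<otimes> g [^] (q ^ s)) = g" using g0 by simp
    then have "g [^] (q ^ s) = g"
      using g0 inv_carrier[OF g0(2)] r_inv_k[OF g0(2)] by (simp add: m_assoc[symmetric])
    then show False using g g0 by (simp add: Kn_def)
  qed
  ultimately show ?thesis
    using S fc[OF g0(2)] integral_iff[of "?f g \<ominus> \<one>" ?S] by auto
qed

lemma frobenius_field_power:
  assumes "r > 0" shows "frobenius_field k (q ^ r)"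
proof
  show "1 < q ^ r" using q_gt_1 assms one_less_power by blast
  show "(x \<oplus> y) [^] (q ^ r) = x [^] (q ^ r) \<oplus> y [^] (q ^ r)"
    if "x \<in> carrier k" "y \<in> carrier k" for x y using frob_pow_add that .
  show "card {x \<in> carrier k. x [^] ((q ^ r) ^ n) = x} = (q ^ r) ^ n" if "n > 0" for n
    using card_frob_fixed[of "r * n"] assms that by (simp add: power_mult)
  show "\<exists>n>0. x [^] ((q ^ r) ^ n) = x" if x: "x \<in> carrier k" for x
  proof -
    obtain n where n: "n > 0" "x [^] (q ^ n) = x" using frob_periodic x by blast
    have "x \<in> Kn (r * n)" using Kn_dvd[of x n "r * n"] n x by (simp add: Kn_def)
    then show ?thesis using n by (auto simp: Kn_def power_mult)
  qed
qed

end

section \<open>Finite subfields of an algebraically closed field\<close>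

context field
begin

lemma eval_replicate_zero:
  "\<lbrakk>x \<in> carrier R; set p \<subseteq> carrier R\<rbrakk> \<Longrightarrow> eval (replicate m \<zero> @ p) x = eval p x"
  by (induction m) (simp_all add: eval_in_carrier)

text \<open>With m units, the polynomial \<open>X^(m+1) - X + 1\<close> would take the value 1
  everywhere and so have no root.\<close>

lemma infinite_carrier:
  assumes "algebraically_closed R" shows "infinite (carrier R)"
proof
  assume fin: "finite (carrier R)"
  interpret algebraically_closed R by fact
  have U: "Units R = carrier R - {\<zero>}" by (rule field_Units)
  define m where "m = card (Units R)"
  have finU: "finite (Units R)" using U fin by simp
  have m: "m > 0" using finU Units_one_closed unfolding m_def card_gt_0_iff by blast
  have pow: "x [^] m = \<one>" if "x \<in> carrier R" "x \<noteq> \<zero>" for x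
    using units_power_order_eq_one[of x] finU U that unfolding m_def by blast
  define P where "P = \<one> # replicate (m - 1) \<zero> @ [\<ominus> \<one>, \<one>]"
  have P: "P \<in> carrier (poly_ring R)"
    unfolding univ_poly_carrier[symmetric] polynomial_def by (auto simp: P_def)
  have "eval P x \<noteq> \<zero>" if x: "x \<in> carrier R" for x
  proof -
    have "eval P x = x [^] Suc m \<oplus> (\<ominus> x \<oplus> \<one>)"
      using m x by (simp add: P_def eval_replicate_zero l_minus)
    also have "x [^] Suc m = x" using pow[OF x] x m by (cases "x = \<zero>") auto
    finally show ?thesis using x by (simp add: a_assoc[symmetric] r_neg)
  qed
  then have "set_mset (roots P) = {}"
    using roots_mem_iff_is_root[OF P] by (auto simp: is_root_def)
  then show False
    using roots_over_carrier[OF P] m by (simp add: splitted_def P_def)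
qed

lemma exists_root:
  assumes "algebraically_closed R" "P \<in> carrier (poly_ring R)" "degree P > 0"
  shows "\<exists>x \<in> carrier R. eval P x = \<zero>"
proof -
  interpret algebraically_closed R by fact
  have "roots P \<noteq> {#}" using roots_over_carrier[OF assms(2)] assms(3) by (auto simp: splitted_def)
  then obtain x where "x \<in># roots P" by blast
  then show ?thesis using roots_mem_iff_is_root[OF assms(2)] by (auto simp: is_root_def)
qed

text \<open>\<open>X\<^sup>Q - X\<close> has no multiple root \<open>a\<close>: by additivity \<open>t\<^sup>Q - t = (t - a)\<^sup>Q - (t - a)\<close>, so a
  factor \<open>(X - a)\<^sup>2\<close> would force \<open>(t - a)\<^bsup>Q-1\<^esup> - 1 = (t - a) S(t)\<close>, which fails at \<open>t = a\<close>.\<close>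

lemma card_pow_fixed:
  fixes Q :: nat
  assumes ac: "algebraically_closed R" and Q: "1 < Q"
    and add: "\<And>x y. \<lbrakk>x \<in> carrier R; y \<in> carrier R\<rbrakk> \<Longrightarrow> (x \<oplus> y) [^] Q = x [^] Q \<oplus> y [^] Q"
  shows "card {x \<in> carrier R. x [^] Q = x} = Q"
proof -
  interpret algebraically_closed R by fact
  interpret UP: domain "poly_ring R" by (rule univ_poly_is_domain[OF carrier_is_subring])
  \<comment> \<open>\<open>X^Q - X\<close> as a coefficient list with the leading coefficient first;
    the \<open>Q - 2\<close> zeros fill the degrees from Q - 1 down to 2.\<close>
  define P where "P = \<one> # replicate (Q - 2) \<zero> @ [\<ominus> \<one>, \<zero>]"
  have P: "P \<in> carrier (poly_ring R)"
    unfolding univ_poly_carrier[symmetric] polynomial_def by (auto simp: P_def)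
  have ev: "eval P x = x [^] Q \<ominus> x" if x: "x \<in> carrier R" for x
  proof -
    have "Suc (Suc (Q - 2)) = Q" using Q by simp
    then show ?thesis using x
      by (simp add: P_def eval_replicate_zero l_minus minus_eq del: nat_pow_Suc)
  qed
  have root: "is_root P x \<longleftrightarrow> x \<in> carrier R \<and> x [^] Q = x" for x
    using ev[of x] by (auto simp: is_root_def P_def)
  have simple: "alg_mult P a \<le> 1" for a
  proof (rule ccontr)
    assume "\<not> alg_mult P a \<le> 1"
    then have a2: "2 \<le> alg_mult P a" by simp
    then have "is_root P a" using alg_mult_gt_zero_iff_is_root[OF P, of a] by simp
    then have a: "a \<in> carrier R" "a [^] Q = a" using root by auto
    let ?L = "[\<one>, \<ominus> a]"
    have L: "?L \<in> carrier (poly_ring R)"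
      unfolding univ_poly_carrier[symmetric] polynomial_def using a by auto
    obtain S where S: "S \<in> carrier (poly_ring R)"
      and PS: "P = (?L [^]\<^bsub>poly_ring R\<^esub> (2::nat)) \<otimes>\<^bsub>poly_ring R\<^esub> S"
      using le_alg_mult_imp_pdivides[OF a(1) P a2] unfolding pdivides_def factor_def by auto
    \<comment> \<open>Cancelling the factor t - a is possible only for t different from a, so the
      contradiction at a is not immediate. As a polynomial, \<open>W\<close> is nonzero because its
      value at a is -1, yet it vanishes at every other point of an infinite field.\<close>
    define W where "W = (?L [^]\<^bsub>poly_ring R\<^esub> (Q - 1)) \<ominus>\<^bsub>poly_ring R\<^esub> \<one>\<^bsub>poly_ring R\<^esub>
       \<ominus>\<^bsub>poly_ring R\<^esub> (?L \<otimes>\<^bsub>poly_ring R\<^esub> S)"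
    have W: "W \<in> carrier (poly_ring R)" using L S by (simp add: W_def)
    have evL: "eval ?L t = t \<ominus> a" if "t \<in> carrier R" for t using that a by (simp add: minus_eq)
    have hom: "ring_hom_cring (poly_ring R) R (\<lambda>p. eval p t)" if "t \<in> carrier R" for t
      using eval_cring_hom[OF carrier_is_subring that] .
    have evS: "eval S t \<in> carrier R" if "t \<in> carrier R" for t
      using eval_in_carrier[OF _ that] S unfolding univ_poly_carrier[symmetric] polynomial_def by auto
    have evP: "eval P t = (t \<ominus> a) \<otimes> (t \<ominus> a) \<otimes> eval S t" if t: "t \<in> carrier R" for t
    proof -
      interpret h: ring_hom_cring "poly_ring R" R "\<lambda>p. eval p t" by (rule hom[OF t])
      show ?thesis unfolding PS using L S evL[OF t] t a by (simp add: numeral_2_eq_2 del: eval.simps)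
    qed
    have evW: "eval W t = (t \<ominus> a) [^] (Q - 1) \<ominus> \<one> \<ominus> (t \<ominus> a) \<otimes> eval S t" if t: "t \<in> carrier R" for t
    proof -
      interpret h: ring_hom_cring "poly_ring R" R "\<lambda>p. eval p t" by (rule hom[OF t])
      show ?thesis unfolding W_def a_minus_def using L S evL[OF t] evS[OF t] t a
        by (simp add: a_minus_def del: eval.simps)
    qed
    have "eval W a = \<ominus> \<one>"
      using Q evS[OF a(1)] a by (subst evW) (auto simp: minus_eq r_neg nat_pow_zero)
    then have "W \<noteq> []" using l_neg[OF one_closed] by auto
    moreover have "eval W t = \<zero>" if t: "t \<in> carrier R" "t \<noteq> a" for t
    proof -
      let ?d = "t \<ominus> a"
      have d: "?d \<in> carrier R" "?d \<noteq> \<zero>" using t a by auto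
      have S': "eval S t \<in> carrier R" by (rule evS[OF t(1)])
      have "t [^] Q = (?d \<oplus> a) [^] Q" using t a by (simp add: minus_eq a_assoc l_neg)
      also have "\<dots> = ?d [^] Q \<oplus> a" using add[OF d(1) a(1)] a by simp
      finally have tQ: "t [^] Q = ?d [^] Q \<oplus> a" .
      have "?d \<otimes> (?d \<otimes> eval S t) = eval P t" using evP[OF t(1)] d S' by (simp add: m_assoc)
      also have "\<dots> = ?d [^] Q \<oplus> a \<ominus> t" using ev t tQ by simp
      also have "\<dots> = ?d [^] Q \<ominus> ?d" using t a d by (simp add: minus_eq minus_add a_ac)
      also have "\<dots> = ?d \<otimes> (?d [^] (Q - 1) \<ominus> \<one>)"
      proof -
        have "?d [^] Q = ?d [^] Suc (Q - 1)" using Q by simp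
        also have "\<dots> = ?d \<otimes> ?d [^] (Q - 1)" using d by (simp add: m_comm)
        finally show ?thesis using d by (simp add: minus_eq r_distr r_minus)
      qed
      finally have "?d \<otimes> eval S t = ?d [^] (Q - 1) \<ominus> \<one>"
        using d S' by (simp add: m_lcancel)
      then show ?thesis using evW[OF t(1)] d S' by (simp add: minus_eq r_neg)
    qed
    ultimately have "carrier R - {a} \<subseteq> {x. is_root W x}" by (auto simp: is_root_def)
    then have "finite (carrier R)"
      using finite_number_of_roots[OF W] finite_subset by fastforce
    then show False using infinite_carrier[OF ac] by simp
  qed
  have roots: "set_mset (roots P) = {x \<in> carrier R. x [^] Q = x}"
    using roots_mem_iff_is_root[OF P] root by auto
  have "count (roots P) x = (if x \<in># roots P then 1 else 0)" for x
    using simple[of x] alg_mult_eq_count_roots[OF P] count_greater_zero_iff[of "roots P" x]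
    by (auto simp: not_in_iff intro: le_antisym)
  then have "size (roots P) = card (set_mset (roots P))"
    by (simp add: size_multiset_overloaded_eq)
  then show ?thesis
    using roots roots_over_carrier[OF P] Q by (simp add: splitted_def P_def)
qed

end

section \<open>Frobenius maps and descent\<close>

text \<open>Bijectivity is left out of the axioms because periodicity implies it
  (\<open>Fp_bij\<close>); instances then have only the algebraic laws and periodicity to
  verify.\<close>

locale frobenius_space = frobenius_field k q + V: module k V
  for k :: "('a, 'f) ring_scheme" (structure) and q and V :: "('a, 'v, 'e) module_scheme" +
  fixes F :: "'v \<Rightarrow> 'v"
  assumes F_additive: "additive_map V V F"
    and F_smult: "\<lbrakk>c \<in> carrier k; v \<in> carrier V\<rbrakk> \<Longrightarrow> F (c \<odot>\<^bsub>V\<^esub> v) = (c [^] q) \<odot>\<^bsub>V\<^esub> F v"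
    and F_periodic: "v \<in> carrier V \<Longrightarrow> \<exists>n>0. (F ^^ n) v = v"
begin

text \<open>A vector space over \<open>Kn n\<close>; \<open>Fix 1\<close> is the form of
  \<open>V\<close> over the base field.\<close>

definition Fix :: "nat \<Rightarrow> 'v set" where
  "Fix n = {v \<in> carrier V. (F ^^ n) v = v}"

definition tr :: "nat \<Rightarrow> 'v \<Rightarrow> 'v" where
  "tr n v = finsum V (\<lambda>i. (F ^^ i) v) {..<n}"

lemma abelian_V: "abelian_group V" by (rule V.M.abelian_group_axioms)

lemma abelian_k: "abelian_group k" by (rule abelian_group_axioms)

lemma smult_additive: "c \<in> carrier k \<Longrightarrow> additive_map V V (\<lambda>v. c \<odot>\<^bsub>V\<^esub> v)"
  by (rule additive_mapI) (auto simp: V.smult_r_distr)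

lemma smult_additive_left: "v \<in> carrier V \<Longrightarrow> additive_map k V (\<lambda>c. c \<odot>\<^bsub>V\<^esub> v)"
  by (rule additive_mapI) (auto simp: V.smult_l_distr)

lemmas Fp_additive = additive_map_funpow[OF F_additive]

lemma Fp_closed: "v \<in> carrier V \<Longrightarrow> (F ^^ n) v \<in> carrier V"
  using additive_map_closed[OF Fp_additive] .

lemma Fp_add: "\<lbrakk>v \<in> carrier V; w \<in> carrier V\<rbrakk> \<Longrightarrow> (F ^^ n) (v \<oplus>\<^bsub>V\<^esub> w) = (F ^^ n) v \<oplus>\<^bsub>V\<^esub> (F ^^ n) w"
  using additive_map_add[OF Fp_additive] .

lemma Fp_smult:
  "\<lbrakk>c \<in> carrier k; v \<in> carrier V\<rbrakk> \<Longrightarrow> (F ^^ n) (c \<odot>\<^bsub>V\<^esub> v) = (c [^] (q ^ n)) \<odot>\<^bsub>V\<^esub> (F ^^ n) v"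
proof (induction n)
  case (Suc n)
  have "(c [^] q ^ n) [^] q = c [^] q ^ Suc n" using Suc.prems by (simp add: nat_pow_pow mult.commute)
  then show ?case using Suc by (simp add: F_smult Fp_closed)
qed simp

lemma Fix_carrier: "v \<in> Fix n \<Longrightarrow> v \<in> carrier V"
  by (simp add: Fix_def)

lemma Fix_1: "v \<in> Fix 1 \<longleftrightarrow> v \<in> carrier V \<and> F v = v"
  by (simp add: Fix_def)

lemma Fix_zero: "\<zero>\<^bsub>V\<^esub> \<in> Fix n"
  using additive_map_zero[OF abelian_V abelian_V Fp_additive] by (simp add: Fix_def)

lemma Fix_add: "\<lbrakk>v \<in> Fix n; w \<in> Fix n\<rbrakk> \<Longrightarrow> v \<oplus>\<^bsub>V\<^esub> w \<in> Fix n"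
  by (simp add: Fix_def Fp_add)

lemma Fix_neg: "v \<in> Fix n \<Longrightarrow> \<ominus>\<^bsub>V\<^esub> v \<in> Fix n"
  using additive_map_neg[OF abelian_V abelian_V Fp_additive] by (simp add: Fix_def)

lemma Fix_smult: "\<lbrakk>c \<in> Kn n; v \<in> Fix n\<rbrakk> \<Longrightarrow> c \<odot>\<^bsub>V\<^esub> v \<in> Fix n"
  by (simp add: Fix_def Fp_smult Kn_def)

lemma Fix_finsum:
  assumes "f \<in> I \<rightarrow> Fix n" shows "finsum V f I \<in> Fix n"
  using assms
proof (induction I rule: infinite_finite_induct)
  case (insert i I)
  then have "f \<in> I \<rightarrow> carrier V" "f i \<in> carrier V" using Fix_carrier by auto
  then show ?case using insert by (simp add: V.M.finsum_insert Fix_add)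
qed (simp_all add: Fix_zero V.M.finsum_infinite)

lemma Fix_mult:
  assumes "v \<in> Fix n" shows "v \<in> Fix (n * j)"
proof -
  have "(F ^^ (n * j)) v = v"
    by (induction j) (use assms in \<open>auto simp: Fix_def funpow_add\<close>)
  then show ?thesis using assms by (simp add: Fix_def)
qed

lemma Fix_dvd: "v \<in> Fix n \<Longrightarrow> n dvd m \<Longrightarrow> v \<in> Fix m"
  using Fix_mult by (auto simp: dvd_def)

lemma Fix_ex: "v \<in> carrier V \<Longrightarrow> \<exists>n>0. v \<in> Fix n"
  using F_periodic by (auto simp: Fix_def)

lemma Fp_fixed: "v \<in> Fix 1 \<Longrightarrow> (F ^^ n) v = v"
  using Fix_mult[of v 1 n] by (simp add: Fix_def)

lemma Fix_ex_common:
  assumes "finite S" "S \<subseteq> carrier V" shows "\<exists>n>0. S \<subseteq> Fix n"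
  using assms
proof (induction S rule: finite_induct)
  case (insert s S)
  then obtain n where n: "n > 0" "S \<subseteq> Fix n" by auto
  obtain m where m: "m > 0" "s \<in> Fix m" using Fix_ex insert.prems by auto
  have "insert s S \<subseteq> Fix (n * m)" using Fix_dvd m n by (auto intro: Fix_dvd)
  then show ?case using n m by (metis nat_0_less_mult_iff)
qed auto

text \<open>If v has period m, then \<open>m n - n\<close> further applications of \<open>F\<close>
  bring \<open>F^n v\<close> back to v, so v vanishes with \<open>F^n v\<close>.\<close>

lemma Fp_inj: "inj_on (F ^^ n) (carrier V)"
proof (rule additive_map_eq_zero_inj[OF abelian_V abelian_V Fp_additive])
  fix v assume v: "v \<in> carrier V" "(F ^^ n) v = \<zero>\<^bsub>V\<^esub>"
  obtain m where m: "m > 0" "v \<in> Fix m" using Fix_ex v by blast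
  have "v \<in> Fix (m * n)" using Fix_mult m by blast
  moreover have "m * n = (m * n - n) + n" using m(1) by simp
  ultimately have "(F ^^ ((m * n - n) + n)) v = v" by (simp add: Fix_def)
  then have "(F ^^ (m * n - n)) ((F ^^ n) v) = v" unfolding funpow_add by simp
  then show "v = \<zero>\<^bsub>V\<^esub>"
    using v additive_map_zero[OF abelian_V abelian_V Fp_additive] by simp
qed

lemma Fp_surj:
  assumes "v \<in> carrier V" shows "\<exists>w \<in> carrier V. (F ^^ n) w = v"
proof -
  obtain m where m: "m > 0" "v \<in> Fix m" using Fix_ex assms by blast
  have "v \<in> Fix (m * n)" using Fix_mult m by blast
  moreover have "m * n = n + (m * n - n)" using m(1) by simp
  ultimately have "(F ^^ (n + (m * n - n))) v = v" by (simp add: Fix_def)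
  then have "(F ^^ n) ((F ^^ (m * n - n)) v) = v" unfolding funpow_add by simp
  then show ?thesis using Fp_closed assms by blast
qed

lemma Fp_bij: "bij_betw (F ^^ n) (carrier V) (carrier V)"
  unfolding bij_betw_def using Fp_inj[of n] Fp_surj[of _ n] Fp_closed[of _ n]
  by (fastforce simp: image_iff)

lemma F_bij: "bij_betw F (carrier V) (carrier V)"
  using Fp_bij[of 1] by simp

lemma tr_closed: "v \<in> carrier V \<Longrightarrow> tr n v \<in> carrier V"
  unfolding tr_def by (rule V.M.finsum_closed) (auto simp: Fp_closed)

lemma tr_additive: "additive_map V V (tr n)"
  unfolding tr_def by (rule additive_map_finsum_fun[OF abelian_V abelian_V Fp_additive])

text \<open>\<open>F\<close> shifts the summands of the trace by one place; the summand
  \<open>F^n v\<close> that enters equals the summand v that is lost.\<close>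

lemma tr_Fix:
  assumes "v \<in> Fix n" shows "tr n v \<in> Fix 1"
proof -
  have v: "v \<in> carrier V" using assms Fix_carrier by blast
  have "F (tr n v) = finsum V (\<lambda>i. (F ^^ Suc i) v) {..<n}"
    unfolding tr_def 
    using additive_map_finsum[OF abelian_V abelian_V F_additive, of "\<lambda>i. (F ^^ i) v" "{..<n}"] v Fp_closed
    by simp
  moreover have "(F ^^ 0) v \<oplus>\<^bsub>V\<^esub> finsum V (\<lambda>i. (F ^^ Suc i) v) {..<n} = tr n v \<oplus>\<^bsub>V\<^esub> (F ^^ n) v"
    unfolding tr_def by (rule V.M.finsum_lessThan_shift) (simp add: Fp_closed v)
  ultimately have "v \<oplus>\<^bsub>V\<^esub> F (tr n v) = v \<oplus>\<^bsub>V\<^esub> tr n v"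
    using assms v tr_closed by (simp add: Fix_def V.M.a_comm)
  then show ?thesis
    unfolding Fix_1 using v tr_closed additive_map_closed[OF F_additive] by simp
qed

text \<open>The coefficients below pick out the \<open>i = 0\<close> term of the traces, because
  \<open>\<Sum> c\<^bsup>q^i - 1\<^esup> = 0\<close> over the nonzero elements of the field with \<open>q\<^sup>n\<close> elements for \<open>0 < i < n\<close>.\<close>

lemma descent:
  assumes n: "n > 0" and v: "v \<in> carrier V"
  shows "v = finsum V (\<lambda>c. (\<ominus> (inv c)) \<odot>\<^bsub>V\<^esub> tr n (c \<odot>\<^bsub>V\<^esub> v)) (Kn n - {\<zero>})"
proof -
  let ?K = "Kn n - {\<zero>}"
  have Kc: "c \<in> carrier k" "inv c \<in> carrier k" if "c \<in> ?K" for c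
    using that Kn_carrier Kn_inv by blast+
  have fin: "finite ?K" using finite_Kn n by simp
  have Fv: "(F ^^ i) v \<in> carrier V" for i using Fp_closed v .
  have "finsum V (\<lambda>c. (\<ominus> (inv c)) \<odot>\<^bsub>V\<^esub> tr n (c \<odot>\<^bsub>V\<^esub> v)) ?K =
    finsum V (\<lambda>c. finsum V (\<lambda>i. (\<ominus> (inv c) \<otimes> c [^] (q ^ i)) \<odot>\<^bsub>V\<^esub> (F ^^ i) v) {..<n}) ?K"
  proof (rule V.M.finsum_cong')
    fix c assume c: "c \<in> ?K"
    have "(\<ominus> (inv c)) \<odot>\<^bsub>V\<^esub> tr n (c \<odot>\<^bsub>V\<^esub> v) =
        finsum V (\<lambda>i. (\<ominus> (inv c)) \<odot>\<^bsub>V\<^esub> (F ^^ i) (c \<odot>\<^bsub>V\<^esub> v)) {..<n}"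
      unfolding tr_def using Kc[OF c] v Fp_closed
      by (intro additive_map_finsum[OF abelian_V abelian_V smult_additive]) auto
    also have "\<dots> = finsum V (\<lambda>i. (\<ominus> (inv c) \<otimes> c [^] (q ^ i)) \<odot>\<^bsub>V\<^esub> (F ^^ i) v) {..<n}"
      using Kc[OF c] v Fv by (intro V.M.finsum_cong') (auto simp: Fp_smult V.smult_assoc1)
    finally show "(\<ominus> (inv c)) \<odot>\<^bsub>V\<^esub> tr n (c \<odot>\<^bsub>V\<^esub> v) = \<dots>" .
  qed (use Kc Fv in \<open>auto intro!: V.M.finsum_closed\<close>)
  also have "\<dots> = finsum V (\<lambda>i. finsum V (\<lambda>c. (\<ominus> (inv c) \<otimes> c [^] (q ^ i)) \<odot>\<^bsub>V\<^esub> (F ^^ i) v) ?K) {..<n}"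
    using Kc Fv fin by (intro V.M.finsum_swap) auto
  also have "\<dots> = finsum V (\<lambda>i. if 0 = i then (F ^^ i) v else \<zero>\<^bsub>V\<^esub>) {..<n}"
  proof (rule V.M.finsum_cong')
    fix i assume i: "i \<in> {..<n}"
    have "finsum V (\<lambda>c. (\<ominus> (inv c) \<otimes> c [^] (q ^ i)) \<odot>\<^bsub>V\<^esub> (F ^^ i) v) ?K =
        (\<Oplus>c\<in>?K. \<ominus> (inv c) \<otimes> c [^] (q ^ i)) \<odot>\<^bsub>V\<^esub> (F ^^ i) v"
      using Kc Fv by (intro additive_map_finsum[OF abelian_k abelian_V smult_additive_left, symmetric]) auto
    also have "(\<Oplus>c\<in>?K. \<ominus> (inv c) \<otimes> c [^] (q ^ i)) = \<ominus> (\<Oplus>c\<in>?K. inv c \<otimes> c [^] (q ^ i))"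
    proof -
      have "(\<Oplus>c\<in>?K. \<ominus> (inv c) \<otimes> c [^] (q ^ i)) = (\<Oplus>c\<in>?K. \<ominus> (inv c \<otimes> c [^] (q ^ i)))"
        using Kc by (intro finsum_cong') (auto simp: l_minus)
      then show ?thesis using Kc by (simp add: finsum_neg)
    qed
    \<comment> \<open>For i = 0 every summand is 1, and 1 summed over the nonzero elements of
      \<open>Kn n\<close> gives -1; the minus sign in the formula compensates for this.\<close>
    also have "(\<Oplus>c\<in>?K. inv c \<otimes> c [^] (q ^ i)) = (if i = 0 then \<ominus> \<one> else \<zero>)"
    proof (cases "i = 0")
      case True
      have "(\<Oplus>c\<in>?K. inv c \<otimes> c [^] (q ^ i)) = (\<Oplus>c\<in>?K. \<one>)"
        using Kc True Kn_carrier by (intro finsum_cong') (auto simp: l_inv_k)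
      then show ?thesis using True sum_one_Kn[OF n] by simp
    qed (use sum_frob_Kn i in auto)
    finally show "finsum V (\<lambda>c. (\<ominus> (inv c) \<otimes> c [^] (q ^ i)) \<odot>\<^bsub>V\<^esub> (F ^^ i) v) ?K =
        (if 0 = i then (F ^^ i) v else \<zero>\<^bsub>V\<^esub>)"
      using v by (cases "i = 0") (simp_all add: Fv)
  qed (use v Fv in auto)
  also have "\<dots> = (F ^^ 0) v"
    using n Fv by (intro V.M.finsum_singleton) auto
  finally show ?thesis by simp
qed

text \<open>By descent every vector is a \<open>k\<close>-combination of fixed vectors. As an
  induction rule this replaces a basis of fixed vectors and is valid in any dimension.\<close>

lemma fix_induct [consumes 1, case_names fixed add smult]:
  assumes v: "v \<in> carrier V"
    and fixed: "\<And>x. x \<in> Fix 1 \<Longrightarrow> P x"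
    and add: "\<And>x y. \<lbrakk>x \<in> carrier V; y \<in> carrier V; P x; P y\<rbrakk> \<Longrightarrow> P (x \<oplus>\<^bsub>V\<^esub> y)"
    and smult: "\<And>c x. \<lbrakk>c \<in> carrier k; x \<in> carrier V; P x\<rbrakk> \<Longrightarrow> P (c \<odot>\<^bsub>V\<^esub> x)"
  shows "P v"
proof -
  \<comment> \<open>The index type is that of the scalars, because the descent formula sums over
    nonzero elements of \<open>Kn n\<close>.\<close>
  have sum: "P (finsum V f I)" if "\<And>i. i \<in> I \<Longrightarrow> f i \<in> carrier V \<and> P (f i)" for f and I :: "'a set"
    using that
  proof (induction I rule: infinite_finite_induct)
    case (insert i I)
    then have "f \<in> I \<rightarrow> carrier V" "f i \<in> carrier V" by auto
    then show ?case using insert by (auto simp: V.M.finsum_insert intro!: add)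
  qed (auto intro: fixed Fix_zero simp: V.M.finsum_infinite)
  obtain n where n: "n > 0" "v \<in> Fix n" using Fix_ex v by blast
  show ?thesis
  proof (subst descent[OF n(1) v], rule sum)
    fix c assume c: "c \<in> Kn n - {\<zero>}"
    then have "c \<in> Kn n" "inv c \<in> carrier k" using Kn_inv Kn_carrier by blast+
    then show "(\<ominus> (inv c)) \<odot>\<^bsub>V\<^esub> tr n (c \<odot>\<^bsub>V\<^esub> v) \<in> carrier V \<and> P ((\<ominus> (inv c)) \<odot>\<^bsub>V\<^esub> tr n (c \<odot>\<^bsub>V\<^esub> v))"
      using smult[of "\<ominus> (inv c)", OF _ tr_closed fixed[OF tr_Fix[OF Fix_smult[OF _ n(2)]]], of c] v
      by (auto simp: tr_closed Kn_carrier)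
  qed
qed

end

text \<open>The field as a one-dimensional space with its own power map as Frobenius. Descent
  applied to this space gives the trace identities for scalars in
  \<open>scalar_trace\<close>.\<close>

lemma (in frobenius_field) self_space:
  "frobenius_space k q \<lparr>carrier = carrier k, monoid.mult = monoid.mult k, one = one k,
     ring.zero = \<zero>, ring.add = ring.add k, smult = monoid.mult k\<rparr> (\<lambda>x. x [^] q)"
  (is "frobenius_space k q ?S _")
proof -
  have ag: "abelian_group ?S"
    by (rule abelian_groupI) (auto simp: a_ac intro: bexI[of _ "\<ominus> _"] l_neg)
  interpret S: module k ?S
    by (rule moduleI[OF is_cring ag]) (auto simp: l_distr r_distr m_assoc)
  have pw: "((\<lambda>x. x [^] q) ^^ n) x = x [^] (q ^ n)" if "x \<in> carrier k" for x n
    by (induction n) (use that in \<open>auto simp: nat_pow_pow mult.commute\<close>)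
  show ?thesis
  proof unfold_locales
    show "additive_map ?S ?S (\<lambda>x. x [^] q)" by (rule additive_mapI) (auto simp: frob_add)
    show "\<exists>n>0. ((\<lambda>x. x [^] q) ^^ n) v = v" if "v \<in> carrier ?S" for v
      using frob_periodic[of v] that pw by auto
  qed (auto simp: nat_pow_distrib)
qed

lemma (in frobenius_field) scalar_trace:
  assumes "n > 0" "d \<in> carrier k"
  shows "d = (\<Oplus>c\<in>Kn n - {\<zero>}. \<ominus> (inv c) \<otimes> (\<Oplus>i\<in>{..<n}. (c \<otimes> d) [^] (q ^ i)))"
    and "d \<in> Kn n \<Longrightarrow> (\<Oplus>i\<in>{..<n}. d [^] (q ^ i)) \<in> Kn 1"
proof -
  let ?S = "\<lparr>carrier = carrier k, monoid.mult = monoid.mult k, one = one k,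
     ring.zero = \<zero>, ring.add = ring.add k, smult = monoid.mult k\<rparr>"
  interpret S: frobenius_space k q ?S "\<lambda>x. x [^] q" by (rule self_space)
  have sum: "finsum ?S = finsum k" by (simp add: fun_eq_iff finsum_def finprod_def)
  have pw: "((\<lambda>x. x [^] q) ^^ n) x = x [^] (q ^ n)" if "x \<in> carrier k" for x n
    by (induction n) (use that in \<open>auto simp: nat_pow_pow mult.commute\<close>)
  have tr: "S.tr n x = (\<Oplus>i\<in>{..<n}. x [^] (q ^ i))" if "x \<in> carrier k" for x
    unfolding S.tr_def sum using that by (intro finsum_cong') (auto simp: pw)
  have "d = (\<Oplus>c\<in>Kn n - {\<zero>}. \<ominus> (inv c) \<otimes> S.tr n (c \<otimes> d))"
    using S.descent[OF assms(1), of d] assms(2) by (simp add: sum)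
  also have "\<dots> = (\<Oplus>c\<in>Kn n - {\<zero>}. \<ominus> (inv c) \<otimes> (\<Oplus>i\<in>{..<n}. (c \<otimes> d) [^] (q ^ i)))"
  proof (rule finsum_cong')
    show "(\<lambda>c. \<ominus> (inv c) \<otimes> (\<Oplus>i\<in>{..<n}. (c \<otimes> d) [^] (q ^ i))) \<in> Kn n - {\<zero>} \<rightarrow> carrier k"
      using assms Kn_inv Kn_carrier by (intro funcsetI m_closed a_inv_closed finsum_closed) blast+
  qed (use assms tr Kn_carrier in auto)
  finally show "d = \<dots>" .
  show "(\<Oplus>i\<in>{..<n}. d [^] (q ^ i)) \<in> Kn 1" if "d \<in> Kn n"
    using S.tr_Fix[of d n] that tr[of d] pw by (simp add: S.Fix_def Kn_def)
qed

text \<open>Since \<open>V = k \<otimes> V\<^sup>F\<close>, a map on the fixed points extends to \<open>V\<close>; the descent formula gives the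
  extension explicitly, which avoids choosing a basis when \<open>V\<close> is infinite-dimensional.\<close>

lemma (in frobenius_space) extension:
  fixes W :: "('a, 'w, 'g) module_scheme" and m :: nat
  assumes W: "module k W"
    and m_add: "\<And>x y. \<lbrakk>x \<in> carrier k; y \<in> carrier k\<rbrakk> \<Longrightarrow> (x \<oplus> y) [^] m = x [^] m \<oplus> y [^] m"
    and D_closed: "\<And>x. x \<in> Fix 1 \<Longrightarrow> D x \<in> carrier W"
    and D_add: "\<And>x y. \<lbrakk>x \<in> Fix 1; y \<in> Fix 1\<rbrakk> \<Longrightarrow> D (x \<oplus>\<^bsub>V\<^esub> y) = D x \<oplus>\<^bsub>W\<^esub> D y"
    and D_smult: "\<And>c x. \<lbrakk>c \<in> Kn 1; x \<in> Fix 1\<rbrakk> \<Longrightarrow> D (c \<odot>\<^bsub>V\<^esub> x) = (c [^] m) \<odot>\<^bsub>W\<^esub> D x"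
  shows "\<exists>E. additive_map V W E \<and>
    (\<forall>c \<in> carrier k. \<forall>v \<in> carrier V. E (c \<odot>\<^bsub>V\<^esub> v) = (c [^] m) \<odot>\<^bsub>W\<^esub> E v) \<and> (\<forall>x \<in> Fix 1. E x = D x)"
proof -
  interpret W: module k W by (rule W)
  have abelian_W: "abelian_group W" by (rule W.M.abelian_group_axioms)
  define K where "K n = Kn n - {\<zero>}" for n
  \<comment> \<open>The value at level n: the descent formula with \<open>D\<close> applied to the
    traces, which are fixed vectors. The coefficients carry the power m because the extension is to
    be semilinear for that power.\<close>
  define e where "e n v = finsum W (\<lambda>c. ((\<ominus> (inv c)) [^] m) \<odot>\<^bsub>W\<^esub> D (tr n (c \<odot>\<^bsub>V\<^esub> v))) (K n)" for n v
  have Kc: "c \<in> Kn n" "c \<in> carrier k" "\<ominus> (inv c) \<in> carrier k" "\<ominus> (inv c) \<in> Kn n" if "c \<in> K n" for c n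
    using that Kn_carrier Kn_inv Kn_neg unfolding K_def by blast+
  have fin: "finite (K n)" if "n > 0" for n using finite_Kn[OF that] by (simp add: K_def)
  have trD: "D (tr n (c \<odot>\<^bsub>V\<^esub> v)) \<in> carrier W" if "c \<in> K n" "v \<in> Fix n" for c n v
    using D_closed tr_Fix Fix_smult Kc that by blast
  have term_closed: "((\<ominus> (inv c)) [^] m) \<odot>\<^bsub>W\<^esub> D (tr n (c \<odot>\<^bsub>V\<^esub> v)) \<in> carrier W"
    if "c \<in> K n" "v \<in> Fix n" for c n v
    using trD[OF that] Kc[OF that(1)] by simp
  have pow_m: "additive_map k k (\<lambda>x. x [^] m)" by (rule additive_mapI) (auto simp: m_add)
  have e_closed: "e n v \<in> carrier W" if "v \<in> Fix n" for n v
    unfolding e_def using term_closed that by (intro W.M.finsum_closed) auto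
  have e_add: "e n (v \<oplus>\<^bsub>V\<^esub> w) = e n v \<oplus>\<^bsub>W\<^esub> e n w" if vw: "v \<in> Fix n" "w \<in> Fix n" for n v w
  proof -
    have "e n (v \<oplus>\<^bsub>V\<^esub> w) = finsum W (\<lambda>c. ((\<ominus> (inv c)) [^] m) \<odot>\<^bsub>W\<^esub> D (tr n (c \<odot>\<^bsub>V\<^esub> v))
        \<oplus>\<^bsub>W\<^esub> ((\<ominus> (inv c)) [^] m) \<odot>\<^bsub>W\<^esub> D (tr n (c \<odot>\<^bsub>V\<^esub> w))) (K n)"
      unfolding e_def
    proof (rule W.M.finsum_cong')
      fix c assume c: "c \<in> K n"
      have "tr n (c \<odot>\<^bsub>V\<^esub> (v \<oplus>\<^bsub>V\<^esub> w)) = tr n (c \<odot>\<^bsub>V\<^esub> v) \<oplus>\<^bsub>V\<^esub> tr n (c \<odot>\<^bsub>V\<^esub> w)"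
        using vw Fix_carrier Kc[OF c] by (simp add: V.smult_r_distr additive_map_add[OF tr_additive])
      moreover have "tr n (c \<odot>\<^bsub>V\<^esub> v) \<in> Fix 1" "tr n (c \<odot>\<^bsub>V\<^esub> w) \<in> Fix 1"
        using vw tr_Fix Fix_smult Kc[OF c] by blast+
      ultimately show "((\<ominus> (inv c)) [^] m) \<odot>\<^bsub>W\<^esub> D (tr n (c \<odot>\<^bsub>V\<^esub> (v \<oplus>\<^bsub>V\<^esub> w))) =
        ((\<ominus> (inv c)) [^] m) \<odot>\<^bsub>W\<^esub> D (tr n (c \<odot>\<^bsub>V\<^esub> v))
        \<oplus>\<^bsub>W\<^esub> ((\<ominus> (inv c)) [^] m) \<odot>\<^bsub>W\<^esub> D (tr n (c \<odot>\<^bsub>V\<^esub> w))"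
        using Kc[OF c] D_add D_closed by (simp add: W.smult_r_distr)
    qed (use term_closed vw in auto)
    then show ?thesis
      unfolding e_def using term_closed vw by (subst W.M.finsum_addf[symmetric]) auto
  qed
  \<comment> \<open>For fixed x the trace of c d x is the scalar trace of c d times x. This scalar
    lies in \<open>Kn 1\<close>, so \<open>D_smult\<close> applies, and \<open>scalar_trace\<close>
    collapses the sum to d; additivity of the m-th power allows it to be taken outside the
    sum.\<close>
  have e_basic: "e n (d \<odot>\<^bsub>V\<^esub> x) = (d [^] m) \<odot>\<^bsub>W\<^esub> D x" if n: "n > 0" and d: "d \<in> Kn n" and x: "x \<in> Fix 1" for n d x
  proof -
    define T where "T c = (\<Oplus>i\<in>{..<n}. (c \<otimes> d) [^] (q ^ i))" for c
    have dc: "d \<in> carrier k" and xc: "x \<in> carrier V" using d x Kn_carrier Fix_carrier by auto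
    have T1: "T c \<in> Kn 1" if "c \<in> K n" for c
      unfolding T_def using scalar_trace(2)[OF n, of "c \<otimes> d"] Kn_mult Kn_carrier d Kc[OF that] by auto
    have Tc: "T c \<in> carrier k" if "c \<in> K n" for c using T1[OF that] Kn_carrier by blast
    have trT: "tr n (c \<odot>\<^bsub>V\<^esub> (d \<odot>\<^bsub>V\<^esub> x)) = T c \<odot>\<^bsub>V\<^esub> x" if c: "c \<in> K n" for c
    proof -
      have "tr n (c \<odot>\<^bsub>V\<^esub> (d \<odot>\<^bsub>V\<^esub> x)) = finsum V (\<lambda>i. ((c \<otimes> d) [^] (q ^ i)) \<odot>\<^bsub>V\<^esub> x) {..<n}"
        unfolding tr_def using Kc[OF c] dc xc x
        by (intro V.M.finsum_cong') (auto simp: V.smult_assoc1[symmetric] Fp_smult Fp_fixed[simplified])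
      also have "\<dots> = T c \<odot>\<^bsub>V\<^esub> x"
        unfolding T_def using Kc[OF c] dc xc
        by (intro additive_map_finsum[OF abelian_k abelian_V smult_additive_left, symmetric]) auto
      finally show ?thesis .
    qed
    have Dx: "D x \<in> carrier W" using D_closed x .
    have "e n (d \<odot>\<^bsub>V\<^esub> x) = finsum W (\<lambda>c. ((\<ominus> (inv c) \<otimes> T c) [^] m) \<odot>\<^bsub>W\<^esub> D x) (K n)"
      unfolding e_def
    proof (rule W.M.finsum_cong')
      fix c assume c: "c \<in> K n"
      then show "((\<ominus> (inv c)) [^] m) \<odot>\<^bsub>W\<^esub> D (tr n (c \<odot>\<^bsub>V\<^esub> (d \<odot>\<^bsub>V\<^esub> x))) =
          ((\<ominus> (inv c) \<otimes> T c) [^] m) \<odot>\<^bsub>W\<^esub> D x"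
        using Kc[OF c] Tc[OF c] Dx
        by (simp add: trT D_smult[OF T1 x] nat_pow_distrib W.smult_assoc1 del: One_nat_def)
    qed (use Kc Tc Dx in auto)
    also have "\<dots> = (\<Oplus>c\<in>K n. (\<ominus> (inv c) \<otimes> T c) [^] m) \<odot>\<^bsub>W\<^esub> D x"
      using Kc Tc Dx
      by (intro additive_map_finsum[OF abelian_k abelian_W, symmetric] additive_mapI)
        (auto simp: W.smult_l_distr)
    also have "(\<Oplus>c\<in>K n. (\<ominus> (inv c) \<otimes> T c) [^] m) = (\<Oplus>c\<in>K n. \<ominus> (inv c) \<otimes> T c) [^] m"
      using Kc Tc by (intro additive_map_finsum[OF abelian_k abelian_k pow_m, symmetric]) auto
    also have "(\<Oplus>c\<in>K n. \<ominus> (inv c) \<otimes> T c) = d"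
      using scalar_trace(1)[OF n dc] by (simp add: K_def T_def)
    finally show ?thesis .
  qed
  have e_sum: "e n (finsum V (\<lambda>i. d i \<odot>\<^bsub>V\<^esub> x i) I) = finsum W (\<lambda>i. (d i [^] m) \<odot>\<^bsub>W\<^esub> D (x i)) I"
    if n: "n > 0" and I: "finite I" and dx: "\<And>i. i \<in> I \<Longrightarrow> d i \<in> Kn n \<and> x i \<in> Fix 1" for n d x and I :: "'a set"
    using I dx
  proof (induction I rule: finite_induct)
    case empty
    have "e n \<zero>\<^bsub>V\<^esub> \<oplus>\<^bsub>W\<^esub> e n \<zero>\<^bsub>V\<^esub> = e n \<zero>\<^bsub>V\<^esub>" using e_add[OF Fix_zero Fix_zero, of n] by simp
    then show ?case using e_closed[OF Fix_zero] by simp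
  next
    case (insert i I)
    have F: "d j \<odot>\<^bsub>V\<^esub> x j \<in> Fix n" if "j \<in> insert i I" for j
      using insert.prems[OF that] Fix_smult Fix_dvd[of "x j" 1 n] by auto
    have c: "(d j [^] m) \<odot>\<^bsub>W\<^esub> D (x j) \<in> carrier W" if "j \<in> insert i I" for j
      using insert.prems[OF that] D_closed Kn_carrier by auto
    have "e n (finsum V (\<lambda>i. d i \<odot>\<^bsub>V\<^esub> x i) (insert i I)) =
        e n (d i \<odot>\<^bsub>V\<^esub> x i \<oplus>\<^bsub>V\<^esub> finsum V (\<lambda>i. d i \<odot>\<^bsub>V\<^esub> x i) I)"
      using insert F Fix_carrier by (subst V.M.finsum_insert) auto
    also have "\<dots> = e n (d i \<odot>\<^bsub>V\<^esub> x i) \<oplus>\<^bsub>W\<^esub> e n (finsum V (\<lambda>i. d i \<odot>\<^bsub>V\<^esub> x i) I)"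
      using F by (intro e_add Fix_finsum) auto
    also have "\<dots> = finsum W (\<lambda>i. (d i [^] m) \<odot>\<^bsub>W\<^esub> D (x i)) (insert i I)"
      using insert c e_basic[OF n] by (subst W.M.finsum_insert) auto
    finally show ?case .
  qed
  \<comment> \<open>Independence of the level: v is expanded by descent at level n, and the formula
    of level n' is evaluated on that expansion, each term of which is a scalar times a fixed
    vector.\<close>
  have e_dvd: "e n' v = e n v" if n: "n > 0" "n' > 0" "n dvd n'" and v: "v \<in> Fix n" for n n' v
  proof -
    have "e n' (finsum V (\<lambda>c. (\<ominus> (inv c)) \<odot>\<^bsub>V\<^esub> tr n (c \<odot>\<^bsub>V\<^esub> v)) (K n)) = e n v"
      unfolding e_def[of n v]
      using Kc fin n v by (intro e_sum) (auto intro: tr_Fix[simplified] Fix_smult Kn_dvd[OF _ n(3)])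
    then show ?thesis using descent[OF n(1) Fix_carrier[OF v]] by (simp add: K_def)
  qed
  have e_smult: "e n (d \<odot>\<^bsub>V\<^esub> v) = (d [^] m) \<odot>\<^bsub>W\<^esub> e n v" if n: "n > 0" and d: "d \<in> Kn n" and v: "v \<in> Fix n" for n d v
  proof -
    have dc: "d \<in> carrier k" and vc: "v \<in> carrier V" using d v Kn_carrier Fix_carrier by auto
    have "d \<odot>\<^bsub>V\<^esub> v = d \<odot>\<^bsub>V\<^esub> finsum V (\<lambda>c. (\<ominus> (inv c)) \<odot>\<^bsub>V\<^esub> tr n (c \<odot>\<^bsub>V\<^esub> v)) (K n)"
      using descent[OF n vc] by (simp add: K_def)
    also have "\<dots> = finsum V (\<lambda>c. d \<odot>\<^bsub>V\<^esub> ((\<ominus> (inv c)) \<odot>\<^bsub>V\<^esub> tr n (c \<odot>\<^bsub>V\<^esub> v))) (K n)"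
      using Kc vc tr_closed dc by (intro additive_map_finsum[OF abelian_V abelian_V smult_additive]) auto
    also have "\<dots> = finsum V (\<lambda>c. (d \<otimes> \<ominus> (inv c)) \<odot>\<^bsub>V\<^esub> tr n (c \<odot>\<^bsub>V\<^esub> v)) (K n)"
      using Kc vc tr_closed dc by (intro V.M.finsum_cong') (auto simp: V.smult_assoc1)
    finally have "e n (d \<odot>\<^bsub>V\<^esub> v) = e n \<dots>" by simp
    also have "\<dots> = finsum W (\<lambda>c. ((d \<otimes> \<ominus> (inv c)) [^] m) \<odot>\<^bsub>W\<^esub> D (tr n (c \<odot>\<^bsub>V\<^esub> v))) (K n)"
      using Kc fin n v d by (intro e_sum) (auto intro: tr_Fix[simplified] Fix_smult Kn_mult)
    also have "\<dots> = finsum W (\<lambda>c. (d [^] m) \<odot>\<^bsub>W\<^esub> (((\<ominus> (inv c)) [^] m) \<odot>\<^bsub>W\<^esub> D (tr n (c \<odot>\<^bsub>V\<^esub> v)))) (K n)"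
      using Kc dc trD v term_closed by (intro W.M.finsum_cong') (auto simp: nat_pow_distrib W.smult_assoc1)
    also have "\<dots> = (d [^] m) \<odot>\<^bsub>W\<^esub> e n v"
      unfolding e_def using term_closed v dc
      by (intro additive_map_finsum[OF abelian_W abelian_W, symmetric] additive_mapI)
        (auto simp: W.smult_r_distr)
    finally show ?thesis .
  qed
  define per where "per v = (SOME n. n > 0 \<and> v \<in> Fix n)" for v
  have per: "per v > 0" "v \<in> Fix (per v)" if "v \<in> carrier V" for v
    using someI_ex[OF Fix_ex[OF that]] unfolding per_def by auto
  define E where "E v = e (per v) v" for v
  have E_eq: "E v = e n v" if "n > 0" "v \<in> Fix n" for v n
  proof -
    have v: "v \<in> carrier V" using that Fix_carrier by blast
    \<comment> \<open>Two periods are compared through their product.\<close>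
    have "e (per v * n) v = e (per v) v" "e (per v * n) v = e n v"
      using per[OF v] that by (auto intro!: e_dvd)
    then show ?thesis by (simp add: E_def)
  qed
  have "additive_map V W E"
  proof (rule additive_mapI)
    show "E v \<in> carrier W" if "v \<in> carrier V" for v
      using per[OF that] e_closed by (simp add: E_def)
    show "E (v \<oplus>\<^bsub>V\<^esub> w) = E v \<oplus>\<^bsub>W\<^esub> E w" if v: "v \<in> carrier V" and w: "w \<in> carrier V" for v w
    proof -
      obtain n where "n > 0" "{v, w} \<subseteq> Fix n" using Fix_ex_common[of "{v, w}"] v w by auto
      then show ?thesis using e_add[of v n w] by (simp add: E_eq Fix_add)
    qed
  qed
  moreover have "E (c \<odot>\<^bsub>V\<^esub> v) = (c [^] m) \<odot>\<^bsub>W\<^esub> E v" if c: "c \<in> carrier k" and v: "v \<in> carrier V" for c v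
  proof -
    obtain a where a: "a > 0" "c \<in> Kn a" using frob_periodic[OF c] c by (auto simp: Kn_def)
    obtain b where b: "b > 0" "v \<in> Fix b" using Fix_ex[OF v] by blast
    have "a * b > 0" "c \<in> Kn (a * b)" "v \<in> Fix (a * b)"
      using a b Kn_dvd[of c a "a * b"] Fix_dvd[of v b "a * b"] by auto
    then show ?thesis using E_eq[of "a * b"] Fix_smult e_smult by simp
  qed
  moreover have "E x = D x" if x: "x \<in> Fix 1" for x
  proof -
    have "E x = e 1 (\<one> \<odot>\<^bsub>V\<^esub> x)" using E_eq[OF _ x] x Fix_carrier[OF x] by simp
    also have "\<dots> = D x" using e_basic[of 1 \<one> x] x D_closed[OF x] Kn_one by simp
    finally show ?thesis .
  qed
  ultimately show ?thesis by blast
qed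

section \<open>Spanning sets and bases\<close>

text \<open>By the pigeonhole principle two iterates i < j agree on Y, so the iterates repeat with
  period \<open>p = j - i\<close> from i on. The exponent \<open>m = (i + 1) p\<close> is a multiple
  of p that is at least i, hence m and 2 m give the same iterate.\<close>

lemma finite_funpow_idempotent:
  assumes "finite Y" "f \<in> Y \<rightarrow> Y"
  shows "\<exists>m>0. \<forall>x \<in> Y. (f ^^ (m + m)) x = (f ^^ m) x"
proof -
  have closed: "(f ^^ n) x \<in> Y" if "x \<in> Y" for n x
    by (induction n) (use that assms in auto)
  have "(\<lambda>n. restrict (f ^^ n) Y) ` UNIV \<subseteq> Y \<rightarrow>\<^sub>E Y"
    using closed by auto
  then have "finite (range (\<lambda>n. restrict (f ^^ n) Y))"
    using finite_PiE[OF assms(1), of "\<lambda>_. Y"] assms(1) finite_subset by blast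
  then have "\<not> inj (\<lambda>n. restrict (f ^^ n) Y)"
    using finite_imageD infinite_UNIV_nat by blast
  then obtain i0 j0 where ij0: "i0 \<noteq> j0" "restrict (f ^^ i0) Y = restrict (f ^^ j0) Y"
    by (auto simp: inj_on_def)
  obtain i j where ij: "i < j" "restrict (f ^^ i) Y = restrict (f ^^ j) Y"
    using ij0 by (metis linorder_neqE_nat)
  define p where "p = j - i"
  have step: "(f ^^ (t + i + p)) x = (f ^^ (t + i)) x" if "x \<in> Y" for t x
  proof -
    have "(f ^^ j) x = (f ^^ i) x" using ij(2) that by (metis restrict_apply')
    moreover have "t + i + p = t + j" using ij by (simp add: p_def)
    moreover have "(f ^^ (t + n)) x = (f ^^ t) ((f ^^ n) x)" for n by (simp add: funpow_add)
    ultimately show ?thesis by metis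
  qed
  have steps: "(f ^^ (t + i + n * p)) x = (f ^^ (t + i)) x" if x: "x \<in> Y" for t n x
  proof (induction n)
    case (Suc n)
    have "(f ^^ (t + i + Suc n * p)) x = (f ^^ ((t + n * p) + i + p)) x" by (simp add: ac_simps)
    also have "\<dots> = (f ^^ ((t + n * p) + i)) x" using step[OF x] .
    also have "\<dots> = (f ^^ (t + i)) x" using Suc by (simp add: ac_simps)
    finally show ?case .
  qed simp
  define m where "m = Suc i * p"
  have m: "m > 0" "m \<ge> i" using ij by (auto simp: m_def p_def) (cases "j - i"; simp)
  have "(f ^^ (m + m)) x = (f ^^ m) x" if "x \<in> Y" for x
    using steps[OF that, of "m - i" "Suc i"] m m_def
    by (simp del: mult_Suc)
  then show ?thesis using m by blast
qed

text \<open>Injectivity cancels one \<open>f^m\<close> from the idempotence of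
  \<open>f^m\<close>.\<close>

lemma finite_funpow_periodic:
  assumes "finite Y" "f \<in> Y \<rightarrow> Y" "inj_on f Y"
  shows "\<exists>m>0. \<forall>x \<in> Y. (f ^^ m) x = x"
proof -
  obtain m where m: "m > 0" "\<forall>x \<in> Y. (f ^^ (m + m)) x = (f ^^ m) x"
    using finite_funpow_idempotent[OF assms(1,2)] by blast
  have closed: "(f ^^ n) x \<in> Y" if "x \<in> Y" for n x
    by (induction n) (use that assms in auto)
  have inj: "(f ^^ n) x = (f ^^ n) y \<Longrightarrow> x = y" if "x \<in> Y" "y \<in> Y" for n x y
  proof (induction n)
    case (Suc n)
    then have "(f ^^ n) x = (f ^^ n) y" using inj_onD[OF assms(3)] closed that by simp
    then show ?case by (rule Suc.IH)
  qed simp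
  have "(f ^^ m) x = x" if "x \<in> Y" for x
    using inj[of "(f ^^ m) x" x m] m(2) that closed by (simp add: funpow_add)
  then show ?thesis using m by blast
qed

locale linear_space = field k + V: module k V
  for k :: "('a, 'f) ring_scheme" (structure) and V :: "('a, 'v, 'e) module_scheme"
begin

definition lincomb :: "'v set \<Rightarrow> ('v \<Rightarrow> 'a) \<Rightarrow> 'v" where
  "lincomb S c = finsum V (\<lambda>s. c s \<odot>\<^bsub>V\<^esub> s) S"

definition spans :: "'v set \<Rightarrow> bool" where
  "spans S \<longleftrightarrow> finite S \<and> S \<subseteq> carrier V \<and>
     (\<forall>v \<in> carrier V. \<exists>c \<in> S \<rightarrow> carrier k. v = lincomb S c)"

definition lin_indep :: "'v set \<Rightarrow> bool" where
  "lin_indep S \<longleftrightarrow> (\<forall>c \<in> S \<rightarrow> carrier k. lincomb S c = \<zero>\<^bsub>V\<^esub> \<longrightarrow> (\<forall>s \<in> S. c s = \<zero>))"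

definition linear :: "('v \<Rightarrow> 'v) \<Rightarrow> bool" where
  "linear f \<longleftrightarrow> additive_map V V f \<and>
     (\<forall>c \<in> carrier k. \<forall>v \<in> carrier V. f (c \<odot>\<^bsub>V\<^esub> v) = c \<odot>\<^bsub>V\<^esub> f v)"

lemma ab_V: "abelian_group V" by (rule V.M.abelian_group_axioms)

lemma linear_closed: "linear f \<Longrightarrow> v \<in> carrier V \<Longrightarrow> f v \<in> carrier V"
  by (auto simp: linear_def dest: additive_map_closed)

lemma linear_add: "\<lbrakk>linear f; v \<in> carrier V; w \<in> carrier V\<rbrakk> \<Longrightarrow> f (v \<oplus>\<^bsub>V\<^esub> w) = f v \<oplus>\<^bsub>V\<^esub> f w"
  by (auto simp: linear_def dest: additive_map_add)

lemma linear_smult: "\<lbrakk>linear f; c \<in> carrier k; v \<in> carrier V\<rbrakk> \<Longrightarrow> f (c \<odot>\<^bsub>V\<^esub> v) = c \<odot>\<^bsub>V\<^esub> f v"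
  by (auto simp: linear_def)

lemma linear_funpow: "linear f \<Longrightarrow> linear (f ^^ n)"
proof (induction n)
  case 0
  show ?case by (auto simp: linear_def intro: additive_mapI)
next
  case (Suc n)
  then show ?case
    using additive_map_compose[of V V f V "f ^^ n"] linear_closed[of "f ^^ n"]
    by (auto simp: linear_def comp_def)
qed

lemma lincomb_closed:
  "\<lbrakk>S \<subseteq> carrier V; c \<in> S \<rightarrow> carrier k\<rbrakk> \<Longrightarrow> lincomb S c \<in> carrier V"
  unfolding lincomb_def by (rule V.M.finsum_closed) auto

lemma lincomb_cong:
  "\<lbrakk>S \<subseteq> carrier V; d \<in> S \<rightarrow> carrier k; \<And>s. s \<in> S \<Longrightarrow> c s = d s\<rbrakk> \<Longrightarrow> lincomb S c = lincomb S d"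
  unfolding lincomb_def by (rule V.M.finsum_cong') auto

lemma lincomb_add:
  assumes "S \<subseteq> carrier V" "c \<in> S \<rightarrow> carrier k" "d \<in> S \<rightarrow> carrier k"
  shows "lincomb S c \<oplus>\<^bsub>V\<^esub> lincomb S d = lincomb S (\<lambda>s. c s \<oplus> d s)"
proof -
  have "lincomb S (\<lambda>s. c s \<oplus> d s) = finsum V (\<lambda>s. c s \<odot>\<^bsub>V\<^esub> s \<oplus>\<^bsub>V\<^esub> d s \<odot>\<^bsub>V\<^esub> s) S"
    unfolding lincomb_def using assms by (intro V.M.finsum_cong') (auto simp: V.smult_l_distr Pi_iff subset_iff)
  then show ?thesis unfolding lincomb_def using assms by (subst V.M.finsum_addf[symmetric]) auto
qed

lemma semilinear_lincomb:
  assumes "S \<subseteq> carrier V" "c \<in> S \<rightarrow> carrier k" "module k W" "additive_map V W f"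
    and "\<And>c v. \<lbrakk>c \<in> carrier k; v \<in> carrier V\<rbrakk> \<Longrightarrow> f (c \<odot>\<^bsub>V\<^esub> v) = (c [^] (m::nat)) \<odot>\<^bsub>W\<^esub> f v"
  shows "f (lincomb S c) = finsum W (\<lambda>s. (c s [^] m) \<odot>\<^bsub>W\<^esub> f s) S"
proof -
  interpret W: module k W by fact
  have "f (lincomb S c) = finsum W (\<lambda>s. f (c s \<odot>\<^bsub>V\<^esub> s)) S"
    unfolding lincomb_def using assms
    by (intro additive_map_finsum[OF ab_V W.M.abelian_group_axioms assms(4)]) auto
  also have "\<dots> = finsum W (\<lambda>s. (c s [^] m) \<odot>\<^bsub>W\<^esub> f s) S"
    using assms by (intro W.M.finsum_cong') (auto simp: Pi_iff subset_iff dest: additive_map_closed[OF assms(4)])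
  finally show ?thesis .
qed

lemma lincomb_smult:
  assumes "S \<subseteq> carrier V" "c \<in> S \<rightarrow> carrier k" "a \<in> carrier k"
  shows "a \<odot>\<^bsub>V\<^esub> lincomb S c = lincomb S (\<lambda>s. a \<otimes> c s)"
proof -
  have "additive_map V V (\<lambda>v. a \<odot>\<^bsub>V\<^esub> v)"
    using assms by (intro additive_mapI) (auto simp: V.smult_r_distr)
  then have "a \<odot>\<^bsub>V\<^esub> lincomb S c = finsum V (\<lambda>s. a \<odot>\<^bsub>V\<^esub> (c s \<odot>\<^bsub>V\<^esub> s)) S"
    unfolding lincomb_def using assms by (intro additive_map_finsum[OF ab_V ab_V]) auto
  also have "\<dots> = lincomb S (\<lambda>s. a \<otimes> c s)"
    unfolding lincomb_def using assms
    by (intro V.M.finsum_cong') (auto simp: V.smult_assoc1 Pi_iff subset_iff)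
  finally show ?thesis .
qed

lemma lincomb_zero: "S \<subseteq> carrier V \<Longrightarrow> lincomb S (\<lambda>_. \<zero>) = \<zero>\<^bsub>V\<^esub>"
  unfolding lincomb_def by (rule V.M.add.finprod_one_eqI) auto

lemma lincomb_remove:
  assumes "finite S" "S \<subseteq> carrier V" "c \<in> S \<rightarrow> carrier k" "u \<in> S" "c u = \<zero>"
  shows "lincomb S c = lincomb (S - {u}) c"
proof -
  have "lincomb S c = c u \<odot>\<^bsub>V\<^esub> u \<oplus>\<^bsub>V\<^esub> lincomb (S - {u}) c"
    unfolding lincomb_def using assms
    by (subst insert_Diff[OF assms(4), symmetric], subst V.M.finsum_insert) auto
  moreover have "lincomb (S - {u}) c \<in> carrier V" using assms by (intro lincomb_closed) auto
  ultimately show ?thesis using assms by auto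
qed

lemma lincomb_single:
  assumes "finite S" "S \<subseteq> carrier V" "u \<in> S"
  shows "lincomb S (\<lambda>s. if s = u then \<one> else \<zero>) = u"
proof -
  have "lincomb S (\<lambda>s. if s = u then \<one> else \<zero>) = finsum V (\<lambda>s. if u = s then s else \<zero>\<^bsub>V\<^esub>) S"
    unfolding lincomb_def using assms by (intro V.M.finsum_cong') auto
  also have "\<dots> = u" using assms by (intro V.M.finsum_singleton) auto
  finally show ?thesis .
qed

text \<open>The third premise is applied to the set of all combinations of S; spanning can then be
  checked by closure properties, without exhibiting coefficients.\<close>

lemma spansI:
  assumes "finite S" "S \<subseteq> carrier V"
    and "\<And>U. \<lbrakk>S \<subseteq> U; U \<subseteq> carrier V; \<zero>\<^bsub>V\<^esub> \<in> U; \<And>x y. \<lbrakk>x \<in> U; y \<in> U\<rbrakk> \<Longrightarrow> x \<oplus>\<^bsub>V\<^esub> y \<in> U;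
        \<And>c x. \<lbrakk>c \<in> carrier k; x \<in> U\<rbrakk> \<Longrightarrow> c \<odot>\<^bsub>V\<^esub> x \<in> U\<rbrakk> \<Longrightarrow> carrier V \<subseteq> U"
  shows "spans S"
proof -
  let ?U = "lincomb S ` (S \<rightarrow> carrier k)"
  have "carrier V \<subseteq> ?U"
  proof (rule assms(3))
    show "S \<subseteq> ?U"
    proof
      fix u assume u: "u \<in> S"
      have "(\<lambda>s. if s = u then \<one> else \<zero>) \<in> S \<rightarrow> carrier k" by auto
      then show "u \<in> ?U" using lincomb_single[OF assms(1,2) u] by (metis (no_types, lifting) imageI)
    qed
    show "?U \<subseteq> carrier V" using lincomb_closed assms(2) by auto
    have "(\<lambda>_. \<zero>) \<in> S \<rightarrow> carrier k" by auto
    then show "\<zero>\<^bsub>V\<^esub> \<in> ?U" using lincomb_zero[OF assms(2)] by (metis (no_types, lifting) imageI)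
    show "x \<oplus>\<^bsub>V\<^esub> y \<in> ?U" if xy: "x \<in> ?U" "y \<in> ?U" for x y
    proof -
      obtain c d where "c \<in> S \<rightarrow> carrier k" "d \<in> S \<rightarrow> carrier k" "x = lincomb S c" "y = lincomb S d"
        using xy by auto
      then show ?thesis using assms(2) by (auto simp: lincomb_add intro!: image_eqI[OF refl])
    qed
    show "a \<odot>\<^bsub>V\<^esub> x \<in> ?U" if a: "a \<in> carrier k" and x: "x \<in> ?U" for a x
    proof -
      obtain c where "c \<in> S \<rightarrow> carrier k" "x = lincomb S c" using x by auto
      then show ?thesis using assms(2) a by (auto simp: lincomb_smult intro!: image_eqI[OF refl])
    qed
  qed
  then show ?thesis using assms(1,2) by (auto simp: spans_def)
qed

lemma spansE:
  assumes "spans S" "v \<in> carrier V"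
  obtains c where "c \<in> S \<rightarrow> carrier k" "v = lincomb S c"
proof -
  have "\<exists>c \<in> S \<rightarrow> carrier k. v = lincomb S c"
    using assms unfolding spans_def by simp
  then show ?thesis using that by (elim bexE)
qed

lemma spans_induct:
  assumes "spans S" "v \<in> carrier V"
    and "\<And>s. s \<in> S \<Longrightarrow> P s" "P \<zero>\<^bsub>V\<^esub>"
    and "\<And>x y. \<lbrakk>x \<in> carrier V; y \<in> carrier V; P x; P y\<rbrakk> \<Longrightarrow> P (x \<oplus>\<^bsub>V\<^esub> y)"
    and "\<And>c x. \<lbrakk>c \<in> carrier k; x \<in> carrier V; P x\<rbrakk> \<Longrightarrow> P (c \<odot>\<^bsub>V\<^esub> x)"
  shows "P v"
proof -
  obtain c where c: "c \<in> S \<rightarrow> carrier k" "v = lincomb S c" using spansE[OF assms(1,2)] by blast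
  have S: "finite S" "S \<subseteq> carrier V" using assms(1) by (auto simp: spans_def)
  have "T \<subseteq> S \<Longrightarrow> P (finsum V (\<lambda>s. c s \<odot>\<^bsub>V\<^esub> s) T)" for T
  proof (induction T rule: infinite_finite_induct)
    case (insert t T)
    then have t: "c t \<in> carrier k" "t \<in> carrier V" "P t" using c S assms(3) by auto
    have T: "(\<lambda>s. c s \<odot>\<^bsub>V\<^esub> s) \<in> T \<rightarrow> carrier V" using c S insert.prems by auto
    then show ?case
      using insert t by (auto simp: V.M.finsum_insert intro!: assms(5,6) V.M.finsum_closed)
  qed (auto simp: assms(4) V.M.finsum_infinite)
  then show ?thesis using c by (simp add: lincomb_def)
qed

text \<open>Subtracting \<open>c u / d u\<close> times the relation d from a combination c makes the
  coefficient at u vanish.\<close>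

lemma dependent_remove:
  assumes "spans S" "d \<in> S \<rightarrow> carrier k" "lincomb S d = \<zero>\<^bsub>V\<^esub>" "u \<in> S" "d u \<noteq> \<zero>"
  shows "spans (S - {u})"
proof -
  have S: "finite S" "S \<subseteq> carrier V" using assms(1) by (auto simp: spans_def)
  have "\<exists>c \<in> S - {u} \<rightarrow> carrier k. v = lincomb (S - {u}) c" if v: "v \<in> carrier V" for v
  proof -
    obtain c where c: "c \<in> S \<rightarrow> carrier k" "v = lincomb S c" using spansE[OF assms(1) v] by blast
    have du: "d u \<in> carrier k" "d u \<in> Units k" using assms field_Units by auto
    let ?a = "\<ominus> (c u \<otimes> inv (d u))"
    let ?e = "\<lambda>s. c s \<oplus> ?a \<otimes> d s"
    have cu: "c u \<in> carrier k" using c assms(4) by auto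
    have a: "?a \<in> carrier k" using cu du by auto
    have "v = v \<oplus>\<^bsub>V\<^esub> ?a \<odot>\<^bsub>V\<^esub> lincomb S d" using assms(3) a v by simp
    also have "?a \<odot>\<^bsub>V\<^esub> lincomb S d = lincomb S (\<lambda>s. ?a \<otimes> d s)" using S assms(2) a by (simp add: lincomb_smult)
    also have "v \<oplus>\<^bsub>V\<^esub> lincomb S (\<lambda>s. ?a \<otimes> d s) = lincomb S ?e"
      unfolding c(2) using S assms(2) a c by (intro lincomb_add) auto
    also have "\<dots> = lincomb (S - {u}) ?e"
    proof (rule lincomb_remove)
      have "?a \<otimes> d u = \<ominus> c u" using du cu by (simp add: l_minus m_assoc)
      then show "?e u = \<zero>" using cu by (simp add: r_neg)
      show "?e \<in> S \<rightarrow> carrier k" using c assms(2) a by auto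
    qed (use S assms in auto)
    finally show ?thesis
      using c assms(2) a by (intro bexI[of _ ?e]) auto
  qed
  then show ?thesis using S by (auto simp: spans_def)
qed

lemma minimal_lin_indep:
  assumes "spans S" "\<And>S'. \<lbrakk>spans S'; S' \<subseteq> S\<rbrakk> \<Longrightarrow> card S \<le> card S'"
  shows "lin_indep S"
proof -
  have "finite S" using assms(1) by (auto simp: spans_def)
  then have "\<not> spans (S - {u})" if "u \<in> S" for u
    using assms(2)[of "S - {u}"] that card_Diff1_less[of S u] by auto
  then show ?thesis unfolding lin_indep_def using dependent_remove[OF assms(1)] by blast
qed

lemma ex_basis:
  assumes "spans S" shows "\<exists>T \<subseteq> S. spans T \<and> lin_indep T"
proof -
  obtain T where T: "T \<subseteq> S" "spans T" and min: "\<And>T'. T' \<subseteq> S \<and> spans T' \<Longrightarrow> card T \<le> card T'"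
    using exists_least_iff[of "\<lambda>n. \<exists>T. T \<subseteq> S \<and> spans T \<and> card T = n"] assms
    by (metis (no_types, lifting) not_le subset_refl)
  then have "lin_indep T" by (intro minimal_lin_indep) (auto intro!: min)
  then show ?thesis using T by blast
qed

lemma lin_indep_unique:
  assumes "lin_indep S" "S \<subseteq> carrier V" "c \<in> S \<rightarrow> carrier k" "d \<in> S \<rightarrow> carrier k"
    and "lincomb S c = lincomb S d" "s \<in> S"
  shows "c s = d s"
proof -
  have m: "\<ominus> \<one> \<in> carrier k" by simp
  have d': "(\<lambda>s. \<ominus> \<one> \<otimes> d s) \<in> S \<rightarrow> carrier k" using assms by auto
  have "lincomb S (\<lambda>s. c s \<oplus> \<ominus> \<one> \<otimes> d s) = lincomb S c \<oplus>\<^bsub>V\<^esub> (\<ominus> \<one>) \<odot>\<^bsub>V\<^esub> lincomb S d"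
    unfolding lincomb_smult[OF assms(2,4) m] by (rule lincomb_add[OF assms(2,3) d', symmetric])
  also have "\<dots> = \<zero>\<^bsub>V\<^esub>"
    using assms lincomb_closed[OF assms(2,4)] by (simp add: V.smult_l_minus V.M.r_neg)
  finally have "c s \<oplus> \<ominus> \<one> \<otimes> d s = \<zero>"
    by (intro assms(1)[unfolded lin_indep_def, rule_format]) (use assms d' in auto)
  moreover have "c s \<in> carrier k" "d s \<in> carrier k" using assms by auto
  ultimately show ?thesis by (simp add: l_minus minus_eq[symmetric])
qed

end

sublocale frobenius_space \<subseteq> linear_space k V
  by unfold_locales

section \<open>Bases of fixed vectors and finiteness of the fixed points\<close>

context frobenius_space
begin

text \<open>If the fixed points form a finite set, that whole set may serve as a spanning set. In
  this way finite dimension is deduced from finiteness of the fixed points.\<close>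

lemma Fix_spans:
  assumes "finite (Fix 1)" shows "spans (Fix 1)"
proof (rule spansI[OF assms])
  show "Fix 1 \<subseteq> carrier V" using Fix_carrier by blast
  fix U assume U: "Fix 1 \<subseteq> U" "U \<subseteq> carrier V" "\<And>x y. \<lbrakk>x \<in> U; y \<in> U\<rbrakk> \<Longrightarrow> x \<oplus>\<^bsub>V\<^esub> y \<in> U"
    "\<And>c x. \<lbrakk>c \<in> carrier k; x \<in> U\<rbrakk> \<Longrightarrow> c \<odot>\<^bsub>V\<^esub> x \<in> U"
  show "carrier V \<subseteq> U"
  proof
    fix v assume "v \<in> carrier V"
    then show "v \<in> U"
    proof (induction rule: fix_induct)
      case (fixed x)
      then show ?case using U(1) by blast
    qed (use U in auto)
  qed
qed

text \<open>Each generator s is replaced by the finitely many fixed vectors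
  \<open>tr n (c s)\<close>, from which descent recovers it; the resulting spanning set is thinned
  out to a basis.\<close>

lemma ex_fixed_basis:
  assumes "spans S" shows "\<exists>T \<subseteq> Fix 1. spans T \<and> lin_indep T"
proof -
  have S: "finite S" "S \<subseteq> carrier V" using assms by (auto simp: spans_def)
  obtain n where n: "n > 0" "S \<subseteq> Fix n" using Fix_ex_common[OF S] by blast
  let ?T = "(\<lambda>(c, s). tr n (c \<odot>\<^bsub>V\<^esub> s)) ` ((Kn n - {\<zero>}) \<times> S)"
  have T: "finite ?T" using finite_Kn[OF n(1)] S by simp
  have TF: "?T \<subseteq> Fix 1" using n by (auto intro!: tr_Fix[unfolded One_nat_def] Fix_smult)
  have "spans ?T"
  proof (rule spansI[OF T])
    show "?T \<subseteq> carrier V" using TF Fix_carrier by blast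
    fix U assume U: "?T \<subseteq> U" "U \<subseteq> carrier V" "\<zero>\<^bsub>V\<^esub> \<in> U" "\<And>x y. \<lbrakk>x \<in> U; y \<in> U\<rbrakk> \<Longrightarrow> x \<oplus>\<^bsub>V\<^esub> y \<in> U"
      "\<And>c x. \<lbrakk>c \<in> carrier k; x \<in> U\<rbrakk> \<Longrightarrow> c \<odot>\<^bsub>V\<^esub> x \<in> U"
    have sum: "finsum V f I \<in> U" if "\<And>i. i \<in> I \<Longrightarrow> f i \<in> U" for f and I :: "'a set"
      using that
    proof (induction I rule: infinite_finite_induct)
      case (insert i I)
      then have "f \<in> I \<rightarrow> carrier V" "f i \<in> carrier V" using U(2) by auto
      then show ?case using insert U(4) by (simp add: V.M.finsum_insert)
    qed (simp_all add: U(3) V.M.finsum_infinite)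
    show "carrier V \<subseteq> U"
    proof
      fix v assume v: "v \<in> carrier V"
      show "v \<in> U"
      proof (rule spans_induct[OF assms v, where P = "\<lambda>x. x \<in> U"])
        fix s assume s: "s \<in> S"
        have "finsum V (\<lambda>c. (\<ominus> (inv c)) \<odot>\<^bsub>V\<^esub> tr n (c \<odot>\<^bsub>V\<^esub> s)) (Kn n - {\<zero>}) \<in> U"
        proof (rule sum)
          fix c assume c: "c \<in> Kn n - {\<zero>}"
          then have "inv c \<in> carrier k" using Kn_inv Kn_carrier by blast
          then show "(\<ominus> (inv c)) \<odot>\<^bsub>V\<^esub> tr n (c \<odot>\<^bsub>V\<^esub> s) \<in> U"
            using U(1) c s by (intro U(5)) auto
        qed
        moreover have sc: "s \<in> carrier V" using s S by blast
        ultimately show "s \<in> U" by (subst descent[OF n(1) sc])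
      next
        show "\<zero>\<^bsub>V\<^esub> \<in> U" by (rule U(3))
      next
        show "x \<oplus>\<^bsub>V\<^esub> y \<in> U" if "x \<in> U" "y \<in> U" for x y using that by (rule U(4))
      next
        show "c \<odot>\<^bsub>V\<^esub> x \<in> U" if "c \<in> carrier k" "x \<in> U" for c x using that by (rule U(5))
      qed
    qed
  qed
  from ex_basis[OF this] obtain B where B: "B \<subseteq> ?T" "spans B" "lin_indep B" by (elim exE conjE)
  then show ?thesis using subset_trans[OF B(1) TF] by (intro exI[of _ B] conjI)
qed

lemma Fp_lincomb:
  assumes "T \<subseteq> Fix 1" "c \<in> T \<rightarrow> carrier k"
  shows "(F ^^ n) (lincomb T c) = lincomb T (\<lambda>t. c t [^] (q ^ n))"
proof -
  have T: "T \<subseteq> carrier V" using assms Fix_carrier by blast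
  have "(F ^^ n) (lincomb T c) = finsum V (\<lambda>s. (c s [^] (q ^ n)) \<odot>\<^bsub>V\<^esub> (F ^^ n) s) T"
    by (rule semilinear_lincomb[OF T assms(2) V.module_axioms Fp_additive Fp_smult])
  also have "\<dots> = lincomb T (\<lambda>t. c t [^] (q ^ n))"
    unfolding lincomb_def using assms T
    by (intro V.M.finsum_cong') (auto simp: Fp_fixed[unfolded One_nat_def] subset_iff Pi_iff)
  finally show ?thesis .
qed

text \<open>In a basis of fixed vectors \<open>F^n\<close> acts on the coordinates as the
  \<open>q^n\<close>-power, so by uniqueness the coordinates of a vector in \<open>Fix n\<close> lie
  in \<open>Kn n\<close>.\<close>

lemma Fix_eq_lincomb:
  assumes "T \<subseteq> Fix 1" "spans T" "lin_indep T"
  shows "Fix n = lincomb T ` (T \<rightarrow>\<^sub>E Kn n)"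
proof
  have T: "T \<subseteq> carrier V" using assms Fix_carrier by blast
  show "lincomb T ` (T \<rightarrow>\<^sub>E Kn n) \<subseteq> Fix n"
  proof
    fix v assume "v \<in> lincomb T ` (T \<rightarrow>\<^sub>E Kn n)"
    then obtain c where c: "c \<in> T \<rightarrow>\<^sub>E Kn n" "v = lincomb T c" by auto
    then have c': "c \<in> T \<rightarrow> carrier k" using Kn_carrier by auto
    have "c t [^] (q ^ n) = c t" if "t \<in> T" for t
      using Kn_pow[OF PiE_mem[OF c(1) that]] .
    then have "lincomb T (\<lambda>t. c t [^] (q ^ n)) = lincomb T c"
      by (intro lincomb_cong[OF T c'])
    then show "v \<in> Fix n"
      using Fp_lincomb[OF assms(1) c', of n] lincomb_closed[OF T c'] c by (simp add: Fix_def)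
  qed
  show "Fix n \<subseteq> lincomb T ` (T \<rightarrow>\<^sub>E Kn n)"
  proof
    fix v assume v: "v \<in> Fix n"
    then obtain c where c: "c \<in> T \<rightarrow> carrier k" "v = lincomb T c"
      using spansE[OF assms(2)] Fix_carrier by blast
    have c2: "(\<lambda>t. c t [^] (q ^ n)) \<in> T \<rightarrow> carrier k" using c by auto
    have "lincomb T (\<lambda>t. c t [^] (q ^ n)) = lincomb T c"
      using Fp_lincomb[OF assms(1) c(1), of n] v c by (simp add: Fix_def)
    then have "c t [^] (q ^ n) = c t" if "t \<in> T" for t
      using lin_indep_unique[OF assms(3) T c2 c(1) _ that] by simp
    then have "restrict c T \<in> T \<rightarrow>\<^sub>E Kn n" using c by (auto simp: Kn_def)
    moreover have "v = lincomb T (restrict c T)"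
      unfolding c(2) using c T by (intro lincomb_cong) auto
    ultimately show "v \<in> lincomb T ` (T \<rightarrow>\<^sub>E Kn n)" by blast
  qed
qed

lemma finite_Fix:
  assumes "spans S" "n > 0" shows "finite (Fix n)"
proof -
  obtain T where T: "T \<subseteq> Fix 1" "spans T" "lin_indep T" using ex_fixed_basis[OF assms(1)] by blast
  then have "finite T" by (auto simp: spans_def)
  then show ?thesis
    unfolding Fix_eq_lincomb[OF T] using finite_Kn[OF assms(2)] by (intro finite_imageI finite_PiE) auto
qed

lemma linear_eqI:
  assumes "additive_map V V f" "additive_map V V g"
    and "\<And>c v. \<lbrakk>c \<in> carrier k; v \<in> carrier V\<rbrakk> \<Longrightarrow> f (c \<odot>\<^bsub>V\<^esub> v) = (c [^] (m::nat)) \<odot>\<^bsub>V\<^esub> f v"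
    and "\<And>c v. \<lbrakk>c \<in> carrier k; v \<in> carrier V\<rbrakk> \<Longrightarrow> g (c \<odot>\<^bsub>V\<^esub> v) = (c [^] m) \<odot>\<^bsub>V\<^esub> g v"
    and "\<And>x. x \<in> Fix 1 \<Longrightarrow> f x = g x" and v: "v \<in> carrier V"
  shows "f v = g v"
  using v
proof (induction rule: fix_induct)
  case (add x y)
  then show ?case by (simp add: additive_map_add[OF assms(1)] additive_map_add[OF assms(2)])
qed (simp_all add: assms)

text \<open>The images of a finite basis of fixed vectors have a common period n, so f commutes with
  \<open>F^n\<close> on that basis and hence everywhere.\<close>

lemma linear_commutes:
  assumes "spans S" "linear f" shows "\<exists>n>0. \<forall>v \<in> carrier V. f ((F ^^ n) v) = (F ^^ n) (f v)"
proof -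
  obtain T where T: "T \<subseteq> Fix 1" "spans T" "lin_indep T" using ex_fixed_basis[OF assms(1)] by blast
  then have Tc: "finite T" "T \<subseteq> carrier V" by (auto simp: spans_def)
  obtain n where n: "n > 0" "f ` T \<subseteq> Fix n"
    using Fix_ex_common[of "f ` T"] Tc linear_closed[OF assms(2)] by (auto simp: image_subset_iff subset_iff)
  have fa: "additive_map V V f" using assms(2) by (simp add: linear_def)
  have "f ((F ^^ n) v) = (F ^^ n) (f v)" if v: "v \<in> carrier V" for v
  proof (rule spans_induct[OF T(2) v])
    show "f ((F ^^ n) s) = (F ^^ n) (f s)" if "s \<in> T" for s
    proof -
      have "f s \<in> Fix n" "s \<in> Fix 1" using that n(2) T(1) by blast+
      then show "f ((F ^^ n) s) = (F ^^ n) (f s)" using Fp_fixed[of s n] by (simp add: Fix_def)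
    qed
    show "f ((F ^^ n) \<zero>\<^bsub>V\<^esub>) = (F ^^ n) (f \<zero>\<^bsub>V\<^esub>)"
      by (simp add: additive_map_zero[OF abelian_V abelian_V fa] additive_map_zero[OF abelian_V abelian_V Fp_additive])
  qed (use linear_closed[OF assms(2)] in
      \<open>auto simp: linear_add[OF assms(2)] linear_smult[OF assms(2)] Fp_add Fp_smult Fp_closed\<close>)
  then show ?thesis using n by blast
qed

text \<open>Finiteness of \<open>Fix n\<close> replaces Fitting's lemma: a linear map has an idempotent power.\<close>

lemma linear_idempotent_power:
  assumes "spans S" "linear f"
  shows "\<exists>m>0. \<forall>v \<in> carrier V. (f ^^ (m + m)) v = (f ^^ m) v"
proof -
  obtain n where n: "n > 0" "\<forall>v \<in> carrier V. f ((F ^^ n) v) = (F ^^ n) (f v)"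
    using linear_commutes[OF assms] by blast
  have "f \<in> Fix n \<rightarrow> Fix n"
  proof
    fix x assume "x \<in> Fix n"
    then have "x \<in> carrier V" "(F ^^ n) x = x" by (auto simp: Fix_def)
    then show "f x \<in> Fix n"
      using n(2) linear_closed[OF assms(2)] by (metis (mono_tags, lifting) Fix_def mem_Collect_eq)
  qed
  then obtain m where m: "m > 0" "\<forall>x \<in> Fix n. (f ^^ (m + m)) x = (f ^^ m) x"
    using finite_funpow_idempotent finite_Fix[OF assms(1) n(1)] by blast
  have lin: "linear (f ^^ m)" "linear (f ^^ (m + m))" using linear_funpow assms(2) by blast+
  \<comment> \<open>\<open>Fix n\<close> contains \<open>Fix 1\<close>, whose
    \<open>k\<close>-combinations are all of \<open>V\<close>, so the equality on
    \<open>Fix n\<close> suffices.\<close>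
  have "(f ^^ (m + m)) v = (f ^^ m) v" if "v \<in> carrier V" for v
  proof (rule linear_eqI[where m = 1 and f = "f ^^ (m + m)" and g = "f ^^ m" and v = v])
    show "(f ^^ (m + m)) x = (f ^^ m) x" if "x \<in> Fix 1" for x
      using m(2) Fix_dvd[OF that, of n] by simp
  qed (use lin that in \<open>auto simp: linear_def\<close>)
  then show ?thesis using m by blast
qed

end

section \<open>Eigenvectors\<close>

context linear_space
begin

text \<open>P(f) v for a coefficient list P with the leading coefficient first, the convention of
  \<open>eval\<close>.\<close>

primrec poly_act :: "('v \<Rightarrow> 'v) \<Rightarrow> 'a list \<Rightarrow> 'v \<Rightarrow> 'v" where
  "poly_act f [] v = \<zero>\<^bsub>V\<^esub>"
| "poly_act f (p # P) v = p \<odot>\<^bsub>V\<^esub> (f ^^ length P) v \<oplus>\<^bsub>V\<^esub> poly_act f P v"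

lemma poly_act_closed:
  "\<lbrakk>linear f; set P \<subseteq> carrier k; v \<in> carrier V\<rbrakk> \<Longrightarrow> poly_act f P v \<in> carrier V"
  by (induction P) (auto simp: linear_closed[OF linear_funpow])

lemma poly_act_snoc:
  assumes "linear f" "set P \<subseteq> carrier k" "c \<in> carrier k" "v \<in> carrier V"
  shows "poly_act f (P @ [c]) v = f (poly_act f P v) \<oplus>\<^bsub>V\<^esub> c \<odot>\<^bsub>V\<^esub> v"
  using assms(2)
proof (induction P)
  case Nil
  have "f \<zero>\<^bsub>V\<^esub> = \<zero>\<^bsub>V\<^esub>" using assms(1) additive_map_zero[OF ab_V ab_V] by (simp add: linear_def)
  then show ?case using assms by simp
next
  case (Cons p P)
  then show ?case
    using assms poly_act_closed[of f P v] linear_closed[OF linear_funpow[OF assms(1)]] linear_closed[OF assms(1)]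
    by (simp add: linear_add linear_smult V.M.a_assoc)
qed

lemma eval_snoc:
  "\<lbrakk>set P \<subseteq> carrier k; a \<in> carrier k; c \<in> carrier k\<rbrakk> \<Longrightarrow> eval (P @ [c]) a = a \<otimes> eval P a \<oplus> c"
proof (induction P)
  case (Cons p P)
  then have "eval P a \<in> carrier k" by (simp add: eval_in_carrier)
  then show ?case using Cons by (simp add: r_distr a_assoc m_lcomm m_comm)
qed simp

text \<open>Synthetic division of \<open>P\<close> by \<open>X - a\<close>.\<close>

lemma poly_act_division:
  assumes "linear f" "set P \<subseteq> carrier k" "a \<in> carrier k"
  shows "\<exists>Q. set Q \<subseteq> carrier k \<and> length Q = length P - 1 \<and> (2 \<le> length P \<longrightarrow> hd Q = hd P) \<and>
    (\<forall>v \<in> carrier V. poly_act f P v =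
       (f (poly_act f Q v) \<oplus>\<^bsub>V\<^esub> (\<ominus> a) \<odot>\<^bsub>V\<^esub> poly_act f Q v) \<oplus>\<^bsub>V\<^esub> eval P a \<odot>\<^bsub>V\<^esub> v)"
  using assms(2)
proof (induction P rule: rev_induct)
  case Nil
  have "f \<zero>\<^bsub>V\<^esub> = \<zero>\<^bsub>V\<^esub>" using assms(1) additive_map_zero[OF ab_V ab_V] by (simp add: linear_def)
  then show ?case using assms(3) by (intro exI[of _ "[]"]) simp
next
  case (snoc c P)
  then have P: "set P \<subseteq> carrier k" and c: "c \<in> carrier k" by auto
  obtain Q where Q: "set Q \<subseteq> carrier k" "length Q = length P - 1" "2 \<le> length P \<longrightarrow> hd Q = hd P"
    and PQ: "\<And>v. v \<in> carrier V \<Longrightarrow> poly_act f P v =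
       (f (poly_act f Q v) \<oplus>\<^bsub>V\<^esub> (\<ominus> a) \<odot>\<^bsub>V\<^esub> poly_act f Q v) \<oplus>\<^bsub>V\<^esub> eval P a \<odot>\<^bsub>V\<^esub> v"
    using snoc.IH P by blast
  have e: "eval P a \<in> carrier k" using P assms(3) by (rule eval_in_carrier)
  show ?case
  proof (cases "P = []")
    case True
    have "f \<zero>\<^bsub>V\<^esub> = \<zero>\<^bsub>V\<^esub>" using assms(1) additive_map_zero[OF ab_V ab_V] by (simp add: linear_def)
    then show ?thesis using True c assms(3) by (intro exI[of _ "[]"]) simp
  next
    case False
    \<comment> \<open>Horner's scheme: reading one more coefficient appends to the quotient the
      value at a of the part read before.\<close>
    define Q' where "Q' = Q @ [eval P a]"
    have Q': "set Q' \<subseteq> carrier k" using Q e by (auto simp: Q'_def)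
    have "poly_act f (P @ [c]) v =
       (f (poly_act f Q' v) \<oplus>\<^bsub>V\<^esub> (\<ominus> a) \<odot>\<^bsub>V\<^esub> poly_act f Q' v) \<oplus>\<^bsub>V\<^esub> eval (P @ [c]) a \<odot>\<^bsub>V\<^esub> v"
      if v: "v \<in> carrier V" for v
    proof -
      let ?x = "poly_act f Q v" and ?e = "eval P a \<odot>\<^bsub>V\<^esub> v"
      have x: "?x \<in> carrier V" using poly_act_closed assms(1) Q(1) v by blast
      have ev: "?e \<in> carrier V" using e v by simp
      have fx: "f ?x \<in> carrier V" "f (f ?x) \<in> carrier V" "f ?e \<in> carrier V"
        using linear_closed[OF assms(1)] x ev by auto
      have Qv: "poly_act f Q' v = f ?x \<oplus>\<^bsub>V\<^esub> ?e"
        unfolding Q'_def using poly_act_snoc assms(1) Q(1) e v by simp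
      have "poly_act f (P @ [c]) v = f (poly_act f P v) \<oplus>\<^bsub>V\<^esub> c \<odot>\<^bsub>V\<^esub> v"
        using poly_act_snoc assms(1) P c v by simp
      also have "f (poly_act f P v) = f (f ?x) \<oplus>\<^bsub>V\<^esub> (\<ominus> a) \<odot>\<^bsub>V\<^esub> f ?x \<oplus>\<^bsub>V\<^esub> f ?e"
        using PQ[OF v] x fx ev assms by (simp add: linear_add linear_smult)
      finally have L: "poly_act f (P @ [c]) v = f (f ?x) \<oplus>\<^bsub>V\<^esub> (\<ominus> a) \<odot>\<^bsub>V\<^esub> f ?x \<oplus>\<^bsub>V\<^esub> f ?e \<oplus>\<^bsub>V\<^esub> c \<odot>\<^bsub>V\<^esub> v" .
      have ae: "(\<ominus> a) \<odot>\<^bsub>V\<^esub> ?e \<oplus>\<^bsub>V\<^esub> (a \<otimes> eval P a) \<odot>\<^bsub>V\<^esub> v = \<zero>\<^bsub>V\<^esub>"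
      proof -
        have "(\<ominus> a) \<odot>\<^bsub>V\<^esub> ?e \<oplus>\<^bsub>V\<^esub> (a \<otimes> eval P a) \<odot>\<^bsub>V\<^esub> v = (\<ominus> a \<otimes> eval P a \<oplus> a \<otimes> eval P a) \<odot>\<^bsub>V\<^esub> v"
          using e v assms(3) by (simp add: V.smult_assoc1 V.smult_l_distr)
        also have "\<ominus> a \<otimes> eval P a \<oplus> a \<otimes> eval P a = \<zero>" using e assms(3) by (simp add: l_minus l_neg)
        finally show ?thesis using v by simp
      qed
      have "(f (poly_act f Q' v) \<oplus>\<^bsub>V\<^esub> (\<ominus> a) \<odot>\<^bsub>V\<^esub> poly_act f Q' v) \<oplus>\<^bsub>V\<^esub> eval (P @ [c]) a \<odot>\<^bsub>V\<^esub> v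
        = (f (f ?x) \<oplus>\<^bsub>V\<^esub> (\<ominus> a) \<odot>\<^bsub>V\<^esub> f ?x \<oplus>\<^bsub>V\<^esub> f ?e \<oplus>\<^bsub>V\<^esub> c \<odot>\<^bsub>V\<^esub> v) \<oplus>\<^bsub>V\<^esub>
          ((\<ominus> a) \<odot>\<^bsub>V\<^esub> ?e \<oplus>\<^bsub>V\<^esub> (a \<otimes> eval P a) \<odot>\<^bsub>V\<^esub> v)"
        unfolding Qv using eval_snoc[OF P assms(3) c] fx ev e v assms c
        by (simp add: linear_add V.smult_r_distr V.smult_l_distr V.M.a_ac)
      also have "\<dots> = poly_act f (P @ [c]) v" unfolding ae L using fx ev v assms(3) c by simp
      finally show ?thesis by simp
    qed
    moreover have "length Q' = length (P @ [c]) - 1" using False Q(2) by (simp add: Q'_def Suc_leI)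
    \<comment> \<open>The leading coefficient is kept so that the quotient of a monic polynomial is
      monic again.\<close>
    moreover have "hd Q' = hd (P @ [c])"
    proof (cases "2 \<le> length P")
      case True
      then have "Q \<noteq> []" using Q(2) by auto
      then show ?thesis using True Q(3) False by (simp add: Q'_def)
    next
      case len: False
      then obtain p where p: "P = [p]" using False by (cases P; cases "tl P") auto
      then show ?thesis using Q(2) P assms(3) by (simp add: Q'_def)
    qed
    ultimately show ?thesis using Q' by (intro exI[of _ Q']) blast
  qed
qed

text \<open>Among the monic polynomials P with P(f) v = 0 take one of least length;
  \<open>X^(2m) - X^m\<close> shows that there is one. Dividing P by X - a for a root a leaves Q,
  and Q(f) v is nonzero by minimality and killed by f - a.\<close>

lemma ex_eigenvector:
  assumes ac: "algebraically_closed k" and f: "linear f" and v: "v \<in> carrier V" "v \<noteq> \<zero>\<^bsub>V\<^esub>"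
    and m: "m > 0" "(f ^^ (m + m)) v = (f ^^ m) v"
  shows "\<exists>c \<in> carrier k. \<exists>w \<in> carrier V. w \<noteq> \<zero>\<^bsub>V\<^esub> \<and> f w = c \<odot>\<^bsub>V\<^esub> w"
proof -
  have cl: "(f ^^ n) v \<in> carrier V" for n using linear_closed[OF linear_funpow[OF f] v(1)] .
  define ann where "ann P \<longleftrightarrow> set P \<subseteq> carrier k \<and> P \<noteq> [] \<and> hd P = \<one> \<and> poly_act f P v = \<zero>\<^bsub>V\<^esub>" for P
  have zero: "poly_act f (replicate n \<zero>) v = \<zero>\<^bsub>V\<^esub>" for n
    by (induction n) (use cl in auto)
  have zeros: "poly_act f (replicate n \<zero> @ P) v = poly_act f P v" if "set P \<subseteq> carrier k" for n P
    by (induction n) (use cl that poly_act_closed[OF f _ v(1)] in auto)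
  have "ann (\<one> # replicate (m - 1) \<zero> @ (\<ominus> \<one>) # replicate m \<zero>)"
  proof -
    have "length (replicate (m - 1) \<zero> @ (\<ominus> \<one>) # replicate m \<zero>) = m + m" using m by simp
    then have "poly_act f (\<one> # replicate (m - 1) \<zero> @ (\<ominus> \<one>) # replicate m \<zero>) v =
      (f ^^ (m + m)) v \<oplus>\<^bsub>V\<^esub> (\<ominus> \<one>) \<odot>\<^bsub>V\<^esub> (f ^^ m) v"
      using cl[of m] cl[of "m + m"] by (simp only: poly_act.simps, subst zeros) (auto simp: zero)
    then show ?thesis using m cl[of m] by (auto simp: ann_def V.smult_l_minus V.M.r_neg)
  qed
  then obtain P where P0: "ann P" and min: "\<And>P'. ann P' \<Longrightarrow> length P \<le> length P'"
    using ex_has_least_nat[of ann _ length] by blast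
  note P = P0[unfolded ann_def]
  have "length P \<noteq> 1"
  proof
    assume "length P = 1"
    then have "P = [\<one>]" using P by (cases P) auto
    then show False using P v by simp
  qed
  then have len: "2 \<le> length P" using P by (cases P; cases "tl P") auto
  have "P \<in> carrier (poly_ring k)"
    unfolding univ_poly_carrier[symmetric] polynomial_def using P by auto
  then obtain a where a: "a \<in> carrier k" "eval P a = \<zero>"
    using exists_root[OF ac _, of P] len by auto
  obtain Q where Q: "set Q \<subseteq> carrier k" "length Q = length P - 1" "hd Q = hd P"
    and PQ: "poly_act f P v =
       (f (poly_act f Q v) \<oplus>\<^bsub>V\<^esub> (\<ominus> a) \<odot>\<^bsub>V\<^esub> poly_act f Q v) \<oplus>\<^bsub>V\<^esub> eval P a \<odot>\<^bsub>V\<^esub> v"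
  proof -
    assume *: "\<And>Q. \<lbrakk>set Q \<subseteq> carrier k; length Q = length P - 1; hd Q = hd P;
       poly_act f P v = (f (poly_act f Q v) \<oplus>\<^bsub>V\<^esub> (\<ominus> a) \<odot>\<^bsub>V\<^esub> poly_act f Q v) \<oplus>\<^bsub>V\<^esub> eval P a \<odot>\<^bsub>V\<^esub> v\<rbrakk>
       \<Longrightarrow> thesis"
    from P have "set P \<subseteq> carrier k" by simp
    from poly_act_division[OF f this a(1)] show thesis
      by (elim exE conjE) (rule *, use len v(1) in simp_all)
  qed
  let ?w = "poly_act f Q v"
  have w: "?w \<in> carrier V" using poly_act_closed f Q(1) v(1) by blast
  have "?w \<noteq> \<zero>\<^bsub>V\<^esub>"
  proof
    assume "?w = \<zero>\<^bsub>V\<^esub>"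
    moreover have "Q \<noteq> []" using Q(2) len by auto
    ultimately have "ann Q" using Q P by (simp add: ann_def)
    then have "length P \<le> length Q" by (rule min)
    then show False using Q(2) len by simp
  qed
  moreover have "f ?w = a \<odot>\<^bsub>V\<^esub> ?w"
  proof -
    have fw: "f ?w \<in> carrier V" using linear_closed f w by blast
    have "f ?w \<oplus>\<^bsub>V\<^esub> \<ominus>\<^bsub>V\<^esub> (a \<odot>\<^bsub>V\<^esub> ?w) = \<zero>\<^bsub>V\<^esub>"
      using PQ P a v w fw by (simp add: V.smult_l_minus)
    then show ?thesis using fw w a V.M.minus_equality[of "f ?w" "\<ominus>\<^bsub>V\<^esub> (a \<odot>\<^bsub>V\<^esub> ?w)"] by simp
  qed
  ultimately show ?thesis using a w by blast
qed

end

section \<open>Local rings with a field of representatives\<close>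

text \<open>\<open>J\<close> is not assumed to be an ideal or even closed under addition. That
  follows from the dichotomy that every element lies in \<open>J\<close> or is a unit, but not both.
  The residue map sends f to the unique c with \<open>f - \<kappa> c\<close> in
  \<open>J\<close>.\<close>

lemma local_ring_residue_hom:
  fixes R :: "('b, 'f) ring_scheme" (structure) and L :: "('c, 'g) ring_scheme"
  assumes "ring R" "field L" "\<kappa> \<in> ring_hom L R" "J \<subseteq> carrier R" "\<one> \<noteq> \<zero>"
    and decomp: "\<And>f. f \<in> carrier R \<Longrightarrow> \<exists>c \<in> carrier L. f \<ominus> \<kappa> c \<in> J"
    and quasi: "\<And>p x. \<lbrakk>p \<in> J; x \<in> carrier R\<rbrakk> \<Longrightarrow> \<one> \<ominus> x \<otimes> p \<in> Units R"
  shows "\<exists>h \<in> ring_hom R L. (\<forall>c \<in> carrier L. h (\<kappa> c) = c) \<and> (\<forall>f \<in> carrier R. h f \<noteq> \<zero>\<^bsub>L\<^esub> \<longrightarrow> f \<in> Units R)"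
proof -
  interpret R: ring R by fact
  interpret L: field L by fact
  interpret \<kappa>: ring_hom_ring L R \<kappa>
    using assms(1-3) L.is_ring by (simp add: ring_hom_ring_def ring_hom_ring_axioms_def)
  have Jc: "p \<in> carrier R" if "p \<in> J" for p using that assms(4) by blast
  have no_inv: False if "p \<in> J" "x \<in> carrier R" "x \<otimes> p = \<one>" for p x
  proof -
    have "\<zero> \<in> Units R" using quasi[OF that(1,2)] that by (simp add: a_minus_def R.r_neg)
    then show False using assms(5) by (auto simp: Units_def)
  qed
  \<comment> \<open>With \<open>p = f - \<kappa> c\<close> and c not zero, f is
    \<open>\<kappa> c\<close> times 1 plus a left multiple of p, and the second factor is a unit by
    quasi-regularity.\<close>
  have dich: "f \<in> J \<or> f \<in> Units R" if f: "f \<in> carrier R" for f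
  proof -
    obtain c where c: "c \<in> carrier L" "f \<ominus> \<kappa> c \<in> J" using decomp f by blast
    show ?thesis
    proof (cases "c = \<zero>\<^bsub>L\<^esub>")
      case True
      then show ?thesis using c f by (simp add: a_minus_def)
    next
      case False
      then have cU: "c \<in> Units L" using c L.field_Units by simp
      let ?u = "\<kappa> (inv\<^bsub>L\<^esub> c)" and ?p = "f \<ominus> \<kappa> c"
      have ic: "inv\<^bsub>L\<^esub> c \<in> carrier L" using cU by simp
      have ku: "?u \<otimes> \<kappa> c = \<one>" "\<kappa> c \<otimes> ?u = \<one>"
        using cU c(1) ic \<kappa>.hom_mult[of "inv\<^bsub>L\<^esub> c" c] \<kappa>.hom_mult[of c "inv\<^bsub>L\<^esub> c"] by simp_all
      have kU: "\<kappa> c \<in> Units R" "?u \<in> carrier R"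
        unfolding Units_def using ku c(1) ic by auto
      have "\<one> \<ominus> (\<ominus> ?u) \<otimes> ?p \<in> Units R" using kU(2) by (intro quasi[OF c(2)]) simp
      moreover have "\<one> \<ominus> (\<ominus> ?u) \<otimes> ?p = ?u \<otimes> f"
      proof -
        have "?u \<otimes> ?p = ?u \<otimes> f \<oplus> \<ominus> \<one>"
          using f kU(2) c(1) ku(1) by (simp add: a_minus_def R.r_minus R.r_distr)
        moreover have "\<one> \<ominus> (\<ominus> ?u) \<otimes> ?p = \<one> \<oplus> ?u \<otimes> ?p"
          using f kU(2) c(1) by (simp add: a_minus_def R.l_minus)
        ultimately show ?thesis using f kU(2) by (simp add: R.a_lcomm[of \<one>] R.r_neg)
      qed
      ultimately have "\<kappa> c \<otimes> (?u \<otimes> f) \<in> Units R" using kU(1) by auto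
      moreover have "\<kappa> c \<otimes> (?u \<otimes> f) = f" using ku f kU c(1) by (simp flip: R.m_assoc)
      ultimately show ?thesis by simp
    qed
  qed
  \<comment> \<open>A product x p outside \<open>J\<close> would be a unit and would give p a left
    inverse.\<close>
  have Jmult: "x \<otimes> p \<in> J" if p: "p \<in> J" and x: "x \<in> carrier R" for p x
  proof (rule ccontr)
    assume "x \<otimes> p \<notin> J"
    then have "x \<otimes> p \<in> Units R" using dich[of "x \<otimes> p"] p x Jc by auto
    then obtain w where w: "w \<in> carrier R" "w \<otimes> (x \<otimes> p) = \<one>" unfolding Units_def by blast
    then have "(w \<otimes> x) \<otimes> p = \<one>" using p x Jc by (simp add: R.m_assoc)
    then show False using no_inv[OF p, of "w \<otimes> x"] w x by simp
  qed
  have Jnu: "p \<notin> Units R" if p: "p \<in> J" for p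
  proof
    assume "p \<in> Units R"
    then obtain w where "w \<in> carrier R" "w \<otimes> p = \<one>" unfolding Units_def by blast
    then show False using no_inv[OF p] by blast
  qed
  \<comment> \<open>If w (p + r) = 1, then w p = 1 - w r is a unit by quasi-regularity of r,
    although w p lies in \<open>J\<close>.\<close>
  have Jadd: "p \<oplus> r \<in> J" if p: "p \<in> J" and r: "r \<in> J" for p r
  proof (rule ccontr)
    assume "p \<oplus> r \<notin> J"
    then have "p \<oplus> r \<in> Units R" using dich[of "p \<oplus> r"] p r Jc by auto
    then obtain w where w: "w \<in> carrier R" "w \<otimes> (p \<oplus> r) = \<one>" unfolding Units_def by blast
    have pc: "p \<in> carrier R" "r \<in> carrier R" using p r Jc by auto
    have "\<one> \<ominus> w \<otimes> r = (w \<otimes> p \<oplus> w \<otimes> r) \<ominus> w \<otimes> r" using w pc by (simp add: R.r_distr)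
    also have "\<dots> = w \<otimes> p" using w(1) pc by (simp add: a_minus_def R.a_assoc R.r_neg)
    finally have "\<one> \<ominus> w \<otimes> r = w \<otimes> p" .
    then have "w \<otimes> p \<in> Units R" using quasi[OF r w(1)] by simp
    then show False using Jnu Jmult[OF p w(1)] by blast
  qed
  \<comment> \<open>If p g = 1, then e = g p is an idempotent in \<open>J\<close>. Since 1 - e is a
    unit and (1 - e) e = 0, it follows that e = 0, and then 1 = p e g = 0.\<close>
  have Jright: "p \<otimes> x \<in> J" if p: "p \<in> J" and x: "x \<in> carrier R" for p x
  proof (rule ccontr)
    assume "p \<otimes> x \<notin> J"
    then have "p \<otimes> x \<in> Units R" using dich[of "p \<otimes> x"] p x Jc by auto
    then obtain w where w: "w \<in> carrier R" "(p \<otimes> x) \<otimes> w = \<one>" unfolding Units_def by blast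
    have pc: "p \<in> carrier R" using p Jc by auto
    let ?g = "x \<otimes> w" let ?e = "?g \<otimes> p"
    have pg: "p \<otimes> ?g = \<one>" using w x pc by (simp add: R.m_assoc)
    have g: "?g \<in> carrier R" "?e \<in> carrier R" using x w pc by auto
    have eJ: "?e \<in> J" using Jmult[OF p g(1)] .
    have "?e \<otimes> ?e = ?g \<otimes> ((p \<otimes> ?g) \<otimes> p)" using g(1) pc by (simp only: R.m_assoc R.m_closed)
    then have ee: "?e \<otimes> ?e = ?e" unfolding pg using pc by simp
    have U: "\<one> \<ominus> ?e \<in> Units R" using quasi[OF eJ R.one_closed] g by simp
    have "(\<one> \<ominus> ?e) \<otimes> ?e = \<zero>" using g ee by (simp add: a_minus_def R.l_distr R.l_minus R.r_neg)
    then have "inv (\<one> \<ominus> ?e) \<otimes> ((\<one> \<ominus> ?e) \<otimes> ?e) = \<zero>" using U by simp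
    then have e0: "?e = \<zero>" using U g by (simp add: R.m_assoc[symmetric])
    have "\<one> = (p \<otimes> ?g) \<otimes> (p \<otimes> ?g)" using pg by simp
    also have "\<dots> = p \<otimes> ?e \<otimes> ?g" using g(1) pc by (simp only: R.m_assoc R.m_closed)
    also have "\<dots> = \<zero>" using e0 pc g(1) by simp
    finally show False using assms(5) by simp
  qed
  have zJ: "\<zero> \<in> J"
  proof -
    obtain c where c: "\<zero> \<ominus> \<kappa> c \<in> J" using decomp R.zero_closed by blast
    show ?thesis using Jmult[OF c R.zero_closed] Jc[OF c] by (simp only: R.l_null)
  qed
  have uniq: "c = d" if c: "c \<in> carrier L" "f \<ominus> \<kappa> c \<in> J" and d: "d \<in> carrier L" "f \<ominus> \<kappa> d \<in> J"
    and f: "f \<in> carrier R" for c d f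
  proof (rule ccontr)
    assume ne: "c \<noteq> d"
    have "(\<ominus> \<one>) \<otimes> (f \<ominus> \<kappa> c) \<oplus> (f \<ominus> \<kappa> d) \<in> J" using c d by (intro Jadd Jmult) auto
    also have "(\<ominus> \<one>) \<otimes> (f \<ominus> \<kappa> c) \<oplus> (f \<ominus> \<kappa> d) = \<kappa> (c \<ominus>\<^bsub>L\<^esub> d)"
      using c(1) d(1) f by (simp add: a_minus_def R.l_minus R.minus_add R.a_ac R.r_neg2 R.r_neg1)
    finally have J: "\<kappa> (c \<ominus>\<^bsub>L\<^esub> d) \<in> J" .
    have "c \<ominus>\<^bsub>L\<^esub> d \<in> Units L" using ne c(1) d(1) L.field_Units by auto
    then have "\<kappa> (inv\<^bsub>L\<^esub> (c \<ominus>\<^bsub>L\<^esub> d)) \<otimes> \<kappa> (c \<ominus>\<^bsub>L\<^esub> d) = \<one>" "inv\<^bsub>L\<^esub> (c \<ominus>\<^bsub>L\<^esub> d) \<in> carrier L"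
      using c(1) d(1) \<kappa>.hom_mult[of "inv\<^bsub>L\<^esub> (c \<ominus>\<^bsub>L\<^esub> d)" "c \<ominus>\<^bsub>L\<^esub> d"] by simp_all
    then show False using no_inv[OF J \<kappa>.hom_closed] by blast
  qed
  define h where "h f = (THE c. c \<in> carrier L \<and> f \<ominus> \<kappa> c \<in> J)" for f
  have hI: "h f = c" if "c \<in> carrier L" "f \<ominus> \<kappa> c \<in> J" "f \<in> carrier R" for f c
    unfolding h_def
  proof (rule the_equality)
    show "d = c" if "d \<in> carrier L \<and> f \<ominus> \<kappa> d \<in> J" for d
      using uniq[of d f c] that \<open>c \<in> carrier L\<close> \<open>f \<ominus> \<kappa> c \<in> J\<close> \<open>f \<in> carrier R\<close> by simp
  qed (use that in simp)
  have h: "h f \<in> carrier L" "f \<ominus> \<kappa> (h f) \<in> J" if "f \<in> carrier R" for f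
  proof -
    obtain c where "c \<in> carrier L" "f \<ominus> \<kappa> c \<in> J" using decomp[OF \<open>f \<in> carrier R\<close>] by (elim bexE)
    then show "h f \<in> carrier L" "f \<ominus> \<kappa> (h f) \<in> J" using hI[of c f] that by simp_all
  qed
  have hk: "h (\<kappa> c) = c" if "c \<in> carrier L" for c
    using that zJ by (intro hI) (auto simp: a_minus_def R.r_neg)
  have "h \<in> ring_hom R L"
  proof (rule ring_hom_memI)
    fix f g assume f: "f \<in> carrier R" and g: "g \<in> carrier R"
    have kc: "\<kappa> (h f) \<in> carrier R" "\<kappa> (h g) \<in> carrier R" using h f g by auto
    show "h (f \<otimes> g) = h f \<otimes>\<^bsub>L\<^esub> h g"
    proof (rule hI)
      have "(f \<ominus> \<kappa> (h f)) \<otimes> g \<oplus> \<kappa> (h f) \<otimes> (g \<ominus> \<kappa> (h g)) \<in> J"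
        using f g h kc by (intro Jadd Jmult Jright) auto
      also have "(f \<ominus> \<kappa> (h f)) \<otimes> g \<oplus> \<kappa> (h f) \<otimes> (g \<ominus> \<kappa> (h g)) = f \<otimes> g \<ominus> \<kappa> (h f \<otimes>\<^bsub>L\<^esub> h g)"
        using f g h kc
        by (simp add: a_minus_def R.l_distr R.r_distr R.l_minus R.r_minus R.a_assoc R.r_neg1 R.r_neg2)
      finally show "f \<otimes> g \<ominus> \<kappa> (h f \<otimes>\<^bsub>L\<^esub> h g) \<in> J" .
    qed (use f g h in auto)
    show "h (f \<oplus> g) = h f \<oplus>\<^bsub>L\<^esub> h g"
    proof (rule hI)
      have "(f \<ominus> \<kappa> (h f)) \<oplus> (g \<ominus> \<kappa> (h g)) \<in> J" using f g h by (intro Jadd) auto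
      also have "(f \<ominus> \<kappa> (h f)) \<oplus> (g \<ominus> \<kappa> (h g)) = f \<oplus> g \<ominus> \<kappa> (h f \<oplus>\<^bsub>L\<^esub> h g)"
        using f g h kc by (simp add: a_minus_def R.minus_add R.a_ac)
      finally show "f \<oplus> g \<ominus> \<kappa> (h f \<oplus>\<^bsub>L\<^esub> h g) \<in> J" .
    qed (use f g h in auto)
  next
    show "h \<one> = \<one>\<^bsub>L\<^esub>" using hk[OF L.one_closed] by simp
  qed (use h in auto)
  moreover have "f \<in> Units R" if f: "f \<in> carrier R" "h f \<noteq> \<zero>\<^bsub>L\<^esub>" for f
  proof -
    have "f \<notin> J"
    proof
      assume "f \<in> J"
      then have "h f = \<zero>\<^bsub>L\<^esub>" using f(1) by (intro hI) (auto simp: a_minus_def)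
      then show False using f(2) by simp
    qed
    then show ?thesis using dich f(1) by blast
  qed
  ultimately show ?thesis using hk by blast
qed

text \<open>A proper left ideal contains no unit and therefore lies in the kernel, so the kernel is
  the only maximal left ideal.\<close>

lemma jacobson_radical_eq_kernel:
  fixes R :: "('b, 'f) ring_scheme" (structure) and L :: "('c, 'g) ring_scheme"
  assumes "ring R" "field L" "h \<in> ring_hom R L"
    and units: "\<And>f. \<lbrakk>f \<in> carrier R; h f \<noteq> \<zero>\<^bsub>L\<^esub>\<rbrakk> \<Longrightarrow> f \<in> Units R"
  shows "jacobson_radical R = a_kernel R L h"
proof -
  interpret R: ring R by fact
  interpret L: field L by fact
  interpret h: ring_hom_ring R L h
    using ring_hom_ringI2[OF assms(1) L.is_ring assms(3)] .
  let ?K = "a_kernel R L h"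
  have K: "f \<in> ?K \<longleftrightarrow> f \<in> carrier R \<and> h f = \<zero>\<^bsub>L\<^esub>" for f
    unfolding a_kernel_def' by (simp only: mem_Collect_eq)
  have "ideal ?K R" by (rule h.kernel_is_ideal)
  then interpret K: ideal ?K R .
  have leftK: "left_ideal ?K R"
    unfolding left_ideal_def using K.additive_subgroup_axioms by (auto intro: K.I_l_closed)
  have full: "I = carrier R" if I: "left_ideal I R" and f: "f \<in> I" "f \<in> Units R" for I f
  proof -
    have Ic: "I \<subseteq> carrier R" using I additive_subgroup.a_subset by (auto simp: left_ideal_def)
    have "x \<in> I" if x: "x \<in> carrier R" for x
    proof -
      have "(x \<otimes> inv f) \<otimes> f \<in> I" using I f x unfolding left_ideal_def by auto
      moreover have "(x \<otimes> inv f) \<otimes> f = x"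
        using x f(2) R.Units_closed[OF f(2)] R.Units_inv_closed[OF f(2)] R.Units_l_inv[OF f(2)]
        by (simp only: R.m_assoc R.r_one)
      ultimately show ?thesis by simp
    qed
    then show ?thesis using Ic by blast
  qed
  have sub: "I \<subseteq> ?K" if I: "left_ideal I R" "I \<noteq> carrier R" for I
  proof
    fix f assume f: "f \<in> I"
    then have "f \<in> carrier R" using I additive_subgroup.a_subset by (auto simp: left_ideal_def)
    then show "f \<in> ?K" using full[OF I(1) f] units I(2) K by blast
  qed
  have "\<one> \<notin> ?K" using h.hom_one by (simp add: K)
  then have proper: "?K \<noteq> carrier R" by auto
  have "maximal_left_ideal I R \<longleftrightarrow> I = ?K" for I
  proof
    assume "maximal_left_ideal I R"
    then show "I = ?K"
      using sub leftK proper unfolding maximal_left_ideal_def by blast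
  next
    assume "I = ?K"
    then show "maximal_left_ideal I R"
      using sub leftK proper unfolding maximal_left_ideal_def by blast
  qed
  then have "{I. maximal_left_ideal I R} = {?K}" by auto
  then show ?thesis unfolding jacobson_radical_def by (auto simp: K)
qed

text \<open>The first isomorphism theorem, once the radical is recognised as the kernel of
  h.\<close>

lemma residue_algebra_isoI:
  fixes R :: "('k, 'b) module" and L :: "'k ring"
  assumes "ring R" "field L" "h \<in> ring_hom R L" "h ` carrier R = carrier L"
    and "\<And>f. \<lbrakk>f \<in> carrier R; h f \<noteq> \<zero>\<^bsub>L\<^esub>\<rbrakk> \<Longrightarrow> f \<in> Units R"
    and "\<And>c f. \<lbrakk>c \<in> K; f \<in> carrier R\<rbrakk> \<Longrightarrow> c \<odot>\<^bsub>R\<^esub> f \<in> carrier R \<and> h (c \<odot>\<^bsub>R\<^esub> f) = c \<otimes>\<^bsub>L\<^esub> h f"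
  shows "residue_algebra_iso K R L"
proof -
  interpret R: ring R by fact
  interpret L: field L by fact
  interpret h: ring_hom_ring R L h
    using assms(1-3) L.is_ring by (simp add: ring_hom_ring_def ring_hom_ring_axioms_def)
  have j: "jacobson_radical R = a_kernel R L h" using jacobson_radical_eq_kernel assms by blast
  show ?thesis
    unfolding residue_algebra_iso_def j
  proof (rule bexI[of _ "\<lambda>Y. the_elem (h ` Y)"])
    show "(\<lambda>Y. the_elem (h ` Y)) \<in> ring_iso (R Quot a_kernel R L h) L"
      using h.FactRing_iso_set assms(4) .
    show "\<forall>c\<in>K. \<forall>x\<in>carrier R. the_elem (h ` (a_kernel R L h +>\<^bsub>R\<^esub> c \<odot>\<^bsub>R\<^esub> x)) =
        c \<otimes>\<^bsub>L\<^esub> the_elem (h ` (a_kernel R L h +>\<^bsub>R\<^esub> x))"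
      using assms(6) h.the_elem_simp by auto
  qed
qed

section \<open>Modules over a possibly non-commutative ring\<close>

context left_module
begin

lemma smult_additive: "a \<in> carrier R \<Longrightarrow> additive_map M M (\<lambda>x. a \<odot>\<^bsub>M\<^esub> x)"
  by (rule additive_mapI) (auto simp: left_smult_closed left_smult_r_distr)

lemma ab_M: "abelian_group M" by (rule M.abelian_group_axioms)

lemma smult_zero: "a \<in> carrier R \<Longrightarrow> a \<odot>\<^bsub>M\<^esub> \<zero>\<^bsub>M\<^esub> = \<zero>\<^bsub>M\<^esub>"
  using additive_map_zero[OF ab_M ab_M smult_additive] .

lemma smult_neg: "a \<in> carrier R \<Longrightarrow> x \<in> carrier M \<Longrightarrow> a \<odot>\<^bsub>M\<^esub> (\<ominus>\<^bsub>M\<^esub> x) = \<ominus>\<^bsub>M\<^esub> (a \<odot>\<^bsub>M\<^esub> x)"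
  using additive_map_neg[OF ab_M ab_M smult_additive] .

text \<open>The subgroup condition in \<open>submodule\<close> includes negatives; these come from
  the action of -1.\<close>

lemma left_submoduleI:
  assumes "U \<subseteq> carrier M" "\<zero>\<^bsub>M\<^esub> \<in> U" "\<And>x y. \<lbrakk>x \<in> U; y \<in> U\<rbrakk> \<Longrightarrow> x \<oplus>\<^bsub>M\<^esub> y \<in> U"
    and "\<And>a x. \<lbrakk>a \<in> carrier R; x \<in> U\<rbrakk> \<Longrightarrow> a \<odot>\<^bsub>M\<^esub> x \<in> U"
  shows "submodule U R M"
proof -
  have "\<ominus>\<^bsub>M\<^esub> x \<in> U" if x: "x \<in> U" for x
  proof -
    have xc: "x \<in> carrier M" using x assms(1) by blast
    have "(\<ominus>\<^bsub>R\<^esub> \<one>\<^bsub>R\<^esub> \<oplus>\<^bsub>R\<^esub> \<one>\<^bsub>R\<^esub>) \<odot>\<^bsub>M\<^esub> x = (\<ominus>\<^bsub>R\<^esub> \<one>\<^bsub>R\<^esub>) \<odot>\<^bsub>M\<^esub> x \<oplus>\<^bsub>M\<^esub> x"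
      using xc by (subst left_smult_l_distr) (auto simp: left_smult_one)
    moreover have "(\<ominus>\<^bsub>R\<^esub> \<one>\<^bsub>R\<^esub> \<oplus>\<^bsub>R\<^esub> \<one>\<^bsub>R\<^esub>) \<odot>\<^bsub>M\<^esub> x = \<zero>\<^bsub>M\<^esub>"
    proof -
      have "\<zero>\<^bsub>R\<^esub> \<odot>\<^bsub>M\<^esub> x \<oplus>\<^bsub>M\<^esub> \<zero>\<^bsub>R\<^esub> \<odot>\<^bsub>M\<^esub> x = \<zero>\<^bsub>R\<^esub> \<odot>\<^bsub>M\<^esub> x"
        using left_smult_l_distr[of "\<zero>\<^bsub>R\<^esub>" "\<zero>\<^bsub>R\<^esub>" x] xc by simp
      then have "\<zero>\<^bsub>R\<^esub> \<odot>\<^bsub>M\<^esub> x = \<zero>\<^bsub>M\<^esub>" using xc left_smult_closed by simp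
      then show ?thesis by (simp add: R.l_neg)
    qed
    ultimately have "\<ominus>\<^bsub>M\<^esub> x = (\<ominus>\<^bsub>R\<^esub> \<one>\<^bsub>R\<^esub>) \<odot>\<^bsub>M\<^esub> x"
      using xc left_smult_closed M.minus_equality by auto
    then show ?thesis using assms(4) x by simp
  qed
  then have "subgroup U (add_monoid M)"
    using assms by (intro subgroup.intro) (auto simp flip: a_inv_def)
  then show ?thesis
    using assms by (intro submodule.intro submodule_axioms.intro) auto
qed

lemma submoduleD:
  assumes "submodule U R M"
  shows "U \<subseteq> carrier M" "\<zero>\<^bsub>M\<^esub> \<in> U" "\<And>x y. \<lbrakk>x \<in> U; y \<in> U\<rbrakk> \<Longrightarrow> x \<oplus>\<^bsub>M\<^esub> y \<in> U"
    "\<And>a x. \<lbrakk>a \<in> carrier R; x \<in> U\<rbrakk> \<Longrightarrow> a \<odot>\<^bsub>M\<^esub> x \<in> U"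
    "\<And>x. x \<in> U \<Longrightarrow> \<ominus>\<^bsub>M\<^esub> x \<in> U"
proof -
  interpret U: submodule U R M by fact
  show "U \<subseteq> carrier M" "\<zero>\<^bsub>M\<^esub> \<in> U" "\<And>x y. \<lbrakk>x \<in> U; y \<in> U\<rbrakk> \<Longrightarrow> x \<oplus>\<^bsub>M\<^esub> y \<in> U"
    "\<And>a x. \<lbrakk>a \<in> carrier R; x \<in> U\<rbrakk> \<Longrightarrow> a \<odot>\<^bsub>M\<^esub> x \<in> U"
    using U.subset U.one_closed U.m_closed U.smult_closed by auto
  show "\<And>x. x \<in> U \<Longrightarrow> \<ominus>\<^bsub>M\<^esub> x \<in> U" using U.m_inv_closed by (simp add: a_inv_def)
qed

lemma submodule_left_module:
  assumes "submodule U R M" shows "left_module R (M\<lparr>carrier := U\<rparr>)"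
proof -
  note U = submoduleD[OF assms]
  have "abelian_group (M\<lparr>carrier := U\<rparr>)"
  proof (rule abelian_groupI)
    fix x assume "x \<in> carrier (M\<lparr>carrier := U\<rparr>)"
    then show "\<exists>y\<in>carrier (M\<lparr>carrier := U\<rparr>). y \<oplus>\<^bsub>M\<lparr>carrier := U\<rparr>\<^esub> x = \<zero>\<^bsub>M\<lparr>carrier := U\<rparr>\<^esub>"
      using U M.l_neg by (intro bexI[of _ "\<ominus>\<^bsub>M\<^esub> x"]) auto
  qed (use U in \<open>auto simp: M.a_ac subset_iff\<close>)
  then show ?thesis
    using U R.ring_axioms
    by (intro left_module.intro left_module_axioms.intro)
      (auto simp: left_smult_l_distr left_smult_r_distr left_smult_assoc left_smult_one subset_iff)
qed

end

lemma module_homI: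
  assumes "\<And>x. x \<in> carrier M \<Longrightarrow> f x \<in> carrier N"
    and "\<And>x y. \<lbrakk>x \<in> carrier M; y \<in> carrier M\<rbrakk> \<Longrightarrow> f (x \<oplus>\<^bsub>M\<^esub> y) = f x \<oplus>\<^bsub>N\<^esub> f y"
    and "\<And>a x. \<lbrakk>a \<in> carrier A; x \<in> carrier M\<rbrakk> \<Longrightarrow> f (a \<odot>\<^bsub>M\<^esub> x) = a \<odot>\<^bsub>N\<^esub> f x"
  shows "f \<in> module_hom A M N"
  using assms by (auto simp: module_hom_def)

lemma module_homD:
  assumes "f \<in> module_hom A M N"
  shows "\<And>x. x \<in> carrier M \<Longrightarrow> f x \<in> carrier N"
    and "\<And>x y. \<lbrakk>x \<in> carrier M; y \<in> carrier M\<rbrakk> \<Longrightarrow> f (x \<oplus>\<^bsub>M\<^esub> y) = f x \<oplus>\<^bsub>N\<^esub> f y"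
    and "\<And>a x. \<lbrakk>a \<in> carrier A; x \<in> carrier M\<rbrakk> \<Longrightarrow> f (a \<odot>\<^bsub>M\<^esub> x) = a \<odot>\<^bsub>N\<^esub> f x"
    and "additive_map M N f"
  using assms by (auto simp: module_hom_def additive_map_def)

lemma module_hom_restrict:
  assumes "f \<in> module_hom A M N" "left_module A M"
  shows "restrict f (carrier M) \<in> module_hom A M N"
proof -
  interpret left_module A M by fact
  show ?thesis using assms(1) by (auto simp: module_hom_def left_smult_closed)
qed

lemma End_algebra_simps:
  "carrier (End_algebra A M) = module_hom A M M \<inter> extensional (carrier M)"
  "monoid.mult (End_algebra A M) = compose (carrier M)"
  "one (End_algebra A M) = (\<lambda>x \<in> carrier M. x)"
  "ring.zero (End_algebra A M) = (\<lambda>x \<in> carrier M. \<zero>\<^bsub>M\<^esub>)"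
  "ring.add (End_algebra A M) = (\<lambda>f g. \<lambda>x \<in> carrier M. f x \<oplus>\<^bsub>M\<^esub> g x)"
  "smult (End_algebra A M) = (\<lambda>c f. \<lambda>x \<in> carrier M. (c \<odot>\<^bsub>A\<^esub> \<one>\<^bsub>A\<^esub>) \<odot>\<^bsub>M\<^esub> f x)"
  by (simp_all add: End_algebra_def)

lemma End_algebra_eqI:
  assumes "f \<in> carrier (End_algebra A M)" "g \<in> carrier (End_algebra A M)"
    and "\<And>x. x \<in> carrier M \<Longrightarrow> f x = g x"
  shows "f = g"
  using assms by (auto simp: End_algebra_simps intro: extensionalityI)

lemma restrict_in_End:
  assumes "left_module A M" "f \<in> module_hom A M M"
  shows "restrict f (carrier M) \<in> carrier (End_algebra A M)"
  using module_hom_restrict[OF assms(2,1)] by (simp add: End_algebra_simps)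

lemma End_algebra_ring:
  assumes "left_module A M" shows "ring (End_algebra A M)"
proof -
  interpret left_module A M by fact
  let ?E = "End_algebra A M"
  have E: "f \<in> carrier ?E \<longleftrightarrow> f \<in> module_hom A M M \<and> f \<in> extensional (carrier M)" for f
    by (simp add: End_algebra_simps)
  have cl: "f x \<in> carrier M" if "f \<in> carrier ?E" "x \<in> carrier M" for f x
    using module_homD(1)[of f A M M x] that by (simp add: E)
  have ad: "f (x \<oplus>\<^bsub>M\<^esub> y) = f x \<oplus>\<^bsub>M\<^esub> f y" if "f \<in> carrier ?E" "x \<in> carrier M" "y \<in> carrier M" for f x y
    using module_homD(2)[of f A M M x y] that by (simp add: E)
  have sm: "f (a \<odot>\<^bsub>M\<^esub> x) = a \<odot>\<^bsub>M\<^esub> f x" if "f \<in> carrier ?E" "a \<in> carrier A" "x \<in> carrier M" for f a x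
    using module_homD(3)[of f A M M a x] that by (simp add: E)
  have addE: "f \<oplus>\<^bsub>?E\<^esub> g \<in> carrier ?E" if "f \<in> carrier ?E" "g \<in> carrier ?E" for f g
    unfolding E End_algebra_simps(5)
    using that by (auto intro!: module_homI simp: cl ad sm left_smult_closed left_smult_r_distr M.a_ac)
  have mulE: "f \<otimes>\<^bsub>?E\<^esub> g \<in> carrier ?E" if "f \<in> carrier ?E" "g \<in> carrier ?E" for f g
    unfolding E End_algebra_simps(2)
    using that by (auto intro!: module_homI simp: cl ad sm left_smult_closed compose_def)
  have negE: "(\<lambda>x \<in> carrier M. \<ominus>\<^bsub>M\<^esub> f x) \<in> carrier ?E" if "f \<in> carrier ?E" for f
    unfolding E using that
    by (auto intro!: module_homI simp: cl ad sm left_smult_closed smult_neg M.minus_add)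
  have zE: "\<zero>\<^bsub>?E\<^esub> \<in> carrier ?E"
    unfolding E End_algebra_simps(4) by (auto intro!: module_homI simp: left_smult_closed smult_zero)
  have oE: "\<one>\<^bsub>?E\<^esub> \<in> carrier ?E"
    unfolding E End_algebra_simps(3) by (auto intro!: module_homI simp: left_smult_closed)
  note ops = End_algebra_simps(2-5) compose_def
  show ?thesis
  proof (rule ringI)
    show "abelian_group ?E"
    proof (rule abelian_groupI)
      fix f assume f: "f \<in> carrier ?E"
      show "\<exists>g\<in>carrier ?E. g \<oplus>\<^bsub>?E\<^esub> f = \<zero>\<^bsub>?E\<^esub>"
        using negE[OF f] f
        by (intro bexI[OF _ negE[OF f]] End_algebra_eqI[OF addE zE]) (auto simp: ops cl M.l_neg)
    next
      fix f g h assume "f \<in> carrier ?E" "g \<in> carrier ?E" "h \<in> carrier ?E"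
      then show "f \<oplus>\<^bsub>?E\<^esub> g \<oplus>\<^bsub>?E\<^esub> h = f \<oplus>\<^bsub>?E\<^esub> (g \<oplus>\<^bsub>?E\<^esub> h)"
        by (intro End_algebra_eqI[OF addE addE] addE) (auto simp: ops cl M.a_assoc)
    next
      fix f g assume "f \<in> carrier ?E" "g \<in> carrier ?E"
      then show "f \<oplus>\<^bsub>?E\<^esub> g = g \<oplus>\<^bsub>?E\<^esub> f"
        by (intro End_algebra_eqI[OF addE addE]) (auto simp: ops cl M.a_comm)
    next
      fix f assume "f \<in> carrier ?E"
      then show "\<zero>\<^bsub>?E\<^esub> \<oplus>\<^bsub>?E\<^esub> f = f"
        using zE by (intro End_algebra_eqI[OF addE]) (auto simp: ops cl)
    qed (use addE zE in auto)
    show "monoid ?E"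
    proof (rule monoidI)
      fix f g h assume "f \<in> carrier ?E" "g \<in> carrier ?E" "h \<in> carrier ?E"
      then show "f \<otimes>\<^bsub>?E\<^esub> g \<otimes>\<^bsub>?E\<^esub> h = f \<otimes>\<^bsub>?E\<^esub> (g \<otimes>\<^bsub>?E\<^esub> h)"
        by (intro End_algebra_eqI[OF mulE mulE] mulE) (auto simp: ops cl)
    next
      fix f assume f: "f \<in> carrier ?E"
      show "\<one>\<^bsub>?E\<^esub> \<otimes>\<^bsub>?E\<^esub> f = f"
        by (rule End_algebra_eqI[OF mulE[OF oE f] f]) (simp add: ops cl[OF f])
      show "f \<otimes>\<^bsub>?E\<^esub> \<one>\<^bsub>?E\<^esub> = f"
        by (rule End_algebra_eqI[OF mulE[OF f oE] f]) (simp add: ops cl[OF f])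
    qed (use mulE oE in auto)
    fix f g h assume f: "f \<in> carrier ?E" and g: "g \<in> carrier ?E" and h: "h \<in> carrier ?E"
    show "(f \<oplus>\<^bsub>?E\<^esub> g) \<otimes>\<^bsub>?E\<^esub> h = f \<otimes>\<^bsub>?E\<^esub> h \<oplus>\<^bsub>?E\<^esub> g \<otimes>\<^bsub>?E\<^esub> h"
      using f g h
      by (intro End_algebra_eqI[OF mulE[OF addE[OF f g] h] addE[OF mulE[OF f h] mulE[OF g h]]])
        (simp add: ops cl)
    show "h \<otimes>\<^bsub>?E\<^esub> (f \<oplus>\<^bsub>?E\<^esub> g) = h \<otimes>\<^bsub>?E\<^esub> f \<oplus>\<^bsub>?E\<^esub> h \<otimes>\<^bsub>?E\<^esub> g"
      using f g h
      by (intro End_algebra_eqI[OF mulE[OF h addE[OF f g]] addE[OF mulE[OF h f] mulE[OF h g]]])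
        (simp add: ops cl ad)
  qed
qed

lemma End_algebra_Units:
  assumes "left_module A M" "f \<in> carrier (End_algebra A M)" "bij_betw f (carrier M) (carrier M)"
  shows "f \<in> Units (End_algebra A M)"
proof -
  interpret left_module A M by fact
  interpret E: ring "End_algebra A M" by (rule End_algebra_ring[OF assms(1)])
  define g where "g = inv_into (carrier M) f"
  have fh: "f \<in> module_hom A M M" using assms(2) by (simp add: End_algebra_simps)
  note f = module_homD[OF fh]
  have g1: "g (f x) = x" if "x \<in> carrier M" for x
    unfolding g_def using assms(3) that by (simp add: bij_betw_def)
  have g2: "g x \<in> carrier M" "f (g x) = x" if "x \<in> carrier M" for x
    unfolding g_def using assms(3) that inv_into_into[of x f "carrier M"] f_inv_into_f[of x f "carrier M"]
    by (auto simp: bij_betw_def)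
  have inj: "x = y" if "x \<in> carrier M" "y \<in> carrier M" "f x = f y" for x y
    using assms(3) that by (auto simp: bij_betw_def inj_on_def)
  have gh: "g \<in> module_hom A M M"
  proof (rule module_homI)
    show "g (x \<oplus>\<^bsub>M\<^esub> y) = g x \<oplus>\<^bsub>M\<^esub> g y" if "x \<in> carrier M" "y \<in> carrier M" for x y
      by (rule inj) (simp_all add: that g2 f(1,2))
    show "g (a \<odot>\<^bsub>M\<^esub> x) = a \<odot>\<^bsub>M\<^esub> g x" if "a \<in> carrier A" "x \<in> carrier M" for a x
      by (rule inj) (simp_all add: that g2 f(1,3) left_smult_closed)
  qed (rule g2)
  let ?g = "restrict g (carrier M)"
  have gE: "?g \<in> carrier (End_algebra A M)" by (rule restrict_in_End[OF assms(1) gh])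
  have "?g \<otimes>\<^bsub>End_algebra A M\<^esub> f = \<one>\<^bsub>End_algebra A M\<^esub>"
    by (rule End_algebra_eqI[OF E.m_closed[OF gE assms(2)] E.one_closed])
      (simp add: End_algebra_simps(2,3) compose_def f(1) g1)
  moreover have "f \<otimes>\<^bsub>End_algebra A M\<^esub> ?g = \<one>\<^bsub>End_algebra A M\<^esub>"
    by (rule End_algebra_eqI[OF E.m_closed[OF assms(2) gE] E.one_closed])
      (simp add: End_algebra_simps(2,3) compose_def g2)
  ultimately show ?thesis using gE assms(2) unfolding Units_def by blast
qed

section \<open>The underlying vector space\<close>

lemma base_space_simps [simp]:
  "carrier (base_space A M) = carrier M"
  "ring.zero (base_space A M) = ring.zero M"
  "ring.add (base_space A M) = ring.add M"
  by (simp_all add: base_space_def)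

lemma base_space_smult: "c \<odot>\<^bsub>base_space A M\<^esub> x = (c \<odot>\<^bsub>A\<^esub> \<one>\<^bsub>A\<^esub>) \<odot>\<^bsub>M\<^esub> x"
  by (simp add: base_space_def)

lemma finsum_base_space: "finsum (base_space A M) = finsum M"
  by (simp add: fun_eq_iff finsum_def finprod_def)

lemma additive_map_base_space:
  "additive_map (base_space A M) (base_space A N) f = additive_map M N f"
  by (simp add: additive_map_def)

text \<open>A bridge between record types: \<open>finite_dimensional\<close> speaks of records
  without extension, \<open>spans\<close> of arbitrary schemes, and both depend only on the
  operations listed.\<close>

lemma (in linear_space) finite_dimensional_iff:
  fixes V' :: "('a, 'v) module" and k' :: "'a ring"
  assumes "carrier k' = carrier k" "carrier V' = carrier V" "ring.zero V' = ring.zero V"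
    "ring.add V' = ring.add V" "smult V' = smult V"
  shows "finite_dimensional k' V' \<longleftrightarrow> (\<exists>S. spans S)"
proof -
  have "finsum V' = (finsum V :: ('v \<Rightarrow> 'v) \<Rightarrow> _)"
    by (intro ext) (simp add: finsum_def finprod_def assms)
  then show ?thesis
    unfolding finite_dimensional_def spans_def lincomb_def using assms by simp
qed

locale frobenius_algebra = frobenius_field k q + A: frobenius_space k q A FA + AA: assoc_algebra k A
  for k :: "'k ring" (structure) and q and A :: "('k, 'a) module" and FA +
  assumes FA_mult: "\<lbrakk>a \<in> carrier A; b \<in> carrier A\<rbrakk> \<Longrightarrow> FA (a \<otimes>\<^bsub>A\<^esub> b) = FA a \<otimes>\<^bsub>A\<^esub> FA b"
    and FA_one: "FA \<one>\<^bsub>A\<^esub> = \<one>\<^bsub>A\<^esub>"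
begin

lemma base_module:
  assumes "left_module A M" shows "module k (base_space A M)"
proof -
  interpret M: left_module A M by fact
  have ab: "abelian_group (base_space A M)"
    by (rule abelian_groupI) (auto simp: M.M.a_ac intro: bexI[of _ "\<ominus>\<^bsub>M\<^esub> _"] M.M.l_neg)
  show ?thesis
  proof (rule moduleI[OF is_cring ab])
    show "c \<odot>\<^bsub>base_space A M\<^esub> x \<in> carrier (base_space A M)"
      if "c \<in> carrier k" "x \<in> carrier (base_space A M)" for c x
      using that by (simp add: base_space_smult M.left_smult_closed)
    show "(c \<oplus> d) \<odot>\<^bsub>base_space A M\<^esub> x = c \<odot>\<^bsub>base_space A M\<^esub> x \<oplus>\<^bsub>base_space A M\<^esub> d \<odot>\<^bsub>base_space A M\<^esub> x"
      if "c \<in> carrier k" "d \<in> carrier k" "x \<in> carrier (base_space A M)" for c d x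
      using that by (simp add: base_space_smult A.V.smult_l_distr M.left_smult_l_distr)
    show "c \<odot>\<^bsub>base_space A M\<^esub> (x \<oplus>\<^bsub>base_space A M\<^esub> y) =
        c \<odot>\<^bsub>base_space A M\<^esub> x \<oplus>\<^bsub>base_space A M\<^esub> c \<odot>\<^bsub>base_space A M\<^esub> y"
      if "c \<in> carrier k" "x \<in> carrier (base_space A M)" "y \<in> carrier (base_space A M)" for c x y
      using that by (simp add: base_space_smult M.left_smult_r_distr)
    show "(c \<otimes> d) \<odot>\<^bsub>base_space A M\<^esub> x = c \<odot>\<^bsub>base_space A M\<^esub> (d \<odot>\<^bsub>base_space A M\<^esub> x)"
      if c: "c \<in> carrier k" "d \<in> carrier k" "x \<in> carrier (base_space A M)" for c d x
    proof -
      have "(c \<otimes> d) \<odot>\<^bsub>A\<^esub> \<one>\<^bsub>A\<^esub> = (c \<odot>\<^bsub>A\<^esub> \<one>\<^bsub>A\<^esub>) \<otimes>\<^bsub>A\<^esub> (d \<odot>\<^bsub>A\<^esub> \<one>\<^bsub>A\<^esub>)"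
        using c by (simp add: AA.smult_mult_left A.V.smult_assoc1)
      then show ?thesis using c by (simp add: base_space_smult M.left_smult_assoc)
    qed
    show "\<one> \<odot>\<^bsub>base_space A M\<^esub> x = x" if "x \<in> carrier (base_space A M)" for x
      using that by (simp add: base_space_smult M.left_smult_one)
  qed
qed

lemma base_linear_space: "left_module A M \<Longrightarrow> linear_space k (base_space A M)"
  using base_module field_axioms by (intro linear_space.intro) auto

text \<open>Multiplication by \<open>c 1_A\<close> on either side is scalar multiplication by c, so
  these elements are central.\<close>

lemma smult_base:
  assumes "left_module A M" "c \<in> carrier k" "a \<in> carrier A" "x \<in> carrier M"
  shows "(c \<odot>\<^bsub>A\<^esub> a) \<odot>\<^bsub>M\<^esub> x = c \<odot>\<^bsub>base_space A M\<^esub> (a \<odot>\<^bsub>M\<^esub> x)"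
    and "a \<odot>\<^bsub>M\<^esub> (c \<odot>\<^bsub>base_space A M\<^esub> x) = c \<odot>\<^bsub>base_space A M\<^esub> (a \<odot>\<^bsub>M\<^esub> x)"
proof -
  interpret M: left_module A M by fact
  have "c \<odot>\<^bsub>A\<^esub> a = (c \<odot>\<^bsub>A\<^esub> \<one>\<^bsub>A\<^esub>) \<otimes>\<^bsub>A\<^esub> a" "c \<odot>\<^bsub>A\<^esub> a = a \<otimes>\<^bsub>A\<^esub> (c \<odot>\<^bsub>A\<^esub> \<one>\<^bsub>A\<^esub>)"
    using assms by (simp_all add: AA.smult_mult_left AA.smult_mult_right)
  then show "(c \<odot>\<^bsub>A\<^esub> a) \<odot>\<^bsub>M\<^esub> x = c \<odot>\<^bsub>base_space A M\<^esub> (a \<odot>\<^bsub>M\<^esub> x)"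
    "a \<odot>\<^bsub>M\<^esub> (c \<odot>\<^bsub>base_space A M\<^esub> x) = c \<odot>\<^bsub>base_space A M\<^esub> (a \<odot>\<^bsub>M\<^esub> x)"
    using assms by (auto simp: base_space_smult M.left_smult_assoc[symmetric] A.V.smult_closed)
qed

text \<open>Degree 0 gives the homomorphisms. A bijective semilinear map of degree s from M to
  itself amounts to an isomorphism from \<open>M^[s]\<close> to M
  (\<open>twist_isomorphic_iff\<close>); in this form it can be composed and extended without
  mentioning twists.\<close>

definition semilinear :: "nat \<Rightarrow> ('a, 'm) module \<Rightarrow> ('a, 'n) module \<Rightarrow> ('m \<Rightarrow> 'n) \<Rightarrow> bool" where
  "semilinear s M N f \<longleftrightarrow> additive_map M N f \<and>
     (\<forall>a \<in> carrier A. \<forall>x \<in> carrier M. f (a \<odot>\<^bsub>M\<^esub> x) = (FA ^^ s) a \<odot>\<^bsub>N\<^esub> f x)"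

lemma semilinearD:
  assumes "semilinear s M N f"
  shows "additive_map M N f" "\<And>x. x \<in> carrier M \<Longrightarrow> f x \<in> carrier N"
    "\<And>x y. \<lbrakk>x \<in> carrier M; y \<in> carrier M\<rbrakk> \<Longrightarrow> f (x \<oplus>\<^bsub>M\<^esub> y) = f x \<oplus>\<^bsub>N\<^esub> f y"
    "\<And>a x. \<lbrakk>a \<in> carrier A; x \<in> carrier M\<rbrakk> \<Longrightarrow> f (a \<odot>\<^bsub>M\<^esub> x) = (FA ^^ s) a \<odot>\<^bsub>N\<^esub> f x"
  using assms by (auto simp: semilinear_def additive_map_def)

lemma FA_power_one: "(FA ^^ s) \<one>\<^bsub>A\<^esub> = \<one>\<^bsub>A\<^esub>"
  by (induction s) (auto simp: FA_one)

lemma FA_power_mult: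
  "\<lbrakk>a \<in> carrier A; b \<in> carrier A\<rbrakk> \<Longrightarrow> (FA ^^ s) (a \<otimes>\<^bsub>A\<^esub> b) = (FA ^^ s) a \<otimes>\<^bsub>A\<^esub> (FA ^^ s) b"
  by (induction s) (auto simp: FA_mult A.Fp_closed)

text \<open>Scalars act through the elements \<open>c 1_A\<close>, and \<open>FA^s\<close> raises
  these to the power \<open>q^s\<close>.\<close>

lemma semilinear_scalar:
  assumes "semilinear s M N f" "c \<in> carrier k" "x \<in> carrier M"
  shows "f (c \<odot>\<^bsub>base_space A M\<^esub> x) = (c [^] (q ^ s)) \<odot>\<^bsub>base_space A N\<^esub> f x"
  using assms semilinearD(4)[OF assms(1), of "c \<odot>\<^bsub>A\<^esub> \<one>\<^bsub>A\<^esub>" x]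
  by (simp add: base_space_smult A.Fp_smult FA_power_one)

lemma semilinear_compose:
  assumes "semilinear s N P f" "semilinear t M N g"
  shows "semilinear (s + t) M P (\<lambda>x. f (g x))"
  using semilinearD[OF assms(1)] semilinearD[OF assms(2)] A.Fp_closed
  by (auto simp: semilinear_def funpow_add intro!: additive_map_compose[of N P f M g])

lemma semilinear_0_hom: "semilinear 0 M N f \<longleftrightarrow> f \<in> module_hom A M N"
  by (auto simp: semilinear_def module_hom_def additive_map_def)

end

section \<open>Modules with a semilinear Frobenius map\<close>

text \<open>The common frame of both situations: r = 1 is a stable module with its Frobenius map,
  and for a periodic module r is the period and \<open>G\<close> is \<open>FM^r\<close>. The
  Frobenius structure is relative to the field with \<open>q^r\<close> elements.\<close>

locale frobenius_module = frobenius_algebra k q A FA + M: left_module A M +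
    G: frobenius_space k "q ^ r" "base_space A M" G
  for k :: "'k ring" (structure) and q and A :: "('k, 'a) module" and FA
    and M :: "('a, 'm) module" and r and G +
  assumes r_pos: "0 < r"
    and G_semilinear: "semilinear r M M G"
    and fd: "\<exists>S. G.spans S"
begin

abbreviation V where "V \<equiv> base_space A M"
abbreviation M0 where "M0 \<equiv> G.Fix 1"
abbreviation AF where "AF \<equiv> A.Fix 1"

lemma ab_M: "abelian_group M" by (rule M.M.abelian_group_axioms)

lemma G_Kn: "G.Kn n = Kn (r * n)"
  by (simp add: Kn_def G.Kn_def power_mult)

lemma M0_iff: "x \<in> M0 \<longleftrightarrow> x \<in> carrier M \<and> G x = x"
  unfolding G.Fix_1 base_space_simps ..

lemma M0_carrier: "x \<in> M0 \<Longrightarrow> x \<in> carrier M"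
  unfolding M0_iff by blast

lemma AF_carrier: "a \<in> AF \<Longrightarrow> a \<in> carrier A"
  by (rule A.Fix_carrier)

lemma finite_M0: "finite M0"
proof -
  obtain S where "G.spans S" using fd by blast
  then show ?thesis by (rule G.finite_Fix) simp
qed

lemma M0_zero: "\<zero>\<^bsub>M\<^esub> \<in> M0"
  using G.Fix_zero[of 1] unfolding base_space_simps .

lemma M0_add: "\<lbrakk>x \<in> M0; y \<in> M0\<rbrakk> \<Longrightarrow> x \<oplus>\<^bsub>M\<^esub> y \<in> M0"
  using G.Fix_add[of x 1 y] unfolding base_space_simps .

lemma M0_smult: "\<lbrakk>c \<in> Kn r; x \<in> M0\<rbrakk> \<Longrightarrow> c \<odot>\<^bsub>V\<^esub> x \<in> M0"
  using G.Fix_smult[of c 1 x] unfolding G_Kn mult_1_right .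

lemma AF_power: "a \<in> AF \<Longrightarrow> (FA ^^ n) a = a"
  by (rule A.Fp_fixed)

lemma M0_act:
  assumes "a \<in> AF" "x \<in> M0" shows "a \<odot>\<^bsub>M\<^esub> x \<in> M0"
proof -
  have a: "a \<in> carrier A" and x: "x \<in> carrier M" "G x = x"
    using assms AF_carrier M0_iff by blast+
  have "G (a \<odot>\<^bsub>M\<^esub> x) = (FA ^^ r) a \<odot>\<^bsub>M\<^esub> G x" by (rule semilinearD(4)[OF G_semilinear a x(1)])
  then show ?thesis
    unfolding M0_iff x(2) AF_power[OF assms(1)] using M.left_smult_closed[OF a x(1)] by blast
qed

lemma left_M: "left_module A M" by (rule M.left_module_axioms)

lemma V_closed: "\<lbrakk>c \<in> carrier k; x \<in> carrier M\<rbrakk> \<Longrightarrow> c \<odot>\<^bsub>V\<^esub> x \<in> carrier M"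
  using G.V.smult_closed by simp

text \<open>The extension of h over \<open>k\<close> commutes with \<open>A^F\<close> on
  \<open>M0\<close>. This spreads to all of M by induction over fixed vectors of M, and then from
  \<open>A^F\<close> to \<open>A\<close>, with \<open>FA^s\<close> appearing, by induction over
  fixed elements of \<open>A\<close>.\<close>

lemma semilinear_extension:
  assumes h_closed: "\<And>x. x \<in> M0 \<Longrightarrow> h x \<in> carrier M"
    and h_add: "\<And>x y. \<lbrakk>x \<in> M0; y \<in> M0\<rbrakk> \<Longrightarrow> h (x \<oplus>\<^bsub>M\<^esub> y) = h x \<oplus>\<^bsub>M\<^esub> h y"
    and h_act: "\<And>a x. \<lbrakk>a \<in> AF; x \<in> M0\<rbrakk> \<Longrightarrow> h (a \<odot>\<^bsub>M\<^esub> x) = a \<odot>\<^bsub>M\<^esub> h x"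
    and h_smult: "\<And>c x. \<lbrakk>c \<in> Kn r; x \<in> M0\<rbrakk> \<Longrightarrow> h (c \<odot>\<^bsub>V\<^esub> x) = (c [^] (q ^ s)) \<odot>\<^bsub>V\<^esub> h x"
  shows "\<exists>H. semilinear s M M H \<and> (\<forall>x \<in> M0. H x = h x)"
proof -
  obtain H where H: "additive_map V V H" "\<And>x. x \<in> M0 \<Longrightarrow> H x = h x"
    and Hs: "\<And>c v. \<lbrakk>c \<in> carrier k; v \<in> carrier V\<rbrakk> \<Longrightarrow> H (c \<odot>\<^bsub>V\<^esub> v) = (c [^] (q ^ s)) \<odot>\<^bsub>V\<^esub> H v"
    using G.extension[OF base_module[OF left_M], of "q ^ s" h]
      frob_pow_add h_closed h_add h_smult G_Kn[of 1] by auto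
  have Ha: "additive_map M M H" using H(1) by (simp add: additive_map_base_space)
  note cl = additive_map_closed[OF Ha] and ad = additive_map_add[OF Ha]
  have H_act: "H (a \<odot>\<^bsub>M\<^esub> v) = a \<odot>\<^bsub>M\<^esub> H v" if a: "a \<in> AF" and v: "v \<in> carrier M" for a v
  proof -
    note ac = AF_carrier[OF a]
    have "v \<in> carrier V" using v by simp
    then show ?thesis
    proof (induction rule: G.fix_induct)
      case (fixed x)
      then show ?case using H(2) h_act a M0_act by simp
    next
      case (add x y)
      then show ?case using ac cl by (simp add: M.left_smult_r_distr ad M.left_smult_closed)
    next
      case (smult c x)
      then have x: "x \<in> carrier M" and c: "c \<in> carrier k" by auto
      have "H (a \<odot>\<^bsub>M\<^esub> (c \<odot>\<^bsub>V\<^esub> x)) = H (c \<odot>\<^bsub>V\<^esub> (a \<odot>\<^bsub>M\<^esub> x))"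
        using smult_base(2)[OF left_M c ac x] by simp
      also have "\<dots> = (c [^] (q ^ s)) \<odot>\<^bsub>V\<^esub> (a \<odot>\<^bsub>M\<^esub> H x)"
        using Hs[OF c, of "a \<odot>\<^bsub>M\<^esub> x"] x ac smult.IH by (simp add: M.left_smult_closed)
      also have "\<dots> = a \<odot>\<^bsub>M\<^esub> ((c [^] (q ^ s)) \<odot>\<^bsub>V\<^esub> H x)"
        using smult_base(2)[OF left_M _ ac cl[OF x], of "c [^] (q ^ s)"] c by simp
      also have "\<dots> = a \<odot>\<^bsub>M\<^esub> H (c \<odot>\<^bsub>V\<^esub> x)" using Hs[OF c, of x] x by simp
      finally show ?case .
    qed
  qed
  have "H (a \<odot>\<^bsub>M\<^esub> v) = (FA ^^ s) a \<odot>\<^bsub>M\<^esub> H v" if a: "a \<in> carrier A" and v: "v \<in> carrier M" for a v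
    using a
  proof (induction rule: A.fix_induct)
    case (fixed b)
    then show ?case using H_act[OF fixed v] A.Fp_fixed[OF fixed, of s] by simp
  next
    case (add b c)
    then show ?case
      using v cl by (simp add: M.left_smult_l_distr ad M.left_smult_closed A.Fp_add A.Fp_closed)
  next
    case (smult c b)
    have "H ((c \<odot>\<^bsub>A\<^esub> b) \<odot>\<^bsub>M\<^esub> v) = H (c \<odot>\<^bsub>V\<^esub> (b \<odot>\<^bsub>M\<^esub> v))"
      using smult_base(1)[OF left_M smult(1,2) v] by simp
    also have "\<dots> = (c [^] (q ^ s)) \<odot>\<^bsub>V\<^esub> ((FA ^^ s) b \<odot>\<^bsub>M\<^esub> H v)"
      using Hs[OF smult(1), of "b \<odot>\<^bsub>M\<^esub> v"] smult v by (simp add: M.left_smult_closed)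
    also have "\<dots> = (FA ^^ s) (c \<odot>\<^bsub>A\<^esub> b) \<odot>\<^bsub>M\<^esub> H v"
      using smult_base(1)[OF left_M _ A.Fp_closed[OF smult(2)] cl[OF v], of "c [^] (q ^ s)"] smult
      by (simp add: A.Fp_smult)
    finally show ?case .
  qed
  then show ?thesis using Ha H(2) by (auto simp: semilinear_def)
qed

lemma semilinear_eqI:
  assumes "semilinear s M M f" "semilinear s M M g" "\<And>x. x \<in> M0 \<Longrightarrow> f x = g x" "v \<in> carrier M"
  shows "f v = g v"
proof (rule G.linear_eqI[where m = "q ^ s" and f = f and g = g])
  show "additive_map V V f" "additive_map V V g"
    using semilinearD(1)[OF assms(1)] semilinearD(1)[OF assms(2)] by (simp_all add: additive_map_base_space)
  show "f (c \<odot>\<^bsub>V\<^esub> x) = (c [^] (q ^ s)) \<odot>\<^bsub>V\<^esub> f x" "g (c \<odot>\<^bsub>V\<^esub> x) = (c [^] (q ^ s)) \<odot>\<^bsub>V\<^esub> g x"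
    if "c \<in> carrier k" "x \<in> carrier V" for c x
    using semilinear_scalar[OF assms(1) that(1)] semilinear_scalar[OF assms(2) that(1)] that(2)
    unfolding base_space_simps by blast+
  show "v \<in> carrier V" using assms(4) unfolding base_space_simps .
qed (rule assms(3))

lemma hom_linear: "f \<in> module_hom A M M \<Longrightarrow> G.linear f"
proof -
  assume f: "f \<in> module_hom A M M"
  then have "semilinear 0 M M f" by (simp add: semilinear_0_hom)
  from semilinear_scalar[OF this] have "f (c \<odot>\<^bsub>V\<^esub> x) = c \<odot>\<^bsub>V\<^esub> f x"
    if "c \<in> carrier k" "x \<in> carrier M" for c x using that by simp
  then show "G.linear f"
    unfolding G.linear_def using module_homD(4)[OF f] by (simp add: additive_map_base_space)
qed

text \<open>An idempotent power \<open>e = f^m\<close> splits M into its image and its kernel, one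
  of which is zero. If the image is zero, f is nilpotent; if the kernel is zero, e is an injective
  idempotent, hence the identity, and \<open>f^(m-1)\<close> inverts f.\<close>

lemma fitting:
  assumes ind: "indecomposable_module k A M" and f: "f \<in> module_hom A M M"
  shows "bij_betw f (carrier M) (carrier M) \<or> (\<exists>m. \<forall>x \<in> carrier M. (f ^^ m) x = \<zero>\<^bsub>M\<^esub>)"
proof -
  have lin: "G.linear f" by (rule hom_linear[OF f])
  obtain S where "G.spans S" using fd by blast
  from G.linear_idempotent_power[OF this lin]
  obtain m where m: "m > 0" "\<forall>v \<in> carrier M. (f ^^ (m + m)) v = (f ^^ m) v" by auto
  define e where "e = f ^^ m"
  have fh: "(f ^^ n) \<in> module_hom A M M" for n
  proof (induction n)
    case (Suc n)
    show ?case using module_homD(1-3)[OF f] module_homD(1-3)[OF Suc.IH] by (intro module_homI) auto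
  qed (auto simp: module_hom_def)
  have eh: "e \<in> module_hom A M M" using fh by (simp add: e_def)
  note e = module_homD(1-3)[OF eh]
  have ez: "e \<zero>\<^bsub>M\<^esub> = \<zero>\<^bsub>M\<^esub>" using additive_map_zero[OF ab_M ab_M module_homD(4)[OF eh]] .
  have ee: "e (e v) = e v" if "v \<in> carrier M" for v
    using m(2) that by (simp add: e_def funpow_add)
  let ?U = "e ` carrier M" and ?W = "{x \<in> carrier M. e x = \<zero>\<^bsub>M\<^esub>}"
  have "submodule ?U A M"
  proof (rule M.left_submoduleI)
    show "\<zero>\<^bsub>M\<^esub> \<in> ?U" using ez by (intro image_eqI[where x = "\<zero>\<^bsub>M\<^esub>"]) auto
    show "x \<oplus>\<^bsub>M\<^esub> y \<in> ?U" if xy: "x \<in> ?U" "y \<in> ?U" for x y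
    proof -
      obtain u v where "u \<in> carrier M" "v \<in> carrier M" "x = e u" "y = e v" using xy by auto
      then show ?thesis using e(2)[of u v] by (intro image_eqI[where x = "u \<oplus>\<^bsub>M\<^esub> v"]) auto
    qed
    show "a \<odot>\<^bsub>M\<^esub> x \<in> ?U" if a: "a \<in> carrier A" and x: "x \<in> ?U" for a x
    proof -
      obtain u where "u \<in> carrier M" "x = e u" using x by auto
      then show ?thesis using e(3)[OF a, of u] a
        by (intro image_eqI[where x = "a \<odot>\<^bsub>M\<^esub> u"]) (auto simp: M.left_smult_closed)
    qed
  qed (use e in auto)
  moreover have "submodule ?W A M"
    using e ez by (intro M.left_submoduleI) (auto simp: M.left_smult_closed M.smult_zero)
  moreover have "?U \<inter> ?W = {\<zero>\<^bsub>M\<^esub>}"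
  proof -
    have "x = \<zero>\<^bsub>M\<^esub>" if "x \<in> ?U" "x \<in> ?W" for x using that ee by auto
    moreover have "\<zero>\<^bsub>M\<^esub> \<in> ?U" using ez by (intro image_eqI[where x = "\<zero>\<^bsub>M\<^esub>"]) auto
    ultimately show ?thesis using ez by auto
  qed
  moreover have "?U <+>\<^bsub>M\<^esub> ?W = carrier M"
  proof -
    have "x \<in> ?U <+>\<^bsub>M\<^esub> ?W" if x: "x \<in> carrier M" for x
    proof -
      have "e (x \<ominus>\<^bsub>M\<^esub> e x) = e x \<ominus>\<^bsub>M\<^esub> e (e x)"
        using additive_map_minus[OF ab_M ab_M module_homD(4)[OF eh]] x e(1) by blast
      then have "x \<ominus>\<^bsub>M\<^esub> e x \<in> ?W" using x e(1) ee by (simp add: a_minus_def M.M.r_neg)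
      moreover have "x = e x \<oplus>\<^bsub>M\<^esub> (x \<ominus>\<^bsub>M\<^esub> e x)"
        using x e(1) by (simp add: a_minus_def M.M.a_lcomm M.M.r_neg)
      ultimately show ?thesis using x unfolding set_add_def' by blast
    qed
    then show ?thesis using e(1) unfolding set_add_def' by auto
  qed
  ultimately have "internal_direct_sum A M ?U ?W" by (simp add: internal_direct_sum_def)
  then consider "?U = {\<zero>\<^bsub>M\<^esub>}" | "?W = {\<zero>\<^bsub>M\<^esub>}"
    using ind unfolding indecomposable_module_def by blast
  then show ?thesis
  proof cases
    case 1
    then have "\<forall>x \<in> carrier M. (f ^^ m) x = \<zero>\<^bsub>M\<^esub>" by (auto simp: e_def)
    then show ?thesis by blast
  next
    case 2
    have inj: "x = y" if "x \<in> carrier M" "y \<in> carrier M" "e x = e y" for x y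
    proof -
      have "inj_on e (carrier M)"
        using 2 by (intro additive_map_eq_zero_inj[OF ab_M ab_M module_homD(4)[OF eh]]) blast
      then show ?thesis using that by (auto dest: inj_onD)
    qed
    have id: "e x = x" if "x \<in> carrier M" for x using inj[of "e x" x] e(1) ee that by simp
    obtain n where n: "m = Suc n" using m(1) by (cases m) auto
    have "bij_betw f (carrier M) (carrier M)"
    proof (rule bij_betw_byWitness[where f' = "f ^^ n"])
      show "\<forall>x \<in> carrier M. (f ^^ n) (f x) = x"
        using id by (simp add: e_def n funpow_swap1)
      show "\<forall>x \<in> carrier M. f ((f ^^ n) x) = x" using id by (simp add: e_def n)
    qed (use module_homD(1)[OF f] module_homD(1)[OF fh] in auto)
    then show ?thesis by blast
  qed
qed

end

declare One_nat_def [simp del]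

section \<open>Nilpotent semigroups of maps\<close>

text \<open>Substituting \<open>x = \<Sum> f_i x\<close> into itself n times writes x as a sum over
  words of length n. In the induction the innermost x of a word of length n is expanded, which
  produces words with one more letter at the end.\<close>

lemma finsum_words_vanish:
  assumes "abelian_group Y" "finite I" "\<And>i. i \<in> I \<Longrightarrow> additive_map Y Y (f i)" "x \<in> carrier Y"
    and x: "x = finsum Y (\<lambda>i. f i x) I"
    and "\<And>w. \<lbrakk>set w \<subseteq> I; length w = n\<rbrakk> \<Longrightarrow> foldr f w x = \<zero>\<^bsub>Y\<^esub>"
  shows "x = \<zero>\<^bsub>Y\<^esub>"
  using assms(6)
proof (induction n)
  case 0
  show ?case using 0[of "[]"] by simp
next
  case (Suc n)
  have add: "additive_map Y Y (foldr f w)" if "set w \<subseteq> I" for w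
    using that
  proof (induction w)
    case Nil
    show ?case by (simp add: additive_map_def)
  next
    case (Cons i w)
    then show ?case
      using additive_map_compose[of Y Y "f i" Y "foldr f w"] assms(3)[of i] by (simp add: comp_def)
  qed
  show ?case
  proof (rule Suc.IH)
    fix w assume w: "set w \<subseteq> I" "length w = n"
    have fc: "(\<lambda>i. f i x) \<in> I \<rightarrow> carrier Y" 
      using additive_map_closed[OF assms(3) assms(4)] by (rule funcsetI)
    have "foldr f w x = foldr f w (finsum Y (\<lambda>i. f i x) I)" by (rule arg_cong[OF x])
    also have "\<dots> = finsum Y (\<lambda>i. foldr f w (f i x)) I"
      by (rule additive_map_finsum[OF assms(1,1) add[OF w(1)] fc])
    also have "\<dots> = finsum Y (\<lambda>i. \<zero>\<^bsub>Y\<^esub>) I"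
    proof -
      have "foldr f w (f i x) = \<zero>\<^bsub>Y\<^esub>" if "i \<in> I" for i
        using Suc.prems[of "w @ [i]"] w that by simp
      then show ?thesis
        by (intro abelian_monoid.finsum_cong'[OF abelian_group.axioms(1)[OF assms(1)] refl])
          (auto simp: abelian_monoid.zero_closed[OF abelian_group.axioms(1)[OF assms(1)]])
    qed
    also have "\<dots> = \<zero>\<^bsub>Y\<^esub>"
      by (rule abelian_monoid.finsum_zero[OF abelian_group.axioms(1)[OF assms(1)]])
    finally show "foldr f w x = \<zero>\<^bsub>Y\<^esub>" .
  qed
qed

text \<open>A finite semigroup of nilpotent maps is nilpotent: in a long product two prefixes \<open>p\<close> and
  \<open>p u\<close> coincide, and then \<open>p = p u\<^sup>m = 0\<close>.\<close>

lemma nil_semigroup_nilpotent: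
  assumes fin: "finite Y" and z: "z \<in> Y"
    and maps: "\<And>f x. \<lbrakk>P f; x \<in> Y\<rbrakk> \<Longrightarrow> f x \<in> Y" and Pz: "\<And>f. P f \<Longrightarrow> f z = z"
    and comp: "\<And>f g. \<lbrakk>P f; P g\<rbrakk> \<Longrightarrow> P (\<lambda>x. f (g x))"
    and nil: "\<And>f. P f \<Longrightarrow> \<exists>m. \<forall>x \<in> Y. (f ^^ m) x = z"
  shows "\<exists>n. \<forall>w. (\<forall>f \<in> set w. P f) \<longrightarrow> length w = n \<longrightarrow> (\<forall>x \<in> Y. foldr id w x = z)"
proof -
  have foldr_P: "P (foldr id w)" if "w \<noteq> []" "\<forall>f \<in> set w. P f" for w
    using that
  proof (induction w)
    case (Cons f w)
    show ?case
    proof (cases "w = []")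
      case True
      then show ?thesis using Cons.prems comp[of f f] by (simp add: comp_def)
    next
      case False
      then show ?thesis using Cons comp[of f "foldr id w"] by (simp add: comp_def id_def)
    qed
  qed simp
  have foldr_Y: "foldr id w x \<in> Y" if "\<forall>f \<in> set w. P f" "x \<in> Y" for w x
    using that by (induction w) (auto simp: maps)
  have foldr_z: "foldr id w z = z" if "\<forall>f \<in> set w. P f" for w
    using that by (induction w) (auto simp: Pz)
  define n where "n = card (Y \<rightarrow>\<^sub>E Y)"
  have finE: "finite (Y \<rightarrow>\<^sub>E Y)" using fin by (intro finite_PiE) auto
  have "foldr id w x = z" if w: "\<forall>f \<in> set w. P f" and len: "length w = n" and x: "x \<in> Y" for w x
  proof -
    define p where "p j = restrict (foldr id (take j w)) Y" for j
    have "p ` {..n} \<subseteq> Y \<rightarrow>\<^sub>E Y"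
    proof -
      have "\<forall>f \<in> set (take j w). P f" for j using w by (auto dest: in_set_takeD)
      then show ?thesis using foldr_Y by (simp add: p_def image_subset_iff)
    qed
    then have "card (p ` {..n}) \<le> n" unfolding n_def using finE card_mono by blast
    then have "\<not> inj_on p {..n}" using card_image[of p "{..n}"] by auto
    then obtain j0 l0 where "j0 \<noteq> l0" "j0 \<le> n" "l0 \<le> n" "p j0 = p l0" by (auto simp: inj_on_def)
    then obtain j l where jl: "j < l" "l \<le> n" "p j = p l"
      by (metis linorder_neqE_nat)
    define u where "u = foldr id (drop j (take l w))"
    have mem: "\<forall>f \<in> set (drop j (take l w)). P f" "\<forall>f \<in> set (take j w). P f" "\<forall>f \<in> set (drop j w). P f"
      using w by (auto dest: in_set_takeD in_set_dropD)
    have "drop j (take l w) \<noteq> []" using jl len by auto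
    then have Pu: "P u" unfolding u_def using foldr_P mem(1) by blast
    have split: "take l w = take j w @ drop j (take l w)"
      using jl append_take_drop_id[of j "take l w"] by (simp add: min_def)
    \<comment> \<open>Since the prefixes of lengths j and l act alike, the factor u between them may
      be inserted after the shorter prefix, and so may every power of u.\<close>
    have step: "foldr id (take j w) y = foldr id (take j w) (u y)" if "y \<in> Y" for y
    proof -
      have "foldr id (take j w) y = p j y" using that by (simp add: p_def)
      also have "\<dots> = p l y" by (simp only: jl(3))
      also have "\<dots> = foldr id (take j w @ drop j (take l w)) y" by (simp add: p_def that flip: split)
      also have "\<dots> = foldr id (take j w) (u y)" by (simp add: u_def)
      finally show ?thesis .
    qed
    have upow: "(u ^^ m) y \<in> Y" if "y \<in> Y" for m y
      by (induction m) (use that maps[OF Pu] in auto)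
    have "foldr id (take j w) y = foldr id (take j w) ((u ^^ m) y)" if "y \<in> Y" for m y
    proof (induction m)
      case (Suc m)
      show ?case using trans[OF Suc.IH step[OF upow[OF that]]] by (simp only: funpow.simps comp_apply)
    qed simp
    moreover obtain m where "\<forall>y \<in> Y. (u ^^ m) y = z" using nil[OF Pu] by blast
    ultimately have pz: "foldr id (take j w) y = z" if "y \<in> Y" for y
      using that foldr_z[OF mem(2)] by metis
    have "foldr id w x = foldr id (take j w @ drop j w) x" by simp
    also have "\<dots> = foldr id (take j w) (foldr id (drop j w) x)" by (simp only: foldr_append)
    also have "\<dots> = z" using pz[OF foldr_Y[OF mem(3) x]] .
    finally show ?thesis .
  qed
  then show ?thesis by blast
qed

lemma (in abelian_group) finsum_Times:
  assumes "finite I" "finite J" "\<And>i j. \<lbrakk>i \<in> I; j \<in> J\<rbrakk> \<Longrightarrow> f i j \<in> carrier G"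
  shows "(\<Oplus>p\<in>I \<times> J. f (fst p) (snd p)) = (\<Oplus>i\<in>I. \<Oplus>j\<in>J. f i j)"
  using assms(1,3)
proof (induction I rule: finite_induct)
  case empty
  then show ?case by (simp add: finsum_empty)
next
  case (insert i I)
  have eq: "insert i I \<times> J = ({i} \<times> J) \<union> (I \<times> J)" by auto
  have img: "{i} \<times> J = Pair i ` J" by auto
  have "(\<Oplus>p\<in>insert i I \<times> J. f (fst p) (snd p)) =
      (\<Oplus>p\<in>{i} \<times> J. f (fst p) (snd p)) \<oplus> (\<Oplus>p\<in>I \<times> J. f (fst p) (snd p))"
    unfolding eq using insert assms(2) by (intro finsum_Un_disjoint) auto
  also have "(\<Oplus>p\<in>{i} \<times> J. f (fst p) (snd p)) = (\<Oplus>j\<in>J. f i j)"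
    unfolding img using insert.prems by (subst finsum_reindex) (auto simp: inj_on_def)
  also have "(\<Oplus>p\<in>I \<times> J. f (fst p) (snd p)) = (\<Oplus>i\<in>I. \<Oplus>j\<in>J. f i j)"
    using insert by auto
  also have "(\<Oplus>j\<in>J. f i j) \<oplus> (\<Oplus>i\<in>I. \<Oplus>j\<in>J. f i j) = (\<Oplus>i\<in>insert i I. \<Oplus>j\<in>J. f i j)"
    using insert by (subst finsum_insert) (auto intro!: finsum_closed)
  finally show ?case .
qed

section \<open>Endomorphisms of the fixed points\<close>

lemma fixed_points_carrier: "carrier (fixed_points U F) = {x \<in> carrier U. F x = x}"
  by (simp add: fixed_points_def)

lemma fixed_points_simps [simp]:
  "monoid.mult (fixed_points U F) = monoid.mult U" "one (fixed_points U F) = one U"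
  "ring.zero (fixed_points U F) = ring.zero U" "ring.add (fixed_points U F) = ring.add U"
  "smult (fixed_points U F) = smult U"
  by (simp_all add: fixed_points_def)

lemma (in frobenius_field) Kn_field: "field (k\<lparr>carrier := Kn n\<rparr>)"
proof -
  have "subring (Kn n) k"
    using Kn_carrier Kn_one Kn_neg Kn_add Kn_mult by (intro subringI) auto
  then have "subfield (Kn n) k"
    using Kn_inv by (intro subfieldI') auto
  then show ?thesis by (rule subfield_iff(2))
qed

lemma (in frobenius_algebra) fixed_ring: "ring (fixed_points A FA)"
proof -
  have "subring {a \<in> carrier A. FA a = a} A"
  proof (rule AA.subringI)
    show "\<one>\<^bsub>A\<^esub> \<in> {a \<in> carrier A. FA a = a}" by (simp add: FA_one)
    show "\<ominus>\<^bsub>A\<^esub> a \<in> {a \<in> carrier A. FA a = a}" if "a \<in> {a \<in> carrier A. FA a = a}" for a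
      using that A.Fix_neg[of a 1] A.Fix_1 by simp
    show "a \<oplus>\<^bsub>A\<^esub> b \<in> {a \<in> carrier A. FA a = a}"
      if "a \<in> {a \<in> carrier A. FA a = a}" "b \<in> {a \<in> carrier A. FA a = a}" for a b
      using that A.Fix_add[of a 1 b] A.Fix_1 by simp
  qed (auto simp: FA_mult)
  from AA.subring_is_ring[OF this] show ?thesis
    by (simp add: fixed_points_def)
qed

section \<open>The grading of endomorphisms of the fixed points modulo r\<close>

context frobenius_module
begin

abbreviation B where "B \<equiv> fixed_points A FA"
abbreviation Y where "Y \<equiv> fixed_points M G"

lemma carrier_B: "carrier B = AF"
  unfolding fixed_points_carrier set_eq_iff A.Fix_1 by blast

lemma carrier_Y: "carrier Y = M0"
  unfolding fixed_points_carrier set_eq_iff M0_iff by blast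

lemma left_module_Y: "left_module B Y"
proof -
  have neg: "\<ominus>\<^bsub>M\<^esub> x \<in> M0" if "x \<in> M0" for x
    using additive_map_neg[OF ab_M ab_M semilinearD(1)[OF G_semilinear]] that
    unfolding M0_iff by simp
  have "abelian_group Y"
  proof (rule abelian_groupI, unfold carrier_Y fixed_points_simps)
    show "\<exists>y\<in>M0. y \<oplus>\<^bsub>M\<^esub> x = \<zero>\<^bsub>M\<^esub>" if "x \<in> M0" for x
      using neg[OF that] M.M.l_neg[OF M0_carrier[OF that]] by blast
  qed (use M0_carrier in \<open>auto simp: M0_add M0_zero M.M.a_ac\<close>)
  then show ?thesis
  proof (intro left_module.intro left_module_axioms.intro)
    show "ring B" by (rule fixed_ring)
  qed (unfold carrier_B carrier_Y fixed_points_simps, auto simp: M0_act M.left_smult_l_distr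
      M.left_smult_r_distr M.left_smult_assoc M.left_smult_one AF_carrier M0_carrier)
qed

lemma ab_Y: "abelian_group Y"
  using left_module_Y by (simp add: left_module_def)

lemma finsum_Y: "g \<in> I \<rightarrow> M0 \<Longrightarrow> finsum Y g I = finsum M g I"
proof (induction I rule: infinite_finite_induct)
  case (infinite I)
  then show ?case
    by (simp add: M.M.finsum_infinite abelian_monoid.finsum_infinite[OF abelian_group.axioms(1)[OF ab_Y]])
next
  case empty
  show ?case by (simp add: M.M.finsum_empty abelian_monoid.finsum_empty[OF abelian_group.axioms(1)[OF ab_Y]])
next
  case (insert i I)
  have gi: "g i \<in> M0" "g \<in> I \<rightarrow> M0" using insert.prems by auto
  then have gm: "g i \<in> carrier M" "g \<in> I \<rightarrow> carrier M" using M0_carrier by auto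
  have "finsum Y g (insert i I) = g i \<oplus>\<^bsub>M\<^esub> finsum Y g I"
    using abelian_monoid.finsum_insert[OF abelian_group.axioms(1)[OF ab_Y] insert.hyps, of g] gi
    unfolding carrier_Y by simp
  then show ?case
    using M.M.finsum_insert[OF insert.hyps gm(2,1)] insert.IH[OF gi(2)] by simp
qed

lemma M0_finsum: "g \<in> I \<rightarrow> M0 \<Longrightarrow> finsum M g I \<in> M0"
  using abelian_monoid.finsum_closed[OF abelian_group.axioms(1)[OF ab_Y], of g I] finsum_Y[of g I]
  unfolding carrier_Y by simp

text \<open>Such maps extend to semilinear maps of degree s on M. The degree matters only modulo r
  (\<open>homogeneous_mod\<close>), because the \<open>q^r\<close>-power is the identity on
  \<open>Kn r\<close>.\<close>

definition homogeneous :: "nat \<Rightarrow> ('m \<Rightarrow> 'm) \<Rightarrow> bool" where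
  "homogeneous s h \<longleftrightarrow> h \<in> module_hom B Y Y \<and>
     (\<forall>c \<in> Kn r. \<forall>x \<in> M0. h (c \<odot>\<^bsub>V\<^esub> x) = (c [^] (q ^ s)) \<odot>\<^bsub>V\<^esub> h x)"

lemma homY_D:
  assumes "h \<in> module_hom B Y Y"
  shows "\<And>x. x \<in> M0 \<Longrightarrow> h x \<in> M0" "\<And>x y. \<lbrakk>x \<in> M0; y \<in> M0\<rbrakk> \<Longrightarrow> h (x \<oplus>\<^bsub>M\<^esub> y) = h x \<oplus>\<^bsub>M\<^esub> h y"
    "\<And>a x. \<lbrakk>a \<in> AF; x \<in> M0\<rbrakk> \<Longrightarrow> h (a \<odot>\<^bsub>M\<^esub> x) = a \<odot>\<^bsub>M\<^esub> h x"
  using module_homD[OF assms] unfolding carrier_B carrier_Y fixed_points_simps by blast+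

lemma homY_I:
  assumes "\<And>x. x \<in> M0 \<Longrightarrow> h x \<in> M0" "\<And>x y. \<lbrakk>x \<in> M0; y \<in> M0\<rbrakk> \<Longrightarrow> h (x \<oplus>\<^bsub>M\<^esub> y) = h x \<oplus>\<^bsub>M\<^esub> h y"
    "\<And>a x. \<lbrakk>a \<in> AF; x \<in> M0\<rbrakk> \<Longrightarrow> h (a \<odot>\<^bsub>M\<^esub> x) = a \<odot>\<^bsub>M\<^esub> h x"
  shows "h \<in> module_hom B Y Y"
  using assms by (intro module_homI) (simp_all add: carrier_B carrier_Y)

lemma homogeneousD:
  assumes "homogeneous s h"
  shows "h \<in> module_hom B Y Y" "\<And>x. x \<in> M0 \<Longrightarrow> h x \<in> M0"
    "\<And>x y. \<lbrakk>x \<in> M0; y \<in> M0\<rbrakk> \<Longrightarrow> h (x \<oplus>\<^bsub>M\<^esub> y) = h x \<oplus>\<^bsub>M\<^esub> h y"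
    "\<And>a x. \<lbrakk>a \<in> AF; x \<in> M0\<rbrakk> \<Longrightarrow> h (a \<odot>\<^bsub>M\<^esub> x) = a \<odot>\<^bsub>M\<^esub> h x"
    "\<And>c x. \<lbrakk>c \<in> Kn r; x \<in> M0\<rbrakk> \<Longrightarrow> h (c \<odot>\<^bsub>V\<^esub> x) = (c [^] (q ^ s)) \<odot>\<^bsub>V\<^esub> h x"
proof -
  show h: "h \<in> module_hom B Y Y" using assms by (simp add: homogeneous_def)
  show "\<And>x. x \<in> M0 \<Longrightarrow> h x \<in> M0"
    "\<And>x y. \<lbrakk>x \<in> M0; y \<in> M0\<rbrakk> \<Longrightarrow> h (x \<oplus>\<^bsub>M\<^esub> y) = h x \<oplus>\<^bsub>M\<^esub> h y"
    "\<And>a x. \<lbrakk>a \<in> AF; x \<in> M0\<rbrakk> \<Longrightarrow> h (a \<odot>\<^bsub>M\<^esub> x) = a \<odot>\<^bsub>M\<^esub> h x"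
    using homY_D[OF h] by blast+
  show "\<And>c x. \<lbrakk>c \<in> Kn r; x \<in> M0\<rbrakk> \<Longrightarrow> h (c \<odot>\<^bsub>V\<^esub> x) = (c [^] (q ^ s)) \<odot>\<^bsub>V\<^esub> h x"
    using assms by (simp add: homogeneous_def)
qed

lemma homogeneous_compose:
  assumes "homogeneous s f" "homogeneous t g" shows "homogeneous (s + t) (\<lambda>x. f (g x))"
proof -
  note f = homogeneousD[OF assms(1)] and g = homogeneousD[OF assms(2)]
  have "(\<lambda>x. f (g x)) \<in> module_hom B Y Y"
    by (rule homY_I) (simp_all add: f(2,3,4) g(2,3,4))
  moreover have "f (g (c \<odot>\<^bsub>V\<^esub> x)) = (c [^] (q ^ (s + t))) \<odot>\<^bsub>V\<^esub> f (g x)" if "c \<in> Kn r" "x \<in> M0" for c x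
    using f(5)[OF Kn_pow_closed[OF that(1)] g(2)[OF that(2)], of "q ^ t"] g(5)[OF that]
      frob_pow_pow[OF Kn_carrier[OF that(1)], of t s] by (simp add: add.commute)
  ultimately show ?thesis by (simp add: homogeneous_def)
qed

lemma homogeneous_funpow: "homogeneous s f \<Longrightarrow> homogeneous (n * s) (f ^^ n)"
proof (induction n)
  case 0
  have "(\<lambda>x. x) \<in> module_hom B Y Y" by (rule homY_I) simp_all
  then show ?case using V_closed Kn_carrier M0_carrier by (simp add: homogeneous_def id_def)
next
  case (Suc n)
  then show ?case using homogeneous_compose[of s f "n * s" "f ^^ n"] by (simp add: comp_def)
qed

lemma homogeneous_mod:
  assumes "homogeneous s f" "s mod r = t mod r" shows "homogeneous t f"
proof -
  have red: "c [^] (q ^ s) = c [^] (q ^ (s mod r))" if "c \<in> Kn r" for c s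
  proof -
    have "c [^] (q ^ (r * (s div r) + s mod r)) = (c [^] (q ^ (r * (s div r)))) [^] (q ^ (s mod r))"
      using Kn_carrier[OF that] by (simp add: frob_pow_pow)
    then show ?thesis using Kn_pow[OF Kn_dvd[OF that, of "r * (s div r)"]] by simp
  qed
  show ?thesis using assms red unfolding homogeneous_def by metis
qed

lemma additive_map_Y: "h \<in> module_hom B Y Y \<Longrightarrow> additive_map Y Y h"
  by (rule module_homD(4))

lemma homogeneous_zero: "h \<in> module_hom B Y Y \<Longrightarrow> h \<zero>\<^bsub>M\<^esub> = \<zero>\<^bsub>M\<^esub>"
  using additive_map_zero[OF ab_Y ab_Y additive_map_Y] by simp

lemma homogeneous_extension:
  assumes "homogeneous s h" shows "\<exists>H. semilinear s M M H \<and> (\<forall>x \<in> M0. H x = h x)"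
  using homogeneousD[OF assms] M0_carrier by (intro semilinear_extension) blast+

text \<open>The inverse of h on the finite set \<open>M0\<close> is homogeneous of degree r - s. The
  extensions of h and of its inverse compose, in either order, to semilinear maps of degree r that
  agree with \<open>G\<close> on \<open>M0\<close>; hence they compose to \<open>G\<close>, which is
  bijective.\<close>

lemma homogeneous_bij:
  assumes h: "homogeneous s h" and s: "s \<le> r" and inj: "inj_on h M0"
    and H: "semilinear s M M H" "\<And>x. x \<in> M0 \<Longrightarrow> H x = h x"
  shows "bij_betw H (carrier M) (carrier M)"
proof -
  note hD = homogeneousD[OF h]
  have surj: "h ` M0 = M0" using endo_inj_surj[OF finite_M0 _ inj] hD(2) by blast
  define g where "g = inv_into M0 h"
  have g: "g x \<in> M0" "h (g x) = x" if "x \<in> M0" for x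
    using that surj inv_into_into[of x h M0] f_inv_into_f[of x h M0] unfolding g_def by auto
  have gh: "g (h x) = x" if "x \<in> M0" for x unfolding g_def using inj that by simp
  have eqI: "x = y" if "x \<in> M0" "y \<in> M0" "h x = h y" for x y using inj_onD[OF inj that(3,1,2)] .
  have "homogeneous (r - s) g"
  proof -
    have "g \<in> module_hom B Y Y"
    proof (rule homY_I)
      show "g (x \<oplus>\<^bsub>M\<^esub> y) = g x \<oplus>\<^bsub>M\<^esub> g y" if "x \<in> M0" "y \<in> M0" for x y
        by (rule eqI) (simp_all add: that g hD(3) M0_add)
      show "g (a \<odot>\<^bsub>M\<^esub> x) = a \<odot>\<^bsub>M\<^esub> g x" if "a \<in> AF" "x \<in> M0" for a x
        by (rule eqI) (simp_all add: that g hD(4) M0_act)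
    qed (rule g)
    moreover have "g (c \<odot>\<^bsub>V\<^esub> x) = (c [^] (q ^ (r - s))) \<odot>\<^bsub>V\<^esub> g x" if c: "c \<in> Kn r" and x: "x \<in> M0" for c x
    proof (rule eqI)
      have "h ((c [^] (q ^ (r - s))) \<odot>\<^bsub>V\<^esub> g x) = ((c [^] (q ^ (r - s))) [^] (q ^ s)) \<odot>\<^bsub>V\<^esub> h (g x)"
        by (rule hD(5)[OF Kn_pow_closed[OF c] g(1)[OF x]])
      also have "(c [^] (q ^ (r - s))) [^] (q ^ s) = c"
        using frob_pow_pow[OF Kn_carrier[OF c], of "r - s" s] s Kn_pow[OF c] by simp
      finally show "h (g (c \<odot>\<^bsub>V\<^esub> x)) = h ((c [^] (q ^ (r - s))) \<odot>\<^bsub>V\<^esub> g x)"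
        using g(2)[OF M0_smult[OF c x]] g(2)[OF x] by simp
    qed (use g(1) M0_smult Kn_pow_closed c x in blast)+
    ultimately show ?thesis by (simp add: homogeneous_def)
  qed
  then obtain H' where H': "semilinear (r - s) M M H'" "\<And>x. x \<in> M0 \<Longrightarrow> H' x = g x"
    using homogeneous_extension by blast
  have r: "s + (r - s) = r" "(r - s) + s = r" using s by auto
  have "semilinear r M M (\<lambda>x. H (H' x))" "semilinear r M M (\<lambda>x. H' (H x))"
    using semilinear_compose[OF H(1) H'(1)] semilinear_compose[OF H'(1) H(1)] unfolding r by blast+
  note comps = this
  have HH: "H (H' v) = G v" "H' (H v) = G v" if "v \<in> carrier M" for v
  proof -
    have "H (H' x) = G x" "H' (H x) = G x" if "x \<in> M0" for x
      using H(2)[OF g(1)[OF that]] H'(2)[OF that] H(2)[OF that] H'(2)[OF hD(2)[OF that]]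
        g(2)[OF that] gh[OF that] that M0_iff[of x] by simp_all
    then show "H (H' v) = G v" "H' (H v) = G v"
      using semilinear_eqI[OF comps(1) G_semilinear _ that] semilinear_eqI[OF comps(2) G_semilinear _ that]
      by blast+
  qed
  have Gb: "bij_betw G (carrier M) (carrier M)" using G.F_bij unfolding base_space_simps .
  have cl: "H v \<in> carrier M" "H' v \<in> carrier M" if "v \<in> carrier M" for v
    using semilinearD(2)[OF H(1) that] semilinearD(2)[OF H'(1) that] by blast+
  show ?thesis
  proof (rule bij_betw_imageI)
    show "inj_on H (carrier M)"
    proof (rule inj_onI)
      fix x y assume "x \<in> carrier M" "y \<in> carrier M" "H x = H y"
      then show "x = y" using HH(2)[of x] HH(2)[of y] bij_betw_imp_inj_on[OF Gb] by (auto dest: inj_onD)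
    qed
    show "H ` carrier M = carrier M"
    proof
      show "H ` carrier M \<subseteq> carrier M" using cl by blast
      show "carrier M \<subseteq> H ` carrier M"
      proof
        fix y assume "y \<in> carrier M"
        then have "y \<in> G ` carrier M" using Gb by (simp add: bij_betw_def)
        then obtain z where z: "z \<in> carrier M" "y = G z" by (elim imageE)
        then show "y \<in> H ` carrier M" using HH(1)[OF z(1)] cl(2)[OF z(1)] by (intro image_eqI[where x = "H' z"]) simp_all
      qed
    qed
  qed
qed

end

text \<open>Minimality of the period in terms of semilinear maps alone. This form serves both for a
  given \<open>FM\<close> with \<open>G = FM^r\<close> and in the converse direction, where
  \<open>G\<close> is found first and \<open>FM\<close> is constructed as its root.\<close>

locale aperiodic_module = frobenius_module +
  assumes ac: "algebraically_closed k"
    and ind: "indecomposable_module k A M"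
    and aperiodic: "\<And>s f. \<lbrakk>0 < s; s < r; semilinear s M M f\<rbrakk> \<Longrightarrow> \<not> bij_betw f (carrier M) (carrier M)"
begin

lemma homogeneous_not_inj:
  assumes "homogeneous s h" "0 < s" "s < r" shows "\<not> inj_on h M0"
proof
  assume inj: "inj_on h M0"
  obtain H where H: "semilinear s M M H" "\<And>x. x \<in> M0 \<Longrightarrow> H x = h x"
    using homogeneous_extension[OF assms(1)] by blast
  have "bij_betw H (carrier M) (carrier M)"
    using homogeneous_bij[OF assms(1) _ inj H] assms(3) by simp
  then show False using aperiodic[OF assms(2,3) H(1)] by blast
qed

text \<open>The degree of \<open>h^r\<close> is 0 modulo r, so it extends to an endomorphism of M.
  By Fitting's lemma that endomorphism is bijective or nilpotent, and the first case would make h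
  injective.\<close>

lemma homogeneous_nilpotent:
  assumes h: "homogeneous s h" and ninj: "\<not> inj_on h M0"
  shows "\<exists>m. \<forall>x \<in> M0. (h ^^ m) x = \<zero>\<^bsub>M\<^esub>"
proof -
  let ?u = "h ^^ r"
  have u: "homogeneous 0 ?u"
    using homogeneous_mod[OF homogeneous_funpow[OF h, of r], of 0] by simp
  have uinj: "\<not> inj_on ?u M0"
  proof
    assume inj: "inj_on ?u M0"
    have "inj_on h M0"
    proof (rule inj_onI)
      fix x y assume xy: "x \<in> M0" "y \<in> M0" "h x = h y"
      obtain n where n: "r = Suc n" using r_pos by (cases r) auto
      have "?u x = ?u y" unfolding n funpow_Suc_right using xy(3) by simp
      then show "x = y" using inj_onD[OF inj _ xy(1,2)] by blast
    qed
    then show False using ninj by blast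
  qed
  obtain H where H: "semilinear 0 M M H" "\<And>x. x \<in> M0 \<Longrightarrow> H x = ?u x"
    using homogeneous_extension[OF u] by blast
  have "H \<in> module_hom A M M" using H(1) by (simp add: semilinear_0_hom)
  from fitting[OF ind this] show ?thesis
  proof
    assume "bij_betw H (carrier M) (carrier M)"
    then have Hi: "inj_on H (carrier M)" by (rule bij_betw_imp_inj_on)
    have "inj_on ?u M0"
    proof (rule inj_onI)
      fix x y assume xy: "x \<in> M0" "y \<in> M0" "?u x = ?u y"
      then show "x = y" using inj_onD[OF Hi, of x y] H(2) M0_carrier by simp
    qed
    then show ?thesis using uinj by blast
  next
    assume "\<exists>m. \<forall>x \<in> carrier M. (H ^^ m) x = \<zero>\<^bsub>M\<^esub>"
    then obtain m where m: "\<forall>x \<in> carrier M. (H ^^ m) x = \<zero>\<^bsub>M\<^esub>" by blast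
    have uY: "(?u ^^ n) x \<in> M0" if "x \<in> M0" for n x
      by (induction n) (use that homogeneousD(2)[OF u] in auto)
    have "(H ^^ n) x = (?u ^^ n) x" if "x \<in> M0" for n x
      by (induction n) (simp_all add: H(2)[OF uY[OF that]])
    then have "(?u ^^ m) x = \<zero>\<^bsub>M\<^esub>" if "x \<in> M0" for x using m M0_carrier[OF that] that by metis
    then have "\<forall>x \<in> M0. (h ^^ (r * m)) x = \<zero>\<^bsub>M\<^esub>" by (simp add: funpow_mult)
    then show ?thesis by blast
  qed
qed

lemma M_nonzero: "carrier M \<noteq> {\<zero>\<^bsub>M\<^esub>}"
  using ind by (simp add: indecomposable_module_def)

lemma M0_nonzero: "M0 \<noteq> {\<zero>\<^bsub>M\<^esub>}"
proof
  assume M0: "M0 = {\<zero>\<^bsub>M\<^esub>}"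
  have "v = \<zero>\<^bsub>M\<^esub>" if "v \<in> carrier M" for v
  proof -
    have "v \<in> carrier V" using that by simp
    then show ?thesis
    proof (induction rule: G.fix_induct)
      case (smult c x)
      then show ?case using G.V.smult_r_null[of c] by simp
    qed (use M0 in auto)
  qed
  then show False using M_nonzero M.M.zero_closed by blast
qed

lemma minus_scalar_hom:
  assumes H: "H \<in> module_hom A M M" and c: "c \<in> carrier k"
  shows "(\<lambda>x. H x \<oplus>\<^bsub>M\<^esub> (\<ominus> c) \<odot>\<^bsub>V\<^esub> x) \<in> module_hom A M M"
proof (rule module_homI)
  note H' = module_homD[OF H]
  have mc: "\<ominus> c \<in> carrier k" using c by simp
  note cc = V_closed[OF mc]
  show "H x \<oplus>\<^bsub>M\<^esub> (\<ominus> c) \<odot>\<^bsub>V\<^esub> x \<in> carrier M" if "x \<in> carrier M" for x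
    using H'(1)[OF that] cc[OF that] by simp
  show "H (x \<oplus>\<^bsub>M\<^esub> y) \<oplus>\<^bsub>M\<^esub> (\<ominus> c) \<odot>\<^bsub>V\<^esub> (x \<oplus>\<^bsub>M\<^esub> y) =
      H x \<oplus>\<^bsub>M\<^esub> (\<ominus> c) \<odot>\<^bsub>V\<^esub> x \<oplus>\<^bsub>M\<^esub> (H y \<oplus>\<^bsub>M\<^esub> (\<ominus> c) \<odot>\<^bsub>V\<^esub> y)"
    if "x \<in> carrier M" "y \<in> carrier M" for x y
    using G.V.smult_r_distr[OF mc, of x y] that H'(1) cc
    by (simp add: H'(2) M.M.a_ac)
  show "H (a \<odot>\<^bsub>M\<^esub> x) \<oplus>\<^bsub>M\<^esub> (\<ominus> c) \<odot>\<^bsub>V\<^esub> (a \<odot>\<^bsub>M\<^esub> x) = a \<odot>\<^bsub>M\<^esub> (H x \<oplus>\<^bsub>M\<^esub> (\<ominus> c) \<odot>\<^bsub>V\<^esub> x)"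
    if "a \<in> carrier A" "x \<in> carrier M" for a x
    using smult_base(2)[OF left_M mc that] that H'(1) cc
    by (simp add: H'(3) M.left_smult_r_distr)
qed

text \<open>An eigenvalue \<open>c\<close> of the extension \<open>H\<close> lies in the field with \<open>q\<^sup>r\<close> elements: \<open>G\<close> maps
  an eigenvector for \<open>c\<close> to one for \<open>c\<^bsup>q^r\<^esup>\<close>, while \<open>H - c\<close> is nilpotent.\<close>

lemma homogeneous_eigenvalue:
  assumes h: "homogeneous 0 h"
  shows "\<exists>c \<in> Kn r. \<not> inj_on (\<lambda>x. h x \<oplus>\<^bsub>M\<^esub> (\<ominus> c) \<odot>\<^bsub>V\<^esub> x) M0"
proof -
  obtain H where H: "semilinear 0 M M H" "\<And>x. x \<in> M0 \<Longrightarrow> H x = h x"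
    using homogeneous_extension[OF h] by blast
  have Hh: "H \<in> module_hom A M M" using H(1) by (simp add: semilinear_0_hom)
  have lin: "G.linear H" by (rule hom_linear[OF Hh])
  obtain S where S: "G.spans S" using fd by blast
  obtain m where m: "m > 0" "\<forall>v \<in> carrier M. (H ^^ (m + m)) v = (H ^^ m) v"
    using G.linear_idempotent_power[OF S lin] unfolding base_space_simps by blast
  obtain v where v: "v \<in> carrier M" "v \<noteq> \<zero>\<^bsub>M\<^esub>" using M_nonzero M.M.zero_closed by blast
  obtain c w where c: "c \<in> carrier k" and w: "w \<in> carrier M" "w \<noteq> \<zero>\<^bsub>M\<^esub>" "H w = c \<odot>\<^bsub>V\<^esub> w"
    using G.ex_eigenvector[OF ac lin, of v m] v m unfolding base_space_simps by blast
  define N where "N x = H x \<oplus>\<^bsub>M\<^esub> (\<ominus> c) \<odot>\<^bsub>V\<^esub> x" for x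
  have Nh: "N \<in> module_hom A M M"
    unfolding N_def by (rule minus_scalar_hom[OF Hh c])
  have Nlin: "G.linear N" by (rule hom_linear[OF Nh])
  have eig: "N x = (d \<ominus> c) \<odot>\<^bsub>V\<^esub> x" if "H x = d \<odot>\<^bsub>V\<^esub> x" "d \<in> carrier k" "x \<in> carrier M" for x d
    unfolding N_def using that c G.V.smult_l_distr[of d "\<ominus> c" x] by (simp add: a_minus_def)
  have "N w = \<zero>\<^bsub>M\<^esub>" using eig[OF w(3) c w(1)] w(1) G.V.smult_l_null[of w] r_neg[OF c]
    by (simp add: a_minus_def)
  then have Nninj: "\<not> inj_on N (carrier M)"
    using w additive_map_inj_on_iff[OF ab_M ab_M module_homD(4)[OF Nh]] by blast
  then have "\<not> bij_betw N (carrier M) (carrier M)" by (auto simp: bij_betw_def)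
  then obtain n where n: "\<forall>x \<in> carrier M. (N ^^ n) x = \<zero>\<^bsub>M\<^esub>" using fitting[OF ind Nh] by blast
  have cK: "c \<in> Kn r"
  proof -
    have HG: "semilinear r M M (\<lambda>x. H (G x))" "semilinear r M M (\<lambda>x. G (H x))"
      using semilinear_compose[OF H(1) G_semilinear] semilinear_compose[OF G_semilinear H(1)] by simp_all
    \<comment> \<open>Both composites are semilinear of degree r, and they agree on
      \<open>M0\<close> because h maps \<open>M0\<close> into itself.\<close>
    have "H (G w) = G (H w)"
    proof (rule semilinear_eqI[OF HG _ w(1)])
      show "H (G x) = G (H x)" if "x \<in> M0" for x
        using H(2)[OF that] homogeneousD(2)[OF h that] that M0_iff by simp
    qed
    also have "\<dots> = (c [^] (q ^ r)) \<odot>\<^bsub>V\<^esub> G w"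
      unfolding w(3) by (rule semilinear_scalar[OF G_semilinear c w(1)])
    finally have Gw: "H (G w) = (c [^] (q ^ r)) \<odot>\<^bsub>V\<^esub> G w" .
    have Gwc: "G w \<in> carrier M" by (rule semilinearD(2)[OF G_semilinear w(1)])
    have Gw0: "G w \<noteq> \<zero>\<^bsub>M\<^esub>"
    proof
      assume "G w = \<zero>\<^bsub>M\<^esub>"
      moreover have "inj_on G (carrier M)" using bij_betw_imp_inj_on[OF G.F_bij] unfolding base_space_simps .
      ultimately show False
        using additive_map_inj_on_iff[OF ab_M ab_M semilinearD(1)[OF G_semilinear]] w by blast
    qed
    \<comment> \<open>On the nonzero vector \<open>G w\<close> the nilpotent map N acts as the
      scalar \<open>c^(q^r) - c\<close>, which must therefore be zero.\<close>
    let ?d = "c [^] (q ^ r) \<ominus> c"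
    have d: "?d \<in> carrier k" using c by simp
    have NG: "(N ^^ i) (G w) = (?d [^] i) \<odot>\<^bsub>V\<^esub> G w" for i
    proof (induction i)
      case 0
      show ?case using G.V.smult_one[of "G w"] Gwc by simp
    next
      case (Suc i)
      have di: "?d [^] i \<in> carrier k" using d by simp
      have "(N ^^ Suc i) (G w) = (?d [^] i) \<odot>\<^bsub>V\<^esub> N (G w)"
        using Suc G.linear_smult[OF Nlin di, of "G w"] Gwc by simp
      also have "\<dots> = (?d [^] i) \<odot>\<^bsub>V\<^esub> (?d \<odot>\<^bsub>V\<^esub> G w)" using eig[OF Gw _ Gwc] c by simp
      also have "\<dots> = (?d [^] Suc i) \<odot>\<^bsub>V\<^esub> G w"
        using G.V.smult_assoc1[OF di d, of "G w"] Gwc by simp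
      finally show ?case .
    qed
    have "?d = \<zero>"
    proof (rule ccontr)
      assume "?d \<noteq> \<zero>"
      then have "?d \<in> Units k" using d field_Units by simp
      then have dn: "?d [^] n \<in> Units k" by (rule Units_pow_closed)
      then have "G w = (inv (?d [^] n) \<otimes> ?d [^] n) \<odot>\<^bsub>V\<^esub> G w"
        using Gwc G.V.smult_one[of "G w"] by simp
      also have "\<dots> = inv (?d [^] n) \<odot>\<^bsub>V\<^esub> ((?d [^] n) \<odot>\<^bsub>V\<^esub> G w)"
        using Gwc dn by (intro G.V.smult_assoc1) auto
      also have "(?d [^] n) \<odot>\<^bsub>V\<^esub> G w = \<zero>\<^bsub>M\<^esub>" using NG[of n] n Gwc by simp
      also have "inv (?d [^] n) \<odot>\<^bsub>V\<^esub> \<zero>\<^bsub>M\<^esub> = \<zero>\<^bsub>M\<^esub>" using G.V.smult_r_null[of "inv (?d [^] n)"] dn by simp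
      finally show False using Gw0 by simp
    qed
    then have "c [^] (q ^ r) = c" using c by simp
    then show ?thesis using c by (simp add: Kn_def)
  qed
  \<comment> \<open>N kills w, but \<open>homogeneous_bij\<close> would make N bijective if its
    restriction to \<open>M0\<close> were injective.\<close>
  moreover have "\<not> inj_on (\<lambda>x. h x \<oplus>\<^bsub>M\<^esub> (\<ominus> c) \<odot>\<^bsub>V\<^esub> x) M0"
  proof
    let ?h = "\<lambda>x. h x \<oplus>\<^bsub>M\<^esub> (\<ominus> c) \<odot>\<^bsub>V\<^esub> x"
    assume inj: "inj_on ?h M0"
    have NM: "N x = ?h x" if "x \<in> M0" for x unfolding N_def using H(2)[OF that] by simp
    have Ns: "semilinear 0 M M N" using Nh by (simp add: semilinear_0_hom)
    have "homogeneous 0 ?h"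
      unfolding homogeneous_def
    proof
      show "?h \<in> module_hom B Y Y"
      proof (rule homY_I)
        show "?h x \<in> M0" if "x \<in> M0" for x
          using homogeneousD(2)[OF h that] M0_smult[OF Kn_neg[OF cK] that] M0_add by blast
        show "?h (x \<oplus>\<^bsub>M\<^esub> y) = ?h x \<oplus>\<^bsub>M\<^esub> ?h y" if "x \<in> M0" "y \<in> M0" for x y
          using module_homD(2)[OF Nh M0_carrier[OF that(1)] M0_carrier[OF that(2)]] NM that M0_add by simp
        show "?h (a \<odot>\<^bsub>M\<^esub> x) = a \<odot>\<^bsub>M\<^esub> ?h x" if "a \<in> AF" "x \<in> M0" for a x
          using module_homD(3)[OF Nh AF_carrier[OF that(1)] M0_carrier[OF that(2)]] NM that M0_act by simp
      qed
      show "\<forall>c\<in>Kn r. \<forall>x\<in>M0. ?h (c \<odot>\<^bsub>V\<^esub> x) = (c [^] (q ^ 0)) \<odot>\<^bsub>V\<^esub> ?h x"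
      proof (intro ballI)
        fix b x assume b: "b \<in> Kn r" and x: "x \<in> M0"
        show "?h (b \<odot>\<^bsub>V\<^esub> x) = (b [^] (q ^ 0)) \<odot>\<^bsub>V\<^esub> ?h x"
          using semilinear_scalar[OF Ns Kn_carrier[OF b] M0_carrier[OF x]] NM[OF M0_smult[OF b x]] NM[OF x]
          by simp
      qed
    qed
    from homogeneous_bij[OF this _ inj Ns NM] have "bij_betw N (carrier M) (carrier M)" by simp
    then show False using Nninj by (auto simp: bij_betw_def)
  qed
  ultimately show ?thesis by blast
qed

end

section \<open>Decomposition of endomorphisms into homogeneous components\<close>

context frobenius_module
begin

text \<open>For c in \<open>Kn 1\<close> the element \<open>c 1_A\<close> belongs to
  \<open>A^F\<close>. For c in \<open>Kn r\<close> this may fail, which is why components of degree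
  other than 0 can occur.\<close>

lemma hom_Kn1_smult:
  assumes f: "f \<in> module_hom B Y Y" and c: "c \<in> Kn 1" and x: "x \<in> M0"
  shows "f (c \<odot>\<^bsub>V\<^esub> x) = c \<odot>\<^bsub>V\<^esub> f x"
proof -
  have "\<one>\<^bsub>A\<^esub> \<in> AF" unfolding A.Fix_1 using FA_one by simp
  then have "c \<odot>\<^bsub>A\<^esub> \<one>\<^bsub>A\<^esub> \<in> AF" by (rule A.Fix_smult[OF c])
  then show ?thesis unfolding base_space_smult by (rule homY_D(3)[OF f _ x])
qed

text \<open>The component of degree \<open>s\<close> of \<open>f\<close> is obtained from the values \<open>f (c x)\<close>, \<open>c\<close> in the field
  with \<open>q\<^sup>r\<close> elements, by the same character orthogonality as in the descent formula.\<close>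

lemma homogeneous_decomposition:
  assumes f: "f \<in> module_hom B Y Y"
  shows "\<exists>g. (\<forall>s. homogeneous s (g s)) \<and> (\<forall>x \<in> M0. f x = finsum M (\<lambda>s. g s x) {..<r})"
proof -
  define K where "K = Kn r - {\<zero>}"
  \<comment> \<open>The summand at c of the component of degree s. The exponent \<open>q^s\<close>
    on the coefficient is what makes the substitution of d c for c pull out the factor
    \<open>d^(q^s)\<close>.\<close>
  define t where "t s c x = ((\<ominus> (inv c)) [^] (q ^ s)) \<odot>\<^bsub>V\<^esub> f (c \<odot>\<^bsub>V\<^esub> x)" for s :: nat and c x
  define g where "g s x = finsum M (\<lambda>c. t s c x) K" for s x
  note fD = homY_D[OF f]
  have Kc: "c \<in> Kn r" "c \<in> carrier k - {\<zero>}" "\<ominus> (inv c) \<in> Kn r" "inv c \<in> carrier k - {\<zero>}" if "c \<in> K" for c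
    using that Kn_carrier Kn_inv[of c r] Kn_neg inv_carrier[of c] unfolding K_def by blast+
  have finK: "finite K" using finite_Kn[OF r_pos] by (simp add: K_def)
  have cx: "c \<odot>\<^bsub>V\<^esub> x \<in> M0" if "c \<in> K" "x \<in> M0" for c x using M0_smult[OF Kc(1)[OF that(1)] that(2)] .
  have t: "t s c x \<in> M0" if "c \<in> K" "x \<in> M0" for s c x
    unfolding t_def using M0_smult[OF Kn_pow_closed[OF Kc(3)[OF that(1)]] fD(1)[OF cx[OF that]]] .
  have tM: "t s c x \<in> carrier M" if "c \<in> K" "x \<in> M0" for s c x using M0_carrier[OF t[OF that]] .
  have g: "g s x \<in> M0" if "x \<in> M0" for s x
    unfolding g_def using t that by (intro M0_finsum) auto
  have "homogeneous s (g s)" for s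
    unfolding homogeneous_def
  proof
    show "g s \<in> module_hom B Y Y"
    proof (rule homY_I)
      show "g s (x \<oplus>\<^bsub>M\<^esub> y) = g s x \<oplus>\<^bsub>M\<^esub> g s y" if x: "x \<in> M0" and y: "y \<in> M0" for x y
      proof -
        have "t s c (x \<oplus>\<^bsub>M\<^esub> y) = t s c x \<oplus>\<^bsub>M\<^esub> t s c y" if c: "c \<in> K" for c
        proof -
          have cc: "c \<in> carrier k" "(\<ominus> (inv c)) [^] (q ^ s) \<in> carrier k" using Kc[OF c] by auto
          have "f (c \<odot>\<^bsub>V\<^esub> (x \<oplus>\<^bsub>M\<^esub> y)) = f (c \<odot>\<^bsub>V\<^esub> x) \<oplus>\<^bsub>M\<^esub> f (c \<odot>\<^bsub>V\<^esub> y)"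
            using G.V.smult_r_distr[OF cc(1), of x y] M0_carrier x y fD(2)[OF cx[OF c x] cx[OF c y]] by simp
          then show ?thesis
            unfolding t_def using G.V.smult_r_distr[OF cc(2), of "f (c \<odot>\<^bsub>V\<^esub> x)" "f (c \<odot>\<^bsub>V\<^esub> y)"]
              M0_carrier[OF fD(1)[OF cx[OF c x]]] M0_carrier[OF fD(1)[OF cx[OF c y]]] by simp
        qed
        then have "g s (x \<oplus>\<^bsub>M\<^esub> y) = finsum M (\<lambda>c. t s c x \<oplus>\<^bsub>M\<^esub> t s c y) K"
          unfolding g_def using tM x y by (intro M.M.finsum_cong') auto
        then show ?thesis unfolding g_def using tM x y by (simp add: M.M.finsum_addf)
      qed
      show "g s (a \<odot>\<^bsub>M\<^esub> x) = a \<odot>\<^bsub>M\<^esub> g s x" if a: "a \<in> AF" and x: "x \<in> M0" for a x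
      proof -
        have "t s c (a \<odot>\<^bsub>M\<^esub> x) = a \<odot>\<^bsub>M\<^esub> t s c x" if c: "c \<in> K" for c
        proof -
          have cc: "c \<in> carrier k" "(\<ominus> (inv c)) [^] (q ^ s) \<in> carrier k" using Kc[OF c] by auto
          have "f (c \<odot>\<^bsub>V\<^esub> (a \<odot>\<^bsub>M\<^esub> x)) = a \<odot>\<^bsub>M\<^esub> f (c \<odot>\<^bsub>V\<^esub> x)"
            using smult_base(2)[OF left_M cc(1) AF_carrier[OF a] M0_carrier[OF x]] fD(3)[OF a cx[OF c x]] by simp
          then show ?thesis
            unfolding t_def
            using smult_base(2)[OF left_M cc(2) AF_carrier[OF a] M0_carrier[OF fD(1)[OF cx[OF c x]]]] by simp
        qed
        then have "g s (a \<odot>\<^bsub>M\<^esub> x) = finsum M (\<lambda>c. a \<odot>\<^bsub>M\<^esub> t s c x) K"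
          unfolding g_def using tM x AF_carrier[OF a] by (intro M.M.finsum_cong') (auto simp: M.left_smult_closed)
        also have "\<dots> = a \<odot>\<^bsub>M\<^esub> g s x"
          unfolding g_def using tM x
          by (intro additive_map_finsum[OF ab_M ab_M M.smult_additive[OF AF_carrier[OF a]], symmetric]) auto
        finally show ?thesis .
      qed
    qed (rule g)
    show "\<forall>d\<in>Kn r. \<forall>x\<in>M0. g s (d \<odot>\<^bsub>V\<^esub> x) = (d [^] (q ^ s)) \<odot>\<^bsub>V\<^esub> g s x"
    proof (intro ballI)
      fix d x assume d: "d \<in> Kn r" and x: "x \<in> M0"
      have xc: "x \<in> carrier V" using M0_carrier[OF x] by simp
      have gxc: "g s y \<in> carrier V" if "y \<in> M0" for y using M0_carrier[OF g[OF that]] by simp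
      show "g s (d \<odot>\<^bsub>V\<^esub> x) = (d [^] (q ^ s)) \<odot>\<^bsub>V\<^esub> g s x"
      proof (cases "d = \<zero>")
        case True
        have "g s \<zero>\<^bsub>M\<^esub> = \<zero>\<^bsub>M\<^esub>"
          by (rule homogeneous_zero[OF \<open>g s \<in> module_hom B Y Y\<close>])
        then show ?thesis using True xc G.V.smult_l_null[OF xc] G.V.smult_l_null[OF gxc[OF x]]
          by (simp add: frob_pow_zero)
      next
        case False
        then have dK: "d \<in> Kn r - {\<zero>}" and dk: "d \<in> carrier k - {\<zero>}" using d Kn_carrier by auto
        have dq: "d [^] (q ^ s) \<in> carrier k" using dk by simp
        have "(d [^] (q ^ s)) \<odot>\<^bsub>V\<^esub> g s x = finsum M (\<lambda>c. (d [^] (q ^ s)) \<odot>\<^bsub>V\<^esub> t s c x) K"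
          unfolding g_def finsum_base_space[symmetric, of M A]
          using tM x by (intro additive_map_finsum[OF G.abelian_V G.abelian_V G.smult_additive[OF dq]]) auto
        also have "\<dots> = finsum M (\<lambda>c. (d [^] (q ^ s)) \<odot>\<^bsub>V\<^esub> t s c x) ((\<lambda>c. d \<otimes> c) ` K)"
          using Kn_nonzero_mult_image(1)[OF dK] by (simp add: K_def)
        also have "\<dots> = finsum M (\<lambda>c. (d [^] (q ^ s)) \<odot>\<^bsub>V\<^esub> t s (d \<otimes> c) x) K"
        proof (rule M.M.finsum_reindex)
          show "inj_on (\<lambda>c. d \<otimes> c) K" using Kn_nonzero_mult_image(2)[OF dK] by (simp add: K_def)
          have "(d [^] (q ^ s)) \<odot>\<^bsub>V\<^esub> t s c x \<in> carrier M" if "c \<in> K" for c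
            using V_closed[OF dq tM[OF that x]] .
          then show "(\<lambda>c. (d [^] (q ^ s)) \<odot>\<^bsub>V\<^esub> t s c x) \<in> (\<lambda>c. d \<otimes> c) ` K \<rightarrow> carrier M"
            using Kn_nonzero_mult_image(1)[OF dK] by (auto simp: K_def)
        qed
        also have "\<dots> = g s (d \<odot>\<^bsub>V\<^esub> x)"
          unfolding g_def
        proof (rule M.M.finsum_cong')
          fix c assume c: "c \<in> K"
          note c' = Kc[OF c]
          have cd: "inv (d \<otimes> c) = inv d \<otimes> inv c" using inv_mult[OF dk c'(2)] .
          have ii: "inv d \<in> carrier k - {\<zero>}" using inv_carrier[OF dk] .
          have "d \<otimes> \<ominus> (inv (d \<otimes> c)) = \<ominus> ((d \<otimes> inv d) \<otimes> inv c)"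
            unfolding cd using dk c'(4) ii by (simp add: r_minus m_assoc)
          also have "\<dots> = \<ominus> (inv c)" using r_inv_k[OF dk] c'(4) by simp
          finally have e: "d \<otimes> \<ominus> (inv (d \<otimes> c)) = \<ominus> (inv c)" .
          have m: "\<ominus> (inv (d \<otimes> c)) \<in> carrier k" unfolding cd using ii c'(4) by simp
          have fc: "f (c \<odot>\<^bsub>V\<^esub> (d \<odot>\<^bsub>V\<^esub> x)) \<in> carrier V"
            using M0_carrier[OF fD(1)[OF cx[OF c M0_smult[OF d x]]]] by simp
          have "(d \<otimes> c) \<odot>\<^bsub>V\<^esub> x = c \<odot>\<^bsub>V\<^esub> (d \<odot>\<^bsub>V\<^esub> x)"
            using dk c'(2) xc by (simp add: G.V.smult_assoc1[symmetric] m_comm del: base_space_simps)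
          then have "(d [^] (q ^ s)) \<odot>\<^bsub>V\<^esub> t s (d \<otimes> c) x =
              (d [^] (q ^ s)) \<odot>\<^bsub>V\<^esub> (((\<ominus> (inv (d \<otimes> c))) [^] (q ^ s)) \<odot>\<^bsub>V\<^esub> f (c \<odot>\<^bsub>V\<^esub> (d \<odot>\<^bsub>V\<^esub> x)))"
            by (simp add: t_def)
          also have "\<dots> = (d [^] (q ^ s) \<otimes> (\<ominus> (inv (d \<otimes> c))) [^] (q ^ s)) \<odot>\<^bsub>V\<^esub> f (c \<odot>\<^bsub>V\<^esub> (d \<odot>\<^bsub>V\<^esub> x))"
            using G.V.smult_assoc1[OF dq nat_pow_closed[OF m] fc] by simp
          also have "d [^] (q ^ s) \<otimes> (\<ominus> (inv (d \<otimes> c))) [^] (q ^ s) = (\<ominus> (inv c)) [^] (q ^ s)"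
            using nat_pow_distrib[of d "\<ominus> (inv (d \<otimes> c))" "q ^ s"] dk m e by simp
          finally show "(d [^] (q ^ s)) \<odot>\<^bsub>V\<^esub> t s (d \<otimes> c) x = t s c (d \<odot>\<^bsub>V\<^esub> x)" by (simp add: t_def)
        qed (use tM M0_smult[OF d x] in auto)
        finally show ?thesis by simp
      qed
    qed
  qed
  moreover have "f x = finsum M (\<lambda>s. g s x) {..<r}" if x: "x \<in> M0" for x
  proof -
    have xc: "x \<in> carrier V" using M0_carrier[OF x] by simp
    \<comment> \<open>The trace of -1/c from \<open>Kn r\<close> down to \<open>Kn 1\<close>; being
      in \<open>Kn 1\<close> it can be moved inside f.\<close>
    define T where "T c = (\<Oplus>s\<in>{..<r}. (\<ominus> (inv c)) [^] (q ^ s))" for c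
    have T: "T c \<in> Kn 1" if "c \<in> K" for c
      unfolding T_def using scalar_trace(2)[OF r_pos _ Kc(3)[OF that]] Kc(4)[OF that] by simp
    have Tc: "T c \<in> carrier k" if "c \<in> K" for c using Kn_carrier[OF T[OF that]] .
    \<comment> \<open>The descent formula for the scalar 1 after the substitution of -1/c for c,
      which permutes the nonzero elements of \<open>Kn r\<close>.\<close>
    have one: "(\<Oplus>c\<in>K. T c \<otimes> c) = \<one>"
    proof -
      let ?n = "\<lambda>c. \<ominus> (inv c)"
      have nn: "?n (?n c) = c" if "c \<in> K" for c
      proof -
        have "\<ominus> (inv c) \<otimes> \<ominus> c = \<one>" using Kc(2,4)[OF that] l_inv_k[OF Kc(2)[OF that]]
          by (simp add: l_minus r_minus)
        then have "inv (\<ominus> (inv c)) = \<ominus> c"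
          using comm_inv_char[of "\<ominus> (inv c)" "\<ominus> c"] Kc(2,4)[OF that] by simp
        then show ?thesis using Kc(2)[OF that] by simp
      qed
      have nK: "?n c \<in> K" if "c \<in> K" for c
        using Kc[OF that] add.inv_eq_1_iff[of "inv c"] by (auto simp: K_def)
      have img: "?n ` K = K"
      proof
        show "K \<subseteq> ?n ` K" using nn nK by (metis image_eqI subsetI)
      qed (use nK in blast)
      have inj: "inj_on ?n K" using nn by (metis inj_on_inverseI)
      have Sc: "(\<Oplus>i\<in>{..<r}. (c \<otimes> \<one>) [^] (q ^ i)) \<in> carrier k" if "c \<in> carrier k" for c
        using that by (intro finsum_closed) auto
      have "\<one> = (\<Oplus>c\<in>K. ?n c \<otimes> (\<Oplus>i\<in>{..<r}. (c \<otimes> \<one>) [^] (q ^ i)))"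
        unfolding K_def using scalar_trace(1)[OF r_pos one_closed] .
      also have "\<dots> = (\<Oplus>c\<in>?n ` K. ?n c \<otimes> (\<Oplus>i\<in>{..<r}. (c \<otimes> \<one>) [^] (q ^ i)))" by (simp only: img)
      also have "\<dots> = (\<Oplus>c\<in>K. ?n (?n c) \<otimes> (\<Oplus>i\<in>{..<r}. (?n c \<otimes> \<one>) [^] (q ^ i)))"
      proof (rule finsum_reindex[OF _ inj], unfold img)
        show "(\<lambda>c. ?n c \<otimes> (\<Oplus>i\<in>{..<r}. (c \<otimes> \<one>) [^] (q ^ i))) \<in> K \<rightarrow> carrier k"
          using Sc Kc by (intro funcsetI m_closed) auto
      qed
      also have "\<dots> = (\<Oplus>c\<in>K. T c \<otimes> c)"
      proof (rule finsum_cong')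
        fix c assume c: "c \<in> K"
        have "(\<Oplus>i\<in>{..<r}. (?n c \<otimes> \<one>) [^] (q ^ i)) = T c"
          unfolding T_def using Kc(4)[OF c] by simp
        then show "?n (?n c) \<otimes> (\<Oplus>i\<in>{..<r}. (?n c \<otimes> \<one>) [^] (q ^ i)) = T c \<otimes> c"
          using nn[OF c] Tc[OF c] Kc(2)[OF c] by (simp add: m_comm)
      qed (use Tc Kc in auto)
      finally show ?thesis by simp
    qed
    have "finsum M (\<lambda>s. g s x) {..<r} = finsum M (\<lambda>c. finsum M (\<lambda>s. t s c x) {..<r}) K"
      unfolding g_def using tM x finK by (intro M.M.finsum_swap) auto
    also have "\<dots> = finsum M (\<lambda>c. f ((T c \<otimes> c) \<odot>\<^bsub>V\<^esub> x)) K"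
    proof (rule M.M.finsum_cong')
      fix c assume c: "c \<in> K"
      note c' = Kc[OF c]
      have fc: "f (c \<odot>\<^bsub>V\<^esub> x) \<in> carrier V" using M0_carrier[OF fD(1)[OF cx[OF c x]]] by simp
      have "finsum M (\<lambda>s. t s c x) {..<r} = T c \<odot>\<^bsub>V\<^esub> f (c \<odot>\<^bsub>V\<^esub> x)"
        unfolding T_def t_def finsum_base_space[symmetric, of M A] using c'(4)
        by (intro additive_map_finsum[OF G.abelian_k G.abelian_V G.smult_additive_left[OF fc], symmetric]) auto
      also have "\<dots> = f (T c \<odot>\<^bsub>V\<^esub> (c \<odot>\<^bsub>V\<^esub> x))" by (rule hom_Kn1_smult[OF f T[OF c] cx[OF c x], symmetric])
      also have "T c \<odot>\<^bsub>V\<^esub> (c \<odot>\<^bsub>V\<^esub> x) = (T c \<otimes> c) \<odot>\<^bsub>V\<^esub> x"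
        using G.V.smult_assoc1[OF Tc[OF c] _ xc] c'(2) by simp
      finally show "finsum M (\<lambda>s. t s c x) {..<r} = f ((T c \<otimes> c) \<odot>\<^bsub>V\<^esub> x)" .
    next
      have "(T c \<otimes> c) \<odot>\<^bsub>V\<^esub> x \<in> M0" if "c \<in> K" for c
        using M0_smult[OF Kn_mult[OF Kn_dvd[OF T[OF that], of r] Kc(1)[OF that]] x] by simp
      then show "(\<lambda>c. f ((T c \<otimes> c) \<odot>\<^bsub>V\<^esub> x)) \<in> K \<rightarrow> carrier M" using M0_carrier fD(1) by blast
    qed simp
    also have "\<dots> = finsum Y (\<lambda>c. f ((T c \<otimes> c) \<odot>\<^bsub>V\<^esub> x)) K"
      using M0_smult[OF Kn_mult[OF Kn_dvd[OF T, of _ r] Kc(1)] x] fD(1) by (intro finsum_Y[symmetric]) auto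
    also have "\<dots> = f (finsum Y (\<lambda>c. (T c \<otimes> c) \<odot>\<^bsub>V\<^esub> x) K)"
      using M0_smult[OF Kn_mult[OF Kn_dvd[OF T, of _ r] Kc(1)] x]
      by (intro additive_map_finsum[OF ab_Y ab_Y additive_map_Y[OF f], symmetric]) (auto simp: carrier_Y)
    also have "finsum Y (\<lambda>c. (T c \<otimes> c) \<odot>\<^bsub>V\<^esub> x) K = finsum M (\<lambda>c. (T c \<otimes> c) \<odot>\<^bsub>V\<^esub> x) K"
      using M0_smult[OF Kn_mult[OF Kn_dvd[OF T, of _ r] Kc(1)] x] by (intro finsum_Y) auto
    also have "\<dots> = (\<Oplus>c\<in>K. T c \<otimes> c) \<odot>\<^bsub>V\<^esub> x"
      unfolding finsum_base_space[symmetric, of M A] using Tc Kc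
      by (intro additive_map_finsum[OF G.abelian_k G.abelian_V G.smult_additive_left[OF xc], symmetric]) auto
    also have "\<dots> = x" unfolding one using G.V.smult_one[OF xc] .
    finally show ?thesis by simp
  qed
  ultimately show ?thesis by blast
qed

end

lemma End_algebra_neg_apply:
  assumes "left_module A M" "f \<in> carrier (End_algebra A M)" "x \<in> carrier M"
  shows "(\<ominus>\<^bsub>End_algebra A M\<^esub> f) x = \<ominus>\<^bsub>M\<^esub> f x"
proof -
  interpret left_module A M by fact
  interpret E: ring "End_algebra A M" by (rule End_algebra_ring[OF assms(1)])
  let ?g = "\<ominus>\<^bsub>End_algebra A M\<^esub> f"
  have g: "?g \<in> carrier (End_algebra A M)" using assms(2) by simp
  have cl: "f x \<in> carrier M" "?g x \<in> carrier M"
    using assms(2,3) g module_homD(1)[of f A M M x] module_homD(1)[of ?g A M M x]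
    by (simp_all add: End_algebra_simps(1))
  have "(?g \<oplus>\<^bsub>End_algebra A M\<^esub> f) x = \<zero>\<^bsub>End_algebra A M\<^esub> x"
    using E.l_neg[OF assms(2)] by simp
  then have "?g x \<oplus>\<^bsub>M\<^esub> f x = \<zero>\<^bsub>M\<^esub>" using assms(3) by (simp add: End_algebra_simps(4,5))
  then show ?thesis using M.minus_equality[OF _ cl] by simp
qed

lemma End_algebra_Units_bij:
  assumes "left_module A M" "f \<in> Units (End_algebra A M)"
  shows "bij_betw f (carrier M) (carrier M)"
proof -
  let ?E = "End_algebra A M"
  interpret E: ring ?E by (rule End_algebra_ring[OF assms(1)])
  obtain g where g: "g \<in> carrier ?E" "f \<in> carrier ?E" "g \<otimes>\<^bsub>?E\<^esub> f = \<one>\<^bsub>?E\<^esub>" "f \<otimes>\<^bsub>?E\<^esub> g = \<one>\<^bsub>?E\<^esub>"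
    using assms(2) unfolding Units_def by blast
  have cl: "h x \<in> carrier M" if "h \<in> carrier ?E" "x \<in> carrier M" for h x
    using module_homD(1)[of h A M M x] that by (simp add: End_algebra_simps(1))
  have gf: "g (f x) = x" "f (g x) = x" if "x \<in> carrier M" for x
    using fun_cong[OF g(3), of x] fun_cong[OF g(4), of x] that
    by (simp_all add: End_algebra_simps(2,3) compose_def)
  show ?thesis
    by (rule bij_betw_byWitness[where f' = g]) (use gf cl g in auto)
qed

section \<open>The field with \<open>q^r\<close> elements inside the endomorphism ring of the fixed
  points\<close>

context frobenius_module
begin

lemma scalar_hom:
  assumes c: "c \<in> Kn r" shows "(\<lambda>x. c \<odot>\<^bsub>V\<^esub> x) \<in> module_hom B Y Y"
proof (rule homY_I)
  note ck = Kn_carrier[OF c]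
  show "c \<odot>\<^bsub>V\<^esub> (x \<oplus>\<^bsub>M\<^esub> y) = c \<odot>\<^bsub>V\<^esub> x \<oplus>\<^bsub>M\<^esub> c \<odot>\<^bsub>V\<^esub> y" if "x \<in> M0" "y \<in> M0" for x y
    using G.V.smult_r_distr[OF ck, of x y] M0_carrier that by simp
  show "c \<odot>\<^bsub>V\<^esub> (a \<odot>\<^bsub>M\<^esub> x) = a \<odot>\<^bsub>M\<^esub> (c \<odot>\<^bsub>V\<^esub> x)" if "a \<in> AF" "x \<in> M0" for a x
    using smult_base(2)[OF left_M ck AF_carrier M0_carrier] that by simp
qed (use M0_smult[OF c] in blast)

lemma homogeneous_add_scalar:
  assumes h: "homogeneous 0 h" and c: "c \<in> Kn r"
  shows "homogeneous 0 (\<lambda>x. h x \<oplus>\<^bsub>M\<^esub> c \<odot>\<^bsub>V\<^esub> x)"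
  unfolding homogeneous_def
proof
  note hD = homogeneousD[OF h] and sD = homY_D[OF scalar_hom[OF c]]
  note ck = Kn_carrier[OF c]
  have cl: "h x \<in> carrier M" "c \<odot>\<^bsub>V\<^esub> x \<in> carrier M" if "x \<in> M0" for x
    using M0_carrier hD(2)[OF that] sD(1)[OF that] by blast+
  show "(\<lambda>x. h x \<oplus>\<^bsub>M\<^esub> c \<odot>\<^bsub>V\<^esub> x) \<in> module_hom B Y Y"
  proof (rule homY_I)
    show "h (x \<oplus>\<^bsub>M\<^esub> y) \<oplus>\<^bsub>M\<^esub> c \<odot>\<^bsub>V\<^esub> (x \<oplus>\<^bsub>M\<^esub> y) = h x \<oplus>\<^bsub>M\<^esub> c \<odot>\<^bsub>V\<^esub> x \<oplus>\<^bsub>M\<^esub> (h y \<oplus>\<^bsub>M\<^esub> c \<odot>\<^bsub>V\<^esub> y)"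
      if "x \<in> M0" "y \<in> M0" for x y
      using hD(3)[OF that] sD(2)[OF that] cl[OF that(1)] cl[OF that(2)] by (simp add: M.M.a_ac)
    show "h (a \<odot>\<^bsub>M\<^esub> x) \<oplus>\<^bsub>M\<^esub> c \<odot>\<^bsub>V\<^esub> (a \<odot>\<^bsub>M\<^esub> x) = a \<odot>\<^bsub>M\<^esub> (h x \<oplus>\<^bsub>M\<^esub> c \<odot>\<^bsub>V\<^esub> x)"
      if "a \<in> AF" "x \<in> M0" for a x
      using hD(4)[OF that] sD(3)[OF that] cl[OF that(2)] M.left_smult_r_distr[OF AF_carrier[OF that(1)]] by simp
  qed (use hD(2) sD(1) M0_add in blast)
  show "\<forall>d\<in>Kn r. \<forall>x\<in>M0. h (d \<odot>\<^bsub>V\<^esub> x) \<oplus>\<^bsub>M\<^esub> c \<odot>\<^bsub>V\<^esub> (d \<odot>\<^bsub>V\<^esub> x) =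
      (d [^] (q ^ 0)) \<odot>\<^bsub>V\<^esub> (h x \<oplus>\<^bsub>M\<^esub> c \<odot>\<^bsub>V\<^esub> x)"
  proof (intro ballI)
    fix d x assume d: "d \<in> Kn r" and x: "x \<in> M0"
    note dk = Kn_carrier[OF d]
    have "c \<odot>\<^bsub>V\<^esub> (d \<odot>\<^bsub>V\<^esub> x) = d \<odot>\<^bsub>V\<^esub> (c \<odot>\<^bsub>V\<^esub> x)"
      using G.V.smult_assoc1[OF ck dk, of x] G.V.smult_assoc1[OF dk ck, of x] M0_carrier[OF x] m_comm[OF ck dk]
      by simp
    then show "h (d \<odot>\<^bsub>V\<^esub> x) \<oplus>\<^bsub>M\<^esub> c \<odot>\<^bsub>V\<^esub> (d \<odot>\<^bsub>V\<^esub> x) = (d [^] (q ^ 0)) \<odot>\<^bsub>V\<^esub> (h x \<oplus>\<^bsub>M\<^esub> c \<odot>\<^bsub>V\<^esub> x)"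
      using hD(5)[OF d x] G.V.smult_r_distr[OF dk, of "h x" "c \<odot>\<^bsub>V\<^esub> x"] cl[OF x] dk by simp
  qed
qed

abbreviation E where "E \<equiv> End_algebra B Y"

lemma E_carrier: "f \<in> carrier E \<longleftrightarrow> f \<in> module_hom B Y Y \<and> f \<in> extensional M0"
  by (simp add: End_algebra_simps(1) carrier_Y)

lemma E_ops:
  "x \<in> M0 \<Longrightarrow> (f \<otimes>\<^bsub>E\<^esub> g) x = f (g x)" "x \<in> M0 \<Longrightarrow> \<one>\<^bsub>E\<^esub> x = x"
  "x \<in> M0 \<Longrightarrow> \<zero>\<^bsub>E\<^esub> x = \<zero>\<^bsub>M\<^esub>" "x \<in> M0 \<Longrightarrow> (f \<oplus>\<^bsub>E\<^esub> g) x = f x \<oplus>\<^bsub>M\<^esub> g x"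
  by (simp_all add: End_algebra_simps(2-5) carrier_Y compose_def)

lemma ring_E: "ring E"
  by (rule End_algebra_ring[OF left_module_Y])

definition scal :: "'k \<Rightarrow> 'm \<Rightarrow> 'm" where
  "scal c = restrict (\<lambda>x. c \<odot>\<^bsub>V\<^esub> x) M0"

lemma scal_apply: "x \<in> M0 \<Longrightarrow> scal c x = c \<odot>\<^bsub>V\<^esub> x"
  by (simp add: scal_def)

lemma scal_E: "c \<in> Kn r \<Longrightarrow> scal c \<in> carrier E"
  using restrict_in_End[OF left_module_Y scalar_hom] by (simp add: scal_def carrier_Y)

lemma E_eqI: "\<lbrakk>f \<in> carrier E; g \<in> carrier E; \<And>x. x \<in> M0 \<Longrightarrow> f x = g x\<rbrakk> \<Longrightarrow> f = g"
  using End_algebra_eqI[of f B Y g] unfolding carrier_Y .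

abbreviation L where "L \<equiv> k\<lparr>carrier := Kn r\<rparr>"

lemma scal_hom: "scal \<in> ring_hom L E"
proof (rule ring_hom_memI)
  interpret E: ring E by (rule ring_E)
  fix c d assume "c \<in> carrier L" "d \<in> carrier L"
  then have c: "c \<in> Kn r" and d: "d \<in> Kn r" by simp_all
  note ck = Kn_carrier[OF c] and dk = Kn_carrier[OF d]
  have "scal (c \<otimes> d) = scal c \<otimes>\<^bsub>E\<^esub> scal d"
  proof (rule E_eqI)
    show "scal (c \<otimes> d) x = (scal c \<otimes>\<^bsub>E\<^esub> scal d) x" if "x \<in> M0" for x
      using that M0_smult[OF d that] G.V.smult_assoc1[OF ck dk, of x] M0_carrier[OF that]
      by (simp add: E_ops scal_apply)
  qed (use c d Kn_mult scal_E in auto)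
  then show "scal (c \<otimes>\<^bsub>L\<^esub> d) = scal c \<otimes>\<^bsub>E\<^esub> scal d" by simp
  have "scal (c \<oplus> d) = scal c \<oplus>\<^bsub>E\<^esub> scal d"
  proof (rule E_eqI)
    show "scal (c \<oplus> d) x = (scal c \<oplus>\<^bsub>E\<^esub> scal d) x" if "x \<in> M0" for x
      using that G.V.smult_l_distr[OF ck dk, of x] M0_carrier[OF that]
      by (simp add: E_ops scal_apply)
  qed (use c d Kn_add scal_E in auto)
  then show "scal (c \<oplus>\<^bsub>L\<^esub> d) = scal c \<oplus>\<^bsub>E\<^esub> scal d" by simp
next
  interpret E: ring E by (rule ring_E)
  have "scal \<one> = \<one>\<^bsub>E\<^esub>"
  proof (rule E_eqI)
    show "scal \<one> x = \<one>\<^bsub>E\<^esub> x" if "x \<in> M0" for x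
      using that G.V.smult_one[of x] M0_carrier[OF that] by (simp add: E_ops scal_apply)
  qed (use Kn_one scal_E in auto)
  then show "scal \<one>\<^bsub>L\<^esub> = \<one>\<^bsub>E\<^esub>" by simp
qed (use scal_E in auto)

end

section \<open>The endomorphism ring of the fixed points is local\<close>

context aperiodic_module
begin

lemma words_of_noninjective_vanish:
  "\<exists>n. \<forall>w. (\<forall>f \<in> set w. \<exists>s. homogeneous s f \<and> \<not> inj_on f M0) \<longrightarrow> length w = n \<longrightarrow>
     (\<forall>x \<in> M0. foldr id w x = \<zero>\<^bsub>M\<^esub>)"
proof (rule nil_semigroup_nilpotent[OF finite_M0 M0_zero])
  fix f g assume "\<exists>s. homogeneous s f \<and> \<not> inj_on f M0" "\<exists>s. homogeneous s g \<and> \<not> inj_on g M0"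
  then obtain s t where f: "homogeneous s f" and g: "homogeneous t g" "\<not> inj_on g M0" by blast
  have "\<not> inj_on (\<lambda>x. f (g x)) M0" using g(2) inj_on_imageI2[of f g M0] by (auto simp: comp_def)
  then show "\<exists>s. homogeneous s (\<lambda>x. f (g x)) \<and> \<not> inj_on (\<lambda>x. f (g x)) M0"
    using homogeneous_compose[OF f g(1)] by blast
next
  fix f assume "\<exists>s. homogeneous s f \<and> \<not> inj_on f M0"
  then show "\<exists>m. \<forall>x\<in>M0. (f ^^ m) x = \<zero>\<^bsub>M\<^esub>" using homogeneous_nilpotent by blast
qed (use homogeneousD(1,2) homogeneous_zero in blast)+

text \<open>The elements whose degree 0 component is not injective will form the radical.\<close>

definition rad_elem where
  "rad_elem f \<longleftrightarrow> f \<in> carrier E \<and> (\<exists>g. (\<forall>s. homogeneous s (g s)) \<and>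
     (\<forall>x \<in> M0. f x = finsum M (\<lambda>s. g s x) {..<r}) \<and> \<not> inj_on (g 0) M0)"

text \<open>If (1 - y p) x = 0, then x = y (p x) is the sum of the terms \<open>h_t (g_s x)\<close>
  over the components of y and p. Every \<open>g_s\<close> is noninjective, for s = 0 by assumption
  and otherwise by aperiodicity, so \<open>finsum_words_vanish\<close> gives x = 0. Injectivity
  suffices for a unit because \<open>M0\<close> is finite.\<close>

lemma rad_elem_quasi_regular:
  assumes p: "rad_elem p" and y: "y \<in> carrier E"
  shows "\<one>\<^bsub>E\<^esub> \<ominus>\<^bsub>E\<^esub> y \<otimes>\<^bsub>E\<^esub> p \<in> Units E"
proof -
  interpret E: ring E by (rule ring_E)
  have pE: "p \<in> carrier E" using p by (simp add: rad_elem_def)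
  obtain g where g': "\<forall>s. homogeneous s (g s)" "\<forall>x \<in> M0. p x = finsum M (\<lambda>s. g s x) {..<r}"
    and g0: "\<not> inj_on (g 0) M0"
    using p unfolding rad_elem_def by (elim conjE exE)
  note g = g'(1)[rule_format] g'(2)[rule_format]
  have "y \<in> module_hom B Y Y" using y E_carrier by blast
  from homogeneous_decomposition[OF this]
  obtain h where h: "\<And>s. homogeneous s (h s)" "\<And>x. x \<in> M0 \<Longrightarrow> y x = finsum M (\<lambda>s. h s x) {..<r}"
    by blast
  have gY: "g s x \<in> M0" and hY: "h s x \<in> M0" if "x \<in> M0" for s x
    using homogeneousD(2)[OF g(1) that] homogeneousD(2)[OF h(1) that] by blast+
  have gn: "\<not> inj_on (g s) M0" if "s < r" for s
    using g0 homogeneous_not_inj[OF g(1)] that by (cases "s = 0") auto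
  define f where "f z = (\<lambda>x. h (fst z) (g (snd z) x))" for z
  have fh: "homogeneous (fst z + snd z) (f z)" for z
    unfolding f_def by (rule homogeneous_compose[OF h(1) g(1)])
  have fn: "\<exists>s. homogeneous s (f z) \<and> \<not> inj_on (f z) M0" if "z \<in> {..<r} \<times> {..<r}" for z
  proof -
    have "\<not> inj_on (g (snd z)) M0" using gn that by auto
    then have "\<not> inj_on (f z) M0"
      using inj_on_imageI2[of "h (fst z)" "g (snd z)" M0] by (auto simp: f_def comp_def)
    then show ?thesis using fh by blast
  qed
  obtain n where "\<forall>w. (\<forall>f \<in> set w. \<exists>s. homogeneous s f \<and> \<not> inj_on f M0) \<longrightarrow> length w = n \<longrightarrow>
      (\<forall>x \<in> M0. foldr id w x = \<zero>\<^bsub>M\<^esub>)"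
    using words_of_noninjective_vanish by (elim exE)
  then have n: "foldr id w x = \<zero>\<^bsub>M\<^esub>"
    if "\<forall>f \<in> set w. \<exists>s. homogeneous s f \<and> \<not> inj_on f M0" "length w = n" "x \<in> M0" for w x
    using that by simp
  let ?u = "\<one>\<^bsub>E\<^esub> \<ominus>\<^bsub>E\<^esub> y \<otimes>\<^bsub>E\<^esub> p"
  have ypE: "y \<otimes>\<^bsub>E\<^esub> p \<in> carrier E" using y pE by simp
  have uE: "?u \<in> carrier E" using ypE by simp
  have pY: "p x \<in> M0" if "x \<in> M0" for x using homY_D(1)[of p] that pE E_carrier by blast
  have yY: "y x \<in> M0" if "x \<in> M0" for x using homY_D(1)[of y] that y E_carrier by blast
  have u: "?u x = x \<ominus>\<^bsub>M\<^esub> y (p x)" if x: "x \<in> M0" for x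
  proof -
    have "(\<ominus>\<^bsub>E\<^esub> (y \<otimes>\<^bsub>E\<^esub> p)) x = \<ominus>\<^bsub>Y\<^esub> (y \<otimes>\<^bsub>E\<^esub> p) x"
      using End_algebra_neg_apply[OF left_module_Y ypE, of x] x by (simp add: carrier_Y)
    moreover have "\<ominus>\<^bsub>Y\<^esub> z = \<ominus>\<^bsub>M\<^esub> z" if "z \<in> M0" for z
    proof -
      interpret Y: abelian_group Y by (rule ab_Y)
      have "\<ominus>\<^bsub>Y\<^esub> z \<in> M0" "\<ominus>\<^bsub>Y\<^esub> z \<oplus>\<^bsub>M\<^esub> z = \<zero>\<^bsub>M\<^esub>"
        using Y.a_inv_closed[of z] Y.l_neg[of z] that by (simp_all add: carrier_Y)
      then show ?thesis using M.M.minus_equality[of "\<ominus>\<^bsub>Y\<^esub> z" z] M0_carrier that by simp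
    qed
    ultimately have "(\<ominus>\<^bsub>E\<^esub> (y \<otimes>\<^bsub>E\<^esub> p)) x = \<ominus>\<^bsub>M\<^esub> y (p x)"
      using yY[OF pY[OF x]] by (simp add: E_ops x)
    then show ?thesis unfolding a_minus_def by (simp add: E_ops x)
  qed
  have "x = \<zero>\<^bsub>M\<^esub>" if x: "x \<in> M0" and ux: "?u x = \<zero>\<^bsub>M\<^esub>" for x
  proof -
    have yp: "y (p x) \<in> M0" using yY pY x by blast
    have "x = x \<ominus>\<^bsub>M\<^esub> y (p x) \<oplus>\<^bsub>M\<^esub> y (p x)"
      using M0_carrier[OF x] M0_carrier[OF yp] by (simp add: a_minus_def M.M.a_assoc M.M.l_neg)
    also have "\<dots> = y (p x)" using ux u[OF x] M0_carrier[OF yp] by simp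
    also have "\<dots> = finsum M (\<lambda>t. h t (p x)) {..<r}" by (rule h(2)[OF pY[OF x]])
    also have "\<dots> = finsum M (\<lambda>t. finsum M (\<lambda>s. h t (g s x)) {..<r}) {..<r}"
    proof (rule M.M.finsum_cong')
      fix t assume "t \<in> {..<r}"
      have "p x = finsum Y (\<lambda>s. g s x) {..<r}" using g(2)[OF x] gY[OF x] by (subst finsum_Y) auto
      then have "h t (p x) = h t (finsum Y (\<lambda>s. g s x) {..<r})" by simp
      also have "\<dots> = finsum Y (\<lambda>s. h t (g s x)) {..<r}"
        using gY[OF x]
        by (intro additive_map_finsum[OF ab_Y ab_Y additive_map_Y[OF homogeneousD(1)[OF h(1)]]]) (auto simp: carrier_Y)
      also have "\<dots> = finsum M (\<lambda>s. h t (g s x)) {..<r}"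
        using hY[OF gY[OF x]] by (intro finsum_Y) auto
      finally show "h t (p x) = finsum M (\<lambda>s. h t (g s x)) {..<r}" .
    next
      have "h t (g s x) \<in> carrier M" for t s using M0_carrier[OF hY[OF gY[OF x]]] .
      then show "(\<lambda>t. finsum M (\<lambda>s. h t (g s x)) {..<r}) \<in> {..<r} \<rightarrow> carrier M"
        by (intro funcsetI M.M.finsum_closed) auto
    qed simp
    also have "\<dots> = finsum M (\<lambda>z. f z x) ({..<r} \<times> {..<r})"
      unfolding f_def using M0_carrier[OF hY[OF gY[OF x]]]
      by (intro M.M.finsum_Times[symmetric, where f = "\<lambda>t s. h t (g s x)"]) auto
    also have "\<dots> = finsum Y (\<lambda>z. f z x) ({..<r} \<times> {..<r})"
      using homogeneousD(2)[OF fh x] by (intro finsum_Y[symmetric]) auto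
    finally have xs: "x = finsum Y (\<lambda>z. f z x) ({..<r} \<times> {..<r})" .
    have "x = \<zero>\<^bsub>Y\<^esub>"
    proof (rule finsum_words_vanish[where f = f and I = "{..<r} \<times> {..<r}" and n = n, OF ab_Y])
      show "x = finsum Y (\<lambda>z. f z x) ({..<r} \<times> {..<r})" by (rule xs)
      show "additive_map Y Y (f z)" for z by (rule additive_map_Y[OF homogeneousD(1)[OF fh]])
      show "x \<in> carrier Y" using x by (simp add: carrier_Y)
      show "foldr f w x = \<zero>\<^bsub>Y\<^esub>" if "set w \<subseteq> {..<r} \<times> {..<r}" "length w = n" for w
      proof -
        have "foldr id (map f w) x = \<zero>\<^bsub>M\<^esub>"
          using that fn x by (intro n) auto
        moreover have "foldr id (map f w) = foldr f w" by (induction w) simp_all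
        ultimately show ?thesis by simp
      qed
    qed simp
    then show ?thesis by simp
  qed
  then have "\<forall>x \<in> carrier Y. ?u x = \<zero>\<^bsub>Y\<^esub> \<longrightarrow> x = \<zero>\<^bsub>Y\<^esub>" by (simp add: carrier_Y)
  moreover have uY: "?u \<in> module_hom B Y Y" using uE E_carrier by blast
  ultimately have "inj_on ?u (carrier Y)"
    using additive_map_inj_on_iff[OF ab_Y ab_Y additive_map_Y[OF uY]] by blast
  moreover have "?u ` carrier Y \<subseteq> carrier Y" using module_homD(1)[OF uY] by blast
  ultimately have "bij_betw ?u (carrier Y) (carrier Y)"
    using endo_inj_surj[of "carrier Y" ?u] finite_M0 by (simp add: bij_betw_def carrier_Y)
  then show ?thesis by (rule End_algebra_Units[OF left_module_Y uE])
qed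

text \<open>Scalars are homogeneous of degree 0, so subtracting an eigenvalue c of the degree 0
  component changes that component alone and makes it noninjective.\<close>

lemma scal_decomposition:
  assumes f: "f \<in> carrier E" shows "\<exists>c \<in> Kn r. rad_elem (f \<ominus>\<^bsub>E\<^esub> scal c)"
proof -
  interpret E: ring E by (rule ring_E)
  interpret L: field L by (rule Kn_field)
  interpret scal: ring_hom_ring L E scal
    by (rule ring_hom_ringI2[OF L.ring_axioms ring_E scal_hom])
  have "f \<in> module_hom B Y Y" using f E_carrier by blast
  from homogeneous_decomposition[OF this]
  obtain g where g: "\<And>s. homogeneous s (g s)" "\<And>x. x \<in> M0 \<Longrightarrow> f x = finsum M (\<lambda>s. g s x) {..<r}"
    by blast
  obtain c where c: "c \<in> Kn r" and ninj: "\<not> inj_on (\<lambda>x. g 0 x \<oplus>\<^bsub>M\<^esub> (\<ominus> c) \<odot>\<^bsub>V\<^esub> x) M0"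
    using homogeneous_eigenvalue[OF g(1)[of 0]] by blast
  note mc = Kn_neg[OF c]
  define g' where "g' s = (if s = 0 then (\<lambda>x. g 0 x \<oplus>\<^bsub>M\<^esub> (\<ominus> c) \<odot>\<^bsub>V\<^esub> x) else g s)" for s
  have "homogeneous s (g' s)" for s
    using homogeneous_add_scalar[OF g(1)[of 0] mc] g(1) by (simp add: g'_def)
  moreover have "(f \<ominus>\<^bsub>E\<^esub> scal c) x = finsum M (\<lambda>s. g' s x) {..<r}" if x: "x \<in> M0" for x
  proof -
    have gM: "g s x \<in> carrier M" for s using M0_carrier[OF homogeneousD(2)[OF g(1) x]] .
    have cM: "(\<ominus> c) \<odot>\<^bsub>V\<^esub> x \<in> carrier M" using M0_carrier[OF M0_smult[OF mc x]] .
    have neg: "\<ominus>\<^bsub>L\<^esub> c = \<ominus> c"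
    proof (rule L.minus_equality)
      show "\<ominus> c \<oplus>\<^bsub>L\<^esub> c = \<zero>\<^bsub>L\<^esub>" using Kn_carrier[OF c] by (simp add: l_neg)
    qed (use c mc in auto)
    have "scal (\<ominus> c) = \<ominus>\<^bsub>E\<^esub> scal c" using scal.hom_a_inv[of c] c neg by simp
    then have "(f \<ominus>\<^bsub>E\<^esub> scal c) x = f x \<oplus>\<^bsub>M\<^esub> (\<ominus> c) \<odot>\<^bsub>V\<^esub> x"
      unfolding a_minus_def using x by (simp add: E_ops scal_apply flip: \<open>scal (\<ominus> c) = _\<close>)
    also have "\<dots> = finsum M (\<lambda>s. g s x) {..<r} \<oplus>\<^bsub>M\<^esub>
        finsum M (\<lambda>s. if 0 = s then (\<ominus> c) \<odot>\<^bsub>V\<^esub> x else \<zero>\<^bsub>M\<^esub>) {..<r}"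
      using M.M.finsum_singleton[of 0 "{..<r}" "\<lambda>_. (\<ominus> c) \<odot>\<^bsub>V\<^esub> x"] r_pos cM g(2)[OF x] by simp
    also have "\<dots> = finsum M (\<lambda>s. g s x \<oplus>\<^bsub>M\<^esub> (if 0 = s then (\<ominus> c) \<odot>\<^bsub>V\<^esub> x else \<zero>\<^bsub>M\<^esub>)) {..<r}"
      using gM cM by (intro M.M.finsum_addf[symmetric]) auto
    also have "\<dots> = finsum M (\<lambda>s. g' s x) {..<r}"
      using gM cM by (intro M.M.finsum_cong') (auto simp: g'_def)
    finally show ?thesis .
  qed
  moreover have "\<not> inj_on (g' 0) M0" using ninj by (simp add: g'_def)
  moreover have "f \<ominus>\<^bsub>E\<^esub> scal c \<in> carrier E" using f scal_E[OF c] by simp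
  ultimately show ?thesis using c unfolding rad_elem_def by blast
qed

theorem residue_hom:
  "\<exists>h \<in> ring_hom E L. (\<forall>c \<in> Kn r. h (scal c) = c) \<and> (\<forall>f \<in> carrier E. h f \<noteq> \<zero> \<longrightarrow> f \<in> Units E)"
proof -
  interpret E: ring E by (rule ring_E)
  have ne: "\<one>\<^bsub>E\<^esub> \<noteq> \<zero>\<^bsub>E\<^esub>"
  proof
    assume eq: "\<one>\<^bsub>E\<^esub> = \<zero>\<^bsub>E\<^esub>"
    have "x = \<zero>\<^bsub>M\<^esub>" if "x \<in> M0" for x using fun_cong[OF eq, of x] E_ops(2,3)[OF that] by simp
    then show False using M0_nonzero M0_zero by blast
  qed
  have sub: "Collect rad_elem \<subseteq> carrier E" by (auto simp: rad_elem_def)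
  have dec: "\<exists>c \<in> carrier L. f \<ominus>\<^bsub>E\<^esub> scal c \<in> Collect rad_elem" if "f \<in> carrier E" for f
    using scal_decomposition[OF that] by simp
  have quasi: "\<one>\<^bsub>E\<^esub> \<ominus>\<^bsub>E\<^esub> y \<otimes>\<^bsub>E\<^esub> p \<in> Units E" if "p \<in> Collect rad_elem" "y \<in> carrier E" for p y
    using rad_elem_quasi_regular that by simp
  have "\<exists>h \<in> ring_hom E L. (\<forall>c \<in> carrier L. h (scal c) = c) \<and>
      (\<forall>f \<in> carrier E. h f \<noteq> \<zero>\<^bsub>L\<^esub> \<longrightarrow> f \<in> Units E)"
    by (rule local_ring_residue_hom[OF ring_E Kn_field scal_hom sub ne dec quasi])
  then show ?thesis by simp
qed

end

section \<open>From the hypotheses to the abstract setting\<close>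

lemma frobenius_mapD:
  assumes "frobenius_map k K V F"
  shows "module k V" "bij_betw F (carrier V) (carrier V)" "additive_map V V F"
    "\<And>c v. \<lbrakk>c \<in> carrier k; v \<in> carrier V\<rbrakk> \<Longrightarrow> F (c \<odot>\<^bsub>V\<^esub> v) = (c [^]\<^bsub>k\<^esub> card K) \<odot>\<^bsub>V\<^esub> F v"
    "\<And>v. v \<in> carrier V \<Longrightarrow> \<exists>n>0. (F ^^ n) v = v"
proof -
  note F = assms[unfolded frobenius_map_def]
  from F show b: "bij_betw F (carrier V) (carrier V)" by (elim conjE)
  from F show "module k V" by (elim conjE)
  have "\<forall>v \<in> carrier V. \<forall>w \<in> carrier V. F (v \<oplus>\<^bsub>V\<^esub> w) = F v \<oplus>\<^bsub>V\<^esub> F w" using F by (elim conjE)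
  then show "additive_map V V F" using bij_betwE[OF b] by (simp add: additive_map_def)
  have "\<forall>c \<in> carrier k. \<forall>v \<in> carrier V. F (c \<odot>\<^bsub>V\<^esub> v) = (c [^]\<^bsub>k\<^esub> card K) \<odot>\<^bsub>V\<^esub> F v"
    using F by (elim conjE)
  then show "\<And>c v. \<lbrakk>c \<in> carrier k; v \<in> carrier V\<rbrakk> \<Longrightarrow> F (c \<odot>\<^bsub>V\<^esub> v) = (c [^]\<^bsub>k\<^esub> card K) \<odot>\<^bsub>V\<^esub> F v"
    by simp
  have "\<forall>v \<in> carrier V. \<exists>n>0. (F ^^ n) v = v" using F by (elim conjE)
  then show "\<And>v. v \<in> carrier V \<Longrightarrow> \<exists>n>0. (F ^^ n) v = v" by simp
qed

lemma frobenius_map_space: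
  assumes "frobenius_field k (card K)" "frobenius_map k K V F"
  shows "frobenius_space k (card K) V F"
  using frobenius_mapD[OF assms(2)]
  by (intro frobenius_space.intro assms(1) frobenius_space_axioms.intro)

text \<open>The arithmetic of \<open>k\<close> is read off from \<open>FA\<close> along the map from
  c to \<open>c 1_A\<close>, which is injective as \<open>1_A\<close> is not zero: additivity of the
  q-power comes from additivity of \<open>FA\<close>, and periodicity of scalars from periodicity of
  \<open>FA\<close>.\<close>

lemma frobenius_algebra_of_morphism:
  assumes q: "primepow q" and card: "card Fq = q" and alg: "algebraic_closure k Fq"
    and A: "assoc_algebra k A" and FA: "frobenius_morphism k Fq A FA" and nz: "\<one>\<^bsub>A\<^esub> \<noteq> \<zero>\<^bsub>A\<^esub>"
  shows "frobenius_algebra k q A FA" "algebraically_closed k" "frobenius_field.Kn k q 1 = Fq"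
proof -
  interpret alg: algebraic_closure k Fq by fact
  interpret A: assoc_algebra k A by fact
  show ac: "algebraically_closed k" by unfold_locales
  have FAm: "frobenius_map k Fq A FA" and FAi: "FA \<in> ring_iso A A"
    using FA by (simp_all add: frobenius_morphism_def)
  note F = frobenius_mapD[OF FAm, unfolded card]
  have FA1: "FA \<one>\<^bsub>A\<^esub> = \<one>\<^bsub>A\<^esub>" and FAh: "FA \<in> ring_hom A A"
    using FAi by (simp_all add: ring_iso_def ring_hom_def)
  have q1: "1 < q" using primepow_gt_Suc_0[OF q] by (simp add: One_nat_def)
  define \<iota> where "\<iota> c = c \<odot>\<^bsub>A\<^esub> \<one>\<^bsub>A\<^esub>" for c
  have iA: "\<iota> c \<in> carrier A" if "c \<in> carrier k" for c
    unfolding \<iota>_def using A.smult_closed[OF that] by simp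
  have i0: "c = \<zero>\<^bsub>k\<^esub>" if c: "c \<in> carrier k" "\<iota> c = \<zero>\<^bsub>A\<^esub>" for c
  proof (rule ccontr)
    assume "c \<noteq> \<zero>\<^bsub>k\<^esub>"
    then have u: "c \<in> Units k" using c(1) alg.field_Units by simp
    have "\<one>\<^bsub>A\<^esub> = (inv\<^bsub>k\<^esub> c \<otimes>\<^bsub>k\<^esub> c) \<odot>\<^bsub>A\<^esub> \<one>\<^bsub>A\<^esub>" using u by simp
    also have "\<dots> = inv\<^bsub>k\<^esub> c \<odot>\<^bsub>A\<^esub> \<iota> c"
      unfolding \<iota>_def using u c(1) by (intro A.smult_assoc1) auto
    also have "\<dots> = \<zero>\<^bsub>A\<^esub>" unfolding c(2) using A.smult_r_null u by simp
    finally show False using nz by simp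
  qed
  have i_inj: "c = d" if "c \<in> carrier k" "d \<in> carrier k" "\<iota> c = \<iota> d" for c d
  proof -
    have "additive_map k A \<iota>" unfolding \<iota>_def by (rule additive_mapI) (auto simp: A.smult_l_distr)
    from additive_map_eq_zero_inj[OF alg.abelian_group_axioms A.M.abelian_group_axioms this]
    have "inj_on \<iota> (carrier k)" using i0 by simp
    from inj_onD[OF this that(3,1,2)] show ?thesis .
  qed
  have iadd: "\<iota> (c \<oplus>\<^bsub>k\<^esub> d) = \<iota> c \<oplus>\<^bsub>A\<^esub> \<iota> d" if "c \<in> carrier k" "d \<in> carrier k" for c d
    unfolding \<iota>_def using that by (intro A.smult_l_distr) auto
  have Fi: "FA (\<iota> c) = \<iota> (c [^]\<^bsub>k\<^esub> q)" if "c \<in> carrier k" for c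
    unfolding \<iota>_def using F(4)[OF that, of "\<one>\<^bsub>A\<^esub>"] FA1 by simp
  have frob: "(x \<oplus>\<^bsub>k\<^esub> y) [^]\<^bsub>k\<^esub> q = x [^]\<^bsub>k\<^esub> q \<oplus>\<^bsub>k\<^esub> y [^]\<^bsub>k\<^esub> q"
    if x: "x \<in> carrier k" and y: "y \<in> carrier k" for x y
  proof (rule i_inj)
    have "\<iota> ((x \<oplus>\<^bsub>k\<^esub> y) [^]\<^bsub>k\<^esub> q) = FA (\<iota> x \<oplus>\<^bsub>A\<^esub> \<iota> y)" using Fi[of "x \<oplus>\<^bsub>k\<^esub> y"] iadd x y by simp
    also have "\<dots> = \<iota> (x [^]\<^bsub>k\<^esub> q) \<oplus>\<^bsub>A\<^esub> \<iota> (y [^]\<^bsub>k\<^esub> q)"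
      using additive_map_add[OF F(3) iA[OF x] iA[OF y]] Fi x y by simp
    finally show "\<iota> ((x \<oplus>\<^bsub>k\<^esub> y) [^]\<^bsub>k\<^esub> q) = \<iota> (x [^]\<^bsub>k\<^esub> q \<oplus>\<^bsub>k\<^esub> y [^]\<^bsub>k\<^esub> q)"
      using iadd x y by simp
  qed (use x y in auto)
  have frobn: "(x \<oplus>\<^bsub>k\<^esub> y) [^]\<^bsub>k\<^esub> (q ^ n) = x [^]\<^bsub>k\<^esub> (q ^ n) \<oplus>\<^bsub>k\<^esub> y [^]\<^bsub>k\<^esub> (q ^ n)"
    if x: "x \<in> carrier k" and y: "y \<in> carrier k" for x y n
  proof (induction n)
    case (Suc n)
    have p: "z [^]\<^bsub>k\<^esub> (q ^ Suc n) = (z [^]\<^bsub>k\<^esub> (q ^ n)) [^]\<^bsub>k\<^esub> q" if "z \<in> carrier k" for z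
      using that by (simp add: alg.nat_pow_pow mult.commute)
    show ?case using Suc frob x y by (simp only: p alg.a_closed alg.nat_pow_closed)
  qed (use x y in simp)
  have per: "\<exists>n>0. x [^]\<^bsub>k\<^esub> (q ^ n) = x" if x: "x \<in> carrier k" for x
  proof -
    obtain n where n: "n > 0" "(FA ^^ n) (\<iota> x) = \<iota> x" using F(5)[OF iA[OF x]] by blast
    have "(FA ^^ n) (\<iota> x) = \<iota> (x [^]\<^bsub>k\<^esub> (q ^ n))" for n
    proof (induction n)
      case (Suc n)
      have "(x [^]\<^bsub>k\<^esub> (q ^ n)) [^]\<^bsub>k\<^esub> q = x [^]\<^bsub>k\<^esub> (q ^ Suc n)"
        using x by (simp add: alg.nat_pow_pow mult.commute)
      then show ?case using Suc Fi[of "x [^]\<^bsub>k\<^esub> (q ^ n)"] x by simp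
    qed (use x in simp)
    then have "x [^]\<^bsub>k\<^esub> (q ^ n) = x" using n(2) i_inj x by simp
    then show ?thesis using n(1) by blast
  qed
  have ff: "frobenius_field k q"
  proof (intro frobenius_field.intro frobenius_field_axioms.intro)
    show "field k" by (rule alg.field_axioms)
    show "card {x \<in> carrier k. x [^]\<^bsub>k\<^esub> (q ^ n) = x} = q ^ n" if "n > 0" for n
      using alg.card_pow_fixed[OF ac, of "q ^ n"] frobn one_less_power[OF q1 that] by blast
  qed (use q1 frob per in auto)
  interpret frobenius_field k q by (rule ff)
  have sp: "frobenius_space k q A FA" using frobenius_map_space[of k Fq A FA] ff FAm card by simp
  show "frobenius_algebra k q A FA"
    using ff sp A FA1 FAh
    by (intro frobenius_algebra.intro frobenius_algebra_axioms.intro) (auto simp: ring_hom_def)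
  have sub: "Fq \<subseteq> carrier k" by (rule alg.subset)
  \<comment> \<open>The order of the unit group of \<open>Fq\<close> gives this inclusion, and
    counting turns it into an equality.\<close>
  have "Fq \<subseteq> Kn 1"
  proof
    fix x assume x: "x \<in> Fq"
    let ?L = "k\<lparr>carrier := Fq\<rparr>"
    interpret L: field ?L by (rule alg.subfield_iff(2)[OF alg.subfield_axioms])
    have finFq: "finite Fq" using card q1 by (intro card_ge_0_finite) simp
    have U: "Units ?L = Fq - {\<zero>\<^bsub>k\<^esub>}" using L.field_Units by simp
    have "card (Units ?L) = q - 1"
      unfolding U using card L.zero_closed finFq by (simp add: card_Diff_singleton)
    moreover have "x [^]\<^bsub>?L\<^esub> card (Units ?L) = \<one>\<^bsub>?L\<^esub>" if "x \<noteq> \<zero>\<^bsub>k\<^esub>"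
      using that x U finFq by (intro L.units_power_order_eq_one) auto
    ultimately have "x [^]\<^bsub>k\<^esub> (q - 1) = \<one>\<^bsub>k\<^esub>" if "x \<noteq> \<zero>\<^bsub>k\<^esub>"
      using that by (simp flip: alg.nat_pow_consistent)
    moreover have "x [^]\<^bsub>k\<^esub> q = x [^]\<^bsub>k\<^esub> (q - 1) \<otimes>\<^bsub>k\<^esub> x"
      using q1 alg.nat_pow_Suc[of x "q - 1"] by simp
    ultimately have "x [^]\<^bsub>k\<^esub> q = x" using x sub by (cases "x = \<zero>\<^bsub>k\<^esub>") auto
    then show "x \<in> Kn 1" using x sub by (auto simp: Kn_def)
  qed
  moreover have "card (Kn 1) = card Fq" using card_Kn[of 1] card by simp
  ultimately show "Kn 1 = Fq" using card_subset_eq[of "Kn 1" Fq] finite_Kn[of 1] by simp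
qed

lemma inv_into_funpow:
  assumes "bij_betw F Y Y" "x \<in> Y"
  shows "(inv_into Y F ^^ n) ((F ^^ n) x) = x" "(F ^^ n) ((inv_into Y F ^^ n) x) = x"
    "(inv_into Y F ^^ n) x \<in> Y"
proof -
  have F: "F y \<in> Y" "inv_into Y F (F y) = y" if "y \<in> Y" for y
    using assms(1) that by (auto simp: bij_betw_def)
  have G: "inv_into Y F y \<in> Y" "F (inv_into Y F y) = y" if "y \<in> Y" for y
    using assms(1) that inv_into_into[of y F Y] f_inv_into_f[of y F Y] by (auto simp: bij_betw_def)
  have Fn: "(F ^^ n) y \<in> Y" if "y \<in> Y" for n y by (induction n) (use F that in auto)
  have Gn: "(inv_into Y F ^^ n) y \<in> Y" if "y \<in> Y" for n y by (induction n) (use G that in auto)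
  show "(inv_into Y F ^^ n) x \<in> Y" using Gn assms(2) .
  show "(inv_into Y F ^^ n) ((F ^^ n) x) = x"
  proof (induction n)
    case (Suc n)
    then show ?case using F(2)[OF Fn[OF assms(2)]] by (simp add: funpow_swap1)
  qed simp
  show "(F ^^ n) ((inv_into Y F ^^ n) x) = x"
  proof (induction n)
    case (Suc n)
    then show ?case using G(2)[OF Gn[OF assms(2)]] by (simp add: funpow_swap1)
  qed simp
qed

lemma iterated_twist_simps [simp]:
  "carrier (iterated_twist A FA FM s M) = carrier M"
  "ring.zero (iterated_twist A FA FM s M) = ring.zero M"
  "ring.add (iterated_twist A FA FM s M) = ring.add M"
  by (induction s) (simp_all add: iterated_twist_def frobenius_twist_def)

lemma iterated_twist_smult:
  "a \<odot>\<^bsub>iterated_twist A FA FM s M\<^esub> x =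
     (FM ^^ s) (((inv_into (carrier A) FA ^^ s) a) \<odot>\<^bsub>M\<^esub> ((inv_into (carrier M) FM ^^ s) x))"
proof (induction s arbitrary: a x)
  case 0
  show ?case by (simp add: iterated_twist_def)
next
  case (Suc s)
  have "iterated_twist A FA FM (Suc s) M = frobenius_twist A FA FM (iterated_twist A FA FM s M)"
    by (simp add: iterated_twist_def)
  then show ?case
    by (simp add: frobenius_twist_def Suc.IH funpow_swap1)
qed

section \<open>Twists and bijective semilinear maps\<close>

context frobenius_algebra
begin

lemma FA_bij: "bij_betw FA (carrier A) (carrier A)"
  by (rule A.F_bij)

text \<open>Reading the twisted action on images under \<open>FA^s\<close> and \<open>FM^s\<close>
  removes the inverse maps from later computations.\<close>

lemma twist_smult_image:
  assumes "bij_betw FM (carrier M) (carrier M)" "a \<in> carrier A" "x \<in> carrier M"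
  shows "((FA ^^ s) a) \<odot>\<^bsub>iterated_twist A FA FM s M\<^esub> ((FM ^^ s) x) = (FM ^^ s) (a \<odot>\<^bsub>M\<^esub> x)"
  by (simp add: iterated_twist_smult inv_into_funpow(1)[OF FA_bij assms(2)] inv_into_funpow(1)[OF assms(1,3)])

text \<open>\<open>FM^s\<close> carries the action on M to the twisted one up to
  \<open>FA^s\<close>, so composing with it turns isomorphisms from the twist into semilinear
  bijections, and composing with its inverse leads back.\<close>

lemma twist_isomorphic_iff:
  assumes M: "left_module A M" and FM: "bij_betw FM (carrier M) (carrier M)" "additive_map M M FM"
  shows "module_isomorphic A (iterated_twist A FA FM s M) M \<longleftrightarrow>
    (\<exists>g. semilinear s M M g \<and> bij_betw g (carrier M) (carrier M))"
proof
  interpret M: left_module A M by (rule M)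
  let ?T = "iterated_twist A FA FM s M" and ?i = "inv_into (carrier M) FM ^^ s"
  have bijs: "bij_betw (FM ^^ s) (carrier M) (carrier M)"
    by (rule bij_betw_funpow[OF FM(1)])
  note inv = inv_into_funpow[OF FM(1)]
  have FMc: "(FM ^^ s) x \<in> carrier M" if "x \<in> carrier M" for x using bij_betwE[OF bijs] that by blast
  {
    assume "module_isomorphic A ?T M"
    then obtain \<theta> where th: "\<theta> \<in> module_hom A ?T M" "bij_betw \<theta> (carrier M) (carrier M)"
      unfolding module_isomorphic_def by auto
    note t = module_homD[OF th(1), unfolded iterated_twist_simps]
    have "semilinear s M M (\<lambda>x. \<theta> ((FM ^^ s) x))"
      unfolding semilinear_def
    proof (intro conjI ballI)
      show "additive_map M M (\<lambda>x. \<theta> ((FM ^^ s) x))"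
        using t(1,2) FMc additive_map_add[OF additive_map_funpow[OF FM(2)]] by (intro additive_mapI) simp_all
      fix a x assume ax: "a \<in> carrier A" "x \<in> carrier M"
      show "\<theta> ((FM ^^ s) (a \<odot>\<^bsub>M\<^esub> x)) = (FA ^^ s) a \<odot>\<^bsub>M\<^esub> \<theta> ((FM ^^ s) x)"
        using t(3)[OF A.Fp_closed[OF ax(1), of s] FMc[OF ax(2)]] twist_smult_image[OF FM(1) ax] by simp
    qed
    moreover have "bij_betw (\<lambda>x. \<theta> ((FM ^^ s) x)) (carrier M) (carrier M)"
      using bij_betw_trans[OF bijs th(2)] by (simp add: comp_def)
    ultimately show "\<exists>g. semilinear s M M g \<and> bij_betw g (carrier M) (carrier M)" by blast
  next
    assume "\<exists>g. semilinear s M M g \<and> bij_betw g (carrier M) (carrier M)"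
    then obtain g where g: "semilinear s M M g" "bij_betw g (carrier M) (carrier M)" by blast
    note gD = semilinearD[OF g(1)]
    define \<theta> where "\<theta> x = g (?i x)" for x
    have th: "\<theta> ((FM ^^ s) x) = g x" if "x \<in> carrier M" for x unfolding \<theta>_def using inv(1)[OF that] by simp
    have ex: "\<exists>y \<in> carrier M. x = (FM ^^ s) y" if "x \<in> carrier M" for x
      using inv(2)[OF that, of s] inv(3)[OF that, of s] by (intro bexI[where x = "?i x"]) simp_all
    have exA: "\<exists>b \<in> carrier A. a = (FA ^^ s) b" if "a \<in> carrier A" for a
      using inv_into_funpow(2,3)[OF FA_bij that, of s]
      by (intro bexI[where x = "(inv_into (carrier A) FA ^^ s) a"]) simp_all
    have "\<theta> \<in> module_hom A ?T M"
    proof (rule module_homI; unfold iterated_twist_simps)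
      show "\<theta> x \<in> carrier M" if "x \<in> carrier M" for x
        unfolding \<theta>_def by (rule gD(2)[OF inv(3)[OF that]])
      show "\<theta> (x \<oplus>\<^bsub>M\<^esub> y) = \<theta> x \<oplus>\<^bsub>M\<^esub> \<theta> y" if xy: "x \<in> carrier M" "y \<in> carrier M" for x y
      proof -
        obtain u v where "u \<in> carrier M" "v \<in> carrier M" "x = (FM ^^ s) u" "y = (FM ^^ s) v"
          using ex[OF xy(1)] ex[OF xy(2)] by (elim bexE)
        then show ?thesis
          using th[of "u \<oplus>\<^bsub>M\<^esub> v"] th[of u] th[of v] gD(3)[of u v]
            additive_map_add[OF additive_map_funpow[OF FM(2)], of u v s] by simp
      qed
      show "\<theta> (a \<odot>\<^bsub>?T\<^esub> x) = a \<odot>\<^bsub>M\<^esub> \<theta> x" if ax: "a \<in> carrier A" "x \<in> carrier M" for a x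
      proof -
        obtain b u where bu: "b \<in> carrier A" "u \<in> carrier M" "a = (FA ^^ s) b" "x = (FM ^^ s) u"
          using ex[OF ax(2)] exA[OF ax(1)] by (elim bexE)
        show ?thesis
          unfolding bu(3,4) twist_smult_image[OF FM(1) bu(1,2)] th[OF bu(2)]
            th[OF M.left_smult_closed[OF bu(1,2)]] by (rule gD(4)[OF bu(1,2)])
      qed
    qed
    moreover have "bij_betw \<theta> (carrier M) (carrier M)"
    proof -
      have "bij_betw ?i (carrier M) (carrier M)"
        by (rule bij_betw_byWitness[where f' = "FM ^^ s"]) (use inv FMc in auto)
      from bij_betw_trans[OF this g(2)] show ?thesis by (simp add: comp_def \<theta>_def[abs_def])
    qed
    ultimately show "module_isomorphic A ?T M" unfolding module_isomorphic_def by auto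
  }
qed

end

section \<open>Direct sums and endomorphisms\<close>

lemma direct_sum_projection:
  assumes "left_module A N" and ds: "internal_direct_sum A N U W"
  shows "\<exists>e \<in> module_hom A N N. (\<forall>x \<in> carrier N. e x \<in> U) \<and> (\<forall>u \<in> U. e u = u) \<and> (\<forall>w \<in> W. e w = \<zero>\<^bsub>N\<^esub>)"
proof -
  interpret N: left_module A N by fact
  have U: "submodule U A N" and W: "submodule W A N" and int: "U \<inter> W = {\<zero>\<^bsub>N\<^esub>}"
    and sum: "U <+>\<^bsub>N\<^esub> W = carrier N"
    using ds by (simp_all add: internal_direct_sum_def)
  note UD = N.submoduleD[OF U] and WD = N.submoduleD[OF W]
  have uniq: "u = u'" if "u \<in> U" "u' \<in> U" "w \<in> W" "w' \<in> W" "u \<oplus>\<^bsub>N\<^esub> w = u' \<oplus>\<^bsub>N\<^esub> w'" for u u' w w'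
  proof -
    have c: "u \<in> carrier N" "u' \<in> carrier N" "w \<in> carrier N" "w' \<in> carrier N"
      using UD(1) WD(1) that(1-4) by auto
    have "\<ominus>\<^bsub>N\<^esub> u' \<oplus>\<^bsub>N\<^esub> (u \<oplus>\<^bsub>N\<^esub> w) \<oplus>\<^bsub>N\<^esub> \<ominus>\<^bsub>N\<^esub> w = \<ominus>\<^bsub>N\<^esub> u' \<oplus>\<^bsub>N\<^esub> (u' \<oplus>\<^bsub>N\<^esub> w') \<oplus>\<^bsub>N\<^esub> \<ominus>\<^bsub>N\<^esub> w"
      using that(5) by simp
    then have "\<ominus>\<^bsub>N\<^esub> u' \<oplus>\<^bsub>N\<^esub> u = w' \<oplus>\<^bsub>N\<^esub> \<ominus>\<^bsub>N\<^esub> w"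
      using c by (simp add: N.M.a_assoc N.M.r_neg N.M.r_neg1)
    moreover have "\<ominus>\<^bsub>N\<^esub> u' \<oplus>\<^bsub>N\<^esub> u \<in> U" using that UD by simp
    moreover have "w' \<oplus>\<^bsub>N\<^esub> \<ominus>\<^bsub>N\<^esub> w \<in> W" using that WD by simp
    ultimately have "\<ominus>\<^bsub>N\<^esub> u' \<oplus>\<^bsub>N\<^esub> u = \<zero>\<^bsub>N\<^esub>" using int by auto
    then have "\<ominus>\<^bsub>N\<^esub> u = \<ominus>\<^bsub>N\<^esub> u'" using c N.M.minus_equality[of "\<ominus>\<^bsub>N\<^esub> u'" u] by simp
    then have "\<ominus>\<^bsub>N\<^esub> (\<ominus>\<^bsub>N\<^esub> u) = \<ominus>\<^bsub>N\<^esub> (\<ominus>\<^bsub>N\<^esub> u')" by simp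
    then show ?thesis using c by (simp only: N.M.minus_minus)
  qed
  have ex: "\<exists>u \<in> U. \<exists>w \<in> W. x = u \<oplus>\<^bsub>N\<^esub> w" if "x \<in> carrier N" for x
    using that unfolding sum[symmetric] set_add_def' by auto
  define e where "e x = (SOME u. u \<in> U \<and> (\<exists>w \<in> W. x = u \<oplus>\<^bsub>N\<^esub> w))" for x
  have e: "e x \<in> U" "\<exists>w \<in> W. x = e x \<oplus>\<^bsub>N\<^esub> w" if "x \<in> carrier N" for x
  proof -
    have "\<exists>u. u \<in> U \<and> (\<exists>w \<in> W. x = u \<oplus>\<^bsub>N\<^esub> w)" using ex[OF that] by blast
    from someI_ex[OF this] show "e x \<in> U" "\<exists>w \<in> W. x = e x \<oplus>\<^bsub>N\<^esub> w" unfolding e_def by blast+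
  qed
  have eI: "e (u \<oplus>\<^bsub>N\<^esub> w) = u" if u: "u \<in> U" and w: "w \<in> W" for u w
  proof -
    have "u \<oplus>\<^bsub>N\<^esub> w \<in> carrier N" using u w UD(1) WD(1) by auto
    then obtain w' where "w' \<in> W" "u \<oplus>\<^bsub>N\<^esub> w = e (u \<oplus>\<^bsub>N\<^esub> w) \<oplus>\<^bsub>N\<^esub> w'" "e (u \<oplus>\<^bsub>N\<^esub> w) \<in> U"
      using e by blast
    then show ?thesis using uniq[OF u _ w] by metis
  qed
  have "e \<in> module_hom A N N"
  proof (rule module_homI)
    show "e x \<in> carrier N" if "x \<in> carrier N" for x using e(1)[OF that] UD(1) by blast
    show "e (x \<oplus>\<^bsub>N\<^esub> y) = e x \<oplus>\<^bsub>N\<^esub> e y" if xy: "x \<in> carrier N" "y \<in> carrier N" for x y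
    proof -
      obtain u w where x: "u \<in> U" "w \<in> W" "x = u \<oplus>\<^bsub>N\<^esub> w" using ex[OF xy(1)] by blast
      obtain u' w' where y: "u' \<in> U" "w' \<in> W" "y = u' \<oplus>\<^bsub>N\<^esub> w'" using ex[OF xy(2)] by blast
      have c: "u \<in> carrier N" "u' \<in> carrier N" "w \<in> carrier N" "w' \<in> carrier N"
        using UD(1) WD(1) x y by auto
      have "x \<oplus>\<^bsub>N\<^esub> y = (u \<oplus>\<^bsub>N\<^esub> u') \<oplus>\<^bsub>N\<^esub> (w \<oplus>\<^bsub>N\<^esub> w')" unfolding x(3) y(3) using c by (simp add: N.M.a_ac)
      then have "e (x \<oplus>\<^bsub>N\<^esub> y) = u \<oplus>\<^bsub>N\<^esub> u'" using eI UD(3)[OF x(1) y(1)] WD(3)[OF x(2) y(2)] by simp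
      then show ?thesis using eI[OF x(1,2)] eI[OF y(1,2)] x(3) y(3) by simp
    qed
    show "e (a \<odot>\<^bsub>N\<^esub> x) = a \<odot>\<^bsub>N\<^esub> e x" if ax: "a \<in> carrier A" "x \<in> carrier N" for a x
    proof -
      obtain u w where x: "u \<in> U" "w \<in> W" "x = u \<oplus>\<^bsub>N\<^esub> w" using ex[OF ax(2)] by blast
      have c: "u \<in> carrier N" "w \<in> carrier N" using UD(1) WD(1) x by auto
      have "a \<odot>\<^bsub>N\<^esub> x = a \<odot>\<^bsub>N\<^esub> u \<oplus>\<^bsub>N\<^esub> a \<odot>\<^bsub>N\<^esub> w"
        unfolding x(3) by (rule N.left_smult_r_distr[OF ax(1) c])
      then show ?thesis using eI[OF UD(4)[OF ax(1) x(1)] WD(4)[OF ax(1) x(2)]] eI[OF x(1,2)] x(3) by simp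
    qed
  qed
  moreover have "e u = u" if "u \<in> U" for u
    using eI[OF that WD(2)] that UD(1) by auto
  moreover have "e w = \<zero>\<^bsub>N\<^esub>" if "w \<in> W" for w
    using eI[OF UD(2) that] that WD(1) by auto
  ultimately show ?thesis using e(1) by blast
qed

text \<open>Let e be the projection to U along W. If h e is not zero, e is a unit that kills W;
  otherwise h (1 - e) = 1, and 1 - e is a unit that kills U.\<close>

lemma indecomposable_of_residue_hom:
  assumes N: "left_module A N" and L: "field L" and h: "h \<in> ring_hom (End_algebra A N) L"
    and units: "\<And>f. \<lbrakk>f \<in> carrier (End_algebra A N); h f \<noteq> \<zero>\<^bsub>L\<^esub>\<rbrakk> \<Longrightarrow> f \<in> Units (End_algebra A N)"
    and ds: "internal_direct_sum A N U W"
  shows "U = {\<zero>\<^bsub>N\<^esub>} \<or> W = {\<zero>\<^bsub>N\<^esub>}"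
proof -
  let ?E = "End_algebra A N"
  interpret N: left_module A N by (rule N)
  interpret L: field L by (rule L)
  interpret E: ring ?E by (rule End_algebra_ring[OF N])
  interpret h: ring_hom_ring ?E L h by (rule ring_hom_ringI2[OF E.ring_axioms L.ring_axioms h])
  have U: "submodule U A N" and W: "submodule W A N" using ds by (simp_all add: internal_direct_sum_def)
  obtain e0 where e0: "e0 \<in> module_hom A N N" "\<forall>u \<in> U. e0 u = u" "\<forall>w \<in> W. e0 w = \<zero>\<^bsub>N\<^esub>"
    using direct_sum_projection[OF N ds] by blast
  define e where "e = restrict e0 (carrier N)"
  have e: "e \<in> carrier ?E" unfolding e_def by (rule restrict_in_End[OF N e0(1)])
  have inj: "x = \<zero>\<^bsub>N\<^esub>" if "f \<in> Units ?E" "f x = \<zero>\<^bsub>N\<^esub>" "x \<in> carrier N" for f x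
  proof -
    have "f \<in> module_hom A N N" using that(1) by (auto simp: Units_def End_algebra_simps(1))
    moreover have "inj_on f (carrier N)" using End_algebra_Units_bij[OF N that(1)] by (simp add: bij_betw_def)
    ultimately show ?thesis
      using that additive_map_inj_on_iff[OF N.M.abelian_group_axioms N.M.abelian_group_axioms module_homD(4)] by blast
  qed
  show ?thesis
  proof (cases "h e = \<zero>\<^bsub>L\<^esub>")
    case False
    then have eU: "e \<in> Units ?E" by (rule units[OF e])
    have "w = \<zero>\<^bsub>N\<^esub>" if "w \<in> W" for w
      using inj[OF eU, of w] that e0(3) N.submoduleD(1)[OF W] by (auto simp: e_def)
    then show ?thesis using N.submoduleD(2)[OF W] by blast
  next
    case True
    let ?f = "\<one>\<^bsub>?E\<^esub> \<ominus>\<^bsub>?E\<^esub> e"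
    have f: "?f \<in> carrier ?E" using e by simp
    have "h ?f = h \<one>\<^bsub>?E\<^esub> \<oplus>\<^bsub>L\<^esub> \<ominus>\<^bsub>L\<^esub> h e" using e by (simp add: a_minus_def)
    then have "h ?f = \<one>\<^bsub>L\<^esub>" using True by simp
    then have fU: "?f \<in> Units ?E" using units[OF f] by simp
    have "u = \<zero>\<^bsub>N\<^esub>" if u: "u \<in> U" for u
    proof -
      have uc: "u \<in> carrier N" using u N.submoduleD(1)[OF U] by blast
      have "?f u = u \<oplus>\<^bsub>N\<^esub> \<ominus>\<^bsub>N\<^esub> e u"
        unfolding a_minus_def using End_algebra_neg_apply[OF N e uc] uc by (simp add: End_algebra_simps(3,5))
      then have "?f u = \<zero>\<^bsub>N\<^esub>" using u uc e0(2) by (simp add: e_def N.M.r_neg)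
      then show ?thesis using inj[OF fU] uc by blast
    qed
    then show ?thesis using N.submoduleD(2)[OF U] by blast
  qed
qed

text \<open>The homomorphism is conjugation by t. It is used to carry the residue map from
  \<open>M'^G\<close> to the fixed points of the stable module.\<close>

lemma End_algebra_transport:
  assumes X: "left_module B X'" and Y: "left_module B Y'" and t: "t \<in> module_hom B Y' X'"
    and bij: "bij_betw t (carrier Y') (carrier X')"
  shows "\<exists>\<Phi> \<in> ring_hom (End_algebra B X') (End_algebra B Y').
    \<Phi> ` carrier (End_algebra B X') = carrier (End_algebra B Y') \<and>
    (\<forall>f \<in> carrier (End_algebra B X'). \<forall>y \<in> carrier Y'. t (\<Phi> f y) = f (t y))"
proof -
  interpret X: left_module B X' by (rule X)
  interpret Y: left_module B Y' by (rule Y)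
  note tD = module_homD[OF t]
  define s where "s = inv_into (carrier Y') t"
  have s: "s x \<in> carrier Y'" "t (s x) = x" if "x \<in> carrier X'" for x
    using bij that inv_into_into[of x t "carrier Y'"] f_inv_into_f[of x t "carrier Y'"]
    unfolding s_def bij_betw_def by auto
  have st: "s (t y) = y" if "y \<in> carrier Y'" for y
    unfolding s_def using bij that by (simp add: bij_betw_def)
  have tinj: "y = z" if "t y = t z" "y \<in> carrier Y'" "z \<in> carrier Y'" for y z
    using inj_onD[OF bij_betw_imp_inj_on[OF bij] that] .
  have sh: "s \<in> module_hom B X' Y'"
  proof (rule module_homI)
    show "s (x \<oplus>\<^bsub>X'\<^esub> y) = s x \<oplus>\<^bsub>Y'\<^esub> s y" if "x \<in> carrier X'" "y \<in> carrier X'" for x y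
      by (rule tinj) (simp_all add: that s tD(2))
    show "s (a \<odot>\<^bsub>X'\<^esub> x) = a \<odot>\<^bsub>Y'\<^esub> s x" if "a \<in> carrier B" "x \<in> carrier X'" for a x
      by (rule tinj) (simp_all add: that s tD(3) X.left_smult_closed Y.left_smult_closed)
  qed (rule s)
  note sD = module_homD[OF sh]
  define \<Phi> where "\<Phi> f = restrict (\<lambda>y. s (f (t y))) (carrier Y')" for f
  have ED: "f x \<in> carrier X'" "f (x \<oplus>\<^bsub>X'\<^esub> y) = f x \<oplus>\<^bsub>X'\<^esub> f y" "a \<in> carrier B \<Longrightarrow> f (a \<odot>\<^bsub>X'\<^esub> x) = a \<odot>\<^bsub>X'\<^esub> f x"
    if "f \<in> carrier (End_algebra B X')" "x \<in> carrier X'" "y \<in> carrier X'" for f x y a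
    using module_homD(1-3)[of f B X' X'] that by (auto simp: End_algebra_simps(1))
  have \<Phi>E: "\<Phi> f \<in> carrier (End_algebra B Y')" if f: "f \<in> carrier (End_algebra B X')" for f
    unfolding \<Phi>_def
  proof (rule restrict_in_End[OF Y], rule module_homI)
    show "s (f (t y)) \<in> carrier Y'" if "y \<in> carrier Y'" for y
      using sD(1)[OF ED(1)[OF f tD(1)[OF that] tD(1)[OF that]]] .
    show "s (f (t (y \<oplus>\<^bsub>Y'\<^esub> z))) = s (f (t y)) \<oplus>\<^bsub>Y'\<^esub> s (f (t z))" if "y \<in> carrier Y'" "z \<in> carrier Y'" for y z
      using that ED(1,2)[OF f tD(1)[OF that(1)] tD(1)[OF that(2)]] ED(1)[OF f tD(1)[OF that(2)] tD(1)[OF that(2)]]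
      by (simp add: tD(2) sD(2))
    show "s (f (t (a \<odot>\<^bsub>Y'\<^esub> y))) = a \<odot>\<^bsub>Y'\<^esub> s (f (t y))" if "a \<in> carrier B" "y \<in> carrier Y'" for a y
      using that ED(1,3)[OF f tD(1)[OF that(2)] tD(1)[OF that(2)]] by (simp add: tD(3) sD(3))
  qed
  have t\<Phi>: "t (\<Phi> f y) = f (t y)" if "f \<in> carrier (End_algebra B X')" "y \<in> carrier Y'" for f y
    using that s(2)[OF ED(1)[OF that(1) tD(1)[OF that(2)] tD(1)[OF that(2)]]] by (simp add: \<Phi>_def)
  have "\<Phi> \<in> ring_hom (End_algebra B X') (End_algebra B Y')"
  proof -
    interpret EX: ring "End_algebra B X'" by (rule End_algebra_ring[OF X])
    interpret EY: ring "End_algebra B Y'" by (rule End_algebra_ring[OF Y])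
    show ?thesis
    proof (rule ring_hom_memI)
      fix f g assume f: "f \<in> carrier (End_algebra B X')" and g: "g \<in> carrier (End_algebra B X')"
      have cl: "\<Phi> f y \<in> carrier Y'" if "f \<in> carrier (End_algebra B X')" "y \<in> carrier Y'" for f y
        using module_homD(1)[of "\<Phi> f" B Y' Y'] \<Phi>E[OF that(1)] that(2) by (simp add: End_algebra_simps(1))
      show "\<Phi> (f \<otimes>\<^bsub>End_algebra B X'\<^esub> g) = \<Phi> f \<otimes>\<^bsub>End_algebra B Y'\<^esub> \<Phi> g"
      proof (rule End_algebra_eqI[OF \<Phi>E[OF EX.m_closed[OF f g]] EY.m_closed[OF \<Phi>E[OF f] \<Phi>E[OF g]]])
        fix y assume y: "y \<in> carrier Y'"
        have "t (\<Phi> (f \<otimes>\<^bsub>End_algebra B X'\<^esub> g) y) = f (g (t y))"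
          using t\<Phi>[OF EX.m_closed[OF f g] y] tD(1)[OF y] by (simp add: End_algebra_simps(2) compose_def)
        also have "\<dots> = t (\<Phi> f (\<Phi> g y))" using t\<Phi>[OF f cl[OF g y]] t\<Phi>[OF g y] by simp
        finally have "\<Phi> (f \<otimes>\<^bsub>End_algebra B X'\<^esub> g) y = \<Phi> f (\<Phi> g y)"
          by (rule tinj[OF _ cl[OF EX.m_closed[OF f g] y] cl[OF f cl[OF g y]]])
        then show "\<Phi> (f \<otimes>\<^bsub>End_algebra B X'\<^esub> g) y = (\<Phi> f \<otimes>\<^bsub>End_algebra B Y'\<^esub> \<Phi> g) y"
          using y by (simp add: End_algebra_simps(2) compose_def)
      qed
      show "\<Phi> (f \<oplus>\<^bsub>End_algebra B X'\<^esub> g) = \<Phi> f \<oplus>\<^bsub>End_algebra B Y'\<^esub> \<Phi> g"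
      proof (rule End_algebra_eqI[OF \<Phi>E[OF EX.a_closed[OF f g]] EY.a_closed[OF \<Phi>E[OF f] \<Phi>E[OF g]]])
        fix y assume y: "y \<in> carrier Y'"
        have "t (\<Phi> (f \<oplus>\<^bsub>End_algebra B X'\<^esub> g) y) = f (t y) \<oplus>\<^bsub>X'\<^esub> g (t y)"
          using t\<Phi>[OF EX.a_closed[OF f g] y] tD(1)[OF y] by (simp add: End_algebra_simps(5))
        also have "\<dots> = t (\<Phi> f y \<oplus>\<^bsub>Y'\<^esub> \<Phi> g y)"
          using t\<Phi>[OF f y] t\<Phi>[OF g y] tD(2)[OF cl[OF f y] cl[OF g y]] by simp
        finally have "\<Phi> (f \<oplus>\<^bsub>End_algebra B X'\<^esub> g) y = \<Phi> f y \<oplus>\<^bsub>Y'\<^esub> \<Phi> g y"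
          by (rule tinj[OF _ cl[OF EX.a_closed[OF f g] y] Y.M.a_closed[OF cl[OF f y] cl[OF g y]]])
        then show "\<Phi> (f \<oplus>\<^bsub>End_algebra B X'\<^esub> g) y = (\<Phi> f \<oplus>\<^bsub>End_algebra B Y'\<^esub> \<Phi> g) y"
          using y by (simp add: End_algebra_simps(5))
      qed
    next
      show "\<Phi> \<one>\<^bsub>End_algebra B X'\<^esub> = \<one>\<^bsub>End_algebra B Y'\<^esub>"
        by (rule End_algebra_eqI[OF \<Phi>E[OF EX.one_closed] EY.one_closed])
          (simp add: \<Phi>_def End_algebra_simps(3) tD(1) st)
    qed (rule \<Phi>E)
  qed
  moreover have "\<Phi> ` carrier (End_algebra B X') = carrier (End_algebra B Y')"
  proof
    show "carrier (End_algebra B Y') \<subseteq> \<Phi> ` carrier (End_algebra B X')"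
    proof
      fix g assume g: "g \<in> carrier (End_algebra B Y')"
      then have gh: "g \<in> module_hom B Y' Y'" by (simp add: End_algebra_simps(1))
      note gD = module_homD[OF gh]
      let ?f = "restrict (\<lambda>x. t (g (s x))) (carrier X')"
      have f: "?f \<in> carrier (End_algebra B X')"
        by (rule restrict_in_End[OF X], rule module_homI) (simp_all add: tD(1,2,3) gD(1,2,3) sD(1,2,3))
      have "\<Phi> ?f = g"
        by (rule End_algebra_eqI[OF \<Phi>E[OF f] g]) (simp add: \<Phi>_def tD(1) st gD(1))
      from this[symmetric] show "g \<in> \<Phi> ` carrier (End_algebra B X')" using f by (rule image_eqI)
    qed
  qed (use \<Phi>E in blast)
  ultimately show ?thesis using t\<Phi> by blast
qed

section \<open>The module \<open>M'\<close> and its associated stable module\<close>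

lemma frobenius_space_map:
  fixes k :: "'a ring" and V :: "('a, 'v) module"
  assumes "frobenius_space k q V F" "frobenius_field.Kn k q 1 = Fq" "card Fq = q"
  shows "frobenius_map k Fq V F"
proof -
  interpret frobenius_space k q V F by fact
  have "c [^]\<^bsub>k\<^esub> q = c" "c \<in> carrier k" if "c \<in> Fq" for c
    using that unfolding assms(2)[symmetric] by (simp_all add: Kn_def)
  then show ?thesis
    unfolding frobenius_map_def assms(3)
    using V.module_axioms F_bij F_additive F_smult F_periodic by (auto simp: additive_map_def)
qed

text \<open>M stands for the structure \<open>M'\<close>. The axiom \<open>twist\<close> says in
  effect that \<open>FM^r\<close> is semilinear of degree r (\<open>power_semilinear\<close>),
  although \<open>FM\<close> itself is only semilinear over the scalars.\<close>

locale periodic_module = frobenius_algebra k q A FA + M: left_module A M +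
    F: frobenius_space k q "base_space A M" FM
  for k :: "'k ring" (structure) and q and A :: "('k, 'a) module" and FA
    and M :: "('a, 'm) module" and FM and r +
  assumes r_pos: "0 < r"
    and twist: "\<And>a x. \<lbrakk>a \<in> carrier A; x \<in> carrier M\<rbrakk> \<Longrightarrow> a \<odot>\<^bsub>iterated_twist A FA FM r M\<^esub> x = a \<odot>\<^bsub>M\<^esub> x"
    and fd: "\<exists>S. F.spans S"
begin

lemma FM_bij: "bij_betw FM (carrier M) (carrier M)"
  using F.F_bij unfolding base_space_simps .

lemma FM_additive: "additive_map M M FM"
  using F.F_additive by (simp add: additive_map_base_space)

lemma FMp_closed: "x \<in> carrier M \<Longrightarrow> (FM ^^ n) x \<in> carrier M"
  using F.Fp_closed[of x n] unfolding base_space_simps .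

lemma FMp_add: "\<lbrakk>x \<in> carrier M; y \<in> carrier M\<rbrakk> \<Longrightarrow> (FM ^^ n) (x \<oplus>\<^bsub>M\<^esub> y) = (FM ^^ n) x \<oplus>\<^bsub>M\<^esub> (FM ^^ n) y"
  using F.Fp_add[of x y n] unfolding base_space_simps .

lemma power_frobenius_space: "frobenius_space k (q ^ r) (base_space A M) (FM ^^ r)"
proof (intro frobenius_space.intro frobenius_space_axioms.intro)
  show "frobenius_field k (q ^ r)" by (rule frobenius_field_power[OF r_pos])
  show "module k (base_space A M)" by (rule F.V.module_axioms)
  show "additive_map (base_space A M) (base_space A M) (FM ^^ r)" by (rule F.Fp_additive)
  show "(FM ^^ r) (c \<odot>\<^bsub>base_space A M\<^esub> v) = (c [^] (q ^ r)) \<odot>\<^bsub>base_space A M\<^esub> (FM ^^ r) v"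
    if "c \<in> carrier k" "v \<in> carrier (base_space A M)" for c v by (rule F.Fp_smult[OF that])
  show "\<exists>n>0. ((FM ^^ r) ^^ n) v = v" if v: "v \<in> carrier (base_space A M)" for v
  proof -
    obtain n where n: "n > 0" "v \<in> F.Fix n" using F.Fix_ex[OF v] by blast
    then have "(FM ^^ (r * n)) v = v" using F.Fix_dvd[of v n "r * n"] by (simp add: F.Fix_def)
    then show ?thesis using n by (auto simp: funpow_mult)
  qed
qed

lemma power_semilinear: "semilinear r M M (FM ^^ r)"
  unfolding semilinear_def
proof (intro conjI ballI)
  show "additive_map M M (FM ^^ r)" by (rule additive_map_funpow[OF FM_additive])
  fix a x assume ax: "a \<in> carrier A" "x \<in> carrier M"
  show "(FM ^^ r) (a \<odot>\<^bsub>M\<^esub> x) = (FA ^^ r) a \<odot>\<^bsub>M\<^esub> (FM ^^ r) x"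
    using twist_smult_image[where s = r, OF FM_bij ax] twist[OF A.Fp_closed[OF ax(1)] FMp_closed[OF ax(2)]] by metis
qed

sublocale P: frobenius_module k q A FA M r "FM ^^ r"
  using frobenius_algebra_axioms M.left_module_axioms power_frobenius_space r_pos power_semilinear fd
  by (intro frobenius_module.intro frobenius_module_axioms.intro) auto

abbreviation T where "T \<equiv> tilde_module A FA FM r M"
abbreviation FT where "FT \<equiv> tilde_frobenius FM r"
abbreviation tw where "tw i \<equiv> iterated_twist A FA FM i M"

lemma T_simps:
  "carrier T = {..<r} \<rightarrow>\<^sub>E carrier M" "ring.zero T = (\<lambda>i \<in> {..<r}. \<zero>\<^bsub>M\<^esub>)"
  "ring.add T = (\<lambda>x y. \<lambda>i \<in> {..<r}. x i \<oplus>\<^bsub>M\<^esub> y i)"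
  "smult T = (\<lambda>a x. \<lambda>i \<in> {..<r}. a \<odot>\<^bsub>tw i\<^esub> x i)"
  by (simp_all add: tilde_module_def)

lemma T_eqI: "\<lbrakk>x \<in> carrier T; y \<in> carrier T; \<And>i. i < r \<Longrightarrow> x i = y i\<rbrakk> \<Longrightarrow> x = y"
  unfolding T_simps by (rule PiE_ext) auto

lemma T_apply: "x \<in> carrier T \<Longrightarrow> i < r \<Longrightarrow> x i \<in> carrier M"
  unfolding T_simps by auto

lemma tw_preimage:
  assumes "a \<in> carrier A" "x \<in> carrier M"
  obtains b y where "b \<in> carrier A" "y \<in> carrier M" "a = (FA ^^ i) b" "x = (FM ^^ i) y"
proof (rule that)
  show "(inv_into (carrier A) FA ^^ i) a \<in> carrier A" "a = (FA ^^ i) ((inv_into (carrier A) FA ^^ i) a)"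
    using inv_into_funpow(2,3)[OF FA_bij assms(1), of i] by simp_all
  show "(inv_into (carrier M) FM ^^ i) x \<in> carrier M" "x = (FM ^^ i) ((inv_into (carrier M) FM ^^ i) x)"
    using inv_into_funpow(2,3)[OF FM_bij assms(2), of i] by simp_all
qed

lemma tw_image:
  "\<lbrakk>a \<in> carrier A; x \<in> carrier M\<rbrakk> \<Longrightarrow> ((FA ^^ i) a) \<odot>\<^bsub>tw i\<^esub> ((FM ^^ i) x) = (FM ^^ i) (a \<odot>\<^bsub>M\<^esub> x)"
  by (rule twist_smult_image[OF FM_bij])

text \<open>Each law is transported from M along the bijections \<open>FA^i\<close> and
  \<open>FM^i\<close>.\<close>

lemma tw_left_module: "left_module A (tw i)"
proof (intro left_module.intro left_module_axioms.intro)
  show "ring A" by (rule AA.ring_axioms)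
  show "abelian_group (tw i)"
    by (rule abelian_groupI) (auto simp: M.M.a_ac intro: bexI[of _ "\<ominus>\<^bsub>M\<^esub> _"] M.M.l_neg)
  show "a \<odot>\<^bsub>tw i\<^esub> x \<in> carrier (tw i)" if "a \<in> carrier A" "x \<in> carrier (tw i)" for a x
    using that FMp_closed M.left_smult_closed inv_into_funpow(3)[OF FA_bij] inv_into_funpow(3)[OF FM_bij]
    by (simp add: iterated_twist_smult)
  show "(a \<oplus>\<^bsub>A\<^esub> b) \<odot>\<^bsub>tw i\<^esub> x = a \<odot>\<^bsub>tw i\<^esub> x \<oplus>\<^bsub>tw i\<^esub> b \<odot>\<^bsub>tw i\<^esub> x"
    if ab: "a \<in> carrier A" "b \<in> carrier A" and x: "x \<in> carrier (tw i)" for a b x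
  proof -
    have xc: "x \<in> carrier M" using x by simp
    obtain a' y where a: "a' \<in> carrier A" "y \<in> carrier M" "a = (FA ^^ i) a'" "x = (FM ^^ i) y"
      by (rule tw_preimage[OF ab(1) xc])
    obtain b' y' where b: "b' \<in> carrier A" "b = (FA ^^ i) b'"
      by (rule tw_preimage[OF ab(2) xc])
    have "a \<oplus>\<^bsub>A\<^esub> b = (FA ^^ i) (a' \<oplus>\<^bsub>A\<^esub> b')" using a b A.Fp_add by simp
    then show ?thesis using a b tw_image
      by (simp add: M.left_smult_l_distr FMp_add M.left_smult_closed)
  qed
  show "a \<odot>\<^bsub>tw i\<^esub> (x \<oplus>\<^bsub>tw i\<^esub> z) = a \<odot>\<^bsub>tw i\<^esub> x \<oplus>\<^bsub>tw i\<^esub> a \<odot>\<^bsub>tw i\<^esub> z"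
    if a: "a \<in> carrier A" and xz: "x \<in> carrier (tw i)" "z \<in> carrier (tw i)" for a x z
  proof -
    have xc: "x \<in> carrier M" "z \<in> carrier M" using xz by simp_all
    obtain a' y where y: "a' \<in> carrier A" "y \<in> carrier M" "a = (FA ^^ i) a'" "x = (FM ^^ i) y"
      by (rule tw_preimage[OF a xc(1)])
    obtain a'' y' where y': "y' \<in> carrier M" "z = (FM ^^ i) y'"
      by (rule tw_preimage[OF a xc(2)])
    have "x \<oplus>\<^bsub>M\<^esub> z = (FM ^^ i) (y \<oplus>\<^bsub>M\<^esub> y')" using y y' FMp_add by simp
    then have "a \<odot>\<^bsub>tw i\<^esub> (x \<oplus>\<^bsub>M\<^esub> z) = (FM ^^ i) (a' \<odot>\<^bsub>M\<^esub> (y \<oplus>\<^bsub>M\<^esub> y'))"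
      using tw_image[OF y(1) M.M.a_closed[OF y(2) y'(1)]] y(3) by simp
    then show ?thesis using y y' tw_image[OF y(1,2)] tw_image[OF y(1) y'(1)]
      by (simp add: M.left_smult_r_distr FMp_add M.left_smult_closed)
  qed
  show "(a \<otimes>\<^bsub>A\<^esub> b) \<odot>\<^bsub>tw i\<^esub> x = a \<odot>\<^bsub>tw i\<^esub> (b \<odot>\<^bsub>tw i\<^esub> x)"
    if ab: "a \<in> carrier A" "b \<in> carrier A" and x: "x \<in> carrier (tw i)" for a b x
  proof -
    have xc: "x \<in> carrier M" using x by simp
    obtain a' y where a: "a' \<in> carrier A" "y \<in> carrier M" "a = (FA ^^ i) a'" "x = (FM ^^ i) y"
      by (rule tw_preimage[OF ab(1) xc])
    obtain b' y' where b: "b' \<in> carrier A" "b = (FA ^^ i) b'"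
      by (rule tw_preimage[OF ab(2) xc])
    have "a \<otimes>\<^bsub>A\<^esub> b = (FA ^^ i) (a' \<otimes>\<^bsub>A\<^esub> b')" using a b FA_power_mult by simp
    then show ?thesis using a b tw_image
      by (simp add: M.left_smult_assoc M.left_smult_closed)
  qed
  show "\<one>\<^bsub>A\<^esub> \<odot>\<^bsub>tw i\<^esub> x = x" if x: "x \<in> carrier (tw i)" for x
  proof -
    have xc: "x \<in> carrier M" using x by simp
    obtain a' y where y: "a' \<in> carrier A" "y \<in> carrier M" "x = (FM ^^ i) y"
      by (rule tw_preimage[OF AA.one_closed xc])
    then show ?thesis using tw_image[OF AA.one_closed y(2), of i] FA_power_one M.left_smult_one by simp
  qed
qed

text \<open>The inverse of \<open>FA^i\<close> extracts the \<open>q^i\<close>-th root of a scalar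
  and \<open>FM^i\<close> restores it, so the two effects cancel and all summands of the stable
  module share one scalar action.\<close>

lemma tw_base:
  assumes c: "c \<in> carrier k" and x: "x \<in> carrier M"
  shows "(c \<odot>\<^bsub>A\<^esub> \<one>\<^bsub>A\<^esub>) \<odot>\<^bsub>tw i\<^esub> x = c \<odot>\<^bsub>base_space A M\<^esub> x"
proof -
  obtain d where d: "d \<in> carrier k" "d [^] (q ^ i) = c" using frob_pow_surj[OF c] by blast
  obtain a' y where y: "a' \<in> carrier A" "y \<in> carrier M" "x = (FM ^^ i) y"
    by (rule tw_preimage[OF AA.one_closed x])
  have d1: "d \<odot>\<^bsub>A\<^esub> \<one>\<^bsub>A\<^esub> \<in> carrier A" using A.V.smult_closed[OF d(1)] by simp
  have "(FA ^^ i) (d \<odot>\<^bsub>A\<^esub> \<one>\<^bsub>A\<^esub>) = c \<odot>\<^bsub>A\<^esub> \<one>\<^bsub>A\<^esub>"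
    using A.Fp_smult[OF d(1), of "\<one>\<^bsub>A\<^esub>" i] FA_power_one d(2) by simp
  then have "(c \<odot>\<^bsub>A\<^esub> \<one>\<^bsub>A\<^esub>) \<odot>\<^bsub>tw i\<^esub> x = (FM ^^ i) (d \<odot>\<^bsub>base_space A M\<^esub> y)"
    using tw_image[OF d1 y(2), of i] y(3) by (simp add: base_space_smult)
  then show ?thesis using F.Fp_smult[OF d(1), of y i] d(2) y by simp
qed

lemma tw_step: "\<lbrakk>a \<in> carrier A; x \<in> carrier M\<rbrakk> \<Longrightarrow> FA a \<odot>\<^bsub>tw (Suc i)\<^esub> FM x = FM (a \<odot>\<^bsub>tw i\<^esub> x)"
  using inv_into_funpow(1)[OF FA_bij, of a 1] inv_into_funpow(1)[OF FM_bij, of x 1] iterated_twist_simps(1)[of A FA FM i M]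
  by (simp add: iterated_twist_def frobenius_twist_def One_nat_def)

lemma T_ops_closed:
  "x \<in> carrier T \<Longrightarrow> y \<in> carrier T \<Longrightarrow> x \<oplus>\<^bsub>T\<^esub> y \<in> carrier T"
  "a \<in> carrier A \<Longrightarrow> x \<in> carrier T \<Longrightarrow> a \<odot>\<^bsub>T\<^esub> x \<in> carrier T" "\<zero>\<^bsub>T\<^esub> \<in> carrier T"
  using left_module.left_smult_closed[OF tw_left_module] by (auto simp: T_simps)

lemma T_op_apply:
  "i < r \<Longrightarrow> (x \<oplus>\<^bsub>T\<^esub> y) i = x i \<oplus>\<^bsub>M\<^esub> y i" "i < r \<Longrightarrow> (a \<odot>\<^bsub>T\<^esub> x) i = a \<odot>\<^bsub>tw i\<^esub> x i" "i < r \<Longrightarrow> \<zero>\<^bsub>T\<^esub> i = \<zero>\<^bsub>M\<^esub>"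
  by (simp_all add: T_simps)

lemma T_left_module: "left_module A T"
proof (intro left_module.intro left_module_axioms.intro)
  show "ring A" by (rule AA.ring_axioms)
  show "abelian_group T"
  proof (rule abelian_groupI)
    fix x assume x: "x \<in> carrier T"
    let ?y = "\<lambda>i \<in> {..<r}. \<ominus>\<^bsub>M\<^esub> x i"
    have y: "?y \<in> carrier T" using T_apply[OF x] by (auto simp: T_simps)
    have "?y \<oplus>\<^bsub>T\<^esub> x = \<zero>\<^bsub>T\<^esub>"
      by (rule T_eqI) (use T_ops_closed x y in \<open>auto simp: T_op_apply T_apply M.M.l_neg\<close>)
    then show "\<exists>y\<in>carrier T. y \<oplus>\<^bsub>T\<^esub> x = \<zero>\<^bsub>T\<^esub>" using y by blast
  next
    fix x y z assume "x \<in> carrier T" "y \<in> carrier T" "z \<in> carrier T"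
    then show "x \<oplus>\<^bsub>T\<^esub> y \<oplus>\<^bsub>T\<^esub> z = x \<oplus>\<^bsub>T\<^esub> (y \<oplus>\<^bsub>T\<^esub> z)"
      by (intro T_eqI T_ops_closed) (auto simp: T_op_apply T_apply M.M.a_assoc)
  next
    fix x y assume "x \<in> carrier T" "y \<in> carrier T"
    then show "x \<oplus>\<^bsub>T\<^esub> y = y \<oplus>\<^bsub>T\<^esub> x"
      by (intro T_eqI T_ops_closed) (auto simp: T_op_apply T_apply M.M.a_comm)
  next
    fix x assume "x \<in> carrier T"
    then show "\<zero>\<^bsub>T\<^esub> \<oplus>\<^bsub>T\<^esub> x = x"
      by (intro T_eqI T_ops_closed) (auto simp: T_op_apply T_apply)
  qed (rule T_ops_closed; assumption)+
  note tw = left_module.left_smult_l_distr[OF tw_left_module] left_module.left_smult_r_distr[OF tw_left_module]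
    left_module.left_smult_assoc[OF tw_left_module] left_module.left_smult_one[OF tw_left_module]
  note tw = tw[unfolded iterated_twist_simps]
  show "(a \<oplus>\<^bsub>A\<^esub> b) \<odot>\<^bsub>T\<^esub> x = a \<odot>\<^bsub>T\<^esub> x \<oplus>\<^bsub>T\<^esub> b \<odot>\<^bsub>T\<^esub> x"
    if "a \<in> carrier A" "b \<in> carrier A" "x \<in> carrier T" for a b x
    using that by (intro T_eqI T_ops_closed) (auto simp: T_op_apply T_apply tw)
  show "a \<odot>\<^bsub>T\<^esub> (x \<oplus>\<^bsub>T\<^esub> y) = a \<odot>\<^bsub>T\<^esub> x \<oplus>\<^bsub>T\<^esub> a \<odot>\<^bsub>T\<^esub> y"
    if "a \<in> carrier A" "x \<in> carrier T" "y \<in> carrier T" for a x y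
    using that by (intro T_eqI T_ops_closed) (auto simp: T_op_apply T_apply tw)
  show "(a \<otimes>\<^bsub>A\<^esub> b) \<odot>\<^bsub>T\<^esub> x = a \<odot>\<^bsub>T\<^esub> (b \<odot>\<^bsub>T\<^esub> x)"
    if "a \<in> carrier A" "b \<in> carrier A" "x \<in> carrier T" for a b x
    using that by (intro T_eqI T_ops_closed) (auto simp: T_op_apply T_apply tw)
  show "\<one>\<^bsub>A\<^esub> \<odot>\<^bsub>T\<^esub> x = x" if "x \<in> carrier T" for x
    using that by (intro T_eqI T_ops_closed) (auto simp: T_op_apply T_apply tw)
qed (rule T_ops_closed; assumption)

definition prev :: "nat \<Rightarrow> nat" where "prev i = (if i = 0 then r - 1 else i - 1)"

lemma prev_less: "i < r \<Longrightarrow> prev i < r"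
  using r_pos by (auto simp: prev_def)

lemma FT_apply: "i < r \<Longrightarrow> FT x i = FM (x (prev i))"
  by (simp add: tilde_frobenius_def prev_def)

lemma FM_closed: "x \<in> carrier M \<Longrightarrow> FM x \<in> carrier M"
  using FMp_closed[of x 1] by (simp add: One_nat_def)

lemma FT_closed: "x \<in> carrier T \<Longrightarrow> FT x \<in> carrier T"
proof -
  assume x: "x \<in> carrier T"
  have "FT x i \<in> carrier M" if "i < r" for i
    using FT_apply[OF that] FM_closed[OF T_apply[OF x prev_less[OF that]]] by simp
  then show ?thesis unfolding T_simps by (auto simp: PiE_iff tilde_frobenius_def extensional_def)
qed

lemma FT_semilinear: "semilinear 1 T T FT"
  unfolding semilinear_def
proof (intro conjI ballI)
  show "additive_map T T FT"
  proof (rule additive_mapI)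
    show "FT x \<in> carrier T" if "x \<in> carrier T" for x using FT_closed that .
    show "FT (x \<oplus>\<^bsub>T\<^esub> y) = FT x \<oplus>\<^bsub>T\<^esub> FT y" if "x \<in> carrier T" "y \<in> carrier T" for x y
      using that by (intro T_eqI T_ops_closed FT_closed)
        (auto simp: T_op_apply FT_apply prev_less T_apply additive_map_add[OF FM_additive])
  qed
  fix a x assume a: "a \<in> carrier A" and x: "x \<in> carrier T"
  have FAa: "FA a \<in> carrier A" using A.Fp_closed[OF a, of 1] by (simp add: One_nat_def)
  have "FT (a \<odot>\<^bsub>T\<^esub> x) = FA a \<odot>\<^bsub>T\<^esub> FT x"
  proof (rule T_eqI)
    fix i assume i: "i < r"
    note xp = T_apply[OF x prev_less[OF i]]
    have "FM (a \<odot>\<^bsub>tw (prev i)\<^esub> x (prev i)) = FA a \<odot>\<^bsub>tw (Suc (prev i))\<^esub> FM (x (prev i))"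
      using tw_step[OF a xp] by simp
    \<comment> \<open>Only the wrap-around from the last entry to entry 0 needs the identity
      \<open>M^[r] = M\<close>.\<close>
    also have "\<dots> = FA a \<odot>\<^bsub>tw i\<^esub> FM (x (prev i))"
    proof (cases "i = 0")
      case True
      then have "Suc (prev i) = r" using r_pos by (simp add: prev_def)
      then show ?thesis using True twist[OF FAa FM_closed[OF xp]]
        by (simp add: iterated_twist_smult)
    qed (simp add: prev_def)
    finally show "FT (a \<odot>\<^bsub>T\<^esub> x) i = (FA a \<odot>\<^bsub>T\<^esub> FT x) i"
      using i by (simp add: FT_apply T_op_apply prev_less)
  qed (use a x FAa T_ops_closed FT_closed in auto)
  then show "FT (a \<odot>\<^bsub>T\<^esub> x) = (FA ^^ 1) a \<odot>\<^bsub>T\<^esub> FT x" by (simp add: One_nat_def)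
qed

lemma T_frobenius_space: "frobenius_space k q (base_space A T) FT"
proof (intro frobenius_space.intro frobenius_space_axioms.intro)
  show "frobenius_field k q" by (rule frobenius_field_axioms)
  show "module k (base_space A T)" by (rule base_module[OF T_left_module])
  show "additive_map (base_space A T) (base_space A T) FT"
    using semilinearD(1)[OF FT_semilinear] by (simp add: additive_map_base_space)
  show "FT (c \<odot>\<^bsub>base_space A T\<^esub> x) = (c [^] q) \<odot>\<^bsub>base_space A T\<^esub> FT x"
    if "c \<in> carrier k" "x \<in> carrier (base_space A T)" for c x
    using semilinear_scalar[OF FT_semilinear that(1), of x] that(2) by simp
  show "\<exists>n>0. (FT ^^ n) x = x" if "x \<in> carrier (base_space A T)" for x
  proof -
    have x: "x \<in> carrier T" using that by simp
    \<comment> \<open>The entries of x have a common period N, and \<open>FT\<close> acts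
      injectively on the finite set of tuples with entries in \<open>Fix N\<close>; hence x is
      periodic.\<close>
    obtain N where N: "N > 0" "x ` {..<r} \<subseteq> F.Fix N"
      using F.Fix_ex_common[of "x ` {..<r}"] T_apply[OF x] by (auto simp: image_subset_iff)
    obtain S where "F.spans S" using fd by blast
    then have "finite (F.Fix N)" using N(1) by (rule F.finite_Fix)
    then have fin: "finite ({..<r} \<rightarrow>\<^sub>E F.Fix N)" by (intro finite_PiE) auto
    have sub: "y \<in> carrier T" if "y \<in> {..<r} \<rightarrow>\<^sub>E F.Fix N" for y
      using that F.Fix_carrier[of _ N] unfolding T_simps base_space_simps by auto
    have FixF: "FM v \<in> F.Fix N" if "v \<in> F.Fix N" for v
      using that FM_closed[of v] by (simp add: F.Fix_def funpow_swap1[symmetric])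
    have maps: "FT y \<in> {..<r} \<rightarrow>\<^sub>E F.Fix N" if y: "y \<in> {..<r} \<rightarrow>\<^sub>E F.Fix N" for y
    proof -
      have "FT y i \<in> F.Fix N" if "i < r" for i
        using FT_apply[OF that] FixF[OF PiE_mem[OF y, of "prev i"]] prev_less[OF that] by simp
      then show ?thesis by (auto simp: PiE_iff tilde_frobenius_def extensional_def)
    qed
    have inj: "inj_on FT ({..<r} \<rightarrow>\<^sub>E F.Fix N)"
    proof (rule inj_onI)
      fix y z assume y: "y \<in> {..<r} \<rightarrow>\<^sub>E F.Fix N" and z: "z \<in> {..<r} \<rightarrow>\<^sub>E F.Fix N" and eq: "FT y = FT z"
      show "y = z"
      proof (rule T_eqI[OF sub[OF y] sub[OF z]])
        fix i assume i: "i < r"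
        define j where "j = (if Suc i < r then Suc i else 0)"
        have j: "j < r" "prev j = i" using i r_pos by (auto simp: j_def prev_def)
        have "FM (y i) = FM (z i)" using fun_cong[OF eq, of j] FT_apply[OF j(1)] j(2) by simp
        then show "y i = z i"
          using inj_onD[OF bij_betw_imp_inj_on[OF FM_bij]] T_apply[OF sub[OF y] i] T_apply[OF sub[OF z] i] by blast
      qed
    qed
    obtain n where "n > 0" "\<forall>y \<in> {..<r} \<rightarrow>\<^sub>E F.Fix N. (FT ^^ n) y = y"
      using finite_funpow_periodic[OF fin _ inj] maps by blast
    moreover have "x \<in> {..<r} \<rightarrow>\<^sub>E F.Fix N" using x N(2) unfolding T_simps by auto
    ultimately show ?thesis by blast
  qed
qed

text \<open>A tuple fixed by the cyclic map must consist of the successive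
  \<open>FM\<close>-iterates of its entry at 0; this is that tuple, so on fixed points \<tau>
  inverts evaluation at 0.\<close>

definition \<tau> where "\<tau> y = (\<lambda>i \<in> {..<r}. (FM ^^ i) y)"

lemma tau_apply: "i < r \<Longrightarrow> \<tau> y i = (FM ^^ i) y"
  by (simp add: \<tau>_def)

lemma tau_T: "y \<in> carrier M \<Longrightarrow> \<tau> y \<in> carrier T"
  unfolding T_simps by (auto simp: \<tau>_def FMp_closed)

lemma tau_fixed: "y \<in> P.M0 \<Longrightarrow> \<tau> y \<in> carrier T \<and> FT (\<tau> y) = \<tau> y"
proof -
  assume y: "y \<in> P.M0"
  have yc: "y \<in> carrier M" "(FM ^^ r) y = y" using y P.M0_iff by blast+
  have "FT (\<tau> y) = \<tau> y"
  proof (rule T_eqI)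
    fix i assume i: "i < r"
    show "FT (\<tau> y) i = \<tau> y i"
    proof (cases "i = 0")
      case True
      have "FM ((FM ^^ (r - 1)) y) = (FM ^^ r) y" using r_pos by (cases r) (simp_all add: One_nat_def)
      then show ?thesis using True i r_pos yc(2) by (simp add: FT_apply tau_apply prev_def)
    next
      case False
      then obtain j where "i = Suc j" by (cases i) auto
      then show ?thesis using i by (simp add: FT_apply tau_apply prev_def One_nat_def)
    qed
  qed (use tau_T yc FT_closed in auto)
  then show ?thesis using tau_T yc by blast
qed

lemma fixed_tau:
  assumes x: "x \<in> carrier T" "FT x = x" shows "x 0 \<in> P.M0" "x = \<tau> (x 0)"
proof -
  have x0: "x 0 \<in> carrier M" using T_apply[OF x(1) r_pos] .
  have pw: "i < r \<Longrightarrow> x i = (FM ^^ i) (x 0)" for i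
  proof (induction i)
    case (Suc i)
    have "x (Suc i) = FM (x i)"
      using fun_cong[OF x(2), of "Suc i"] FT_apply[OF Suc.prems] by (simp add: prev_def)
    then show ?case using Suc by simp
  qed simp
  have "x 0 = FM (x (r - 1))" using fun_cong[OF x(2), of 0] FT_apply[OF r_pos] by (simp add: prev_def)
  also have "\<dots> = FM ((FM ^^ (r - 1)) (x 0))" using pw[of "r - 1"] r_pos by simp
  also have "\<dots> = (FM ^^ r) (x 0)" using r_pos by (cases r) (simp_all add: One_nat_def)
  finally show "x 0 \<in> P.M0" using x0 P.M0_iff by simp
  show "x = \<tau> (x 0)" by (rule T_eqI[OF x(1) tau_T[OF x0]]) (rule trans[OF pw tau_apply[symmetric]])
qed

abbreviation XT where "XT \<equiv> fixed_points T FT"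

lemma tau_bij: "bij_betw \<tau> (carrier P.Y) (carrier XT)"
  unfolding P.carrier_Y fixed_points_carrier[of T]
proof (rule bij_betw_byWitness[where f' = "\<lambda>x. x 0"])
  show "\<forall>y \<in> P.M0. \<tau> y 0 = y" using tau_apply[OF r_pos] by simp
  show "\<forall>x \<in> {x \<in> carrier T. FT x = x}. \<tau> (x 0) = x" using fixed_tau(2) by auto
  show "\<tau> ` P.M0 \<subseteq> {x \<in> carrier T. FT x = x}" using tau_fixed by auto
  show "(\<lambda>x. x 0) ` {x \<in> carrier T. FT x = x} \<subseteq> P.M0" using fixed_tau(1) by auto
qed

lemma tau_hom: "\<tau> \<in> module_hom P.B P.Y XT"
proof (rule module_homI; unfold P.carrier_Y P.carrier_B fixed_points_carrier[of T] fixed_points_simps)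
  show "\<tau> x \<in> {x \<in> carrier T. FT x = x}" if "x \<in> P.M0" for x using tau_fixed[OF that] by simp
  show "\<tau> (x \<oplus>\<^bsub>M\<^esub> y) = \<tau> x \<oplus>\<^bsub>T\<^esub> \<tau> y" if xy: "x \<in> P.M0" "y \<in> P.M0" for x y
  proof -
    have "x \<in> carrier M" "y \<in> carrier M" using xy P.M0_carrier by blast+
    then show ?thesis
      by (intro T_eqI T_ops_closed tau_T) (simp_all add: tau_apply T_op_apply FMp_add)
  qed
  show "\<tau> (a \<odot>\<^bsub>M\<^esub> x) = a \<odot>\<^bsub>T\<^esub> \<tau> x" if ax: "a \<in> P.AF" "x \<in> P.M0" for a x
  proof -
    have c: "a \<in> carrier A" "x \<in> carrier M" using ax P.AF_carrier P.M0_carrier by blast+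
    show ?thesis
    proof (rule T_eqI)
      show "\<tau> (a \<odot>\<^bsub>M\<^esub> x) i = (a \<odot>\<^bsub>T\<^esub> \<tau> x) i" if "i < r" for i
        using tw_image[OF c, of i] P.AF_power[OF ax(1), of i] that by (simp add: tau_apply T_op_apply)
    qed (use c M.left_smult_closed tau_T T_ops_closed in auto)
  qed
qed

sublocale TF: frobenius_space k q "base_space A T" FT
  by (rule T_frobenius_space)

lemma T_fixed_finite: "finite (TF.Fix 1)"
proof -
  have "TF.Fix 1 = carrier XT" unfolding fixed_points_carrier using TF.Fix_1 by auto
  moreover have "finite (carrier P.Y)" unfolding P.carrier_Y by (rule P.finite_M0)
  ultimately show ?thesis using bij_betw_finite[OF tau_bij] by simp
qed

text \<open>No basis of the direct sum is written down; the finite set of fixed points spans by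
  descent.\<close>

lemma T_fd: "\<exists>S. TF.spans S"
  using TF.Fix_spans[OF T_fixed_finite] by blast

lemma T_frobenius_module: "frobenius_module k q A FA T 1 FT"
  using frobenius_algebra_axioms T_left_module T_frobenius_space FT_semilinear T_fd
  by (intro frobenius_module.intro frobenius_module_axioms.intro) auto

end

section \<open>Transport along isomorphisms\<close>

lemma module_isomorphism_inverse:
  assumes M: "left_module A M" and f: "f \<in> module_hom A M N" "bij_betw f (carrier M) (carrier N)"
  shows "inv_into (carrier M) f \<in> module_hom A N M"
    "bij_betw (inv_into (carrier M) f) (carrier N) (carrier M)"
proof -
  interpret M: left_module A M by (rule M)
  note fD = module_homD[OF f(1)]
  let ?g = "inv_into (carrier M) f"
  show b: "bij_betw ?g (carrier N) (carrier M)" by (rule bij_betw_inv_into[OF f(2)])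
  have gc: "?g x \<in> carrier M" if "x \<in> carrier N" for x using bij_betwE[OF b] that by blast
  have fg: "f (?g x) = x" if "x \<in> carrier N" for x by (rule bij_betw_inv_into_right[OF f(2) that])
  have gf: "?g (f x) = x" if "x \<in> carrier M" for x by (rule bij_betw_inv_into_left[OF f(2) that])
  show "?g \<in> module_hom A N M"
  proof (rule module_homI)
    show "?g (x \<oplus>\<^bsub>N\<^esub> y) = ?g x \<oplus>\<^bsub>M\<^esub> ?g y" if "x \<in> carrier N" "y \<in> carrier N" for x y
      using gf[OF M.M.a_closed[OF gc[OF that(1)] gc[OF that(2)]]] fD(2)[OF gc[OF that(1)] gc[OF that(2)]]
        fg that by simp
    show "?g (a \<odot>\<^bsub>N\<^esub> x) = a \<odot>\<^bsub>M\<^esub> ?g x" if "a \<in> carrier A" "x \<in> carrier N" for a x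
      using gf[OF M.left_smult_closed[OF that(1) gc[OF that(2)]]] fD(3)[OF that(1) gc[OF that(2)]] fg that by simp
  qed (rule gc)
qed

lemma internal_direct_sum_image:
  assumes M: "left_module A M" and N: "left_module A N"
    and f: "f \<in> module_hom A M N" "bij_betw f (carrier M) (carrier N)"
    and ds: "internal_direct_sum A M U W"
  shows "internal_direct_sum A N (f ` U) (f ` W)"
    "f ` U = {\<zero>\<^bsub>N\<^esub>} \<Longrightarrow> U = {\<zero>\<^bsub>M\<^esub>}" "f ` W = {\<zero>\<^bsub>N\<^esub>} \<Longrightarrow> W = {\<zero>\<^bsub>M\<^esub>}"
proof -
  interpret M: left_module A M by (rule M)
  interpret N: left_module A N by (rule N)
  note fD = module_homD[OF f(1)]
  have f0: "f \<zero>\<^bsub>M\<^esub> = \<zero>\<^bsub>N\<^esub>"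
    using additive_map_zero[OF M.M.abelian_group_axioms N.M.abelian_group_axioms fD(4)] .
  have inj: "x = y" if "f x = f y" "x \<in> carrier M" "y \<in> carrier M" for x y
    using inj_onD[OF bij_betw_imp_inj_on[OF f(2)] that] .
  have U: "submodule U A M" and W: "submodule W A M" and int: "U \<inter> W = {\<zero>\<^bsub>M\<^esub>}"
    and sum: "U <+>\<^bsub>M\<^esub> W = carrier M"
    using ds by (simp_all add: internal_direct_sum_def)
  have sub: "submodule (f ` H) A N" if H: "submodule H A M" for H
  proof (rule N.left_submoduleI)
    note HD = M.submoduleD[OF H]
    show "f ` H \<subseteq> carrier N" using HD(1) fD(1) by auto
    show "\<zero>\<^bsub>N\<^esub> \<in> f ` H" using f0 HD(2) by (metis imageI)
    show "x \<oplus>\<^bsub>N\<^esub> y \<in> f ` H" if xy: "x \<in> f ` H" "y \<in> f ` H" for x y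
    proof -
      from xy obtain u v where u: "u \<in> H" "x = f u" "v \<in> H" "y = f v" by (elim imageE)
      have "u \<in> carrier M" "v \<in> carrier M" using u HD(1) by blast+
      then have "x \<oplus>\<^bsub>N\<^esub> y = f (u \<oplus>\<^bsub>M\<^esub> v)" using fD(2)[of u v] u by simp
      then show ?thesis using HD(3)[OF u(1,3)] by (rule image_eqI)
    qed
    show "a \<odot>\<^bsub>N\<^esub> x \<in> f ` H" if ax: "a \<in> carrier A" "x \<in> f ` H" for a x
    proof -
      from ax(2) obtain u where u: "u \<in> H" "x = f u" by (elim imageE)
      then have "a \<odot>\<^bsub>N\<^esub> x = f (a \<odot>\<^bsub>M\<^esub> u)" using fD(3)[OF ax(1), of u] HD(1) by auto
      then show ?thesis using HD(4)[OF ax(1) u(1)] by (rule image_eqI)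
    qed
  qed
  have UW: "U \<subseteq> carrier M" "W \<subseteq> carrier M" using M.submoduleD(1) U W by blast+
  have "f ` U \<inter> f ` W = f ` (U \<inter> W)"
    using inj_on_image_Int[OF bij_betw_imp_inj_on[OF f(2)] UW] by simp
  then have i: "f ` U \<inter> f ` W = {\<zero>\<^bsub>N\<^esub>}" using int f0 by simp
  have "carrier N \<subseteq> f ` U <+>\<^bsub>N\<^esub> f ` W"
  proof
    fix y assume "y \<in> carrier N"
    then have "y \<in> f ` carrier M" using f(2) by (simp add: bij_betw_def)
    then obtain x where x: "x \<in> carrier M" "y = f x" by (elim imageE) simp
    then have "x \<in> U <+>\<^bsub>M\<^esub> W" using sum by simp
    then obtain u w where u: "u \<in> U" "w \<in> W" "x = u \<oplus>\<^bsub>M\<^esub> w" unfolding set_add_def' by auto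
    then have "y = f u \<oplus>\<^bsub>N\<^esub> f w" using x fD(2)[of u w] UW by auto
    then show "y \<in> f ` U <+>\<^bsub>N\<^esub> f ` W" unfolding set_add_def' using u by blast
  qed
  moreover have "f ` U <+>\<^bsub>N\<^esub> f ` W \<subseteq> carrier N"
    unfolding set_add_def' using fD(1) UW by auto
  ultimately show "internal_direct_sum A N (f ` U) (f ` W)"
    unfolding internal_direct_sum_def using sub[OF U] sub[OF W] i by blast
  have z: "H = {\<zero>\<^bsub>M\<^esub>}" if H: "submodule H A M" "f ` H = {\<zero>\<^bsub>N\<^esub>}" for H
  proof -
    note HD = M.submoduleD[OF H(1)]
    have "h = \<zero>\<^bsub>M\<^esub>" if h: "h \<in> H" for h
    proof (rule inj)
      have "f h \<in> f ` H" using h by (rule imageI)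
      then show "f h = f \<zero>\<^bsub>M\<^esub>" unfolding H(2) f0 by simp
    qed (use HD(1) h in auto)
    then show ?thesis using HD(2) by blast
  qed
  show "f ` U = {\<zero>\<^bsub>N\<^esub>} \<Longrightarrow> U = {\<zero>\<^bsub>M\<^esub>}" by (rule z[OF U])
  show "f ` W = {\<zero>\<^bsub>N\<^esub>} \<Longrightarrow> W = {\<zero>\<^bsub>M\<^esub>}" by (rule z[OF W])
qed

lemma indecomposable_module_transport:
  assumes ind: "indecomposable_module k A N" and M: "fd_module k A M" and iso: "module_isomorphic A M N"
  shows "indecomposable_module k A M"
proof -
  have Mm: "left_module A M" and Nm: "left_module A N"
    using M ind by (simp_all add: indecomposable_module_def fd_module_def)
  from iso obtain f where f: "f \<in> module_hom A M N" "bij_betw f (carrier M) (carrier N)"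
    unfolding module_isomorphic_def by (elim bexE)
  interpret M: left_module A M by (rule Mm)
  interpret N: left_module A N by (rule Nm)
  have "f \<zero>\<^bsub>M\<^esub> = \<zero>\<^bsub>N\<^esub>"
    using additive_map_zero[OF M.M.abelian_group_axioms N.M.abelian_group_axioms module_homD(4)[OF f(1)]] .
  then have "carrier M \<noteq> {\<zero>\<^bsub>M\<^esub>}"
    using ind f(2) by (auto simp: indecomposable_module_def bij_betw_def)
  moreover have "U = {\<zero>\<^bsub>M\<^esub>} \<or> W = {\<zero>\<^bsub>M\<^esub>}" if "internal_direct_sum A M U W" for U W
    using internal_direct_sum_image[OF Mm Nm f that] ind unfolding indecomposable_module_def by metis
  ultimately show ?thesis unfolding indecomposable_module_def using M by blast
qed

section \<open>The endomorphism ring of the associated stable module\<close>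

context periodic_module
begin

lemma XT_left_module: "left_module P.B XT"
proof -
  interpret FT: frobenius_module k q A FA T 1 FT by (rule T_frobenius_module)
  show ?thesis by (rule FT.left_module_Y)
qed

lemma T_stable:
  assumes "Kn 1 = Fq" "card Fq = q"
  shows "F_stable_pair k Fq A FA T FT"
proof -
  have "finite_dimensional k (base_space A T)"
    using TF.finite_dimensional_iff[of k "base_space A T"] T_fd by simp
  moreover have "frobenius_map k Fq (base_space A T) FT"
    by (rule frobenius_space_map[OF T_frobenius_space assms])
  ultimately show ?thesis
    unfolding F_stable_pair_def fd_module_def using T_left_module semilinearD(4)[OF FT_semilinear]
    by (simp add: One_nat_def)
qed

lemma base_scalar_fixed:
  assumes c: "c \<in> Kn 1" shows "c \<odot>\<^bsub>A\<^esub> \<one>\<^bsub>A\<^esub> \<in> P.AF"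
  by (rule A.Fix_smult[OF c]) (simp add: A.Fix_1 FA_one)

text \<open>The residue map is transported along \<tau>. It is linear over \<open>Kn 1\<close>
  because c acts on endomorphisms through \<open>c 1_A\<close>, which corresponds to composing with
  \<open>scal c\<close>, and c is the residue of \<open>scal c\<close>.\<close>

lemma stable_End_residue_hom:
  assumes "aperiodic_module k q A FA M r (FM ^^ r)"
  shows "\<exists>h \<in> ring_hom (End_algebra P.B XT) P.L.
    h ` carrier (End_algebra P.B XT) = Kn r \<and>
    (\<forall>f \<in> carrier (End_algebra P.B XT). h f \<noteq> \<zero> \<longrightarrow> f \<in> Units (End_algebra P.B XT)) \<and>
    (\<forall>c \<in> Kn 1. \<forall>f \<in> carrier (End_algebra P.B XT). c \<odot>\<^bsub>End_algebra P.B XT\<^esub> f \<in> carrier (End_algebra P.B XT) \<and>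
       h (c \<odot>\<^bsub>End_algebra P.B XT\<^esub> f) = c \<otimes> h f)"
proof -
  interpret Q: aperiodic_module k q A FA M r "FM ^^ r" by fact
  let ?E = "End_algebra P.B XT"
  interpret X: left_module P.B XT by (rule XT_left_module)
  interpret E: ring P.E by (rule P.ring_E)
  note tD = module_homD[OF tau_hom]
  from Q.residue_hom obtain h where h: "h \<in> ring_hom P.E P.L" "\<forall>c\<in>Kn r. h (P.scal c) = c"
    "\<forall>f\<in>carrier P.E. h f \<noteq> \<zero> \<longrightarrow> f \<in> Units P.E"
    by (elim bexE conjE)
  from End_algebra_transport[OF XT_left_module P.left_module_Y tau_hom tau_bij]
  obtain \<Phi> where \<Phi>: "\<Phi> \<in> ring_hom ?E P.E" "\<Phi> ` carrier ?E = carrier P.E"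
    "\<forall>f \<in> carrier ?E. \<forall>y \<in> carrier P.Y. \<tau> (\<Phi> f y) = f (\<tau> y)"
    by (elim bexE conjE)
  have tinj: "x = y" if "\<tau> x = \<tau> y" "x \<in> carrier P.Y" "y \<in> carrier P.Y" for x y
    using inj_onD[OF bij_betw_imp_inj_on[OF tau_bij] that] .
  have \<Phi>E: "\<Phi> f \<in> carrier P.E" if "f \<in> carrier ?E" for f using \<Phi>(2) that by blast
  have \<Phi>c: "\<Phi> f y \<in> carrier P.Y" if "f \<in> carrier ?E" "y \<in> carrier P.Y" for f y
    using \<Phi>E[OF that(1)] module_homD(1)[of "\<Phi> f" P.B P.Y P.Y] that(2) by (simp add: P.E_carrier)
  have hom: "h \<circ> \<Phi> \<in> ring_hom ?E P.L" by (rule ring_hom_trans[OF \<Phi>(1) h(1)])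
  have surj: "(h \<circ> \<Phi>) ` carrier ?E = Kn r"
  proof
    show "(h \<circ> \<Phi>) ` carrier ?E \<subseteq> Kn r" using ring_hom_closed[OF hom] by auto
    show "Kn r \<subseteq> (h \<circ> \<Phi>) ` carrier ?E"
    proof
      fix c assume c: "c \<in> Kn r"
      then have "P.scal c \<in> \<Phi> ` carrier ?E" using P.scal_E \<Phi>(2) by simp
      then obtain f where f: "f \<in> carrier ?E" "\<Phi> f = P.scal c" by (elim imageE) simp
      then have "c = (h \<circ> \<Phi>) f" using h(2) c by simp
      then show "c \<in> (h \<circ> \<Phi>) ` carrier ?E" using f(1) by (rule image_eqI)
    qed
  qed
  have units: "f \<in> Units ?E" if f: "f \<in> carrier ?E" "(h \<circ> \<Phi>) f \<noteq> \<zero>" for f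
  proof (rule End_algebra_Units[OF XT_left_module f(1)])
    have "\<Phi> f \<in> Units P.E" using h(3) \<Phi>E[OF f(1)] f(2) by simp
    then have "bij_betw (\<Phi> f) (carrier P.Y) (carrier P.Y)" by (rule End_algebra_Units_bij[OF P.left_module_Y])
    then have "bij_betw (\<tau> \<circ> \<Phi> f) (carrier P.Y) (carrier XT)" using tau_bij by (rule bij_betw_trans)
    then have "bij_betw (f \<circ> \<tau>) (carrier P.Y) (carrier XT)"
      using bij_betw_cong[of "carrier P.Y" "\<tau> \<circ> \<Phi> f" "f \<circ> \<tau>" "carrier XT"] \<Phi>(3) f(1) by simp
    then show "bij_betw f (carrier XT) (carrier XT)"
      using bij_betw_comp_iff[OF tau_bij] by blast
  qed
  have smult: "c \<odot>\<^bsub>?E\<^esub> f \<in> carrier ?E \<and> (h \<circ> \<Phi>) (c \<odot>\<^bsub>?E\<^esub> f) = c \<otimes> (h \<circ> \<Phi>) f"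
    if c: "c \<in> Kn 1" and f: "f \<in> carrier ?E" for c f
  proof -
    define b where "b = c \<odot>\<^bsub>A\<^esub> \<one>\<^bsub>A\<^esub>"
    have bB: "b \<in> carrier P.B" unfolding b_def P.carrier_B by (rule base_scalar_fixed[OF c])
    have ck: "c \<in> carrier k" using c by (simp add: Kn_def)
    have cr: "c \<in> Kn r" using Kn_dvd[of c 1 r] c by simp
    have fh: "f \<in> module_hom P.B XT XT" using f by (simp add: End_algebra_simps(1))
    note fD = module_homD[OF fh]
    have bcomm: "b \<odot>\<^bsub>XT\<^esub> (a \<odot>\<^bsub>XT\<^esub> x) = a \<odot>\<^bsub>XT\<^esub> (b \<odot>\<^bsub>XT\<^esub> x)"
      if "a \<in> carrier P.B" "x \<in> carrier XT" for a x
      using smult_base(2)[OF T_left_module ck, of a x] that P.AF_carrier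
      by (simp add: b_def base_space_smult P.carrier_B fixed_points_carrier[of T])
    have cf: "c \<odot>\<^bsub>?E\<^esub> f = restrict (\<lambda>x. b \<odot>\<^bsub>XT\<^esub> f x) (carrier XT)"
      by (simp add: End_algebra_simps(6) b_def)
    have cfE: "c \<odot>\<^bsub>?E\<^esub> f \<in> carrier ?E"
      unfolding cf
    proof (rule restrict_in_End[OF XT_left_module], rule module_homI)
      show "b \<odot>\<^bsub>XT\<^esub> f x \<in> carrier XT" if "x \<in> carrier XT" for x
        by (rule X.left_smult_closed[OF bB fD(1)[OF that]])
      show "b \<odot>\<^bsub>XT\<^esub> f (x \<oplus>\<^bsub>XT\<^esub> y) = b \<odot>\<^bsub>XT\<^esub> f x \<oplus>\<^bsub>XT\<^esub> b \<odot>\<^bsub>XT\<^esub> f y"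
        if "x \<in> carrier XT" "y \<in> carrier XT" for x y
        unfolding fD(2)[OF that] by (rule X.left_smult_r_distr[OF bB fD(1)[OF that(1)] fD(1)[OF that(2)]])
      show "b \<odot>\<^bsub>XT\<^esub> f (a \<odot>\<^bsub>XT\<^esub> x) = a \<odot>\<^bsub>XT\<^esub> (b \<odot>\<^bsub>XT\<^esub> f x)"
        if "a \<in> carrier P.B" "x \<in> carrier XT" for a x
        unfolding fD(3)[OF that] by (rule bcomm[OF that(1) fD(1)[OF that(2)]])
    qed
    have "\<Phi> (c \<odot>\<^bsub>?E\<^esub> f) = P.scal c \<otimes>\<^bsub>P.E\<^esub> \<Phi> f"
    proof (rule P.E_eqI[OF \<Phi>E[OF cfE] E.m_closed[OF P.scal_E[OF cr] \<Phi>E[OF f]]])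
      fix y assume "y \<in> P.M0"
      then have y: "y \<in> carrier P.Y" unfolding P.carrier_Y .
      have "\<tau> (\<Phi> (c \<odot>\<^bsub>?E\<^esub> f) y) = b \<odot>\<^bsub>XT\<^esub> f (\<tau> y)"
        using \<Phi>(3) cfE y tD(1)[OF y] by (simp add: cf)
      also have "\<dots> = \<tau> (b \<odot>\<^bsub>P.Y\<^esub> \<Phi> f y)" using tD(3)[OF bB \<Phi>c[OF f y]] \<Phi>(3) f y by simp
      finally have e: "\<Phi> (c \<odot>\<^bsub>?E\<^esub> f) y = b \<odot>\<^bsub>P.Y\<^esub> \<Phi> f y"
        by (rule tinj[OF _ \<Phi>c[OF cfE y] left_module.left_smult_closed[OF P.left_module_Y bB \<Phi>c[OF f y]]])
      have "(P.scal c \<otimes>\<^bsub>P.E\<^esub> \<Phi> f) y = P.scal c (\<Phi> f y)" using P.E_ops(1)[of y] y P.carrier_Y by simp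
      also have "\<dots> = b \<odot>\<^bsub>P.Y\<^esub> \<Phi> f y"
        using P.scal_apply[of "\<Phi> f y" c] \<Phi>c[OF f y] unfolding P.carrier_Y by (simp add: base_space_smult b_def)
      finally show "\<Phi> (c \<odot>\<^bsub>?E\<^esub> f) y = (P.scal c \<otimes>\<^bsub>P.E\<^esub> \<Phi> f) y" using e by simp
    qed
    then have "h (\<Phi> (c \<odot>\<^bsub>?E\<^esub> f)) = h (P.scal c) \<otimes>\<^bsub>P.L\<^esub> h (\<Phi> f)"
      using ring_hom_mult[OF h(1) P.scal_E[OF cr] \<Phi>E[OF f]] by simp
    then show ?thesis using cfE h(2) cr by simp
  qed
  show ?thesis using hom surj units smult by blast
qed

text \<open>\<open>FT\<close> maps U and W into themselves, so uniqueness of components makes the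
  components of a fixed vector fixed. A stable summand whose fixed points are zero is zero by
  descent.\<close>

lemma fixed_decomposition:
  assumes card: "card Fq = q" and ds: "internal_direct_sum A T U W"
    and U: "F_stable_pair k Fq A FA (T\<lparr>carrier := U\<rparr>) FT" and W: "F_stable_pair k Fq A FA (T\<lparr>carrier := W\<rparr>) FT"
  defines "fixed \<equiv> (\<lambda>H. {x \<in> H. FT x = x})"
  shows "internal_direct_sum P.B XT (fixed U) (fixed W)"
    "fixed U = {\<zero>\<^bsub>XT\<^esub>} \<Longrightarrow> U = {\<zero>\<^bsub>T\<^esub>}" "fixed W = {\<zero>\<^bsub>XT\<^esub>} \<Longrightarrow> W = {\<zero>\<^bsub>T\<^esub>}"
proof -
  interpret T: left_module A T by (rule T_left_module)
  interpret X: left_module P.B XT by (rule XT_left_module)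
  have Us: "submodule U A T" and Ws: "submodule W A T" and int: "U \<inter> W = {\<zero>\<^bsub>T\<^esub>}"
    and sum: "U <+>\<^bsub>T\<^esub> W = carrier T"
    using ds by (simp_all add: internal_direct_sum_def)
  note UD = T.submoduleD[OF Us] and WD = T.submoduleD[OF Ws]
  have sp: "frobenius_space k q (base_space A (T\<lparr>carrier := H\<rparr>)) FT"
    if "F_stable_pair k Fq A FA (T\<lparr>carrier := H\<rparr>) FT" for H
    using frobenius_map_space[of k Fq "base_space A (T\<lparr>carrier := H\<rparr>)" FT] that card frobenius_field_axioms
    by (simp add: F_stable_pair_def)
  have FH: "FT x \<in> H" if H: "F_stable_pair k Fq A FA (T\<lparr>carrier := H\<rparr>) FT" "x \<in> H" for H x
  proof -
    interpret S: frobenius_space k q "base_space A (T\<lparr>carrier := H\<rparr>)" FT by (rule sp[OF H(1)])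
    show ?thesis using bij_betwE[OF S.F_bij] H(2) by simp
  qed
  have FTadd: "FT (x \<oplus>\<^bsub>T\<^esub> y) = FT x \<oplus>\<^bsub>T\<^esub> FT y" if "x \<in> carrier T" "y \<in> carrier T" for x y
    using semilinearD(3)[OF FT_semilinear that] .
  have XTc: "x \<in> carrier XT \<longleftrightarrow> x \<in> carrier T \<and> FT x = x" for x by (simp add: fixed_points_carrier[of T])
  have sub: "submodule (fixed H) P.B XT" if H: "submodule H A T" for H
  proof (rule X.left_submoduleI)
    note HD = T.submoduleD[OF H]
    show "fixed H \<subseteq> carrier XT" using HD(1) by (auto simp: fixed_def XTc)
    show "\<zero>\<^bsub>XT\<^esub> \<in> fixed H" using HD(2) X.M.zero_closed by (simp add: fixed_def XTc)
    show "x \<oplus>\<^bsub>XT\<^esub> y \<in> fixed H" if xy: "x \<in> fixed H" "y \<in> fixed H" for x y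
    proof -
      have c: "x \<in> carrier T" "y \<in> carrier T" using xy HD(1) by (auto simp: fixed_def)
      show ?thesis using xy HD(3)[of x y] FTadd[OF c] by (simp add: fixed_def)
    qed
    show "a \<odot>\<^bsub>XT\<^esub> x \<in> fixed H" if ax: "a \<in> carrier P.B" "x \<in> fixed H" for a x
    proof -
      have "x \<in> carrier XT" using ax(2) HD(1) by (auto simp: fixed_def XTc)
      from X.left_smult_closed[OF ax(1) this] have "FT (a \<odot>\<^bsub>T\<^esub> x) = a \<odot>\<^bsub>T\<^esub> x" by (simp add: XTc)
      moreover have "a \<in> carrier A" using ax(1) P.AF_carrier by (simp add: P.carrier_B)
      ultimately show ?thesis using HD(4) ax(2) by (simp add: fixed_def)
    qed
  qed
  have "carrier XT \<subseteq> fixed U <+>\<^bsub>XT\<^esub> fixed W"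
  proof
    fix x assume x: "x \<in> carrier XT"
    then have "x \<in> U <+>\<^bsub>T\<^esub> W" unfolding sum XTc by blast
    then obtain u w where u: "u \<in> U" "w \<in> W" "x = u \<oplus>\<^bsub>T\<^esub> w" unfolding set_add_def' by auto
    \<comment> \<open>The projection to U separates the components of x = u + w and of
      \<open>FT x = FT u + FT w\<close>.\<close>
    from direct_sum_projection[OF T_left_module ds] obtain e where
      e: "e \<in> module_hom A T T" "\<forall>u \<in> U. e u = u" "\<forall>w \<in> W. e w = \<zero>\<^bsub>T\<^esub>" by (elim exE bexE conjE)
    have c: "u \<in> carrier T" "w \<in> carrier T" "FT u \<in> U" "FT w \<in> W"
      using u UD(1) WD(1) FH[OF U] FH[OF W] by auto
    then have Fc: "FT u \<in> carrier T" "FT w \<in> carrier T" using UD(1) WD(1) by auto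
    have eq: "u \<oplus>\<^bsub>T\<^esub> w = FT u \<oplus>\<^bsub>T\<^esub> FT w" using x u(3) FTadd[OF c(1,2)] by (simp add: XTc)
    then have "e u \<oplus>\<^bsub>T\<^esub> e w = e (FT u) \<oplus>\<^bsub>T\<^esub> e (FT w)"
      using module_homD(2)[OF e(1) c(1,2)] module_homD(2)[OF e(1) Fc] by simp
    then have Fu: "FT u = u" using e(2,3) u c Fc by simp
    then have "FT w = w" using eq c Fc by simp
    then show "x \<in> fixed U <+>\<^bsub>XT\<^esub> fixed W"
      unfolding set_add_def' using Fu u by (auto simp: fixed_def)
  qed
  moreover have "fixed U <+>\<^bsub>XT\<^esub> fixed W \<subseteq> carrier XT"
  proof
    fix x assume "x \<in> fixed U <+>\<^bsub>XT\<^esub> fixed W"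
    then obtain u w where u: "u \<in> fixed U" "w \<in> fixed W" "x = u \<oplus>\<^bsub>XT\<^esub> w" unfolding set_add_def' by auto
    then show "x \<in> carrier XT" using X.M.a_closed X.submoduleD(1)[OF sub[OF Us]] X.submoduleD(1)[OF sub[OF Ws]] by blast
  qed
  moreover have "fixed U \<inter> fixed W = {\<zero>\<^bsub>XT\<^esub>}"
    using X.submoduleD(2)[OF sub[OF Us]] X.submoduleD(2)[OF sub[OF Ws]] int by (auto simp: fixed_def)
  ultimately show "internal_direct_sum P.B XT (fixed U) (fixed W)"
    unfolding internal_direct_sum_def using sub[OF Us] sub[OF Ws] by blast
  have z: "H = {\<zero>\<^bsub>T\<^esub>}" if H: "F_stable_pair k Fq A FA (T\<lparr>carrier := H\<rparr>) FT" "fixed H = {\<zero>\<^bsub>XT\<^esub>}" "submodule H A T" for H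
  proof -
    interpret S: frobenius_space k q "base_space A (T\<lparr>carrier := H\<rparr>)" FT by (rule sp[OF H(1)])
    have "v = \<zero>\<^bsub>T\<^esub>" if v: "v \<in> H" for v
    proof -
      have "v \<in> carrier (base_space A (T\<lparr>carrier := H\<rparr>))" using v by simp
      then show ?thesis
      proof (induction v rule: S.fix_induct)
        case (fixed v)
        then have "v \<in> fixed H" using S.Fix_1[of v] by (simp add: \<open>fixed \<equiv> \<lambda>H. {x \<in> H. FT x = x}\<close>)
        then show ?case unfolding H(2) by simp
      next
        case (add v w)
        then show ?case using S.V.M.r_zero[OF S.V.M.zero_closed] by simp
      next
        case (smult c v)
        then show ?case using S.V.smult_r_null[of c] by simp
      qed
    qed
    then show ?thesis using T.submoduleD(2)[OF H(3)] by blast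
  qed
  show "fixed U = {\<zero>\<^bsub>XT\<^esub>} \<Longrightarrow> U = {\<zero>\<^bsub>T\<^esub>}" by (rule z[OF U _ Us])
  show "fixed W = {\<zero>\<^bsub>XT\<^esub>} \<Longrightarrow> W = {\<zero>\<^bsub>T\<^esub>}" by (rule z[OF W _ Ws])
qed

theorem stable_module_residue_field:
  assumes ap: "aperiodic_module k q A FA M r (FM ^^ r)" and Fq: "Kn 1 = Fq" "card Fq = q"
  shows "F_indecomposable k Fq A FA T FT"
    "residue_algebra_iso Fq (End_algebra P.B XT) (k\<lparr>carrier := {x \<in> carrier k. x [^] (q ^ r) = x}\<rparr>)"
proof -
  interpret Q: aperiodic_module k q A FA M r "FM ^^ r" by (rule ap)
  let ?E = "End_algebra P.B XT"
  have L: "k\<lparr>carrier := {x \<in> carrier k. x [^] (q ^ r) = x}\<rparr> = P.L" by (simp add: Kn_def)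
  from stable_End_residue_hom[OF ap] obtain h where h: "h \<in> ring_hom ?E P.L" "h ` carrier ?E = Kn r"
    "\<forall>f \<in> carrier ?E. h f \<noteq> \<zero> \<longrightarrow> f \<in> Units ?E"
    "\<forall>c \<in> Kn 1. \<forall>f \<in> carrier ?E. c \<odot>\<^bsub>?E\<^esub> f \<in> carrier ?E \<and> h (c \<odot>\<^bsub>?E\<^esub> f) = c \<otimes> h f"
    by (elim bexE conjE)
  show "residue_algebra_iso Fq ?E (k\<lparr>carrier := {x \<in> carrier k. x [^] (q ^ r) = x}\<rparr>)"
    unfolding L
  proof (rule residue_algebra_isoI[OF End_algebra_ring[OF XT_left_module] Kn_field h(1)])
    show "f \<in> Units ?E" if "f \<in> carrier ?E" "h f \<noteq> \<zero>\<^bsub>P.L\<^esub>" for f using h(3) that by simp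
    show "c \<odot>\<^bsub>?E\<^esub> f \<in> carrier ?E \<and> h (c \<odot>\<^bsub>?E\<^esub> f) = c \<otimes>\<^bsub>P.L\<^esub> h f" if "c \<in> Fq" "f \<in> carrier ?E" for c f
      using h(4) that Fq(1) by simp
  qed (use h(2) in simp)
  obtain y where y: "y \<in> P.M0" "y \<noteq> \<zero>\<^bsub>M\<^esub>" using Q.M0_nonzero P.M0_zero by blast
  have "\<tau> y 0 \<noteq> \<zero>\<^bsub>T\<^esub> 0" using y tau_apply[OF r_pos] r_pos by (simp add: T_op_apply)
  then have "\<tau> y \<noteq> \<zero>\<^bsub>T\<^esub>" by metis
  then have nz: "carrier T \<noteq> {\<zero>\<^bsub>T\<^esub>}" using tau_fixed[OF y(1)] by blast
  have "U = {\<zero>\<^bsub>T\<^esub>} \<or> W = {\<zero>\<^bsub>T\<^esub>}"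
    if UW: "internal_direct_sum A T U W" "F_stable_pair k Fq A FA (T\<lparr>carrier := U\<rparr>) FT"
      "F_stable_pair k Fq A FA (T\<lparr>carrier := W\<rparr>) FT" for U W
  proof -
    note d = fixed_decomposition[OF Fq(2) UW]
    have "{x \<in> U. FT x = x} = {\<zero>\<^bsub>XT\<^esub>} \<or> {x \<in> W. FT x = x} = {\<zero>\<^bsub>XT\<^esub>}"
    proof (rule indecomposable_of_residue_hom[OF XT_left_module Kn_field h(1) _ d(1)])
      show "f \<in> Units ?E" if "f \<in> carrier ?E" "h f \<noteq> \<zero>\<^bsub>P.L\<^esub>" for f using h(3) that by simp
    qed
    then show ?thesis using d(2,3) by blast
  qed
  then show "F_indecomposable k Fq A FA T FT"
    unfolding F_indecomposable_def using T_stable[OF Fq] nz by blast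
qed

end

section \<open>From a period to aperiodicity\<close>

locale frobenius_setting = frobenius_algebra k q A FA
  for k :: "'k ring" (structure) and q and A :: "('k, 'a) module" and FA +
  fixes Fq
  assumes Kn_1: "Kn 1 = Fq" and card_Fq: "card Fq = q" and ac: "algebraically_closed k"
begin

text \<open>M and \<open>M'\<close> share the underlying vector space, so \<open>FM\<close> is a
  Frobenius map for both. A bijective semilinear map of degree s on \<open>M'\<close>, conjugated by
  the isomorphism with M, would show that s is at least the period.\<close>

lemma aperiodic_structure:
  assumes ind: "indecomposable_module k A M" and FM: "frobenius_map k Fq (base_space A M) FM"
    and per: "is_F_period A FA M FM r" and ps: "periodic_structure k A FA M FM r M'"
  shows "periodic_module k q A FA M' FM r" "aperiodic_module k q A FA M' r (FM ^^ r)"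
proof -
  have Mm: "left_module A M" using ind by (simp add: indecomposable_module_def fd_module_def)
  have fd: "fd_module k A M'" and cM: "carrier M' = carrier M" and zM: "\<zero>\<^bsub>M'\<^esub> = \<zero>\<^bsub>M\<^esub>"
    and aM: "\<And>x y. \<lbrakk>x \<in> carrier M; y \<in> carrier M\<rbrakk> \<Longrightarrow> x \<oplus>\<^bsub>M'\<^esub> y = x \<oplus>\<^bsub>M\<^esub> y"
    and sM: "\<And>c x. \<lbrakk>c \<in> carrier k; x \<in> carrier M\<rbrakk> \<Longrightarrow> c \<odot>\<^bsub>base_space A M'\<^esub> x = c \<odot>\<^bsub>base_space A M\<^esub> x"
    and iso: "module_isomorphic A M' M"
    and tw: "\<And>a x. \<lbrakk>a \<in> carrier A; x \<in> carrier M\<rbrakk> \<Longrightarrow> a \<odot>\<^bsub>iterated_twist A FA FM r M'\<^esub> x = a \<odot>\<^bsub>M'\<^esub> x"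
    using ps by (simp_all add: periodic_structure_def)
  have M'm: "left_module A M'" using fd by (simp add: fd_module_def)
  interpret S: frobenius_space k q "base_space A M" FM
    using frobenius_map_space[of k Fq "base_space A M" FM] FM frobenius_field_axioms card_Fq by simp
  have FMc: "FM x \<in> carrier M" if "x \<in> carrier M" for x using bij_betwE[OF S.F_bij] that by simp
  have Fadd: "additive_map M M FM" using S.F_additive by (simp add: additive_map_base_space)
  have sp: "frobenius_space k q (base_space A M') FM"
  proof (intro frobenius_space.intro frobenius_space_axioms.intro)
    show "frobenius_field k q" by (rule frobenius_field_axioms)
    show "module k (base_space A M')" by (rule base_module[OF M'm])
    show "additive_map (base_space A M') (base_space A M') FM"
      using Fadd by (simp add: additive_map_def cM aM Pi_iff)
    show "FM (c \<odot>\<^bsub>base_space A M'\<^esub> v) = (c [^] q) \<odot>\<^bsub>base_space A M'\<^esub> FM v"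
      if "c \<in> carrier k" "v \<in> carrier (base_space A M')" for c v
      using that S.F_smult[of c v] sM[of c v] sM[of "c [^] q" "FM v"] FMc[of v] by (simp add: cM)
    show "\<exists>n>0. (FM ^^ n) v = v" if "v \<in> carrier (base_space A M')" for v
      using that S.F_periodic[of v] by (simp add: cM)
  qed
  interpret S': frobenius_space k q "base_space A M'" FM by (rule sp)
  have spans: "\<exists>H. S'.spans H"
    using S'.finite_dimensional_iff[of k "base_space A M'"] fd by (simp add: fd_module_def)
  have r: "r \<ge> 1" using per by (simp add: is_F_period_def)
  show pm: "periodic_module k q A FA M' FM r"
    using frobenius_algebra_axioms M'm sp r tw spans
    by (intro periodic_module.intro periodic_module_axioms.intro) (auto simp: cM)
  interpret pm: periodic_module k q A FA M' FM r by (rule pm)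
  from iso obtain \<phi> where \<phi>: "\<phi> \<in> module_hom A M' M" "bij_betw \<phi> (carrier M') (carrier M)"
    unfolding module_isomorphic_def by (elim bexE)
  note \<psi> = module_isomorphism_inverse[OF M'm \<phi>]
  show "aperiodic_module k q A FA M' r (FM ^^ r)"
  proof (intro aperiodic_module.intro aperiodic_module_axioms.intro)
    show "frobenius_module k q A FA M' r (FM ^^ r)" by (rule pm.P.frobenius_module_axioms)
    show "algebraically_closed k" by (rule ac)
    show "indecomposable_module k A M'" by (rule indecomposable_module_transport[OF ind fd iso])
    fix s f assume s: "0 < s" "s < r" and f: "semilinear s M' M' f"
    show "\<not> bij_betw f (carrier M') (carrier M')"
    proof
      assume b: "bij_betw f (carrier M') (carrier M')"
      let ?g = "\<lambda>x. \<phi> (f (inv_into (carrier M') \<phi> x))"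
      have "semilinear (0 + (s + 0)) M M ?g"
        by (rule semilinear_compose[OF _ semilinear_compose[OF f]]) (simp_all add: semilinear_0_hom \<phi>(1) \<psi>(1))
      moreover have "bij_betw ?g (carrier M) (carrier M)"
        using bij_betw_trans[OF bij_betw_trans[OF \<psi>(2) b] \<phi>(2)] by (simp add: comp_def)
      moreover have "bij_betw FM (carrier M) (carrier M)" using S.F_bij by simp
      ultimately have "module_isomorphic A (iterated_twist A FA FM s M) M"
        using twist_isomorphic_iff[OF Mm _ Fadd, of s] by auto
      then have "r \<le> s" using per s by (simp add: is_F_period_def)
      then show False using s by simp
    qed
  qed
qed

end

section \<open>Extending a module over the fixed algebra to a stable module\<close>

text \<open>V with F is a model of \<open>k \<otimes> N\<close>, and \<kappa> identifies its fixed
  points with N. The action of \<open>A\<close> is obtained in two extensions: \<open>E\<close>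
  extends each element of \<open>A^F\<close> from the fixed vectors to V, and \<open>act\<close>
  extends from \<open>A^F\<close> to \<open>A\<close> for each vector.\<close>

locale descent_module = frobenius_algebra k q A FA + F: frobenius_space k q V F +
    N: left_module "fixed_points A FA" N
  for k :: "'k ring" (structure) and q and A :: "('k, 'a) module" and FA
    and V :: "('k, 'v) module" and F and N :: "('a, 'n) module" +
  fixes \<kappa> :: "'v \<Rightarrow> 'n"
  assumes kappa_bij: "bij_betw \<kappa> (F.Fix 1) (carrier N)"
    and kappa_add: "\<lbrakk>x \<in> F.Fix 1; y \<in> F.Fix 1\<rbrakk> \<Longrightarrow> \<kappa> (x \<oplus>\<^bsub>V\<^esub> y) = \<kappa> x \<oplus>\<^bsub>N\<^esub> \<kappa> y"
    and kappa_smult: "\<lbrakk>c \<in> Kn 1; x \<in> F.Fix 1\<rbrakk> \<Longrightarrow> \<kappa> (c \<odot>\<^bsub>V\<^esub> x) = (c \<odot>\<^bsub>A\<^esub> \<one>\<^bsub>A\<^esub>) \<odot>\<^bsub>N\<^esub> \<kappa> x"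
begin

text \<open>The action on N, transported to the fixed vectors by \<kappa>.\<close>

definition D :: "'a \<Rightarrow> 'v \<Rightarrow> 'v" where
  "D b x = inv_into (F.Fix 1) \<kappa> (b \<odot>\<^bsub>N\<^esub> \<kappa> x)"

lemma carrier_fixed: "carrier (fixed_points A FA) = A.Fix 1"
  unfolding fixed_points_carrier using A.Fix_1 by auto

lemma kappa_closed: "x \<in> F.Fix 1 \<Longrightarrow> \<kappa> x \<in> carrier N"
  using bij_betwE[OF kappa_bij] by blast

lemma kappa_inj: "\<lbrakk>\<kappa> x = \<kappa> y; x \<in> F.Fix 1; y \<in> F.Fix 1\<rbrakk> \<Longrightarrow> x = y"
  using inj_onD[OF bij_betw_imp_inj_on[OF kappa_bij]] by blast

lemma N_closed: "\<lbrakk>b \<in> A.Fix 1; n \<in> carrier N\<rbrakk> \<Longrightarrow> b \<odot>\<^bsub>N\<^esub> n \<in> carrier N"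
  using N.left_smult_closed unfolding carrier_fixed .

lemma D_Fix: "\<lbrakk>b \<in> A.Fix 1; x \<in> F.Fix 1\<rbrakk> \<Longrightarrow> D b x \<in> F.Fix 1"
  unfolding D_def using bij_betwE[OF bij_betw_inv_into[OF kappa_bij]] N_closed[OF _ kappa_closed] by blast

lemma kappa_D: "\<lbrakk>b \<in> A.Fix 1; x \<in> F.Fix 1\<rbrakk> \<Longrightarrow> \<kappa> (D b x) = b \<odot>\<^bsub>N\<^esub> \<kappa> x"
  unfolding D_def by (rule bij_betw_inv_into_right[OF kappa_bij]) (rule N_closed[OF _ kappa_closed])

lemma D_eqI: "\<lbrakk>b \<in> A.Fix 1; x \<in> F.Fix 1; y \<in> F.Fix 1; \<kappa> y = b \<odot>\<^bsub>N\<^esub> \<kappa> x\<rbrakk> \<Longrightarrow> D b x = y"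
  by (rule kappa_inj) (simp_all add: kappa_D D_Fix)

lemma scalar_Fix: "c \<in> Kn 1 \<Longrightarrow> c \<odot>\<^bsub>A\<^esub> \<one>\<^bsub>A\<^esub> \<in> A.Fix 1"
  by (rule A.Fix_smult) (simp_all add: A.Fix_1 FA_one)

lemma scalar_mult:
  "\<lbrakk>c \<in> carrier k; b \<in> carrier A\<rbrakk> \<Longrightarrow> (c \<odot>\<^bsub>A\<^esub> \<one>\<^bsub>A\<^esub>) \<otimes>\<^bsub>A\<^esub> b = c \<odot>\<^bsub>A\<^esub> b"
  "\<lbrakk>c \<in> carrier k; b \<in> carrier A\<rbrakk> \<Longrightarrow> b \<otimes>\<^bsub>A\<^esub> (c \<odot>\<^bsub>A\<^esub> \<one>\<^bsub>A\<^esub>) = c \<odot>\<^bsub>A\<^esub> b"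
  by (simp_all add: AA.smult_mult_left AA.smult_mult_right)

lemma D_add_left:
  "\<lbrakk>b \<in> A.Fix 1; c \<in> A.Fix 1; x \<in> F.Fix 1\<rbrakk> \<Longrightarrow> D (b \<oplus>\<^bsub>A\<^esub> c) x = D b x \<oplus>\<^bsub>V\<^esub> D c x"
  using N.left_smult_l_distr[unfolded carrier_fixed, of b c "\<kappa> x"]
  by (intro D_eqI) (simp_all add: A.Fix_add F.Fix_add D_Fix kappa_add kappa_D kappa_closed)

lemma D_add: "\<lbrakk>b \<in> A.Fix 1; x \<in> F.Fix 1; y \<in> F.Fix 1\<rbrakk> \<Longrightarrow> D b (x \<oplus>\<^bsub>V\<^esub> y) = D b x \<oplus>\<^bsub>V\<^esub> D b y"
  using N.left_smult_r_distr[unfolded carrier_fixed, of b "\<kappa> x" "\<kappa> y"]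
  by (intro D_eqI) (simp_all add: F.Fix_add D_Fix kappa_add kappa_D kappa_closed)

lemma D_smult_left:
  assumes c: "c \<in> Kn 1" and b: "b \<in> A.Fix 1" and x: "x \<in> F.Fix 1"
  shows "D (c \<odot>\<^bsub>A\<^esub> b) x = c \<odot>\<^bsub>V\<^esub> D b x"
proof (rule D_eqI[OF A.Fix_smult[OF c b] x F.Fix_smult[OF c D_Fix[OF b x]]])
  show "\<kappa> (c \<odot>\<^bsub>V\<^esub> D b x) = (c \<odot>\<^bsub>A\<^esub> b) \<odot>\<^bsub>N\<^esub> \<kappa> x"
    using N.left_smult_assoc[unfolded carrier_fixed, OF scalar_Fix[OF c] b kappa_closed[OF x]]
      scalar_mult(1)[of c b] c Kn_carrier A.Fix_carrier[OF b]
    by (simp add: kappa_smult[OF c D_Fix[OF b x]] kappa_D[OF b x])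
qed

lemma D_smult:
  assumes c: "c \<in> Kn 1" and b: "b \<in> A.Fix 1" and x: "x \<in> F.Fix 1"
  shows "D b (c \<odot>\<^bsub>V\<^esub> x) = c \<odot>\<^bsub>V\<^esub> D b x"
proof (rule D_eqI[OF b F.Fix_smult[OF c x] F.Fix_smult[OF c D_Fix[OF b x]]])
  have ck: "c \<in> carrier k" using c Kn_carrier by blast
  have "(c \<odot>\<^bsub>A\<^esub> \<one>\<^bsub>A\<^esub>) \<odot>\<^bsub>N\<^esub> (b \<odot>\<^bsub>N\<^esub> \<kappa> x) = (c \<odot>\<^bsub>A\<^esub> b) \<odot>\<^bsub>N\<^esub> \<kappa> x"
    using N.left_smult_assoc[unfolded carrier_fixed, OF scalar_Fix[OF c] b kappa_closed[OF x]]
      scalar_mult(1)[OF ck A.Fix_carrier[OF b]] by simp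
  also have "\<dots> = b \<odot>\<^bsub>N\<^esub> ((c \<odot>\<^bsub>A\<^esub> \<one>\<^bsub>A\<^esub>) \<odot>\<^bsub>N\<^esub> \<kappa> x)"
    using N.left_smult_assoc[unfolded carrier_fixed, OF b scalar_Fix[OF c] kappa_closed[OF x]]
      scalar_mult(2)[OF ck A.Fix_carrier[OF b]] by simp
  finally show "\<kappa> (c \<odot>\<^bsub>V\<^esub> D b x) = b \<odot>\<^bsub>N\<^esub> \<kappa> (c \<odot>\<^bsub>V\<^esub> x)"
    by (simp add: kappa_smult[OF c D_Fix[OF b x]] kappa_D[OF b x] kappa_smult[OF c x])
qed

definition linear_map where
  "linear_map W f \<longleftrightarrow> additive_map W V f \<and>
     (\<forall>c \<in> carrier k. \<forall>v \<in> carrier W. f (c \<odot>\<^bsub>W\<^esub> v) = c \<odot>\<^bsub>V\<^esub> f v)"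

lemma pow_1: "c \<in> carrier k \<Longrightarrow> c [^] (1::nat) = c"
  by simp

lemma ex_E: "b \<in> A.Fix 1 \<Longrightarrow> \<exists>f. linear_map V f \<and> (\<forall>x \<in> F.Fix 1. f x = D b x)"
proof -
  assume b: "b \<in> A.Fix 1"
  have "\<exists>f. additive_map V V f \<and>
      (\<forall>c \<in> carrier k. \<forall>v \<in> carrier V. f (c \<odot>\<^bsub>V\<^esub> v) = (c [^] (1::nat)) \<odot>\<^bsub>V\<^esub> f v) \<and> (\<forall>x \<in> F.Fix 1. f x = D b x)"
  proof (rule F.extension[OF F.V.module_axioms])
    show "D b (c \<odot>\<^bsub>V\<^esub> x) = (c [^] (1::nat)) \<odot>\<^bsub>V\<^esub> D b x" if "c \<in> Kn 1" "x \<in> F.Fix 1" for c x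
      using D_smult[OF that(1) b that(2)] pow_1[OF Kn_carrier[OF that(1)]] by simp
  qed (use b in \<open>simp_all add: D_add F.Fix_carrier[OF D_Fix]\<close>)
  then show ?thesis unfolding linear_map_def by (simp add: pow_1)
qed

definition E :: "'a \<Rightarrow> 'v \<Rightarrow> 'v" where
  "E b = (SOME f. linear_map V f \<and> (\<forall>x \<in> F.Fix 1. f x = D b x))"

lemma E: "b \<in> A.Fix 1 \<Longrightarrow> linear_map V (E b) \<and> (\<forall>x \<in> F.Fix 1. E b x = D b x)"
  unfolding E_def by (rule someI_ex[OF ex_E])

lemma E_Fix: "\<lbrakk>b \<in> A.Fix 1; x \<in> F.Fix 1\<rbrakk> \<Longrightarrow> E b x = D b x"
  using E by blast

lemma linear_mapD:
  assumes "linear_map W f"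
  shows "\<And>x. x \<in> carrier W \<Longrightarrow> f x \<in> carrier V"
    "\<And>x y. \<lbrakk>x \<in> carrier W; y \<in> carrier W\<rbrakk> \<Longrightarrow> f (x \<oplus>\<^bsub>W\<^esub> y) = f x \<oplus>\<^bsub>V\<^esub> f y"
    "\<And>c x. \<lbrakk>c \<in> carrier k; x \<in> carrier W\<rbrakk> \<Longrightarrow> f (c \<odot>\<^bsub>W\<^esub> x) = c \<odot>\<^bsub>V\<^esub> f x"
  using assms by (auto simp: linear_map_def additive_map_def)

lemma linear_map_eqI:
  assumes f: "linear_map V f" and g: "linear_map V g" and fg: "\<And>x. x \<in> F.Fix 1 \<Longrightarrow> f x = g x"
    and v: "v \<in> carrier V"
  shows "f v = g v"
  using v
proof (induction v rule: F.fix_induct)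
  case (fixed x) then show ?case by (rule fg)
next
  case (add x y) then show ?case using linear_mapD(2)[OF f] linear_mapD(2)[OF g] by simp
next
  case (smult c x) then show ?case using linear_mapD(3)[OF f] linear_mapD(3)[OF g] by simp
qed

lemma linear_mapI:
  assumes "\<And>x. x \<in> carrier W \<Longrightarrow> f x \<in> carrier V"
    and "\<And>x y. \<lbrakk>x \<in> carrier W; y \<in> carrier W\<rbrakk> \<Longrightarrow> f (x \<oplus>\<^bsub>W\<^esub> y) = f x \<oplus>\<^bsub>V\<^esub> f y"
    and "\<And>c x. \<lbrakk>c \<in> carrier k; x \<in> carrier W\<rbrakk> \<Longrightarrow> f (c \<odot>\<^bsub>W\<^esub> x) = c \<odot>\<^bsub>V\<^esub> f x"
  shows "linear_map W f"
  using assms by (auto simp: linear_map_def additive_map_def)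

lemma linear_map_add:
  "\<lbrakk>linear_map V f; linear_map V g\<rbrakk> \<Longrightarrow> linear_map V (\<lambda>v. f v \<oplus>\<^bsub>V\<^esub> g v)"
  by (rule linear_mapI) (simp_all add: linear_mapD F.V.M.a_ac F.V.smult_r_distr)

lemma linear_map_smult:
  "\<lbrakk>c \<in> carrier k; linear_map V f\<rbrakk> \<Longrightarrow> linear_map V (\<lambda>v. c \<odot>\<^bsub>V\<^esub> f v)"
  by (rule linear_mapI)
    (simp_all add: linear_mapD F.V.smult_r_distr F.V.smult_assoc1[symmetric] m_comm)

lemma linear_map_comp: "\<lbrakk>linear_map V f; linear_map V g\<rbrakk> \<Longrightarrow> linear_map V (\<lambda>v. f (g v))"
  by (rule linear_mapI) (simp_all add: linear_mapD)

lemma E_add: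
  assumes "b \<in> A.Fix 1" "c \<in> A.Fix 1" "v \<in> carrier V"
  shows "E (b \<oplus>\<^bsub>A\<^esub> c) v = E b v \<oplus>\<^bsub>V\<^esub> E c v"
proof (rule linear_map_eqI[OF _ linear_map_add _ assms(3)])
  show "E (b \<oplus>\<^bsub>A\<^esub> c) x = E b x \<oplus>\<^bsub>V\<^esub> E c x" if "x \<in> F.Fix 1" for x
    unfolding E_Fix[OF A.Fix_add[OF assms(1,2)] that] E_Fix[OF assms(1) that] E_Fix[OF assms(2) that]
    by (rule D_add_left[OF assms(1,2) that])
qed (rule conjunct1[OF E[OF A.Fix_add[OF assms(1,2)]]] conjunct1[OF E[OF assms(1)]] conjunct1[OF E[OF assms(2)]])+

lemma E_smult:
  assumes "c \<in> Kn 1" "b \<in> A.Fix 1" "v \<in> carrier V"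
  shows "E (c \<odot>\<^bsub>A\<^esub> b) v = c \<odot>\<^bsub>V\<^esub> E b v"
proof (rule linear_map_eqI[OF _ linear_map_smult _ assms(3)])
  show "linear_map V (E (c \<odot>\<^bsub>A\<^esub> b))" by (rule conjunct1[OF E[OF A.Fix_smult[OF assms(1,2)]]])
  show "linear_map V (E b)" by (rule conjunct1[OF E[OF assms(2)]])
  show "c \<in> carrier k" by (rule Kn_carrier[OF assms(1)])
  show "E (c \<odot>\<^bsub>A\<^esub> b) x = c \<odot>\<^bsub>V\<^esub> E b x" if "x \<in> F.Fix 1" for x
    unfolding E_Fix[OF A.Fix_smult[OF assms(1,2)] that] E_Fix[OF assms(2) that]
    by (rule D_smult_left[OF assms(1,2) that])
qed

lemma ex_act: "v \<in> carrier V \<Longrightarrow> \<exists>f. linear_map A f \<and> (\<forall>b \<in> A.Fix 1. f b = E b v)"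
proof -
  assume v: "v \<in> carrier V"
  have "\<exists>f. additive_map A V f \<and>
      (\<forall>c \<in> carrier k. \<forall>a \<in> carrier A. f (c \<odot>\<^bsub>A\<^esub> a) = (c [^] (1::nat)) \<odot>\<^bsub>V\<^esub> f a) \<and> (\<forall>b \<in> A.Fix 1. f b = E b v)"
  proof (rule A.extension[OF F.V.module_axioms])
    show "E b v \<in> carrier V" if "b \<in> A.Fix 1" for b using linear_mapD(1)[of V "E b" v] E[OF that] v by simp
    show "E (c \<odot>\<^bsub>A\<^esub> b) v = (c [^] (1::nat)) \<odot>\<^bsub>V\<^esub> E b v" if "c \<in> Kn 1" "b \<in> A.Fix 1" for c b
      using E_smult[OF that v] pow_1[OF Kn_carrier[OF that(1)]] by simp
  qed (use v in \<open>simp_all add: E_add\<close>)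
  then show ?thesis unfolding linear_map_def by (simp add: pow_1)
qed

text \<open>The extension in the algebra variable is chosen separately for every v; linearity in v
  is therefore not built in and is proved as \<open>act_linear\<close>.\<close>

definition act :: "'a \<Rightarrow> 'v \<Rightarrow> 'v" where
  "act a v = (SOME f. linear_map A f \<and> (\<forall>b \<in> A.Fix 1. f b = E b v)) a"

lemma act: "v \<in> carrier V \<Longrightarrow> linear_map A (\<lambda>a. act a v) \<and> (\<forall>b \<in> A.Fix 1. act b v = E b v)"
  unfolding act_def by (rule someI_ex[OF ex_act])

lemmas act_left = linear_mapD[OF conjunct1[OF act]]

lemma act_fixed: "\<lbrakk>b \<in> A.Fix 1; v \<in> carrier V\<rbrakk> \<Longrightarrow> act b v = E b v"
  using act by blast

text \<open>For elements of \<open>A^F\<close> the action is \<open>E\<close>, which is linear; sums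
  and scalar multiples inherit this, and by descent they exhaust \<open>A\<close>.\<close>

lemma act_linear: "a \<in> carrier A \<Longrightarrow> linear_map V (act a)"
proof (induction a rule: A.fix_induct)
  case (fixed b)
  note Ed = linear_mapD[OF conjunct1[OF E[OF fixed]]]
  show ?case by (rule linear_mapI) (simp_all add: act_fixed[OF fixed] Ed)
next
  case (add a b)
  have "linear_map V (\<lambda>v. act a v \<oplus>\<^bsub>V\<^esub> act b v)" by (rule linear_map_add) fact+
  note l = linear_mapD[OF this]
  show ?case by (rule linear_mapI) (use add l in \<open>simp_all add: act_left(2)\<close>)
next
  case (smult c a)
  have "linear_map V (\<lambda>v. c \<odot>\<^bsub>V\<^esub> act a v)" by (rule linear_map_smult) fact+
  note l = linear_mapD[OF this]
  show ?case by (rule linear_mapI) (use smult l in \<open>simp_all add: act_left(3)\<close>)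
qed

lemmas act_right = linear_mapD[OF act_linear]

lemma act_one: "v \<in> carrier V \<Longrightarrow> act \<one>\<^bsub>A\<^esub> v = v"
proof -
  assume v: "v \<in> carrier V"
  have 1: "\<one>\<^bsub>A\<^esub> \<in> A.Fix 1" by (simp add: A.Fix_1 FA_one)
  have "E \<one>\<^bsub>A\<^esub> v = v"
  proof (rule linear_map_eqI[OF _ _ _ v])
    show "linear_map V (E \<one>\<^bsub>A\<^esub>)" using E[OF 1] by simp
    show "linear_map V (\<lambda>v. v)" by (rule linear_mapI) simp_all
    show "E \<one>\<^bsub>A\<^esub> x = x" if x: "x \<in> F.Fix 1" for x
      using E[OF 1] x D_eqI[OF 1 x x] N.left_smult_one[OF kappa_closed[OF x]] by simp
  qed
  then show ?thesis using act_fixed[OF 1 v] by simp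
qed

text \<open>Both factors are reduced to \<open>A^F\<close> by induction over fixed elements, the
  left one first. There the two sides are linear in v, and on fixed vectors the identity is
  associativity of the action on N.\<close>

lemma act_mult:
  assumes "a \<in> carrier A" "b \<in> carrier A" "v \<in> carrier V"
  shows "act (a \<otimes>\<^bsub>A\<^esub> b) v = act a (act b v)"
proof -
  have v: "v \<in> carrier V" by fact
  have ac: "act x v \<in> carrier V" if "x \<in> carrier A" for x by (rule act_left(1)[OF v that])
  show ?thesis
    using assms(1)
  proof (induction a rule: A.fix_induct)
    case (add x y)
    note c = AA.m_closed[OF _ assms(2)]
    show ?case
      unfolding AA.l_distr[OF add(1,2) assms(2)] act_left(2)[OF v c[OF add(1)] c[OF add(2)]]
        act_left(2)[OF ac[OF assms(2)] add(1,2)] add(3,4) ..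
  next
    case (smult c x)
    show ?case
      unfolding AA.smult_mult_left[OF smult(1,2) assms(2)] act_left(3)[OF v smult(1) AA.m_closed[OF smult(2) assms(2)]]
        act_left(3)[OF ac[OF assms(2)] smult(1,2)] smult(3) ..
  next
  case (fixed a)
  have aA: "a \<in> carrier A" by (rule A.Fix_carrier[OF fixed])
  show ?case using assms(2)
  proof (induction b rule: A.fix_induct)
    case (add x y)
    note c = AA.m_closed[OF aA]
    show ?case
      unfolding AA.r_distr[OF add(1,2) aA] act_left(2)[OF v c[OF add(1)] c[OF add(2)]]
        act_left(2)[OF v add(1,2)] act_right(2)[OF aA ac[OF add(1)] ac[OF add(2)]] add(3,4) ..
  next
    case (smult c x)
    show ?case
      unfolding AA.smult_mult_right[OF smult(1) aA smult(2)] act_left(3)[OF v smult(1) AA.m_closed[OF aA smult(2)]]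
        act_left(3)[OF v smult(1,2)] act_right(3)[OF aA smult(1) ac[OF smult(2)]] smult(3) ..
  next
    case (fixed b)
    have a: "a \<in> A.Fix 1" by fact
    have ab: "a \<otimes>\<^bsub>A\<^esub> b \<in> A.Fix 1" using a fixed by (simp add: A.Fix_1 FA_mult)
    have "E (a \<otimes>\<^bsub>A\<^esub> b) v = E a (E b v)"
    proof (rule linear_map_eqI[OF conjunct1[OF E[OF ab]]
          linear_map_comp[OF conjunct1[OF E[OF a]] conjunct1[OF E[OF fixed]]] _ assms(3)])
      fix x assume x: "x \<in> F.Fix 1"
      have "D (a \<otimes>\<^bsub>A\<^esub> b) x = D a (D b x)"
      proof (rule D_eqI[OF ab x D_Fix[OF a D_Fix[OF fixed x]]])
        show "\<kappa> (D a (D b x)) = (a \<otimes>\<^bsub>A\<^esub> b) \<odot>\<^bsub>N\<^esub> \<kappa> x"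
          unfolding kappa_D[OF a D_Fix[OF fixed x]] kappa_D[OF fixed x]
          using N.left_smult_assoc[unfolded carrier_fixed fixed_points_simps, OF a fixed kappa_closed[OF x]]
          by (rule sym)
      qed
      then show "E (a \<otimes>\<^bsub>A\<^esub> b) x = E a (E b x)"
        unfolding E_Fix[OF ab x] E_Fix[OF fixed x] E_Fix[OF a D_Fix[OF fixed x]] .
    qed
    then show ?case
      unfolding act_fixed[OF ab assms(3)] act_fixed[OF fixed assms(3)]
        act_fixed[OF a linear_mapD(1)[OF conjunct1[OF E[OF fixed]] assms(3)]] .
  qed
  qed
qed

text \<open>Both sides are semilinear in a and in v, and for fixed a and v they agree because the
  action of \<open>A^F\<close> preserves the fixed vectors.\<close>

lemma F_act:
  assumes "a \<in> carrier A" "v \<in> carrier V"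
  shows "F (act a v) = act (FA a) (F v)"
proof -
  have Fc: "F v \<in> carrier V" if "v \<in> carrier V" for v using F.F_additive that by (auto simp: additive_map_def)
  have FAc: "FA a \<in> carrier A" if "a \<in> carrier A" for a using A.F_additive that by (auto simp: additive_map_def)
  have Fadd: "F (v \<oplus>\<^bsub>V\<^esub> w) = F v \<oplus>\<^bsub>V\<^esub> F w" if "v \<in> carrier V" "w \<in> carrier V" for v w
    using F.F_additive that by (auto simp: additive_map_def)
  have FAadd: "FA (a \<oplus>\<^bsub>A\<^esub> b) = FA a \<oplus>\<^bsub>A\<^esub> FA b" if "a \<in> carrier A" "b \<in> carrier A" for a b
    using A.F_additive that by (auto simp: additive_map_def)
  show ?thesis using assms(1)
  proof (induction a rule: A.fix_induct)
    case (add x y)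
    then show ?case using assms(2) Fc FAc by (simp add: act_left Fadd FAadd)
  next
    case (smult c x)
    then show ?case using assms(2) Fc FAc by (simp add: act_left F.F_smult A.F_smult)
  next
    case (fixed a)
    have a: "a \<in> carrier A" "FA a = a" using fixed by (simp_all add: A.Fix_1)
    show ?case unfolding a(2) using assms(2)
    proof (induction v rule: F.fix_induct)
      case (add x y)
      then show ?case using a Fc by (simp add: act_right Fadd)
    next
      case (smult c x)
      then show ?case using a Fc by (simp add: act_right F.F_smult)
    next
      case (fixed x)
      have x: "x \<in> carrier V" "F x = x" using fixed by (simp_all add: F.Fix_1)
      have "act a x = D a x" using act_fixed[OF \<open>a \<in> A.Fix 1\<close> x(1)] E_Fix[OF \<open>a \<in> A.Fix 1\<close> fixed] by simp
      then show ?case using D_Fix[OF \<open>a \<in> A.Fix 1\<close> fixed] x(2) by (simp add: F.Fix_1)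
    qed
  qed
qed

definition ext_module :: "('a, 'v) module" where
  "ext_module = \<lparr>carrier = carrier V, monoid.mult = undefined, one = undefined,
     ring.zero = \<zero>\<^bsub>V\<^esub>, ring.add = ring.add V, smult = act\<rparr>"

lemma ext_module_simps [simp]:
  "carrier ext_module = carrier V" "ring.zero ext_module = \<zero>\<^bsub>V\<^esub>"
  "ring.add ext_module = ring.add V" "smult ext_module = act"
  by (simp_all add: ext_module_def)

lemma ext_left_module: "left_module A ext_module"
proof (intro left_module.intro left_module_axioms.intro)
  show "ring A" by (rule AA.ring_axioms)
  show "abelian_group ext_module"
    by (rule abelian_groupI) (auto simp: F.V.M.a_ac intro: bexI[of _ "\<ominus>\<^bsub>V\<^esub> _"] F.V.M.l_neg)
qed (simp_all add: act_left(1,2) act_right(2) act_mult act_one)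

lemma ext_base_smult: "\<lbrakk>c \<in> carrier k; v \<in> carrier V\<rbrakk> \<Longrightarrow> c \<odot>\<^bsub>base_space A ext_module\<^esub> v = c \<odot>\<^bsub>V\<^esub> v"
  by (simp add: base_space_smult act_left(3) act_one)

lemma ext_frobenius_space: "frobenius_space k q (base_space A ext_module) F"
proof (intro frobenius_space.intro frobenius_space_axioms.intro)
  show "frobenius_field k q" by (rule frobenius_field_axioms)
  show "module k (base_space A ext_module)" by (rule base_module[OF ext_left_module])
  show "additive_map (base_space A ext_module) (base_space A ext_module) F"
    using F.F_additive by (simp add: additive_map_def)
  show "F (c \<odot>\<^bsub>base_space A ext_module\<^esub> v) = (c [^] q) \<odot>\<^bsub>base_space A ext_module\<^esub> F v"
    if "c \<in> carrier k" "v \<in> carrier (base_space A ext_module)" for c v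
    using that F.F_smult F.F_additive by (simp add: ext_base_smult additive_map_def Pi_iff)
  show "\<exists>n>0. (F ^^ n) v = v" if "v \<in> carrier (base_space A ext_module)" for v
    using that F.F_periodic by simp
qed

lemma ext_frobenius_module:
  assumes "finite (carrier N)"
  shows "frobenius_module k q A FA ext_module 1 F"
proof -
  interpret S: frobenius_space k q "base_space A ext_module" F by (rule ext_frobenius_space)
  have "S.Fix 1 = F.Fix 1" by (auto simp: S.Fix_1 F.Fix_1)
  then have "finite (S.Fix 1)" using assms bij_betw_finite[OF kappa_bij] by simp
  then have "\<exists>H. S.spans H" using S.Fix_spans by blast
  moreover have "semilinear 1 ext_module ext_module F"
    using F.F_additive F_act by (simp add: semilinear_def additive_map_def One_nat_def)
  ultimately show ?thesis
    using frobenius_algebra_axioms ext_left_module ext_frobenius_space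
    by (intro frobenius_module.intro frobenius_module_axioms.intro) auto
qed

lemma kappa_iso:
  "\<kappa> \<in> module_hom (fixed_points A FA) (fixed_points ext_module F) N"
  "bij_betw \<kappa> (carrier (fixed_points ext_module F)) (carrier N)"
proof -
  have c: "carrier (fixed_points ext_module F) = F.Fix 1"
    unfolding fixed_points_carrier by (auto simp: F.Fix_1)
  show "bij_betw \<kappa> (carrier (fixed_points ext_module F)) (carrier N)" unfolding c by (rule kappa_bij)
  show "\<kappa> \<in> module_hom (fixed_points A FA) (fixed_points ext_module F) N"
  proof (rule module_homI; unfold c carrier_fixed fixed_points_simps ext_module_simps)
    show "\<kappa> (act a x) = a \<odot>\<^bsub>N\<^esub> \<kappa> x" if "a \<in> A.Fix 1" "x \<in> F.Fix 1" for a x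
      using act_fixed[OF that(1) F.Fix_carrier[OF that(2)]] E_Fix[OF that] kappa_D[OF that] by simp
  qed (simp_all add: kappa_closed kappa_add)
qed

end

section \<open>Coordinate spaces\<close>

definition coordinate_space :: "('k, 'f) ring_scheme \<Rightarrow> nat \<Rightarrow> ('k, nat \<Rightarrow> 'k) module" where
  "coordinate_space k n =
     \<lparr>carrier = {..<n} \<rightarrow>\<^sub>E carrier k, monoid.mult = undefined, one = undefined,
      ring.zero = (\<lambda>i \<in> {..<n}. \<zero>\<^bsub>k\<^esub>), ring.add = (\<lambda>x y. \<lambda>i \<in> {..<n}. x i \<oplus>\<^bsub>k\<^esub> y i),
      smult = (\<lambda>c x. \<lambda>i \<in> {..<n}. c \<otimes>\<^bsub>k\<^esub> x i)\<rparr>"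

context frobenius_field
begin

definition coordinate_frobenius :: "nat \<Rightarrow> (nat \<Rightarrow> 'a) \<Rightarrow> nat \<Rightarrow> 'a" where
  "coordinate_frobenius n x = (\<lambda>i \<in> {..<n}. x i [^] q)"

lemma coordinate_frobenius_space: "frobenius_space k q (coordinate_space k n) (coordinate_frobenius n)"
proof -
  let ?V = "coordinate_space k n" and ?F = "coordinate_frobenius n"
  have c: "carrier ?V = {..<n} \<rightarrow>\<^sub>E carrier k" by (simp add: coordinate_space_def)
  have ops: "(x \<oplus>\<^bsub>?V\<^esub> y) i = x i \<oplus> y i" "(a \<odot>\<^bsub>?V\<^esub> x) i = a \<otimes> x i" "\<zero>\<^bsub>?V\<^esub> i = \<zero>" "?F x i = x i [^] q"
    if "i < n" for x y a i
    using that by (simp_all add: coordinate_space_def coordinate_frobenius_def)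
  have cl: "x \<oplus>\<^bsub>?V\<^esub> y \<in> carrier ?V" "\<zero>\<^bsub>?V\<^esub> \<in> carrier ?V" "?F x \<in> carrier ?V"
    if "x \<in> carrier ?V" "y \<in> carrier ?V" for x y
    using that by (auto simp: coordinate_space_def coordinate_frobenius_def)
  have scl: "a \<odot>\<^bsub>?V\<^esub> x \<in> carrier ?V" if "a \<in> carrier k" "x \<in> carrier ?V" for a x
    using that by (auto simp: coordinate_space_def)
  have z: "\<zero>\<^bsub>?V\<^esub> \<in> carrier ?V" by (auto simp: coordinate_space_def)
  have eqI: "x = y" if "x \<in> carrier ?V" "y \<in> carrier ?V" "\<And>i. i < n \<Longrightarrow> x i = y i" for x y
    using that unfolding c by (intro PiE_ext) auto
  have ap: "x i \<in> carrier k" if "x \<in> carrier ?V" "i < n" for x i using that unfolding c by auto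
  have ab: "abelian_group ?V"
  proof (rule abelian_groupI)
    fix x assume x: "x \<in> carrier ?V"
    let ?y = "\<lambda>i \<in> {..<n}. \<ominus> x i"
    have y: "?y \<in> carrier ?V" using ap[OF x] unfolding c by auto
    have "?y \<oplus>\<^bsub>?V\<^esub> x = \<zero>\<^bsub>?V\<^esub>"
      by (rule eqI[OF cl(1)[OF y x] z]) (use ap[OF x] in \<open>simp add: ops l_neg\<close>)
    then show "\<exists>y\<in>carrier ?V. y \<oplus>\<^bsub>?V\<^esub> x = \<zero>\<^bsub>?V\<^esub>" using y by blast
  next
    fix x y w assume "x \<in> carrier ?V" "y \<in> carrier ?V" "w \<in> carrier ?V"
    then show "x \<oplus>\<^bsub>?V\<^esub> y \<oplus>\<^bsub>?V\<^esub> w = x \<oplus>\<^bsub>?V\<^esub> (y \<oplus>\<^bsub>?V\<^esub> w)"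
      by (intro eqI cl) (simp_all add: ops ap a_assoc)
  next
    fix x y assume "x \<in> carrier ?V" "y \<in> carrier ?V"
    then show "x \<oplus>\<^bsub>?V\<^esub> y = y \<oplus>\<^bsub>?V\<^esub> x"
      by (intro eqI cl) (simp_all add: ops ap a_comm)
  next
    fix x assume "x \<in> carrier ?V"
    then show "\<zero>\<^bsub>?V\<^esub> \<oplus>\<^bsub>?V\<^esub> x = x"
      by (intro eqI cl z) (simp_all add: ops ap)
  qed (use cl z in blast)+
  have mod: "module k ?V"
  proof (rule moduleI[OF is_cring ab])
    show "(a \<oplus> b) \<odot>\<^bsub>?V\<^esub> x = a \<odot>\<^bsub>?V\<^esub> x \<oplus>\<^bsub>?V\<^esub> b \<odot>\<^bsub>?V\<^esub> x"
      if "a \<in> carrier k" "b \<in> carrier k" "x \<in> carrier ?V" for a b x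
      using that by (intro eqI scl cl) (simp_all add: ops ap l_distr)
    show "a \<odot>\<^bsub>?V\<^esub> (x \<oplus>\<^bsub>?V\<^esub> y) = a \<odot>\<^bsub>?V\<^esub> x \<oplus>\<^bsub>?V\<^esub> a \<odot>\<^bsub>?V\<^esub> y"
      if "a \<in> carrier k" "x \<in> carrier ?V" "y \<in> carrier ?V" for a x y
      using that by (intro eqI scl cl) (simp_all add: ops ap r_distr)
    show "(a \<otimes> b) \<odot>\<^bsub>?V\<^esub> x = a \<odot>\<^bsub>?V\<^esub> (b \<odot>\<^bsub>?V\<^esub> x)"
      if "a \<in> carrier k" "b \<in> carrier k" "x \<in> carrier ?V" for a b x
      using that by (intro eqI scl cl) (simp_all add: ops ap m_assoc)
    show "\<one> \<odot>\<^bsub>?V\<^esub> x = x" if "x \<in> carrier ?V" for x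
      using that by (intro eqI scl) (simp_all add: ops ap)
  qed (rule scl)
  show ?thesis
  proof (intro frobenius_space.intro frobenius_space_axioms.intro)
    show "frobenius_field k q" by (rule frobenius_field_axioms)
    show "module k ?V" by (rule mod)
    show "additive_map ?V ?V ?F"
    proof (rule additive_mapI)
      show "?F (x \<oplus>\<^bsub>?V\<^esub> y) = ?F x \<oplus>\<^bsub>?V\<^esub> ?F y" if "x \<in> carrier ?V" "y \<in> carrier ?V" for x y
        using that by (intro eqI cl) (simp_all add: ops ap frob_add)
    qed (use cl in blast)
    show "?F (a \<odot>\<^bsub>?V\<^esub> x) = (a [^] q) \<odot>\<^bsub>?V\<^esub> ?F x" if "a \<in> carrier k" "x \<in> carrier ?V" for a x
      using that by (intro eqI cl(3) scl z) (simp_all add: ops ap nat_pow_distrib)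
    show "\<exists>m>0. (?F ^^ m) x = x" if x: "x \<in> carrier ?V" for x
    proof -
      interpret S: frobenius_space k q "\<lparr>carrier = carrier k, monoid.mult = monoid.mult k, one = one k,
        ring.zero = \<zero>, ring.add = ring.add k, smult = monoid.mult k\<rparr>" "\<lambda>x. x [^] q" by (rule self_space)
      have pw: "((\<lambda>x. x [^] q) ^^ m) a = a [^] (q ^ m)" if "a \<in> carrier k" for a m
        by (induction m) (use that in \<open>auto simp: nat_pow_pow mult.commute\<close>)
      obtain m where m: "m > 0" "x ` {..<n} \<subseteq> S.Fix m"
        using S.Fix_ex_common[of "x ` {..<n}"] ap[OF x] by (auto simp: image_subset_iff)
      have xm: "x i [^] (q ^ m) = x i" if "i < n" for i
        using m(2) pw[OF ap[OF x that], of m] that by (auto simp: S.Fix_def image_subset_iff)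
      have "(?F ^^ j) x \<in> carrier ?V \<and> (\<forall>i<n. (?F ^^ j) x i = x i [^] (q ^ j))" for j
        by (induction j) (use x in \<open>auto simp: cl ops ap nat_pow_pow mult.commute\<close>)
      then have "(?F ^^ m) x = x" using x xm by (intro eqI) auto
      then show ?thesis using m(1) by blast
    qed
  qed
qed

end

lemma (in frobenius_algebra) fixed_base_module:
  assumes N: "left_module (fixed_points A FA) N"
  shows "module (k\<lparr>carrier := Kn 1\<rparr>) (base_space (fixed_points A FA) N)"
proof -
  interpret N: left_module "fixed_points A FA" N by (rule N)
  interpret K: field "k\<lparr>carrier := Kn 1\<rparr>" by (rule Kn_field)
  let ?i = "\<lambda>c. c \<odot>\<^bsub>A\<^esub> \<one>\<^bsub>A\<^esub>"
  have i: "?i c \<in> carrier (fixed_points A FA)" if "c \<in> Kn 1" for c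
  proof -
    have "?i c \<in> A.Fix 1" by (rule A.Fix_smult[OF that]) (simp add: A.Fix_1 FA_one)
    then show ?thesis by (simp add: A.Fix_1 fixed_points_carrier)
  qed
  have ab: "abelian_group (base_space (fixed_points A FA) N)"
    by (rule abelian_groupI) (auto simp: N.M.a_ac intro: bexI[of _ "\<ominus>\<^bsub>N\<^esub> _"] N.M.l_neg)
  show ?thesis
  proof (rule moduleI[OF K.is_cring ab])
    let ?S = "base_space (fixed_points A FA) N" and ?K = "k\<lparr>carrier := Kn 1\<rparr>"
    show "c \<odot>\<^bsub>?S\<^esub> x \<in> carrier ?S" if "c \<in> carrier ?K" "x \<in> carrier ?S" for c x
      using that N.left_smult_closed[OF i] by (simp add: base_space_smult)
    show "(c \<oplus>\<^bsub>?K\<^esub> d) \<odot>\<^bsub>?S\<^esub> x = c \<odot>\<^bsub>?S\<^esub> x \<oplus>\<^bsub>?S\<^esub> d \<odot>\<^bsub>?S\<^esub> x"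
      if "c \<in> carrier ?K" "d \<in> carrier ?K" "x \<in> carrier ?S" for c d x
      using that N.left_smult_l_distr[OF i[of c] i[of d], of x] Kn_carrier[of c 1] Kn_carrier[of d 1]
      by (simp add: base_space_smult A.V.smult_l_distr)
    show "c \<odot>\<^bsub>?S\<^esub> (x \<oplus>\<^bsub>?S\<^esub> y) = c \<odot>\<^bsub>?S\<^esub> x \<oplus>\<^bsub>?S\<^esub> c \<odot>\<^bsub>?S\<^esub> y"
      if "c \<in> carrier ?K" "x \<in> carrier ?S" "y \<in> carrier ?S" for c x y
      using that N.left_smult_r_distr[OF i[of c], of x y] by (simp add: base_space_smult)
    show "(c \<otimes>\<^bsub>?K\<^esub> d) \<odot>\<^bsub>?S\<^esub> x = c \<odot>\<^bsub>?S\<^esub> (d \<odot>\<^bsub>?S\<^esub> x)"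
      if "c \<in> carrier ?K" "d \<in> carrier ?K" "x \<in> carrier ?S" for c d x
      using that N.left_smult_assoc[OF i[of c] i[of d], of x] Kn_carrier[of c 1] Kn_carrier[of d 1]
      by (simp add: base_space_smult AA.smult_mult_left A.V.smult_assoc1)
    show "\<one>\<^bsub>?K\<^esub> \<odot>\<^bsub>?S\<^esub> x = x" if "x \<in> carrier ?S" for x
      using that N.left_smult_one by (simp add: base_space_smult)
  qed
qed

text \<open>A basis of N over \<open>Kn 1\<close>, numbered by g, identifies N with the tuples over
  \<open>Kn 1\<close>, which are the fixed points of the coordinatewise Frobenius on the n-tuples
  over \<open>k\<close>.\<close>

lemma (in frobenius_algebra) fixed_module_coordinates:
  assumes N: "left_module (fixed_points A FA) N"
    and fd: "finite_dimensional (k\<lparr>carrier := Kn 1\<rparr>) (base_space (fixed_points A FA) N)"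
  shows "\<exists>n \<kappa>. descent_module k q A FA (coordinate_space k n) (coordinate_frobenius n) N \<kappa>"
    "finite (carrier N)"
proof -
  let ?K = "k\<lparr>carrier := Kn 1\<rparr>" and ?B = "fixed_points A FA"
  let ?S = "base_space ?B N"
  interpret N: left_module ?B N by (rule N)
  interpret K: field ?K by (rule Kn_field)
  interpret LS: linear_space ?K ?S
    by (intro linear_space.intro fixed_base_module[OF N] K.field_axioms)
  obtain S where "LS.spans S" using LS.finite_dimensional_iff[of ?K ?S] fd by auto
  then obtain T where T: "LS.spans T" "LS.lin_indep T" using LS.ex_basis by blast
  have Tc: "finite T" "T \<subseteq> carrier N" using T(1) by (simp_all add: LS.spans_def)
  define n where "n = card T"
  obtain g where g: "bij_betw g T {..<n}"
    using ex_bij_betw_finite_nat[OF Tc(1)] by (auto simp: n_def atLeast0LessThan)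
  have gn: "g t < n" if "t \<in> T" for t using bij_betwE[OF g] that by auto
  interpret F: frobenius_space k q "coordinate_space k n" "coordinate_frobenius n"
    by (rule coordinate_frobenius_space)
  have cs: "carrier (coordinate_space k n) = {..<n} \<rightarrow>\<^sub>E carrier k" by (simp add: coordinate_space_def)
  have Fix: "F.Fix 1 = {..<n} \<rightarrow>\<^sub>E Kn 1"
  proof (intro equalityI subsetI)
    fix x assume "x \<in> F.Fix 1"
    then have x: "x \<in> {..<n} \<rightarrow>\<^sub>E carrier k" "coordinate_frobenius n x = x"
      unfolding F.Fix_1 cs by simp_all
    have "x i \<in> Kn 1" if "i < n" for i
      using fun_cong[OF x(2), of i] that x(1) by (auto simp: coordinate_frobenius_def Kn_def)
    then show "x \<in> {..<n} \<rightarrow>\<^sub>E Kn 1" using x(1) by auto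
  next
    fix x assume x: "x \<in> {..<n} \<rightarrow>\<^sub>E Kn 1"
    then have c: "x \<in> carrier (coordinate_space k n)" using Kn_carrier by (auto simp: coordinate_space_def)
    have "coordinate_frobenius n x = x"
    proof
      show "coordinate_frobenius n x i = x i" for i
        using x by (cases "i < n") (auto simp: coordinate_frobenius_def Kn_def PiE_iff extensional_def)
    qed
    then show "x \<in> F.Fix 1" using c by (simp add: F.Fix_1)
  qed
  define \<kappa> where "\<kappa> x = LS.lincomb T (\<lambda>t. x (g t))" for x
  have Tx: "(\<lambda>t. x (g t)) \<in> T \<rightarrow> carrier ?K" if "x \<in> F.Fix 1" for x
    using that gn unfolding Fix by auto
  have TS: "T \<subseteq> carrier ?S" using Tc by simp
  have "inj_on \<kappa> (F.Fix 1)"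
  proof (rule inj_onI)
    fix x y assume x: "x \<in> F.Fix 1" and y: "y \<in> F.Fix 1" and eq: "\<kappa> x = \<kappa> y"
    have "x (g t) = y (g t)" if "t \<in> T" for t
      using LS.lin_indep_unique[OF T(2) TS Tx[OF x] Tx[OF y] eq[unfolded \<kappa>_def] that] .
    moreover have "\<exists>t \<in> T. i = g t" if "i < n" for i using g that by (auto simp: bij_betw_def)
    ultimately have "x i = y i" if "i < n" for i using that by metis
    then show "x = y" using x y unfolding Fix by (intro PiE_ext) auto
  qed
  moreover have "\<kappa> ` F.Fix 1 = carrier N"
  proof
    show "\<kappa> ` F.Fix 1 \<subseteq> carrier N" unfolding \<kappa>_def using LS.lincomb_closed[OF TS Tx] by auto
    show "carrier N \<subseteq> \<kappa> ` F.Fix 1"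
    proof
      fix v assume v: "v \<in> carrier N"
      obtain c where c: "c \<in> T \<rightarrow> carrier ?K" "v = LS.lincomb T c"
        using LS.spansE[OF T(1), of v] v by auto
      let ?x = "\<lambda>i \<in> {..<n}. c (inv_into T g i)"
      have x: "?x \<in> F.Fix 1"
        unfolding Fix using c(1) bij_betwE[OF bij_betw_inv_into[OF g]] by (auto simp: Pi_iff)
      have "\<kappa> ?x = LS.lincomb T c"
        unfolding \<kappa>_def
        by (rule LS.lincomb_cong[OF TS c(1)]) (simp add: gn bij_betw_inv_into_left[OF g])
      then show "v \<in> \<kappa> ` F.Fix 1" using c(2) x by (metis imageI)
    qed
  qed
  ultimately have bij: "bij_betw \<kappa> (F.Fix 1) (carrier N)" by (simp add: bij_betw_def)
  have "finite (F.Fix 1)" unfolding Fix using finite_Kn[of 1] by (intro finite_PiE) auto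
  then show "finite (carrier N)" using bij_betw_finite[OF bij] by simp
  have add: "\<kappa> (x \<oplus>\<^bsub>coordinate_space k n\<^esub> y) = \<kappa> x \<oplus>\<^bsub>N\<^esub> \<kappa> y" if xy: "x \<in> F.Fix 1" "y \<in> F.Fix 1" for x y
  proof -
    have "\<kappa> x \<oplus>\<^bsub>N\<^esub> \<kappa> y = LS.lincomb T (\<lambda>t. x (g t) \<oplus>\<^bsub>?K\<^esub> y (g t))"
      using LS.lincomb_add[OF TS Tx[OF xy(1)] Tx[OF xy(2)]] by (simp add: \<kappa>_def)
    also have "\<dots> = LS.lincomb T (\<lambda>t. (x \<oplus>\<^bsub>coordinate_space k n\<^esub> y) (g t))"
      by (rule sym, rule LS.lincomb_cong[OF TS])
        (use Tx[OF xy(1)] Tx[OF xy(2)] in \<open>auto simp: coordinate_space_def gn intro!: Kn_add\<close>)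
    finally show ?thesis by (simp add: \<kappa>_def)
  qed
  have smult: "\<kappa> (c \<odot>\<^bsub>coordinate_space k n\<^esub> x) = (c \<odot>\<^bsub>A\<^esub> \<one>\<^bsub>A\<^esub>) \<odot>\<^bsub>N\<^esub> \<kappa> x" if cx: "c \<in> Kn 1" "x \<in> F.Fix 1" for c x
  proof -
    have "(c \<odot>\<^bsub>A\<^esub> \<one>\<^bsub>A\<^esub>) \<odot>\<^bsub>N\<^esub> \<kappa> x = c \<odot>\<^bsub>?S\<^esub> LS.lincomb T (\<lambda>t. x (g t))"
      by (simp add: \<kappa>_def base_space_smult)
    also have "\<dots> = LS.lincomb T (\<lambda>t. c \<otimes>\<^bsub>?K\<^esub> x (g t))"
      using LS.lincomb_smult[OF TS Tx[OF cx(2)], of c] cx(1) by simp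
    also have "\<dots> = LS.lincomb T (\<lambda>t. (c \<odot>\<^bsub>coordinate_space k n\<^esub> x) (g t))"
      by (rule sym, rule LS.lincomb_cong[OF TS])
        (use Tx[OF cx(2)] cx(1) in \<open>auto simp: coordinate_space_def gn intro!: Kn_mult\<close>)
    finally show ?thesis by (simp add: \<kappa>_def)
  qed
  have "descent_module k q A FA (coordinate_space k n) (coordinate_frobenius n) N \<kappa>"
    by (intro descent_module.intro descent_module_axioms.intro frobenius_algebra_axioms
        F.frobenius_space_axioms N bij add smult)
  then show "\<exists>n \<kappa>. descent_module k q A FA (coordinate_space k n) (coordinate_frobenius n) N \<kappa>" by blast
qed

section \<open>Direct summands\<close>

text \<open>Bijectivity of \<open>g f\<close> provides for each y a u with
  \<open>g (f u) = g y\<close>, and then y = f u + (y - f u) is the required splitting.\<close>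

lemma split_pair_direct_sum:
  assumes M: "left_module A M" and N: "left_module A N"
    and f: "f \<in> module_hom A M N" and g: "g \<in> module_hom A N M"
    and bij: "bij_betw (\<lambda>x. g (f x)) (carrier M) (carrier M)"
  shows "internal_direct_sum A N (f ` carrier M) {y \<in> carrier N. g y = \<zero>\<^bsub>M\<^esub>}"
proof -
  interpret M: left_module A M by (rule M)
  interpret N: left_module A N by (rule N)
  note fD = module_homD[OF f] and gD = module_homD[OF g]
  let ?U = "f ` carrier M" and ?W = "{y \<in> carrier N. g y = \<zero>\<^bsub>M\<^esub>}"
  have f0: "f \<zero>\<^bsub>M\<^esub> = \<zero>\<^bsub>N\<^esub>"
    by (rule additive_map_zero[OF M.M.abelian_group_axioms N.M.abelian_group_axioms fD(4)])
  have g0: "g \<zero>\<^bsub>N\<^esub> = \<zero>\<^bsub>M\<^esub>"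
    by (rule additive_map_zero[OF N.M.abelian_group_axioms M.M.abelian_group_axioms gD(4)])
  have U: "submodule ?U A N"
  proof (rule N.left_submoduleI)
    show "?U \<subseteq> carrier N" using fD(1) by auto
    show "\<zero>\<^bsub>N\<^esub> \<in> ?U" using f0[symmetric] M.M.zero_closed by (rule image_eqI)
    show "x \<oplus>\<^bsub>N\<^esub> y \<in> ?U" if xy: "x \<in> ?U" "y \<in> ?U" for x y
    proof -
      from xy obtain u v where "x = f u" "u \<in> carrier M" "y = f v" "v \<in> carrier M" by (elim imageE)
      then have "x \<oplus>\<^bsub>N\<^esub> y = f (u \<oplus>\<^bsub>M\<^esub> v)" "u \<oplus>\<^bsub>M\<^esub> v \<in> carrier M" using fD(2) by simp_all
      then show ?thesis by (rule image_eqI)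
    qed
    show "a \<odot>\<^bsub>N\<^esub> x \<in> ?U" if ax: "a \<in> carrier A" "x \<in> ?U" for a x
    proof -
      from ax(2) obtain u where "x = f u" "u \<in> carrier M" by (elim imageE)
      then have "a \<odot>\<^bsub>N\<^esub> x = f (a \<odot>\<^bsub>M\<^esub> u)" "a \<odot>\<^bsub>M\<^esub> u \<in> carrier M"
        using fD(3)[OF ax(1)] M.left_smult_closed[OF ax(1)] by simp_all
      then show ?thesis by (rule image_eqI)
    qed
  qed
  have W: "submodule ?W A N"
    by (rule N.left_submoduleI) (auto simp: g0 gD(2,3) N.left_smult_closed M.smult_zero)
  have "y = \<zero>\<^bsub>N\<^esub>" if y: "y \<in> ?U" "y \<in> ?W" for y
  proof -
    from y(1) obtain u where u: "y = f u" "u \<in> carrier M" by (elim imageE)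
    have "g (f u) = g (f \<zero>\<^bsub>M\<^esub>)" using y(2) u(1) f0 g0 by simp
    then have "u = \<zero>\<^bsub>M\<^esub>" using inj_onD[OF bij_betw_imp_inj_on[OF bij]] u(2) M.M.zero_closed by blast
    then show ?thesis using u(1) f0 by simp
  qed
  then have int: "?U \<inter> ?W = {\<zero>\<^bsub>N\<^esub>}" using N.submoduleD(2)[OF U] N.submoduleD(2)[OF W] by blast
  have "carrier N \<subseteq> ?U <+>\<^bsub>N\<^esub> ?W"
  proof
    fix y assume y: "y \<in> carrier N"
    have "g y \<in> (\<lambda>x. g (f x)) ` carrier M" using bij gD(1)[OF y] by (simp add: bij_betw_def)
    then obtain u where u: "g y = g (f u)" "u \<in> carrier M" by (elim imageE)
    let ?w = "y \<oplus>\<^bsub>N\<^esub> \<ominus>\<^bsub>N\<^esub> f u"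
    have fu: "f u \<in> carrier N" by (rule fD(1)[OF u(2)])
    have "g ?w = g y \<oplus>\<^bsub>M\<^esub> \<ominus>\<^bsub>M\<^esub> g (f u)"
      using gD(2)[OF y N.M.a_inv_closed[OF fu]]
        additive_map_neg[OF N.M.abelian_group_axioms M.M.abelian_group_axioms gD(4) fu] by simp
    also have "\<dots> = \<zero>\<^bsub>M\<^esub>" unfolding u(1) by (rule M.M.r_neg[OF gD(1)[OF fu]])
    finally have "?w \<in> ?W" using y fu by simp
    moreover have "y = f u \<oplus>\<^bsub>N\<^esub> ?w" using y fu by (simp add: N.M.a_lcomm N.M.r_neg)
    ultimately show "y \<in> ?U <+>\<^bsub>N\<^esub> ?W" unfolding set_add_def' using u(2) by blast
  qed
  moreover have "?U <+>\<^bsub>N\<^esub> ?W \<subseteq> carrier N" unfolding set_add_def' using fD(1) by auto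
  ultimately show ?thesis unfolding internal_direct_sum_def using U W int by blast
qed

section \<open>Indecomposable direct summands\<close>

context frobenius_algebra
begin

text \<open>A direct summand given by its projection. Unlike complements, projections simply compose
  when a summand of a summand is taken.\<close>

definition retract where
  "retract M U e \<longleftrightarrow> submodule U A M \<and> e \<in> module_hom A M (M\<lparr>carrier := U\<rparr>) \<and> (\<forall>u \<in> U. e u = u)"

lemma retract_direct_sum:
  assumes M: "left_module A M" and e: "retract M U e"
  shows "internal_direct_sum A M U {y \<in> carrier M. e y = \<zero>\<^bsub>M\<^esub>}"
proof -
  interpret M: left_module A M by (rule M)
  let ?U = "M\<lparr>carrier := U\<rparr>"
  have U: "submodule U A M" and eh: "e \<in> module_hom A M ?U" and id: "\<And>u. u \<in> U \<Longrightarrow> e u = u"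
    using e by (auto simp: retract_def)
  have i: "(\<lambda>x. x) \<in> module_hom A ?U M" by (rule module_homI) (use M.submoduleD(1)[OF U] in auto)
  have "bij_betw (\<lambda>x. e x) (carrier ?U) (carrier ?U)"
    using bij_betw_cong[of U "\<lambda>x. x" e U] id by (simp add: bij_betw_def)
  from split_pair_direct_sum[OF M.submodule_left_module[OF U] M i eh this] show ?thesis by simp
qed

text \<open>An upper bound for the dimension of U. Minimising it requires no comparison of the sizes
  of two bases.\<close>

definition dim_bound where
  "dim_bound M U n \<longleftrightarrow> (\<exists>S. linear_space.spans k (base_space A (M\<lparr>carrier := U\<rparr>)) S \<and> card S = n)"

text \<open>Let U be a nonzero retract with a spanning set S of the least size that occurs among
  nonzero retracts. If U is the direct sum of a nonzero U1 and U2, with projection p to U1, then p S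
  spans U1, so by minimality p is injective on S and p S is independent. A vector of U2 is a
  combination of S killed by p, hence all its coefficients are zero.\<close>

lemma ex_indecomposable_retract:
  assumes M: "left_module A M" and fd: "\<exists>S. linear_space.spans k (base_space A M) S"
    and nz: "carrier M \<noteq> {\<zero>\<^bsub>M\<^esub>}"
  shows "\<exists>U e. retract M U e \<and> indecomposable_module k A (M\<lparr>carrier := U\<rparr>)"
proof -
  interpret M: left_module A M by (rule M)
  interpret V: linear_space k "base_space A M" by (rule base_linear_space[OF M])
  define good where "good n \<longleftrightarrow> (\<exists>U e. retract M U e \<and> U \<noteq> {\<zero>\<^bsub>M\<^esub>} \<and> dim_bound M U n)" for n
  have "retract M (carrier M) (\<lambda>x. x)"
    unfolding retract_def using M.left_submoduleI[of "carrier M"] M.left_smult_closed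
    by (auto intro!: module_homI)
  moreover have "\<exists>n. dim_bound M (carrier M) n"
    using fd by (simp add: dim_bound_def)
  ultimately have "\<exists>n. good n" using nz unfolding good_def by blast
  then have "good (LEAST n. good n)" by (rule LeastI_ex)
  then obtain U e where e: "retract M U e" and Unz: "U \<noteq> {\<zero>\<^bsub>M\<^esub>}"
    and dim: "dim_bound M U (LEAST n. good n)"
    unfolding good_def by (elim exE conjE)
  let ?U = "M\<lparr>carrier := U\<rparr>"
  have U: "submodule U A M" and eh: "e \<in> module_hom A M ?U" and id: "\<And>u. u \<in> U \<Longrightarrow> e u = u"
    using e by (auto simp: retract_def)
  note UD = M.submoduleD[OF U]
  have Um: "left_module A ?U" by (rule M.submodule_left_module[OF U])
  interpret U: left_module A ?U by (rule Um)
  interpret UV: linear_space k "base_space A ?U" by (rule base_linear_space[OF Um])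
  obtain S where S: "UV.spans S" "card S = (LEAST n. good n)"
    using dim unfolding dim_bound_def by (elim exE conjE)
  have Sc: "finite S" "S \<subseteq> carrier (base_space A ?U)" using S(1) by (simp_all add: UV.spans_def)
  have key: "U2 = {\<zero>\<^bsub>M\<^esub>}" if ds: "internal_direct_sum A ?U U1 U2" and U1: "U1 \<noteq> {\<zero>\<^bsub>M\<^esub>}" for U1 U2
  proof -
    have s1: "submodule U1 A ?U" and s2: "submodule U2 A ?U" using ds by (simp_all add: internal_direct_sum_def)
    note D1 = U.submoduleD[OF s1] and D2 = U.submoduleD[OF s2]
    have s1M: "submodule U1 A M" by (rule M.left_submoduleI) (use D1 UD in auto)
    let ?U1 = "M\<lparr>carrier := U1\<rparr>"
    from direct_sum_projection[OF Um ds] obtain p where p: "p \<in> module_hom A ?U ?U"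
      "\<forall>x\<in>carrier ?U. p x \<in> U1" "\<forall>u\<in>U1. p u = u" "\<forall>w\<in>U2. p w = \<zero>\<^bsub>?U\<^esub>"
      by (elim bexE conjE)
    note pD = module_homD[OF p(1)]
    have U1U: "U1 \<subseteq> U" using D1(1) by simp
    have "retract M U1 (\<lambda>x. p (e x))"
      unfolding retract_def
    proof (intro conjI s1M ballI)
      show "(\<lambda>x. p (e x)) \<in> module_hom A M ?U1"
        by (rule module_homI) (use p(2) module_homD[OF eh] pD in auto)
      show "p (e u) = u" if "u \<in> U1" for u using that p(3) id U1U by auto
    qed
    then have lower: "(LEAST n. good n) \<le> m" if "dim_bound M U1 m" for m
      using that U1 unfolding good_def by (intro Least_le) blast
    have U1m: "left_module A ?U1" by (rule M.submodule_left_module[OF s1M])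
    interpret U1V: linear_space k "base_space A ?U1" by (rule base_linear_space[OF U1m])
    have lin: "p (c \<odot>\<^bsub>base_space A ?U\<^esub> x) = c \<odot>\<^bsub>base_space A ?U1\<^esub> p x" if "c \<in> carrier k" "x \<in> U" for c x
      using pD(3)[of "c \<odot>\<^bsub>A\<^esub> \<one>\<^bsub>A\<^esub>" x] that by (simp add: base_space_smult)
    have lc: "p (UV.lincomb S c) = finsum (base_space A ?U1) (\<lambda>s. (c s [^] (1::nat)) \<odot>\<^bsub>base_space A ?U1\<^esub> p s) S"
      if c: "c \<in> S \<rightarrow> carrier k" for c
    proof (rule UV.semilinear_lincomb[OF Sc(2) c U1V.V.module_axioms])
      show "additive_map (base_space A ?U) (base_space A ?U1) p"
        by (rule additive_mapI) (use p(2) pD(2) in auto)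
      show "p (c \<odot>\<^bsub>base_space A ?U\<^esub> v) = (c [^] (1::nat)) \<odot>\<^bsub>base_space A ?U1\<^esub> p v"
        if "c \<in> carrier k" "v \<in> carrier (base_space A ?U)" for c v
        using lin[of c v] that by simp
    qed
    have pS: "p ` S \<subseteq> carrier (base_space A ?U1)" using p(2) Sc(2) by auto
    have spans: "U1V.spans (p ` S)"
    proof (rule U1V.spansI[OF finite_imageI[OF Sc(1)] pS])
      fix H assume H: "p ` S \<subseteq> H" "\<zero>\<^bsub>base_space A ?U1\<^esub> \<in> H"
        "\<And>x y. \<lbrakk>x \<in> H; y \<in> H\<rbrakk> \<Longrightarrow> x \<oplus>\<^bsub>base_space A ?U1\<^esub> y \<in> H"
        "\<And>c x. \<lbrakk>c \<in> carrier k; x \<in> H\<rbrakk> \<Longrightarrow> c \<odot>\<^bsub>base_space A ?U1\<^esub> x \<in> H"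
      have z: "p \<zero>\<^bsub>?U\<^esub> = \<zero>\<^bsub>?U\<^esub>"
        by (rule additive_map_zero[OF U.M.abelian_group_axioms U.M.abelian_group_axioms pD(4)])
      have "p u \<in> H" if "u \<in> carrier (base_space A ?U)" for u
        using that
      proof (rule UV.spans_induct[OF S(1)])
        show "p s \<in> H" if "s \<in> S" for s using H(1) that by blast
        show "p \<zero>\<^bsub>base_space A ?U\<^esub> \<in> H" using z H(2) by simp
        show "p (x \<oplus>\<^bsub>base_space A ?U\<^esub> y) \<in> H"
          if "x \<in> carrier (base_space A ?U)" "y \<in> carrier (base_space A ?U)" "p x \<in> H" "p y \<in> H" for x y
          using pD(2)[of x y] H(3)[OF that(3,4)] that(1,2) by simp
        show "p (c \<odot>\<^bsub>base_space A ?U\<^esub> x) \<in> H"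
          if "c \<in> carrier k" "x \<in> carrier (base_space A ?U)" "p x \<in> H" for c x
          using lin[of c x] H(4)[OF that(1,3)] that by simp
      qed
      then have "p u \<in> H" if "u \<in> U1" for u using U1U that by auto
      then show "carrier (base_space A ?U1) \<subseteq> H" using p(3) by auto
    qed
    have "dim_bound M U1 (card (p ` S))" using spans by (auto simp: dim_bound_def)
    then have "card S \<le> card (p ` S)" using lower S(2) by simp
    then have cardS: "card (p ` S) = card S" using card_image_le[OF Sc(1), of p] by linarith
    then have inj: "inj_on p S" by (rule eq_card_imp_inj_on[OF Sc(1)])
    have indep: "U1V.lin_indep (p ` S)"
    proof (rule U1V.minimal_lin_indep[OF spans])
      fix S' assume "U1V.spans S'"
      then show "card (p ` S) \<le> card S'" using lower[of "card S'"] cardS S(2) by (auto simp: dim_bound_def)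
    qed
    have "w = \<zero>\<^bsub>M\<^esub>" if w: "w \<in> U2" for w
    proof -
      have wU: "w \<in> carrier (base_space A ?U)" using w D2(1) by auto
      obtain c where c: "c \<in> S \<rightarrow> carrier k" "w = UV.lincomb S c" by (rule UV.spansE[OF S(1) wU])
      define d where "d t = c (inv_into S p t)" for t
      have dp: "d (p s) = c s" if "s \<in> S" for s using inj that by (simp add: d_def)
      have dc: "d \<in> p ` S \<rightarrow> carrier k" using c(1) dp by auto
      have pc: "p s \<in> carrier (base_space A ?U1)" if "s \<in> S" for s using pS that by auto
      have "U1V.lincomb (p ` S) d = finsum (base_space A ?U1) (\<lambda>s. d (p s) \<odot>\<^bsub>base_space A ?U1\<^esub> p s) S"
        unfolding U1V.lincomb_def
      proof (rule U1V.V.M.finsum_reindex[OF _ inj])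
        show "(\<lambda>t. d t \<odot>\<^bsub>base_space A ?U1\<^esub> t) \<in> p ` S \<rightarrow> carrier (base_space A ?U1)"
          using U1V.V.smult_closed dc pS by (auto simp: Pi_iff image_subset_iff)
      qed
      also have "\<dots> = finsum (base_space A ?U1) (\<lambda>s. (c s [^] (1::nat)) \<odot>\<^bsub>base_space A ?U1\<^esub> p s) S"
      proof (rule U1V.V.M.finsum_cong'[OF refl])
        show "(\<lambda>s. (c s [^] (1::nat)) \<odot>\<^bsub>base_space A ?U1\<^esub> p s) \<in> S \<rightarrow> carrier (base_space A ?U1)"
          using U1V.V.smult_closed c(1) pc by (auto simp: Pi_iff)
        show "d (p s) \<odot>\<^bsub>base_space A ?U1\<^esub> p s = (c s [^] (1::nat)) \<odot>\<^bsub>base_space A ?U1\<^esub> p s" if "s \<in> S" for s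
        proof -
          have "c s \<in> carrier k" using c(1) that by auto
          then show ?thesis using dp[OF that] by simp
        qed
      qed
      also have "\<dots> = p w" unfolding c(2) by (rule lc[OF c(1), symmetric])
      also have "\<dots> = \<zero>\<^bsub>M\<^esub>" using p(4) w by simp
      finally have "U1V.lincomb (p ` S) d = \<zero>\<^bsub>base_space A ?U1\<^esub>" by simp
      then have "d t = \<zero>" if "t \<in> p ` S" for t using indep dc that unfolding U1V.lin_indep_def by blast
      then have "c s = \<zero>" if "s \<in> S" for s using dp[OF that] that by simp
      then have "UV.lincomb S c = UV.lincomb S (\<lambda>_. \<zero>)" by (intro UV.lincomb_cong[OF Sc(2)]) auto
      then show ?thesis using c(2) UV.lincomb_zero[OF Sc(2)] by simp
    qed
    then have "U2 \<subseteq> {\<zero>\<^bsub>M\<^esub>}" by blast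
    moreover have "\<zero>\<^bsub>M\<^esub> \<in> U2" using D2(2) by simp
    ultimately show ?thesis by blast
  qed
  have "finite_dimensional k (base_space A ?U)"
    unfolding UV.finite_dimensional_iff[of k "base_space A ?U", OF refl refl refl refl refl] using S(1) by blast
  moreover have "\<forall>U1 U2. internal_direct_sum A ?U U1 U2 \<longrightarrow> U1 = {\<zero>\<^bsub>?U\<^esub>} \<or> U2 = {\<zero>\<^bsub>?U\<^esub>}"
  proof (intro allI impI)
    fix U1 U2 assume "internal_direct_sum A ?U U1 U2"
    from key[OF this] show "U1 = {\<zero>\<^bsub>?U\<^esub>} \<or> U2 = {\<zero>\<^bsub>?U\<^esub>}" by (cases "U1 = {\<zero>\<^bsub>M\<^esub>}") simp_all
  qed
  moreover have "carrier ?U \<noteq> {\<zero>\<^bsub>?U\<^esub>}" using Unz by simp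
  ultimately have "indecomposable_module k A ?U"
    unfolding indecomposable_module_def fd_module_def using Um by blast
  then show ?thesis using e by blast
qed

end

section \<open>Bijective semilinear maps and roots of Frobenius maps\<close>

context frobenius_space
begin

text \<open>N is chosen so that \<open>Fix N\<close> contains v and the images of a basis of fixed
  vectors. As \<open>Kn N\<close> is closed under powers, G maps the finite set \<open>Fix N\<close>
  injectively into itself.\<close>

lemma semilinear_periodic:
  assumes S: "spans S" and G: "additive_map V V G" "inj_on G (carrier V)"
    and Gs: "\<And>c v. \<lbrakk>c \<in> carrier k; v \<in> carrier V\<rbrakk> \<Longrightarrow> G (c \<odot>\<^bsub>V\<^esub> v) = (c [^] (m::nat)) \<odot>\<^bsub>V\<^esub> G v"
    and v: "v \<in> carrier V"
  shows "\<exists>n>0. (G ^^ n) v = v"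
proof -
  have Gc: "G x \<in> carrier V" if "x \<in> carrier V" for x using G(1) that by (auto simp: additive_map_def)
  obtain T where T: "T \<subseteq> Fix 1" "spans T" "lin_indep T" using ex_fixed_basis[OF S] by (elim exE conjE)
  have Tc: "finite T" "T \<subseteq> carrier V" using T(2) by (simp_all add: spans_def)
  obtain N where N: "N > 0" "insert v (G ` T) \<subseteq> Fix N"
    using Fix_ex_common[of "insert v (G ` T)"] Tc v Gc by (auto simp: image_subset_iff subset_iff)
  have "G x \<in> Fix N" if x: "x \<in> Fix N" for x
  proof -
    have "x \<in> lincomb T ` (T \<rightarrow>\<^sub>E Kn N)" using x unfolding Fix_eq_lincomb[OF T] .
    then obtain c where c: "x = lincomb T c" "c \<in> T \<rightarrow>\<^sub>E Kn N" by (elim imageE)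
    have cK: "c t \<in> Kn N" if "t \<in> T" for t using c(2) that by auto
    have ck: "c \<in> T \<rightarrow> carrier k" using cK Kn_carrier by blast
    have "G x = finsum V (\<lambda>t. (c t [^] m) \<odot>\<^bsub>V\<^esub> G t) T"
      unfolding c(1) by (rule semilinear_lincomb[OF Tc(2) ck V.module_axioms G(1) Gs])
    also have "\<dots> \<in> Fix N"
    proof (rule Fix_finsum)
      show "(\<lambda>t. (c t [^] m) \<odot>\<^bsub>V\<^esub> G t) \<in> T \<rightarrow> Fix N"
        using Fix_smult[OF Kn_pow_closed[OF cK]] N(2) by auto
    qed
    finally show ?thesis .
  qed
  moreover have "inj_on G (Fix N)" using G(2) Fix_carrier by (meson inj_on_subset subsetI)
  moreover have "finite (Fix N)" by (rule finite_Fix[OF S N(1)])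
  ultimately obtain n where "n > 0" "\<forall>x \<in> Fix N. (G ^^ n) x = x"
    using finite_funpow_periodic[of "Fix N" G] by blast
  then show ?thesis using N(2) by blast
qed

text \<open>In a basis of \<open>F\<close>-fixed vectors \<open>F\<close> is the q-power of the
  coordinates, and the p-power of the coordinates is an r-th root of it. The root depends on the
  basis, and no compatibility with an algebra action is claimed.\<close>

lemma frobenius_root:
  fixes p r
  assumes p: "frobenius_field k p" and q: "q = p ^ r" and S: "spans S"
  shows "\<exists>H. frobenius_space k p V H \<and> (\<forall>v \<in> carrier V. (H ^^ r) v = F v)"
proof -
  interpret P: frobenius_field k p by (rule p)
  obtain T where T: "T \<subseteq> Fix 1" "spans T" "lin_indep T" using ex_fixed_basis[OF S] by (elim exE conjE)
  have Tc: "finite T" "T \<subseteq> carrier V" using T(2) by (simp_all add: spans_def)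
  define co where "co v = (SOME c. c \<in> T \<rightarrow> carrier k \<and> v = lincomb T c)" for v
  have co: "co v \<in> T \<rightarrow> carrier k \<and> v = lincomb T (co v)" if v: "v \<in> carrier V" for v
  proof -
    obtain c where "c \<in> T \<rightarrow> carrier k" "v = lincomb T c" by (rule spansE[OF T(2) v])
    then have "\<exists>c. c \<in> T \<rightarrow> carrier k \<and> v = lincomb T c" by blast
    then show ?thesis unfolding co_def by (rule someI_ex)
  qed
  define H where "H v = lincomb T (\<lambda>t. co v t [^] p)" for v
  have H: "H (lincomb T c) = lincomb T (\<lambda>t. c t [^] p)" if c: "c \<in> T \<rightarrow> carrier k" for c
  proof -
    have v: "lincomb T c \<in> carrier V" by (rule lincomb_closed[OF Tc(2) c])
    have "co (lincomb T c) t = c t" if "t \<in> T" for t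
      using lin_indep_unique[OF T(3) Tc(2) conjunct1[OF co[OF v]] c conjunct2[OF co[OF v], symmetric] that] .
    then show ?thesis unfolding H_def using c by (intro lincomb_cong[OF Tc(2)]) auto
  qed
  have pw: "(\<lambda>t. c t [^] (n::nat)) \<in> T \<rightarrow> carrier k" if "c \<in> T \<rightarrow> carrier k" for c n using that by auto
  have Hn: "(H ^^ n) (lincomb T c) = lincomb T (\<lambda>t. c t [^] (p ^ n))" if c: "c \<in> T \<rightarrow> carrier k" for c n
  proof (induction n)
    case 0
    have "(\<lambda>t. c t [^] (1::nat)) \<in> T \<rightarrow> carrier k" by (rule pw[OF c])
    then show ?case by (simp, intro lincomb_cong[OF Tc(2)]) (use c in \<open>auto simp: Pi_iff\<close>)
  next
    case (Suc n)
    have "(H ^^ Suc n) (lincomb T c) = lincomb T (\<lambda>t. (c t [^] (p ^ n)) [^] p)"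
      using Suc H[OF pw[OF c]] by simp
    also have "\<dots> = lincomb T (\<lambda>t. c t [^] (p ^ Suc n))"
      by (rule lincomb_cong[OF Tc(2) pw[OF c]]) (use c in \<open>auto simp: nat_pow_pow mult.commute Pi_iff\<close>)
    finally show ?case .
  qed
  have Hc: "H v \<in> carrier V" if "v \<in> carrier V" for v
    unfolding H_def by (rule lincomb_closed[OF Tc(2) pw[OF conjunct1[OF co[OF that]]]])
  have "frobenius_space k p V H"
  proof (intro frobenius_space.intro frobenius_space_axioms.intro)
    show "frobenius_field k p" by (rule p)
    show "module k V" by (rule V.module_axioms)
    show "additive_map V V H"
    proof (rule additive_mapI[OF Hc])
      fix v w assume v: "v \<in> carrier V" and w: "w \<in> carrier V"
      obtain c where c: "c \<in> T \<rightarrow> carrier k" "v = lincomb T c" by (rule spansE[OF T(2) v])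
      obtain d where d: "d \<in> T \<rightarrow> carrier k" "w = lincomb T d" by (rule spansE[OF T(2) w])
      have cd: "(\<lambda>t. c t \<oplus> d t) \<in> T \<rightarrow> carrier k" using c(1) d(1) by auto
      have "H (v \<oplus>\<^bsub>V\<^esub> w) = lincomb T (\<lambda>t. (c t \<oplus> d t) [^] p)"
        using lincomb_add[OF Tc(2) c(1) d(1)] H[OF cd] c(2) d(2) by simp
      also have "\<dots> = lincomb T (\<lambda>t. c t [^] p \<oplus> d t [^] p)"
        by (rule lincomb_cong[OF Tc(2)]) (use c(1) d(1) in \<open>auto simp: Pi_iff P.frob_add\<close>)
      also have "\<dots> = H v \<oplus>\<^bsub>V\<^esub> H w"
        using lincomb_add[OF Tc(2) pw[OF c(1)] pw[OF d(1)]] H[OF c(1)] H[OF d(1)] c(2) d(2) by simp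
      finally show "H (v \<oplus>\<^bsub>V\<^esub> w) = H v \<oplus>\<^bsub>V\<^esub> H w" .
    qed
    show "H (a \<odot>\<^bsub>V\<^esub> v) = (a [^] p) \<odot>\<^bsub>V\<^esub> H v" if a: "a \<in> carrier k" and v: "v \<in> carrier V" for a v
    proof -
      obtain c where c: "c \<in> T \<rightarrow> carrier k" "v = lincomb T c" by (rule spansE[OF T(2) v])
      have ac: "(\<lambda>t. a \<otimes> c t) \<in> T \<rightarrow> carrier k" using c(1) a by auto
      have "H (a \<odot>\<^bsub>V\<^esub> v) = lincomb T (\<lambda>t. (a \<otimes> c t) [^] p)"
        using lincomb_smult[OF Tc(2) c(1) a] H[OF ac] c(2) by simp
      also have "\<dots> = lincomb T (\<lambda>t. (a [^] p) \<otimes> c t [^] p)"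
        by (rule lincomb_cong[OF Tc(2)]) (use c(1) a in \<open>auto simp: Pi_iff nat_pow_distrib\<close>)
      also have "\<dots> = (a [^] p) \<odot>\<^bsub>V\<^esub> H v"
        using lincomb_smult[OF Tc(2) pw[OF c(1)], of "a [^] p"] a H[OF c(1)] c(2) by simp
      finally show ?thesis .
    qed
    show "\<exists>n>0. (H ^^ n) v = v" if v: "v \<in> carrier V" for v
    proof -
      obtain c where c: "c \<in> T \<rightarrow> carrier k" "v = lincomb T c" by (rule spansE[OF T(2) v])
      interpret X: frobenius_space k p "\<lparr>carrier = carrier k, monoid.mult = monoid.mult k, one = one k,
        ring.zero = \<zero>, ring.add = ring.add k, smult = monoid.mult k\<rparr>" "\<lambda>x. x [^] p" by (rule P.self_space)
      have pwr: "((\<lambda>x. x [^] p) ^^ j) a = a [^] (p ^ j)" if "a \<in> carrier k" for a j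
        by (induction j) (use that in \<open>auto simp: nat_pow_pow mult.commute\<close>)
      have cT: "c ` T \<subseteq> carrier k" using c(1) by auto
      obtain n where n: "n > 0" "c ` T \<subseteq> X.Fix n"
        using X.Fix_ex_common[of "c ` T"] Tc(1) cT by auto
      have "c t [^] (p ^ n) = c t" if "t \<in> T" for t
      proof -
        have "c t \<in> X.Fix n" using n(2) that by blast
        then show ?thesis using pwr[of "c t" n] by (simp add: X.Fix_def)
      qed
      then have "(H ^^ n) v = v" unfolding c(2) Hn[OF c(1)] by (rule lincomb_cong[OF Tc(2) c(1)])
      then show ?thesis using n(1) by blast
    qed
  qed
  moreover have "(H ^^ r) v = F v" if v: "v \<in> carrier V" for v
  proof -
    obtain c where c: "c \<in> T \<rightarrow> carrier k" "v = lincomb T c" by (rule spansE[OF T(2) v])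
    have "F v = (F ^^ 1) v" by (simp add: One_nat_def)
    also have "\<dots> = lincomb T (\<lambda>t. c t [^] (q ^ 1))" unfolding c(2) by (rule Fp_lincomb[OF T(1) c(1)])
    also have "\<dots> = (H ^^ r) v" unfolding c(2) Hn[OF c(1)] q by simp
    finally show ?thesis by simp
  qed
  ultimately show ?thesis by blast
qed

end

section \<open>Direct summands of stable modules\<close>

context frobenius_module
begin

lemma G_power_act: "\<lbrakk>a \<in> AF; x \<in> carrier M\<rbrakk> \<Longrightarrow> (G ^^ i) (a \<odot>\<^bsub>M\<^esub> x) = a \<odot>\<^bsub>M\<^esub> (G ^^ i) x"
proof (induction i)
  case (Suc i)
  have "(G ^^ i) x \<in> carrier M" using G.Fp_closed[of x i] Suc.prems(2) unfolding base_space_simps .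
  from semilinearD(4)[OF G_semilinear AF_carrier[OF Suc.prems(1)] this]
  show ?case using Suc by (simp add: AF_power)
qed simp

lemma trace_hom:
  assumes f: "f \<in> module_hom B Z M" and fixed: "\<And>x. x \<in> carrier Z \<Longrightarrow> f x \<in> G.Fix m"
  shows "(\<lambda>x. G.tr m (f x)) \<in> module_hom B Z Y"
proof (rule module_homI)
  note fD = module_homD[OF f]
  show "G.tr m (f x) \<in> carrier Y" if "x \<in> carrier Z" for x
    unfolding carrier_Y by (rule G.tr_Fix[OF fixed[OF that]])
  show "G.tr m (f (x \<oplus>\<^bsub>Z\<^esub> y)) = G.tr m (f x) \<oplus>\<^bsub>Y\<^esub> G.tr m (f y)"
    if "x \<in> carrier Z" "y \<in> carrier Z" for x y
    using additive_map_add[OF G.tr_additive, of "f x" "f y"] fD(1,2) that by simp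
  show "G.tr m (f (a \<odot>\<^bsub>Z\<^esub> x)) = a \<odot>\<^bsub>Y\<^esub> G.tr m (f x)" if a: "a \<in> carrier B" and x: "x \<in> carrier Z" for a x
  proof -
    have aF: "a \<in> AF" using a unfolding carrier_B .
    have fx: "f x \<in> carrier M" by (rule fD(1)[OF x])
    have Gc: "(G ^^ i) (f x) \<in> carrier M" for i using G.Fp_closed[of "f x" i] fx unfolding base_space_simps by blast
    have "G.tr m (f (a \<odot>\<^bsub>Z\<^esub> x)) = finsum M (\<lambda>i. a \<odot>\<^bsub>M\<^esub> (G ^^ i) (f x)) {..<m}"
      unfolding G.tr_def finsum_base_space fD(3)[OF a x] G_power_act[OF aF fx] ..
    also have "\<dots> = a \<odot>\<^bsub>M\<^esub> finsum M (\<lambda>i. (G ^^ i) (f x)) {..<m}"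
      using Gc by (intro additive_map_finsum[OF ab_M ab_M M.smult_additive[OF AF_carrier[OF aF]], symmetric]) blast
    finally show ?thesis by (simp add: G.tr_def finsum_base_space)
  qed
qed

lemma scalar_mult_hom:
  assumes f: "f \<in> module_hom B Z M" and c: "c \<in> carrier k"
  shows "(\<lambda>x. c \<odot>\<^bsub>V\<^esub> f x) \<in> module_hom B Z M"
proof (rule module_homI)
  note fD = module_homD[OF f]
  show "c \<odot>\<^bsub>V\<^esub> f (a \<odot>\<^bsub>Z\<^esub> x) = a \<odot>\<^bsub>M\<^esub> (c \<odot>\<^bsub>V\<^esub> f x)" if "a \<in> carrier B" "x \<in> carrier Z" for a x
    using that smult_base(2)[OF left_M c _ fD(1)[OF that(2)], of a] AF_carrier
    by (simp add: fD(3) carrier_B)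
  show "c \<odot>\<^bsub>V\<^esub> f (x \<oplus>\<^bsub>Z\<^esub> y) = c \<odot>\<^bsub>V\<^esub> f x \<oplus>\<^bsub>M\<^esub> c \<odot>\<^bsub>V\<^esub> f y" if "x \<in> carrier Z" "y \<in> carrier Z" for x y
    using G.V.smult_r_distr[OF c, of "f x" "f y"] fD(1,2) that by simp
qed (use module_homD(1)[OF f] c V_closed in blast)

text \<open>\<open>G\<close> need not preserve U, but the power that fixes a finite spanning set of
  U does.\<close>

lemma submodule_frobenius_power:
  assumes U: "submodule U A M" and fdU: "linear_space.spans k (base_space A (M\<lparr>carrier := U\<rparr>)) S"
  shows "\<exists>n>0. frobenius_space k (q ^ (n * r)) (base_space A (M\<lparr>carrier := U\<rparr>)) (G ^^ n) \<and>
    semilinear (n * r) (M\<lparr>carrier := U\<rparr>) (M\<lparr>carrier := U\<rparr>) (G ^^ n)"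
proof -
  let ?U = "M\<lparr>carrier := U\<rparr>"
  note UD = M.submoduleD[OF U]
  have Um: "left_module A ?U" by (rule M.submodule_left_module[OF U])
  interpret L: linear_space k "base_space A ?U" by (rule base_linear_space[OF Um])
  have S: "finite S" "S \<subseteq> carrier V" using fdU UD(1) by (auto simp: L.spans_def)
  obtain n where n: "n > 0" "S \<subseteq> G.Fix n" using G.Fix_ex_common[OF S] by blast
  have UV: "u \<in> carrier V" if "u \<in> U" for u using UD(1) that by auto
  have semi: "semilinear (i * r) M M (G ^^ i)" for i
  proof (induction i)
    case 0
    show ?case by (simp add: semilinear_def additive_map_def)
  next
    case (Suc i)
    show ?case using semilinear_compose[OF G_semilinear Suc] by (simp add: comp_def)
  qed
  note sD = semilinearD[OF semi[of n]]
  have sc: "(G ^^ n) (c \<odot>\<^bsub>base_space A ?U\<^esub> u) = (c [^] (q ^ (n * r))) \<odot>\<^bsub>base_space A ?U\<^esub> (G ^^ n) u"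
    if "c \<in> carrier k" "u \<in> U" for c u
    using semilinear_scalar[OF semi[of n] that(1), of u] UD(1) that(2) by (auto simp: base_space_smult)
  have cl: "(G ^^ n) u \<in> U" if "u \<in> U" for u
  proof -
    have "u \<in> carrier (base_space A ?U)" using that by simp
    from fdU this show ?thesis
    proof (rule L.spans_induct)
      show "(G ^^ n) s \<in> U" if "s \<in> S" for s
      proof -
        have "(G ^^ n) s = s" "s \<in> U" using that n(2) fdU by (auto simp: G.Fix_def L.spans_def)
        then show ?thesis by simp
      qed
      show "(G ^^ n) \<zero>\<^bsub>base_space A ?U\<^esub> \<in> U"
        using additive_map_zero[OF ab_M ab_M sD(1)] UD(2) by simp
      show "(G ^^ n) (x \<oplus>\<^bsub>base_space A ?U\<^esub> y) \<in> U"
        if "x \<in> carrier (base_space A ?U)" "y \<in> carrier (base_space A ?U)" "(G ^^ n) x \<in> U" "(G ^^ n) y \<in> U" for x y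
        using that sD(3)[of x y] UD(3)[of "(G ^^ n) x" "(G ^^ n) y"] UD(1) by (simp add: subset_iff)
      show "(G ^^ n) (c \<odot>\<^bsub>base_space A ?U\<^esub> x) \<in> U"
        if "c \<in> carrier k" "x \<in> carrier (base_space A ?U)" "(G ^^ n) x \<in> U" for c x
        using sc[OF that(1), of x] L.V.smult_closed[of "c [^] (q ^ (n * r))" "(G ^^ n) x"] that by simp
    qed
  qed
  have add: "additive_map ?U ?U (G ^^ n)"
    by (rule additive_mapI) (use cl sD(3) UD(1) in auto)
  have "frobenius_space k (q ^ (n * r)) (base_space A ?U) (G ^^ n)"
  proof (intro frobenius_space.intro frobenius_space_axioms.intro)
    show "frobenius_field k (q ^ (n * r))" using n(1) r_pos by (intro frobenius_field_power) simp
    show "module k (base_space A ?U)" by (rule base_module[OF Um])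
    show "additive_map (base_space A ?U) (base_space A ?U) (G ^^ n)"
      using add by (simp add: additive_map_base_space)
    show "\<exists>j>0. ((G ^^ n) ^^ j) u = u" if u: "u \<in> carrier (base_space A ?U)" for u
    proof -
      have uV: "u \<in> carrier V" using u UV by simp
      obtain j where j: "j > 0" "u \<in> G.Fix j" using G.Fix_ex[OF uV] by blast
      then have "(G ^^ (n * j)) u = u" using G.Fix_dvd[of u j "n * j"] by (simp add: G.Fix_def)
      then show ?thesis using j(1) by (auto simp: funpow_mult)
    qed
  qed (use sc in simp)
  moreover have "semilinear (n * r) ?U ?U (G ^^ n)"
    unfolding semilinear_def using add sD(4) UD(1) by auto
  ultimately show ?thesis using n(1) by blast
qed

end

text \<open>If \<open>M\<close> is a direct summand of a stable module \<open>N\<close>, the descent formula for \<open>N\<close>, followed by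
  the projection to \<open>M\<close> and the trace of \<open>G\<close>, writes a nonzero scalar as a sum of endomorphisms of
  \<open>M\<^sup>G\<close> that factor through \<open>N\<^sup>F\<close>; by locality one of them is bijective.\<close>

lemma (in aperiodic_module) fixed_points_summand:
  fixes N :: "('b, 'n) module"
  assumes N: "frobenius_module k q A FA N 1 F"
    and \<iota>: "\<iota> \<in> module_hom A M N" and \<pi>: "\<pi> \<in> module_hom A N M"
    and \<pi>\<iota>: "\<And>x. x \<in> carrier M \<Longrightarrow> \<pi> (\<iota> x) = x"
  shows "\<exists>\<theta> \<in> module_hom B Y (fixed_points N F). \<exists>\<rho> \<in> module_hom B (fixed_points N F) Y.
    bij_betw (\<lambda>x. \<rho> (\<theta> x)) (carrier Y) (carrier Y)"
proof -
  interpret N: frobenius_module k q A FA N 1 F by (rule N)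
  interpret E: ring E by (rule ring_E)
  interpret L: field L by (rule Kn_field)
  note iD = module_homD[OF \<iota>] and pD = module_homD[OF \<pi>]
  have pk: "\<pi> (c \<odot>\<^bsub>N.V\<^esub> y) = c \<odot>\<^bsub>V\<^esub> \<pi> y" if "c \<in> carrier k" "y \<in> carrier N" for c y
    using semilinear_scalar[of 0 N M \<pi>, OF _ that] \<pi> that by (simp add: semilinear_0_hom)
  have "finite (\<pi> ` N.M0)" "\<pi> ` N.M0 \<subseteq> carrier V"
    using N.finite_M0 pD(1) N.M0_carrier by auto
  then obtain m0 where m0: "m0 > 0" "\<pi> ` N.M0 \<subseteq> G.Fix m0" using G.Fix_ex_common by blast
  have "finite (\<iota> ` M0)" "\<iota> ` M0 \<subseteq> carrier N.V"
    using finite_M0 iD(1) M0_carrier by auto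
  then obtain l0 where l0: "l0 > 0" "\<iota> ` M0 \<subseteq> N.G.Fix l0" using N.G.Fix_ex_common by blast
  \<comment> \<open>The field of level l relative to q, used for N, is the field of level m relative
    to \<open>q^r\<close>, used for M. One set of scalars c therefore serves for the descent in N
    and for the trace of \<open>G\<close>.\<close>
  define m where "m = m0 * l0"
  define l where "l = r * m"
  have pos: "m > 0" "l > 0" using m0 l0 r_pos by (simp_all add: m_def l_def)
  have pF: "\<pi> y \<in> G.Fix m" if "y \<in> N.M0" for y
    using G.Fix_dvd[of "\<pi> y" m0 m] m0(2) that by (auto simp: m_def)
  have iF: "\<iota> x \<in> N.G.Fix l" if "x \<in> M0" for x
    using N.G.Fix_dvd[of "\<iota> x" l0 l] l0(2) that by (auto simp: l_def m_def)
  have Kl: "N.G.Kn l = Kn l" "G.Kn m = Kn l" using N.G_Kn[of l] G_Kn[of m] by (simp_all add: l_def)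
  have \<iota>B: "\<iota> \<in> module_hom B Y N"
    by (rule module_homI) (use iD M0_carrier AF_carrier in \<open>auto simp: carrier_Y carrier_B\<close>)
  have \<pi>B: "\<pi> \<in> module_hom B N.Y M"
    by (rule module_homI) (use pD N.M0_carrier AF_carrier in \<open>auto simp: N.carrier_Y carrier_B\<close>)
  define \<theta> where "\<theta> c x = N.G.tr l (c \<odot>\<^bsub>N.V\<^esub> \<iota> x)" for c x
  define \<rho> where "\<rho> d y = G.tr m (d \<odot>\<^bsub>V\<^esub> \<pi> y)" for d y
  have \<theta>: "\<theta> c \<in> module_hom B Y N.Y" if c: "c \<in> Kn l" for c
    unfolding \<theta>_def
  proof (rule N.trace_hom[OF N.scalar_mult_hom[OF \<iota>B Kn_carrier[OF c]]])
    show "c \<odot>\<^bsub>N.V\<^esub> \<iota> x \<in> N.G.Fix l" if "x \<in> carrier Y" for x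
      using that c unfolding carrier_Y by (intro N.G.Fix_smult iF) (simp_all add: Kl)
  qed
  have \<rho>: "\<rho> d \<in> module_hom B N.Y Y" if d: "d \<in> Kn l" for d
    unfolding \<rho>_def
  proof (rule trace_hom[OF scalar_mult_hom[OF \<pi>B Kn_carrier[OF d]]])
    show "d \<odot>\<^bsub>V\<^esub> \<pi> x \<in> G.Fix m" if "x \<in> carrier N.Y" for x
      using that d unfolding N.carrier_Y by (intro G.Fix_smult pF) (simp_all add: Kl)
  qed
  define t where "t g = (\<Oplus>i\<in>{..<m}. g [^] ((q ^ r) ^ i))" for g
  \<comment> \<open>If the trace from \<open>Kn l\<close> to \<open>Kn r\<close> vanished
    identically, the descent formula for the scalar 1 would read 1 = 0.\<close>
  have "\<exists>g \<in> Kn l. t g \<noteq> \<zero>"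
  proof (rule ccontr)
    assume "\<not> (\<exists>g \<in> Kn l. t g \<noteq> \<zero>)"
    then have t0: "(\<Oplus>i\<in>{..<m}. (c \<otimes> \<one>) [^] ((q ^ r) ^ i)) = \<zero>" if "c \<in> Kn l - {\<zero>}" for c
      using that Kn_carrier by (auto simp: t_def)
    have "\<one> = (\<Oplus>c\<in>Kn l - {\<zero>}. \<ominus> (inv c) \<otimes> (\<Oplus>i\<in>{..<m}. (c \<otimes> \<one>) [^] ((q ^ r) ^ i)))"
      using G.scalar_trace(1)[OF pos(1) one_closed] unfolding Kl .
    also have "\<dots> = (\<Oplus>c\<in>Kn l - {\<zero>}. \<zero>)"
    proof (rule finsum_cong'[OF refl])
      show "\<ominus> (inv c) \<otimes> (\<Oplus>i\<in>{..<m}. (c \<otimes> \<one>) [^] ((q ^ r) ^ i)) = \<zero>" if "c \<in> Kn l - {\<zero>}" for c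
        unfolding t0[OF that] using inv_carrier[of c] Kn_carrier[of c l] that by simp
    qed simp
    finally show False by (simp add: finsum_zero)
  qed
  then obtain g where g: "g \<in> Kn l" "t g \<noteq> \<zero>" by blast
  have gk: "g \<in> carrier k" by (rule Kn_carrier[OF g(1)])
  have tg: "t g \<in> Kn r" using G.scalar_trace(2)[OF pos(1) gk] g(1) G_Kn[of 1] unfolding Kl t_def by simp
  let ?K = "Kn l - {\<zero>}"
  \<comment> \<open>The descent coefficient -1/c times g. Without g the composites would add up to
    the trace of 1, which may be zero; with it they add up to the nonzero scalar
    \<open>t g\<close>.\<close>
  define d where "d c = g \<otimes> \<ominus> (inv c)" for c
  have Kc: "c \<in> Kn l" "c \<in> carrier k" "\<ominus> (inv c) \<in> Kn l" "\<ominus> (inv c) \<in> carrier k" if "c \<in> ?K" for c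
    using that Kn_inv Kn_neg Kn_carrier by blast+
  have dK: "d c \<in> Kn l" if "c \<in> ?K" for c unfolding d_def using Kc[OF that] g(1) Kn_mult by blast
  have sum: "finsum M (\<lambda>c. \<rho> (d c) (\<theta> c x)) ?K = t g \<odot>\<^bsub>V\<^esub> x" if x: "x \<in> M0" for x
  proof -
    have xM: "x \<in> carrier M" by (rule M0_carrier[OF x])
    have \<theta>c: "\<theta> c x \<in> carrier N" if "c \<in> ?K" for c
      using module_homD(1)[OF \<theta>[OF Kc(1)[OF that]], of x] x N.M0_carrier unfolding carrier_Y N.carrier_Y by blast
    have \<theta>s: "(\<ominus> (inv c)) \<odot>\<^bsub>N.V\<^esub> \<theta> c x \<in> carrier N" if "c \<in> ?K" for c
      by (rule N.V_closed[OF Kc(4)[OF that] \<theta>c[OF that]])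
    have "\<iota> x = finsum N (\<lambda>c. (\<ominus> (inv c)) \<odot>\<^bsub>N.V\<^esub> \<theta> c x) ?K"
      using N.G.descent[OF pos(2), of "\<iota> x"] iD(1)[OF xM] unfolding Kl finsum_base_space \<theta>_def by simp
    then have "x = \<pi> (finsum N (\<lambda>c. (\<ominus> (inv c)) \<odot>\<^bsub>N.V\<^esub> \<theta> c x) ?K)" using \<pi>\<iota>[OF xM] by simp
    also have "\<dots> = finsum M (\<lambda>c. \<pi> ((\<ominus> (inv c)) \<odot>\<^bsub>N.V\<^esub> \<theta> c x)) ?K"
      using \<theta>s by (intro additive_map_finsum[OF N.ab_M ab_M pD(4)]) blast
    also have "\<dots> = finsum M (\<lambda>c. (\<ominus> (inv c)) \<odot>\<^bsub>V\<^esub> \<pi> (\<theta> c x)) ?K"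
      using Kc(4) \<theta>c pD(1) V_closed by (intro M.M.finsum_cong') (auto simp: pk)
    finally have "g \<odot>\<^bsub>V\<^esub> x = g \<odot>\<^bsub>V\<^esub> finsum V (\<lambda>c. (\<ominus> (inv c)) \<odot>\<^bsub>V\<^esub> \<pi> (\<theta> c x)) ?K"
      unfolding finsum_base_space by simp
    also have "\<dots> = finsum V (\<lambda>c. g \<odot>\<^bsub>V\<^esub> ((\<ominus> (inv c)) \<odot>\<^bsub>V\<^esub> \<pi> (\<theta> c x))) ?K"
      using Kc(4) \<theta>c pD(1) V_closed
      by (intro additive_map_finsum[OF G.abelian_V G.abelian_V G.smult_additive[OF gk]]) auto
    also have "\<dots> = finsum V (\<lambda>c. d c \<odot>\<^bsub>V\<^esub> \<pi> (\<theta> c x)) ?K"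
    proof (rule G.V.M.finsum_cong'[OF refl])
      show "(\<lambda>c. d c \<odot>\<^bsub>V\<^esub> \<pi> (\<theta> c x)) \<in> ?K \<rightarrow> carrier V"
        using dK[THEN Kn_carrier] \<theta>c pD(1) V_closed by auto
      show "g \<odot>\<^bsub>V\<^esub> ((\<ominus> (inv c)) \<odot>\<^bsub>V\<^esub> \<pi> (\<theta> c x)) = d c \<odot>\<^bsub>V\<^esub> \<pi> (\<theta> c x)" if "c \<in> ?K" for c
        using G.V.smult_assoc1[OF gk Kc(4)[OF that], of "\<pi> (\<theta> c x)"] pD(1)[OF \<theta>c[OF that]] by (simp add: d_def)
    qed
    finally have "G.tr m (g \<odot>\<^bsub>V\<^esub> x) = G.tr m (finsum V (\<lambda>c. d c \<odot>\<^bsub>V\<^esub> \<pi> (\<theta> c x)) ?K)" by simp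
    also have "\<dots> = finsum V (\<lambda>c. \<rho> (d c) (\<theta> c x)) ?K"
      unfolding \<rho>_def using dK[THEN Kn_carrier] \<theta>c pD(1) V_closed
      by (intro additive_map_finsum[OF G.abelian_V G.abelian_V G.tr_additive]) auto
    finally have "finsum M (\<lambda>c. \<rho> (d c) (\<theta> c x)) ?K = G.tr m (g \<odot>\<^bsub>V\<^esub> x)" unfolding finsum_base_space by simp
    also have "\<dots> = finsum V (\<lambda>i. (g [^] ((q ^ r) ^ i)) \<odot>\<^bsub>V\<^esub> x) {..<m}"
      unfolding G.tr_def
    proof (rule G.V.M.finsum_cong'[OF refl])
      show "(G ^^ i) (g \<odot>\<^bsub>V\<^esub> x) = (g [^] ((q ^ r) ^ i)) \<odot>\<^bsub>V\<^esub> x" for i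
        using G.Fp_smult[OF gk, of x i] G.Fp_fixed[OF x, of i] xM by simp
    qed (use gk xM V_closed in auto)
    also have "\<dots> = t g \<odot>\<^bsub>V\<^esub> x"
      unfolding t_def using gk xM
      by (intro additive_map_finsum[OF G.abelian_k G.abelian_V G.smult_additive_left, symmetric]) auto
    finally show ?thesis .
  qed
  have comp: "(\<lambda>x. \<rho> (d c) (\<theta> c x)) \<in> module_hom B Y Y" if "c \<in> ?K" for c
    using module_homD[OF \<theta>[OF Kc(1)[OF that]]] module_homD[OF \<rho>[OF dK[OF that]]]
    by (intro module_homI) simp_all
  define f where "f c = restrict (\<lambda>x. \<rho> (d c) (\<theta> c x)) (carrier Y)" for c
  have fE: "f c \<in> carrier E" if "c \<in> ?K" for c
    unfolding f_def by (rule restrict_in_End[OF left_module_Y comp[OF that]])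
  then have fE': "f \<in> ?K \<rightarrow> carrier E" by blast
  obtain h where h: "h \<in> ring_hom E L" "\<forall>c \<in> Kn r. h (scal c) = c"
    "\<forall>f \<in> carrier E. h f \<noteq> \<zero> \<longrightarrow> f \<in> Units E"
    using residue_hom by (elim bexE conjE)
  have h_add: "additive_map E L h"
    by (rule additive_mapI) (use h(1) in \<open>auto simp: ring_hom_def\<close>)
  have "finsum E f ?K = scal (t g)"
  proof (rule E_eqI[OF E.finsum_closed[OF fE'] scal_E[OF tg]])
    fix x assume x: "x \<in> M0"
    have "additive_map E Y (\<lambda>f. f x)"
    proof (rule additive_mapI)
      show "f x \<in> carrier Y" if "f \<in> carrier E" for f
        using that homY_D(1)[of f x] x unfolding E_carrier carrier_Y by blast
      show "(f \<oplus>\<^bsub>E\<^esub> f') x = f x \<oplus>\<^bsub>Y\<^esub> f' x" for f f' using E_ops[OF x] by simp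
    qed
    from additive_map_finsum[OF E.abelian_group_axioms ab_Y this fE']
    have "finsum E f ?K x = finsum Y (\<lambda>c. f c x) ?K" .
    also have "\<dots> = finsum M (\<lambda>c. f c x) ?K"
    proof (rule finsum_Y, rule funcsetI)
      show "f c x \<in> M0" if "c \<in> ?K" for c
        using fE[OF that] homY_D(1)[of "f c" x] x unfolding E_carrier by blast
    qed
    also have "\<dots> = finsum M (\<lambda>c. \<rho> (d c) (\<theta> c x)) ?K" using x by (simp add: f_def carrier_Y)
    also have "\<dots> = scal (t g) x" using sum[OF x] scal_apply[OF x] by simp
    finally show "finsum E f ?K x = scal (t g) x" .
  qed
  then have "finsum L (\<lambda>c. h (f c)) ?K = t g"
    using additive_map_finsum[OF E.abelian_group_axioms L.abelian_group_axioms h_add fE'] h(2) tg by simp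
  then have "\<exists>c \<in> ?K. h (f c) \<noteq> \<zero>"
  proof (rule contrapos_pp)
    assume "\<not> (\<exists>c \<in> ?K. h (f c) \<noteq> \<zero>)"
    then have "finsum L (\<lambda>c. h (f c)) ?K = finsum L (\<lambda>c. \<zero>\<^bsub>L\<^esub>) ?K"
      using L.zero_closed by (intro L.finsum_cong'[OF refl]) auto
    also have "\<dots> = \<zero>\<^bsub>L\<^esub>" by (rule L.finsum_zero)
    finally show "finsum L (\<lambda>c. h (f c)) ?K \<noteq> t g" using g(2) by simp
  qed
  then obtain c where c: "c \<in> ?K" "h (f c) \<noteq> \<zero>" by blast
  have "f c \<in> Units E" using h(3) c fE by blast
  from End_algebra_Units_bij[OF left_module_Y this]
  have "bij_betw (f c) (carrier Y) (carrier Y)" .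
  then have "bij_betw (\<lambda>x. \<rho> (d c) (\<theta> c x)) (carrier Y) (carrier Y)"
    using bij_betw_cong[of "carrier Y" "f c" "\<lambda>x. \<rho> (d c) (\<theta> c x)" "carrier Y"] by (simp add: f_def)
  then show ?thesis using \<theta>[OF Kc(1)[OF c(1)]] \<rho>[OF dK[OF c(1)]] by blast
qed

section \<open>Every indecomposable module over the fixed algebra comes from a periodic
  module\<close>

context frobenius_setting
begin

text \<open>H shows that some positive degree admits a bijective semilinear map; \<open>G\<close> is
  one of least degree r. Periodicity of its orbits is not part of that choice and is supplied by
  \<open>semilinear_periodic\<close>, with H as the Frobenius map of comparison.\<close>

lemma ex_aperiodic_structure:
  assumes ind: "indecomposable_module k A M" and n: "n > 0"
    and H: "frobenius_space k (q ^ n) (base_space A M) H" "semilinear n M M H"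
  shows "\<exists>r G. aperiodic_module k q A FA M r G"
proof -
  have Mm: "left_module A M" using ind by (simp add: indecomposable_module_def fd_module_def)
  interpret H: frobenius_space k "q ^ n" "base_space A M" H by (rule H(1))
  obtain S where S: "H.spans S"
    using H.finite_dimensional_iff[of k "base_space A M"] ind
    by (auto simp: indecomposable_module_def fd_module_def)
  define P where "P s \<longleftrightarrow> s > 0 \<and> (\<exists>g. semilinear s M M g \<and> bij_betw g (carrier M) (carrier M))" for s
  have "P n" unfolding P_def using n H(2) H.F_bij by auto
  define r where "r = (LEAST s. P s)"
  have "P r" unfolding r_def by (rule LeastI) fact
  then obtain G where r: "r > 0" and G: "semilinear r M M G" "bij_betw G (carrier M) (carrier M)"
    unfolding P_def by blast
  have Gs: "G (c \<odot>\<^bsub>base_space A M\<^esub> v) = (c [^] (q ^ r)) \<odot>\<^bsub>base_space A M\<^esub> G v"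
    if "c \<in> carrier k" "v \<in> carrier (base_space A M)" for c v
    using semilinear_scalar[OF G(1) that(1), of v] that(2) by simp
  have Ga: "additive_map (base_space A M) (base_space A M) G"
    using semilinearD(1)[OF G(1)] by (simp add: additive_map_base_space)
  have "frobenius_space k (q ^ r) (base_space A M) G"
  proof (intro frobenius_space.intro frobenius_space_axioms.intro)
    show "frobenius_field k (q ^ r)" by (rule frobenius_field_power[OF r])
    show "module k (base_space A M)" by (rule base_module[OF Mm])
    show "\<exists>n>0. (G ^^ n) v = v" if "v \<in> carrier (base_space A M)" for v
      by (rule H.semilinear_periodic[OF S Ga _ Gs that])
        (use G(2) in \<open>simp_all add: bij_betw_def\<close>)
  qed (fact Ga Gs)+
  then have "frobenius_module k q A FA M r G"
    using frobenius_algebra_axioms Mm r G(1) S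
    by (intro frobenius_module.intro frobenius_module_axioms.intro) auto
  moreover have "\<not> bij_betw f (carrier M) (carrier M)" if "0 < s" "s < r" "semilinear s M M f" for s f
  proof
    assume "bij_betw f (carrier M) (carrier M)"
    then have "P s" using that unfolding P_def by blast
    then have "r \<le> s" unfolding r_def by (rule Least_le)
    then show False using that by simp
  qed
  ultimately have "aperiodic_module k q A FA M r G"
    using ac ind by (intro aperiodic_module.intro aperiodic_module_axioms.intro)
  then show ?thesis by blast
qed

text \<open>\<open>FM\<close> is an r-th root of \<open>G\<close> as a map on the vector space.
  Since \<open>FM^r = G\<close> is semilinear of degree r, the r-fold twist of M is M itself, so M
  can be taken as its own \<open>M'\<close>; minimality of r is aperiodicity.\<close>

lemma aperiodic_period:
  assumes ap: "aperiodic_module k q A FA M r G"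
  shows "\<exists>FM. frobenius_map k Fq (base_space A M) FM \<and> is_F_period A FA M FM r \<and>
    periodic_structure k A FA M FM r M \<and> fixed_points M (FM ^^ r) = fixed_points M G"
proof -
  interpret M: aperiodic_module k q A FA M r G by (rule ap)
  have fd: "fd_module k A M" using M.ind by (simp add: indecomposable_module_def)
  obtain S where S: "M.G.spans S" using M.fd by blast
  obtain FM where FM: "frobenius_space k q (base_space A M) FM"
    and FMr: "\<And>v. v \<in> carrier M \<Longrightarrow> (FM ^^ r) v = G v"
    using M.G.frobenius_root[OF frobenius_field_axioms refl S] by auto
  interpret F: frobenius_space k q "base_space A M" FM by (rule FM)
  have b: "bij_betw FM (carrier M) (carrier M)" using F.F_bij by simp
  have Fa: "additive_map M M FM" using F.F_additive by (simp add: additive_map_base_space)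
  note iso = twist_isomorphic_iff[OF M.left_M b Fa]
  have "bij_betw G (carrier M) (carrier M)" using M.G.F_bij by simp
  then have "module_isomorphic A (iterated_twist A FA FM r M) M"
    unfolding iso using M.G_semilinear by blast
  moreover have "r \<le> s" if "s \<ge> 1" "module_isomorphic A (iterated_twist A FA FM s M) M" for s
  proof (rule ccontr)
    assume "\<not> r \<le> s"
    moreover have "\<exists>g. semilinear s M M g \<and> bij_betw g (carrier M) (carrier M)"
      using that(2) unfolding iso .
    ultimately show False using M.aperiodic[of s] that(1) by auto
  qed
  moreover have "1 \<le> r" using M.r_pos by (simp add: One_nat_def)
  ultimately have per: "is_F_period A FA M FM r" unfolding is_F_period_def by blast
  have tw: "a \<odot>\<^bsub>iterated_twist A FA FM r M\<^esub> x = a \<odot>\<^bsub>M\<^esub> x" if a: "a \<in> carrier A" and x: "x \<in> carrier M" for a x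
  proof -
    define b' y where "b' = (inv_into (carrier A) FA ^^ r) a" and "y = (inv_into (carrier M) FM ^^ r) x"
    then have y: "b' \<in> carrier A" "y \<in> carrier M" "a = (FA ^^ r) b'" "x = (FM ^^ r) y"
      using inv_into_funpow(2,3)[OF FA_bij a, of r] inv_into_funpow(2,3)[OF b x, of r] by simp_all
    have "a \<odot>\<^bsub>iterated_twist A FA FM r M\<^esub> x = G (b' \<odot>\<^bsub>M\<^esub> y)"
      unfolding y(3,4) twist_smult_image[OF b y(1,2)] by (rule FMr[OF M.M.left_smult_closed[OF y(1,2)]])
    then show ?thesis using semilinearD(4)[OF M.G_semilinear y(1,2)] y(3,4) FMr[OF y(2)] by simp
  qed
  have "(\<lambda>x. x) \<in> module_hom A M M" by (rule module_homI) simp_all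
  then have "module_isomorphic A M M"
    unfolding module_isomorphic_def by (rule rev_bexI) (simp add: bij_betw_def)
  then have "periodic_structure k A FA M FM r M"
    unfolding periodic_structure_def by (simp add: fd tw)
  moreover have "frobenius_map k Fq (base_space A M) FM"
    by (rule frobenius_space_map[OF FM Kn_1 card_Fq])
  moreover have "fixed_points M (FM ^^ r) = fixed_points M G"
  proof -
    have "{x \<in> carrier M. (FM ^^ r) x = x} = {x \<in> carrier M. G x = x}" using FMr by auto
    then show ?thesis by (simp add: fixed_points_def)
  qed
  ultimately show ?thesis using per by blast
qed

lemma indecomposable_fixed_module:
  fixes N :: "('a, 'n) module"
  assumes ind: "indecomposable_module (k\<lparr>carrier := Fq\<rparr>) (fixed_points A FA) N"
  shows "\<exists>(M :: ('a, nat \<Rightarrow> 'k) module) FM r M'.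
    indecomposable_module k A M \<and> F_periodic k Fq A FA M \<and>
    frobenius_map k Fq (base_space A M) FM \<and> is_F_period A FA M FM r \<and>
    periodic_structure k A FA M FM r M' \<and>
    module_isomorphic (fixed_points A FA) N
      (fixed_points (tilde_module A FA FM r M') (tilde_frobenius FM r))"
proof -
  let ?B = "fixed_points A FA"
  have Nm: "left_module ?B N" and Nz: "carrier N \<noteq> {\<zero>\<^bsub>N\<^esub>}"
    and Nfd: "finite_dimensional (k\<lparr>carrier := Kn 1\<rparr>) (base_space ?B N)"
    using ind unfolding Kn_1 by (simp_all add: indecomposable_module_def fd_module_def)
  obtain d \<kappa> where "descent_module k q A FA (coordinate_space k d) (coordinate_frobenius d) N \<kappa>"
    using fixed_module_coordinates(1)[OF Nm Nfd] by blast
  then interpret D: descent_module k q A FA "coordinate_space k d" "coordinate_frobenius d" N \<kappa> .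
  let ?F = "coordinate_frobenius d"
  define W where "W = D.ext_module"
  have fm: "frobenius_module k q A FA W 1 ?F"
    unfolding W_def by (rule D.ext_frobenius_module[OF fixed_module_coordinates(2)[OF Nm Nfd]])
  interpret W: frobenius_module k q A FA W 1 ?F by (rule fm)
  have \<kappa>: "\<kappa> \<in> module_hom ?B W.Y N" "bij_betw \<kappa> (carrier W.Y) (carrier N)"
    using D.kappa_iso unfolding W_def .
  have "carrier W.Y \<noteq> {\<zero>\<^bsub>W.Y\<^esub>}"
  proof
    assume "carrier W.Y = {\<zero>\<^bsub>W.Y\<^esub>}"
    then have "carrier N = {\<kappa> \<zero>\<^bsub>W.Y\<^esub>}" using \<kappa>(2) by (metis bij_betw_def image_empty image_insert)
    moreover have "\<zero>\<^bsub>N\<^esub> \<in> carrier N" by (rule D.N.M.zero_closed)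
    ultimately show False using Nz by (metis singletonD)
  qed
  then have "carrier W \<noteq> {\<zero>\<^bsub>W\<^esub>}" using W.M0_zero unfolding W.carrier_Y fixed_points_simps
    using W.M0_carrier by blast
  from ex_indecomposable_retract[OF W.left_M W.fd this] obtain U e
    where e: "retract W U e" and Uind: "indecomposable_module k A (W\<lparr>carrier := U\<rparr>)" by (elim exE conjE)
  let ?M = "W\<lparr>carrier := U\<rparr>"
  have U: "submodule U A W" and eh: "e \<in> module_hom A W ?M" and eid: "\<And>u. u \<in> U \<Longrightarrow> e u = u"
    using e by (auto simp: retract_def)
  note UD = W.M.submoduleD[OF U]
  have Ufd: "fd_module k A ?M" using Uind by (simp add: indecomposable_module_def)
  have Um: "left_module A ?M" using Ufd by (simp add: fd_module_def)
  interpret UL: linear_space k "base_space A ?M" by (rule base_linear_space[OF Um])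
  obtain S where S: "UL.spans S"
    using UL.finite_dimensional_iff[of k "base_space A ?M"] Ufd by (auto simp: fd_module_def)
  \<comment> \<open>The Frobenius map of \<open>W\<close> need not preserve the summand, but a power
    of it does; this provides the bijective semilinear map from which the period is
    extracted.\<close>
  obtain n where n: "n > 0" "frobenius_space k (q ^ (n * 1)) (base_space A ?M) (?F ^^ n)"
    "semilinear (n * 1) ?M ?M (?F ^^ n)"
    using W.submodule_frobenius_power[OF U S] by blast
  obtain r G where ap: "aperiodic_module k q A FA ?M r G"
    using ex_aperiodic_structure[OF Uind n(1) n(2,3)[unfolded mult_1_right]] by (elim exE)
  interpret M: aperiodic_module k q A FA ?M r G by (rule ap)
  obtain FM where FM: "frobenius_map k Fq (base_space A ?M) FM" and per: "is_F_period A FA ?M FM r"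
    and ps: "periodic_structure k A FA ?M FM r ?M" and fix_eq: "fixed_points ?M (FM ^^ r) = M.Y"
    using aperiodic_period[OF ap] by blast
  interpret T: periodic_module k q A FA ?M FM r by (rule aperiodic_structure(1)[OF Uind FM per ps])
  have incl: "(\<lambda>x. x) \<in> module_hom A ?M W" by (rule module_homI) (use UD(1) in auto)
  obtain \<theta> \<rho> where \<theta>: "\<theta> \<in> module_hom ?B M.Y W.Y" and \<rho>: "\<rho> \<in> module_hom ?B W.Y M.Y"
    and bij: "bij_betw (\<lambda>x. \<rho> (\<theta> x)) (carrier M.Y) (carrier M.Y)"
    using M.fixed_points_summand[OF fm incl eh] eid by auto
  let ?im = "\<theta> ` carrier M.Y" and ?ker = "{y \<in> carrier W.Y. \<rho> y = \<zero>\<^bsub>M.Y\<^esub>}"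
  have ds: "internal_direct_sum ?B W.Y ?im ?ker"
    by (rule split_pair_direct_sum[where f = \<theta> and g = \<rho>, OF M.left_module_Y W.left_module_Y \<theta> \<rho> bij])
  interpret Y: left_module ?B W.Y by (rule W.left_module_Y)
  have \<theta>inj: "inj_on \<theta> (carrier M.Y)" using bij by (auto simp: bij_betw_def inj_on_def)
  have imz: "?im \<noteq> {\<zero>\<^bsub>W.Y\<^esub>}"
  proof
    assume im: "?im = {\<zero>\<^bsub>W.Y\<^esub>}"
    have "x = \<zero>\<^bsub>?M\<^esub>" if "x \<in> M.M0" for x
    proof -
      have "\<theta> x = \<theta> \<zero>\<^bsub>?M\<^esub>"
        using im imageI[OF that, of \<theta>] imageI[OF M.M0_zero, of \<theta>] unfolding M.carrier_Y by (metis singletonD)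
      then show ?thesis by (rule inj_onD[OF \<theta>inj[unfolded M.carrier_Y] _ that M.M0_zero])
    qed
    then show False using M.M0_nonzero M.M0_zero by blast
  qed
  note im = internal_direct_sum_image[OF W.left_module_Y Nm \<kappa> ds]
  \<comment> \<open>The splitting of the fixed points of \<open>W\<close> is carried to N by
    \<kappa>. The image of \<theta> is not zero, so indecomposability of N kills the complement and
    \<theta> becomes an isomorphism.\<close>
  have "\<kappa> ` ?im = {\<zero>\<^bsub>N\<^esub>} \<or> \<kappa> ` ?ker = {\<zero>\<^bsub>N\<^esub>}"
    using ind im(1) unfolding indecomposable_module_def by (elim conjE allE impE)
  then have ker: "?ker = {\<zero>\<^bsub>W.Y\<^esub>}" using im(2,3) imz by argo
  have "?im = carrier W.Y"
  proof -
    have sub: "submodule ?im ?B W.Y" "?im <+>\<^bsub>W.Y\<^esub> ?ker = carrier W.Y"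
      using ds by (simp_all add: internal_direct_sum_def)
    have "x \<in> ?im" if x: "x \<in> carrier W.Y" for x
    proof -
      have "x \<in> ?im <+>\<^bsub>W.Y\<^esub> {\<zero>\<^bsub>W.Y\<^esub>}" using x sub(2) unfolding ker by argo
      then obtain u where "u \<in> ?im" "x = u \<oplus>\<^bsub>W.Y\<^esub> \<zero>\<^bsub>W.Y\<^esub>"
        unfolding set_add_def' by (elim UN_E) (metis singletonD)
      moreover have "u \<in> carrier W.Y" if "u \<in> ?im" for u using Y.submoduleD(1)[OF sub(1)] that by (rule subsetD)
      ultimately show ?thesis using Y.M.r_zero by simp
    qed
    then show ?thesis using Y.submoduleD(1)[OF sub(1)] by blast
  qed
  then have \<theta>b: "bij_betw \<theta> (carrier M.Y) (carrier W.Y)" using \<theta>inj by (simp add: bij_betw_def)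
  note \<kappa>' = module_isomorphism_inverse[OF W.left_module_Y \<kappa>]
    and \<theta>' = module_isomorphism_inverse[OF M.left_module_Y \<theta> \<theta>b]
  have \<tau>: "T.\<tau> \<in> module_hom ?B M.Y T.XT" "bij_betw T.\<tau> (carrier M.Y) (carrier T.XT)"
    using T.tau_hom T.tau_bij unfolding fix_eq .
  \<comment> \<open>From N back along \<kappa> to the fixed points of \<open>W\<close>, back along
    \<theta> to the fixed points of \<open>G\<close>, and forward by \<tau> to those of the stable
    module.\<close>
  define f where "f x = T.\<tau> (inv_into (carrier M.Y) \<theta> (inv_into (carrier W.Y) \<kappa> x))" for x
  have "f \<in> module_hom ?B N T.XT"
    unfolding f_def using module_homD(1-3)[OF \<kappa>'(1)] module_homD(1-3)[OF \<theta>'(1)] module_homD(1-3)[OF \<tau>(1)]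
    by (intro module_homI) (simp_all del: fixed_points_simps)
  moreover have "bij_betw f (carrier N) (carrier T.XT)"
    using bij_betw_trans[OF bij_betw_trans[OF \<kappa>'(2) \<theta>'(2)] \<tau>(2)] by (simp add: comp_def f_def[abs_def])
  ultimately have iso: "module_isomorphic ?B N T.XT" unfolding module_isomorphic_def by blast
  have "F_stable_pair k Fq A FA W ?F"
  proof -
    have "finite_dimensional k (base_space A W)"
      using W.G.finite_dimensional_iff[of k "base_space A W"] W.fd by simp
    moreover have "frobenius_space k q (base_space A W) ?F" using D.ext_frobenius_space unfolding W_def .
    from frobenius_space_map[OF this Kn_1 card_Fq] have "frobenius_map k Fq (base_space A W) ?F" .
    ultimately show ?thesis
      unfolding F_stable_pair_def fd_module_def using W.left_M semilinearD(4)[OF W.G_semilinear]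
      by (simp add: One_nat_def)
  qed
  moreover have "module_isomorphic A ?M ?M"
    using ps by (simp add: periodic_structure_def)
  \<comment> \<open>The ambient stable module is \<open>W\<close>, and the complement of U is the
    kernel of its projection.\<close>
  ultimately have "F_periodic k Fq A FA ?M"
    unfolding F_periodic_def using retract_direct_sum[OF W.left_M e]
    by (intro conjI[OF Ufd] exI[of _ W] exI[of _ ?F] exI[of _ U] exI conjI)
  then show ?thesis using Uind FM per ps iso by (intro exI conjI)
qed

end

text \<open>From x = 1 x = 0 x every element vanishes. This settles the zero algebra, over which
  there are no indecomposable modules; otherwise the scalars embed into \<open>A\<close>.\<close>

lemma (in left_module) trivial_carrier:
  assumes "\<one>\<^bsub>R\<^esub> = \<zero>\<^bsub>R\<^esub>" shows "carrier M = {\<zero>\<^bsub>M\<^esub>}"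
proof -
  have "x = \<zero>\<^bsub>M\<^esub>" if x: "x \<in> carrier M" for x
  proof -
    have "(\<zero>\<^bsub>R\<^esub> \<oplus>\<^bsub>R\<^esub> \<zero>\<^bsub>R\<^esub>) \<odot>\<^bsub>M\<^esub> x = \<zero>\<^bsub>R\<^esub> \<odot>\<^bsub>M\<^esub> x \<oplus>\<^bsub>M\<^esub> \<zero>\<^bsub>R\<^esub> \<odot>\<^bsub>M\<^esub> x"
      by (rule left_smult_l_distr) (simp_all add: x)
    then have "x = x \<oplus>\<^bsub>M\<^esub> x" using left_smult_one[OF x] assms by simp
    then show ?thesis using x M.add.l_cancel_one' by metis
  qed
  then show ?thesis by blast
qed

theorem theorem5p1:
  fixes k :: "'k ring" and Fq :: "'k set" and q :: nat
    and A :: "('k, 'a) module" and FA :: "'a \<Rightarrow> 'a"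
  assumes "primepow q" and "card Fq = q" and "algebraic_closure k Fq"
    and "assoc_algebra k A" and "frobenius_morphism k Fq A FA"
  shows
    "(\<forall>(M :: ('a, 'm) module) FM r M'.
        indecomposable_module k A M \<and> F_periodic k Fq A FA M \<and>
        frobenius_map k Fq (base_space A M) FM \<and> is_F_period A FA M FM r \<and>
        periodic_structure k A FA M FM r M'
        \<longrightarrow>
        F_indecomposable k Fq A FA (tilde_module A FA FM r M') (tilde_frobenius FM r) \<and>
        residue_algebra_iso Fq
          (End_algebra (fixed_points A FA)
             (fixed_points (tilde_module A FA FM r M') (tilde_frobenius FM r)))
          (k\<lparr>carrier := {x \<in> carrier k. x [^]\<^bsub>k\<^esub> (q ^ r) = x}\<rparr>))
     \<and>
     (\<forall>N :: ('a, 'n) module.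
        indecomposable_module (k\<lparr>carrier := Fq\<rparr>) (fixed_points A FA) N
        \<longrightarrow>
        (\<exists>(M :: ('a, nat \<Rightarrow> 'k) module) FM r M'.
           indecomposable_module k A M \<and> F_periodic k Fq A FA M \<and>
           frobenius_map k Fq (base_space A M) FM \<and> is_F_period A FA M FM r \<and>
           periodic_structure k A FA M FM r M' \<and>
           module_isomorphic (fixed_points A FA) N
             (fixed_points (tilde_module A FA FM r M') (tilde_frobenius FM r))))"
proof -
  show ?thesis
  proof (cases "\<one>\<^bsub>A\<^esub> = \<zero>\<^bsub>A\<^esub>")
    case True
    have "carrier N = {\<zero>\<^bsub>N\<^esub>}" if "left_module A N" for N :: "('a, 'm) module"
      using left_module.trivial_carrier[OF that True] .
    moreover have "carrier N = {\<zero>\<^bsub>N\<^esub>}" if "left_module (fixed_points A FA) N" for N :: "('a, 'n) module"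
      using left_module.trivial_carrier[OF that] True by simp
    ultimately show ?thesis unfolding indecomposable_module_def fd_module_def by blast
  next
    case False
    note alg = frobenius_algebra_of_morphism[OF assms False]
    interpret frobenius_setting k q A FA Fq
      using alg assms(2) by (intro frobenius_setting.intro frobenius_setting_axioms.intro)
    show ?thesis
    proof (intro conjI[of "\<forall>M. _ M"] allI impI)
      fix M :: "('a, 'm) module" and FM r M'
      assume "indecomposable_module k A M \<and> F_periodic k Fq A FA M \<and>
        frobenius_map k Fq (base_space A M) FM \<and> is_F_period A FA M FM r \<and>
        periodic_structure k A FA M FM r M'"
      then have H: "indecomposable_module k A M" "frobenius_map k Fq (base_space A M) FM"
        "is_F_period A FA M FM r" "periodic_structure k A FA M FM r M'" by blast+
      note P = aperiodic_structure[OF H]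
      interpret P: periodic_module k q A FA M' FM r by (rule P(1))
      show "F_indecomposable k Fq A FA (tilde_module A FA FM r M') (tilde_frobenius FM r) \<and>
        residue_algebra_iso Fq
          (End_algebra (fixed_points A FA)
             (fixed_points (tilde_module A FA FM r M') (tilde_frobenius FM r)))
          (k\<lparr>carrier := {x \<in> carrier k. x [^]\<^bsub>k\<^esub> (q ^ r) = x}\<rparr>)"
        using P.stable_module_residue_field[OF P(2) Kn_1 card_Fq] by blast
    qed (rule indecomposable_fixed_module)
  qed
qed

end
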